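(* Let $(\mathcal{X},f,\mu)$ be a measure preserving dynamical system with observable $\phi$, and let $X_i=\phi\circ f^{i-1}$ $(i\ge 1)$ and $M_n=\max(X_1,\dots,X_n)$ (standing assumptions as in the context). Suppose there exist sequences $a_n>0$, $b_n\in\mathbb{R}$ and a non-degenerate distribution function $G$ such that $n\mu\{X_1>u/a_n+b_n\}\to-\log G(u)$ as $n\to\infty$ for every $u\in\mathbb{R}$ (with $-\log 0=+\infty$). Suppose that for every $r\ge 1$, every $0<x_1\le x_2\le\cdots\le x_r$, and all real sequences $u_n^{(1)}\ge u_n^{(2)}\ge\cdots\ge u_n^{(r)}$ with $n\mu\{X_1>u_n^{(k)}\}\to x_k$ for all $k\le r$, both conditions $\mathcal{D}_r(u_n^{(k)})$ and $\mathcal{D}_r'(u_n^{(k)})$ hold. Let $\mathcal{R}_n$ and $\mathcal{V}_n$ be the record time and record value point processes $$\mathcal{R}_n=\sum_{j=1}^\infty\delta_{j/n}\cdot 1_{\{X_j>M_{j-1}\}},\qquad \mathcal{V}_n=\sum_{\tau_k}\delta_{Y_n(\tau_k/n)},$$ where $Y_n(\tau_k/n)=a_n(M_{\tau_k}-b_n)=a_n(X_{\tau_k}-b_n)$ and $(\tau_k)$ are the record times. Then: (1) $\mathcal{R}_n$ converges weakly to a point process $\mathcal{R}$ on the state space $(0,\infty)$, where $\mathcal{R}$ is a Poisson random measure with intensity $\gamma(t)=1/t$; i.e. for any $0<a<b<\infty$ and any integer $k\ge0$, $$\lim_{n\to\infty}\mu\{\mathcal{R}_n(a,b)=k\}=\frac{(\log(b/a))^k}{k!}\cdot\frac{a}{b}.$$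 (2) $\mathcal{V}_n$ converges weakly to a point process $\mathcal{V}$ on the state space $E\subset\mathbb{R}$ (the domain of $G$), where $\mathcal{V}$ is a Poisson random measure with mean measure $\lambda_V$ given by $\lambda_V([a,b])=-\log(-\log G(b))+\log(-\log G(a))$ for $[a,b]\subset E$.
   Context: Standing assumptions: $\mathcal{X}\subset\mathbb{R}^d$, $f:\mathcal{X}\to\mathcal{X}$ is measurable, $\mu$ is an $f$-invariant probability measure on $\mathcal{X}$, absolutely continuous with respect to Lebesgue measure with density $\rho$. The observable is $\phi(x)=\psi(\mathrm{dist}(x,\tilde x))$, where $\mathrm{dist}$ is the Euclidean distance, $\tilde x\in\mathcal{X}$ is a fixed point of the space, and $\psi:[0,\infty)\to\mathbb{R}\cup\{+\infty\}$ is measurable, finite on $(0,\infty)$, with $\sup_{v\ge0}\psi(v)=\psi(0)$. The integer part of $s$ is $[s]$. Process and record times: $Y_n(t)=a_n(M_{[nt]}-b_n)$ for $t\ge1/n$ and $Y_n(t)=a_n(X_1-b_n)$ for $0<t<1/n$. Record times: $\tau_1=1$ and $\tau_k=\inf\{j>\tau_{k-1}:X_j>M_{j-1}\}$ (with $M_0=-\infty$). Domain of $G$: $E$ is the open interval between the left and right end-points of $G$ (where $0<G<1$): $(-\infty,\infty)$ for Gumbel, $(0,\infty)$ for Fréchet, $(-\infty,0)$ for Weibull type $G$. Maxima over sets: $\mathfrak{R}$ is the ring of subsets of $[0,\infty)$ generated by the intervals $[a,b)$, so each element is a finite union of such intervals. For $A\in\mathfrak{R}$ let $M(A)=\max\{X_{i+1}: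 i\in A\cap\mathbb{Z}\}$ (with $\max\emptyset=-\infty$), so that $M([0,n))=M_n$; and $A+t=\{a+t:a\in A\}$. Condition $\mathcal{D}_r(u_n^{(k)})$, for real sequences $(u_n^{(k)})_n$, $1\le k\le r$: there is a function $\gamma(n,t)$ such that for all $n,t\in\mathbb{N}$, all pairwise disjoint $\mathcal{A}_1,\dots,\mathcal{A}_r\in\mathfrak{R}$, and all choices of $u_{n,0},u_{n,1},\dots,u_{n,r}$ each from $\{u_n^{(1)},\dots,u_n^{(r)}\}$, $$\Big|\mu\big(\{X_1>u_{n,0}\}\cap\{M(\mathcal{A}_1+t)\le u_{n,1},\dots,M(\mathcal{A}_r+t)\le u_{n,r}\}\big)-\mu\{X_1>u_{n,0}\}\,\mu\{M(\mathcal{A}_1)\le u_{n,1},\dots,M(\mathcal{A}_r)\le u_{n,r}\}\Big|\le\gamma(n,t),$$ and $n\gamma(n,t_n)\to0$ for some integer sequence $t_n=o(n)$. Condition $\mathcal{D}_r'(u_n^{(k)})$: for each $i\in\{1,\dots,r\}$, $$\lim_{q\to\infty}\limsup_{n\to\infty}\, n\sum_{j=2}^{[n/q]}\mu\big(\{X_1>u_n^{(i)}\}\cap\{X_j>u_n^{(i)}\}\big)=0.$$ Point processes: a point process on a state space $S$ is a random counting measure, finite on compact subsets of $S$. A Poisson random measure with mean measure $\lambda$ is a point process $\xi$ such that $\xi(A)$ is Poisson with mean $\lambda(A)$ for each Borel $A$, and $\xi(A_1),\dots,\xi(A_m)$ are independent for disjoint $A_1,\dots,A_m$; it has intensity $\gamma$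 if $\lambda(A)=\int_A\gamma(t)\,dt$. Weak convergence $\xi_n\to\xi$ of point processes on $S$ means $(\xi_n(B_1),\dots,\xi_n(B_m))\to(\xi(B_1),\dots,\xi(B_m))$ in distribution for all finite collections of bounded (relatively compact in $S$) Borel sets $B_i$ with $\xi(\partial B_i)=0$ almost surely. *)

theory Defs
  imports "HOL-Probability.Probability" "HOL-Library.Landau_Symbols"
begin

section \<open>The dynamical system and its process\<close>

(* X is a Borel subset of the Euclidean space 'a and carries the trace Borel sigma-algebra;
   the density rho determines mu. *)
definition acim_system ::
    "'a::euclidean_space set \<Rightarrow> ('a \<Rightarrow> 'a) \<Rightarrow> 'a measure \<Rightarrow> ('a \<Rightarrow> ennreal) \<Rightarrow> bool" where
  "acim_system \<X> f \<mu> \<rho> \<longleftrightarrow>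
     \<X> \<in> sets borel \<and>
     \<rho> \<in> borel_measurable (restrict_space lborel \<X>) \<and>
     \<mu> = density (restrict_space lborel \<X>) \<rho> \<and>
     prob_space \<mu> \<and>
     f \<in> measurable \<mu> \<mu> \<and>
     distr \<mu> \<mu> f = \<mu>"

(* psi is only relevant on [0,oo). *)
definition admissible_profile :: "(real \<Rightarrow> ereal) \<Rightarrow> bool" where
  "admissible_profile \<psi> \<longleftrightarrow>
     \<psi> \<in> borel_measurable (restrict_space borel {0..}) \<and>
     (\<forall>v\<ge>0. \<psi> v \<noteq> -\<infinity>) \<and>
     (\<forall>v>0. \<psi> v \<noteq> \<infinity>) \<and>
     (SUP v\<in>{0..}. \<psi> v) = \<psi> 0"

definition observable :: "(real \<Rightarrow> ereal) \<Rightarrow> 'a::euclidean_space \<Rightarrow> 'a \<Rightarrow> ereal" where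
  "observable \<psi> z x = \<psi> (dist x z)"

(* Indexed from i = 1; the value at i = 0 is never used. *)
definition orbit_process :: "('a \<Rightarrow> ereal) \<Rightarrow> ('a \<Rightarrow> 'a) \<Rightarrow> nat \<Rightarrow> 'a \<Rightarrow> ereal" where
  "orbit_process \<phi> f i = \<phi> \<circ> (f ^^ (i - 1))"

(* Supremum over a finite set in ereal, hence a maximum, with value -oo for n = 0. *)
definition running_max :: "(nat \<Rightarrow> 'w \<Rightarrow> ereal) \<Rightarrow> nat \<Rightarrow> 'w \<Rightarrow> ereal" where
  "running_max X n \<omega> = (SUP i\<in>{1..n}. X i \<omega>)"

definition max_over :: "(nat \<Rightarrow> 'w \<Rightarrow> ereal) \<Rightarrow> real set \<Rightarrow> 'w \<Rightarrow> ereal" where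
  "max_over X A \<omega> = (SUP i\<in>{i. real i \<in> A}. X (i + 1) \<omega>)"


section \<open>Distribution functions\<close>

definition nondegenerate_df :: "(real \<Rightarrow> real) \<Rightarrow> bool" where
  "nondegenerate_df G \<longleftrightarrow>
     (\<exists>N. real_distribution N \<and> G = cdf N \<and> (\<forall>c. N \<noteq> return borel c))"

definition neg_log :: "real \<Rightarrow> ereal" where
  "neg_log p = (if p = 0 then \<infinity> else ereal (- ln p))"

(* The open interval between the left and the right end-point of G. *)
definition df_domain :: "(real \<Rightarrow> real) \<Rightarrow> real set" where
  "df_domain G =
     {u. Inf (ereal ` {v. 0 < G v}) < ereal u \<and> ereal u < Sup (ereal ` {v. G v < 1})}"


section \<open>Mixing and anti-clustering conditions\<close>

definition interval_ring :: "real set set" where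
  "interval_ring =
     \<Inter>{R. ring_of_sets {0..} R \<and> (\<forall>a b. 0 \<le> a \<longrightarrow> a \<le> b \<longrightarrow> {a..<b} \<in> R)}"

(* u k n is the level u_n^(k). *)
definition cond_D ::
    "'w measure \<Rightarrow> (nat \<Rightarrow> 'w \<Rightarrow> ereal) \<Rightarrow> nat \<Rightarrow> (nat \<Rightarrow> nat \<Rightarrow> real) \<Rightarrow> bool" where
  "cond_D \<mu> X r u \<longleftrightarrow>
     (\<exists>\<gamma> :: nat \<Rightarrow> nat \<Rightarrow> real.
        (\<forall>n t. \<forall>A :: nat \<Rightarrow> real set. \<forall>v :: nat \<Rightarrow> real.
           (\<forall>i\<in>{1..r}. A i \<in> interval_ring) \<longrightarrow> disjoint_family_on A {1..r} \<longrightarrow>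
           (\<forall>i\<in>{0..r}. v i \<in> (\<lambda>k. u k n) ` {1..r}) \<longrightarrow>
           \<bar>measure \<mu> {\<omega>\<in>space \<mu>. ereal (v 0) < X 1 \<omega> \<and>
                (\<forall>i\<in>{1..r}. max_over X ((\<lambda>a. a + real t) ` A i) \<omega> \<le> ereal (v i))}
            - measure \<mu> {\<omega>\<in>space \<mu>. ereal (v 0) < X 1 \<omega>} *
              measure \<mu> {\<omega>\<in>space \<mu>. \<forall>i\<in>{1..r}. max_over X (A i) \<omega> \<le> ereal (v i)}\<bar>
           \<le> \<gamma> n t) \<and>
        (\<exists>t :: nat \<Rightarrow> nat. (\<lambda>n. real (t n)) \<in> o(\<lambda>n. real n) \<and>
           (\<lambda>n. real n * \<gamma> n (t n)) \<longlonglongrightarrow> 0))"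

definition cond_D' ::
    "'w measure \<Rightarrow> (nat \<Rightarrow> 'w \<Rightarrow> ereal) \<Rightarrow> nat \<Rightarrow> (nat \<Rightarrow> nat \<Rightarrow> real) \<Rightarrow> bool" where
  "cond_D' \<mu> X r u \<longleftrightarrow>
     (\<forall>i\<in>{1..r}.
        (\<lambda>q. limsup (\<lambda>n. ereal (real n * (\<Sum>j=2..n div q.
           measure \<mu> {\<omega>\<in>space \<mu>. ereal (u i n) < X 1 \<omega> \<and> ereal (u i n) < X j \<omega>}))))
        \<longlonglongrightarrow> 0)"


section \<open>Point processes\<close>

(* A realisation is a measure on the trace Borel sigma-algebra of the state space S. *)
definition point_process ::
    "'w measure \<Rightarrow> 's::topological_space set \<Rightarrow> ('w \<Rightarrow> 's measure) \<Rightarrow> bool" where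
  "point_process \<Omega> S \<xi> \<longleftrightarrow>
     (\<forall>\<omega>\<in>space \<Omega>. sets (\<xi> \<omega>) = sets (restrict_space borel S) \<and>
        (\<forall>A\<in>sets (restrict_space borel S). emeasure (\<xi> \<omega>) A \<in> insert \<infinity> (range of_nat)) \<and>
        (\<forall>K. compact K \<longrightarrow> K \<subseteq> S \<longrightarrow> emeasure (\<xi> \<omega>) K < \<infinity>)) \<and>
     (\<forall>A\<in>sets (restrict_space borel S). (\<lambda>\<omega>. emeasure (\<xi> \<omega>) A) \<in> borel_measurable \<Omega>)"

(* Poisson with mean 0 is the unit mass at 0 (here 0 ^ 0 = 1), and Poisson with infinite mean
   is the unit mass at infinity. *)
definition poisson_random_measure ::
    "'w measure \<Rightarrow> 's::topological_space set \<Rightarrow> 's measure \<Rightarrow> ('w \<Rightarrow> 's measure) \<Rightarrow> bool" where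
  "poisson_random_measure \<Omega> S lam \<xi> \<longleftrightarrow>
     prob_space \<Omega> \<and>
     point_process \<Omega> S \<xi> \<and>
     sets lam = sets (restrict_space borel S) \<and>
     (\<forall>A\<in>sets lam. emeasure lam A < \<infinity> \<longrightarrow>
        (\<forall>k::nat. measure \<Omega> {\<omega>\<in>space \<Omega>. emeasure (\<xi> \<omega>) A = of_nat k}
                  = measure lam A ^ k / fact k * exp (- measure lam A))) \<and>
     (\<forall>A\<in>sets lam. emeasure lam A = \<infinity> \<longrightarrow> (AE \<omega> in \<Omega>. emeasure (\<xi> \<omega>) A = \<infinity>)) \<and>
     (\<forall>(m::nat) A. (\<forall>i<m. A i \<in> sets lam) \<longrightarrow> disjoint_family_on A {..<m} \<longrightarrow>
        prob_space.indep_vars \<Omega> (\<lambda>_. borel) (\<lambda>i \<omega>. emeasure (\<xi> \<omega>) (A i)) {..<m})"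

definition converges_in_distribution ::
    "'w measure \<Rightarrow> (nat \<Rightarrow> 'w \<Rightarrow> 'b::topological_space) \<Rightarrow> 'v measure \<Rightarrow> ('v \<Rightarrow> 'b) \<Rightarrow> bool" where
  "converges_in_distribution M Z \<Omega> W \<longleftrightarrow>
     (\<forall>g :: 'b \<Rightarrow> real. continuous_on UNIV g \<longrightarrow> bounded (range g) \<longrightarrow>
        (\<lambda>n. \<integral>\<omega>. g (Z n \<omega>) \<partial>M) \<longlonglongrightarrow> (\<integral>\<omega>. g (W \<omega>) \<partial>\<Omega>))"

(* A vector of m counts in [0,oo] is encoded as a function on nat that is 0 from index m on;
   nat => ennreal carries the product topology.  Infinite values are kept because the processes
   xi n need not be locally finite for small n. *)
definition counts_vector ::
    "('w \<Rightarrow> 's measure) \<Rightarrow> (nat \<Rightarrow> 's set) \<Rightarrow> nat \<Rightarrow> 'w \<Rightarrow> nat \<Rightarrow> ennreal" where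
  "counts_vector \<xi> B m \<omega> = (\<lambda>i. if i < m then emeasure (\<xi> \<omega>) (B i) else 0)"

(* For open S the boundary of a set with closure inside S is the same in S and in the whole space. *)
definition pp_weak_convergence ::
    "'s::topological_space set \<Rightarrow> 'w measure \<Rightarrow> (nat \<Rightarrow> 'w \<Rightarrow> 's measure) \<Rightarrow>
     'v measure \<Rightarrow> ('v \<Rightarrow> 's measure) \<Rightarrow> bool" where
  "pp_weak_convergence S M \<xi>s \<Omega> \<xi> \<longleftrightarrow>
     (\<forall>(m::nat) B.
        (\<forall>i<m. B i \<in> sets borel \<and> compact (closure (B i)) \<and> closure (B i) \<subseteq> S \<and>
               (AE \<omega> in \<Omega>. emeasure (\<xi> \<omega>) (frontier (B i)) = 0)) \<longrightarrow>
        converges_in_distribution M (\<lambda>n. counts_vector (\<xi>s n) B m) \<Omega> (counts_vector \<xi> B m))"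


section \<open>Record times and record values\<close>

(* record_time X w k is the (k+1)-st record time; it is infinite if there is no such record. *)
primrec record_time :: "(nat \<Rightarrow> 'w \<Rightarrow> ereal) \<Rightarrow> 'w \<Rightarrow> nat \<Rightarrow> enat" where
  "record_time X \<omega> 0 = 1"
| "record_time X \<omega> (Suc k) =
     Inf (enat ` {j. record_time X \<omega> k < enat j \<and> running_max X (j - 1) \<omega> < X j \<omega>})"

definition max_process ::
    "(nat \<Rightarrow> 'w \<Rightarrow> ereal) \<Rightarrow> (nat \<Rightarrow> real) \<Rightarrow> (nat \<Rightarrow> real) \<Rightarrow> nat \<Rightarrow> 'w \<Rightarrow> real \<Rightarrow> ereal" where
  "max_process X a b n \<omega> t =
     ereal (a n) *
       ((if 1 / real n \<le> t then running_max X (nat \<lfloor>real n * t\<rfloor>) \<omega> else X 1 \<omega>) - ereal (b n))"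

(* A sum of Dirac measures is the push-forward of the counting measure on the index set. *)
definition record_time_process ::
    "(nat \<Rightarrow> 'w \<Rightarrow> ereal) \<Rightarrow> nat \<Rightarrow> 'w \<Rightarrow> real measure" where
  "record_time_process X n \<omega> =
     distr (count_space {j. 1 \<le> j \<and> running_max X (j - 1) \<omega> < X j \<omega>})
       (restrict_space borel {0<..}) (\<lambda>j. real j / real n)"

definition scaled_record ::
    "(nat \<Rightarrow> 'w \<Rightarrow> ereal) \<Rightarrow> (nat \<Rightarrow> real) \<Rightarrow> (nat \<Rightarrow> real) \<Rightarrow> nat \<Rightarrow> 'w \<Rightarrow> nat \<Rightarrow> ereal" where
  "scaled_record X a b n \<omega> k =
     max_process X a b n \<omega> (real (the_enat (record_time X \<omega> k)) / real n)"

(* As a point process on S it consists of the record values lying in S. *)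
definition record_value_process ::
    "(nat \<Rightarrow> 'w \<Rightarrow> ereal) \<Rightarrow> (nat \<Rightarrow> real) \<Rightarrow> (nat \<Rightarrow> real) \<Rightarrow> real set \<Rightarrow>
     nat \<Rightarrow> 'w \<Rightarrow> real measure" where
  "record_value_process X a b S n \<omega> =
     distr (count_space {k. record_time X \<omega> k \<noteq> \<infinity> \<and> scaled_record X a b n \<omega> k \<in> ereal ` S})
       (restrict_space borel S) (\<lambda>k. real_of_ereal (scaled_record X a b n \<omega> k))"

end

(* The mixing conditions give, by peeling off one exceedance at a time, the joint limit law of
   maxima over disjoint time blocks at several levels: in the limit these maxima behave like those
   of independent variables. Cutting time (respectively the level axis) into cells, the event that
   a cell contains no record time (record value) is a race between the block maxima (between the
   first visits to the level bins), and the winner of a race of independent exponential clocks has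
   an explicit law. So the avoidance probabilities of unions of cells converge to products, which
   are the avoidance probabilities of Poisson processes. As records do not cluster, the avoidance
   probabilities on fine grids determine the limit law of all counts. The limiting processes are
   images of a unit rate Poisson process on the line, under exp for the record times and under the
   inverse of - ln (- ln G) for the record values. *)

theory Submission
  imports Defs
begin

section \<open>Limits of rescaled tails\<close>

text \<open>The mixing conditions speak only of maxima staying below levels. They say nothing
  directly about visits to a bin between two levels, since a higher value in the same block hides
  such a visit. Record values depend on these visits. Hence the blocks of rescaled length \<delta>:
  two exceedances of the lowest level in one block have probability of order
  \<open>\<delta>^2\<close>, so over the order of \<open>1 / \<delta>\<close> blocks the maxima can
  stand for the single values. The race needs a level for every positive limiting tail mass, that
  is, \<open>- ln G\<close> must take every positive value. This is extracted from the tail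
  asymptotics themselves and not from the classification of extreme value laws. At fixed n the
  record processes need not be locally finite; the counts are therefore compared through patterns of
  empty cells. All limits are taken in two stages, n for a fixed discretisation m and m afterwards,
  which is the purpose of \<open>double_sandwich\<close>.\<close>

lemma double_sandwich:
  fixes p :: "nat \<Rightarrow> real"
  assumes bnd: "\<And>m::nat. \<forall>\<^sub>F n in sequentially. l m n \<le> p n \<and> p n \<le> u m n"
    and l: "\<And>m. l m \<longlonglongrightarrow> L m" and u: "\<And>m. u m \<longlonglongrightarrow> U m"
    and L: "L \<longlonglongrightarrow> T" and U: "U \<longlonglongrightarrow> T"
  shows "p \<longlonglongrightarrow> T"
proof (rule order_tendstoI)
  fix c assume "c < T"
  then have "\<forall>\<^sub>F m in sequentially. c < L m" using L by (rule order_tendstoD[rotated])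
  then obtain m where "c < L m" by (auto simp: eventually_sequentially)
  then have "\<forall>\<^sub>F n in sequentially. c < l m n" using l order_tendstoD(1) by blast
  with bnd[of m] show "\<forall>\<^sub>F n in sequentially. c < p n" by eventually_elim auto
next
  fix c assume "T < c"
  then have "\<forall>\<^sub>F m in sequentially. U m < c" using U by (rule order_tendstoD[rotated])
  then obtain m where "U m < c" by (auto simp: eventually_sequentially)
  then have "\<forall>\<^sub>F n in sequentially. u m n < c" using u order_tendstoD(2) by blast
  with bnd[of m] show "\<forall>\<^sub>F n in sequentially. p n < c" by eventually_elim auto
qed

text \<open>At \<open>p = 0\<close> the limit is \<infinity> and \<open>f x < exp (- r)\<close> is
  turned into \<open>neg_log (f x) > r\<close>, zeros of \<open>f\<close> included; elsewhere it is
  continuity of the logarithm. This carries right continuity and the end limits of \<open>G\<close>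
  over to \<open>neg_log (G u)\<close>.\<close>

lemma tendsto_neg_log:
  assumes "(f \<longlongrightarrow> p) F" and "\<And>x. 0 \<le> f x"
  shows "((\<lambda>x. neg_log (f x)) \<longlongrightarrow> neg_log p) F"
proof (cases "F = bot")
  case False
  have "0 \<le> p" using tendsto_lowerbound[OF assms(1) _ False, of 0] assms(2) by auto
  show ?thesis
  proof (cases "p = 0")
    case True
    have "((\<lambda>x. neg_log (f x)) \<longlongrightarrow> \<infinity>) F"
      unfolding tendsto_PInfty
    proof
      fix r :: real
      have "\<forall>\<^sub>F x in F. f x < exp (- r)"
        using assms(1) True by (auto intro: order_tendstoD)
      then show "\<forall>\<^sub>F x in F. ereal r < neg_log (f x)"
      proof eventually_elim
        case (elim x)
        show ?case
        proof (cases "f x = 0")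
          case False
          then have "0 < f x" using assms(2)[of x] by simp
          then have "ln (f x) < - r" using elim by (metis exp_less_cancel_iff exp_ln)
          then show ?thesis by (simp add: neg_log_def False)
        qed (simp add: neg_log_def)
      qed
    qed
    then show ?thesis using True by (simp add: neg_log_def)
  next
    case False
    then have "0 < p" using \<open>0 \<le> p\<close> by simp
    then have "((\<lambda>x. ereal (- ln (f x))) \<longlongrightarrow> ereal (- ln p)) F"
      by (intro tendsto_intros assms(1)) simp
    moreover have "\<forall>\<^sub>F x in F. ereal (- ln (f x)) = neg_log (f x)"
      using order_tendstoD(1)[OF assms(1) \<open>0 < p\<close>] by eventually_elim (simp add: neg_log_def)
    ultimately have "((\<lambda>x. neg_log (f x)) \<longlongrightarrow> ereal (- ln p)) F"
      by (rule Lim_transform_eventually)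
    then show ?thesis using False by (simp add: neg_log_def)
  qed
qed simp

text \<open>A distribution function with no values other than 0 and 1 is, by right continuity, the
  indicator of some \<open>{c..}\<close>, hence that of the point mass at \<open>c\<close>; and
  distribution functions determine their laws.\<close>

lemma nondegenerate_df_intermediate:
  assumes "nondegenerate_df G"
  obtains u where "0 < G u" "G u < 1"
proof -
  obtain N where N: "real_distribution N" "G = cdf N" "\<And>c. N \<noteq> return borel c"
    using assms by (auto simp: nondegenerate_df_def)
  interpret N: real_distribution N by fact
  have "\<exists>u. 0 < G u \<and> G u < 1"
  proof (rule ccontr)
    assume "\<not> ?thesis"
    then have two: "G u = 0 \<or> G u = 1" for u
      using N.cdf_nonneg[of u] N.cdf_bounded_prob[of u] N(2) by (metis less_eq_real_def)
    define A where "A = {u. G u = 1}"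
    have mono: "G u \<le> G v" if "u \<le> v" for u v using that N(2) N.cdf_nondecreasing by simp
    have "\<forall>\<^sub>F u in at_top. 0 < G u"
      using N.cdf_lim_at_top_prob N(2) by (auto intro: order_tendstoD)
    then obtain u1 where u1: "u1 \<in> A" using two by (force simp: A_def eventually_at_top_linorder)
    have "\<forall>\<^sub>F u in at_bot. G u < 1"
      using N.cdf_lim_at_bot N(2) by (auto intro: order_tendstoD)
    then obtain u2 where u2: "\<And>u. u \<le> u2 \<Longrightarrow> G u < 1" by (auto simp: eventually_at_bot_linorder)
    have bdd: "bdd_below A"
      by (rule bdd_belowI[of _ u2]) (metis A_def linear mem_Collect_eq less_irrefl u2)
    \<comment> \<open>The only possible jump: \<open>G\<close> is 1 to the right of \<open>c\<close>
      and 0 to the left, and right continuity settles the value at \<open>c\<close> itself.\<close>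
    define c where "c = Inf A"
    have up: "G u = 1" if less: "c < u" for u
    proof -
      obtain w where "w \<in> A" "w < u" using less u1 bdd cInf_less_iff[of A u] unfolding c_def by (metis empty_iff)
      then show ?thesis using mono[of w u] two[of u] by (auto simp: A_def)
    qed
    have lo: "G u = 0" if "u < c" for u
      using cInf_lower[OF _ bdd, of u] that two[of u] by (auto simp: A_def c_def)
    have "(G \<longlongrightarrow> G c) (at_right c)"
      using N.cdf_is_right_cont[of c] N(2) by (simp add: continuous_within)
    moreover have "(G \<longlongrightarrow> 1) (at_right c)"
      by (rule tendsto_eventually) (auto simp: eventually_at_filter up)
    ultimately have "G c = 1" by (intro tendsto_unique[of "at_right c"]) auto
    then have "cdf N x = cdf (return borel c) x" for x
      using up[of x] lo[of x] N(2) by (cases x c rule: linorder_cases) (auto simp: cdf_def measure_return)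
    moreover have "real_distribution (return borel c)"
      by (auto simp: real_distribution_def real_distribution_axioms_def prob_space_return)
    ultimately have "N = return borel c"
      using N(1) by (intro cdf_unique) auto
    then show False using N(3) by auto
  qed
  then show ?thesis using that by blast
qed

(* If the limit h jumped over the values in (c, d), two levels of the m-th normalisation,
   m ~ n s, with tails strictly inside n (c, d) / n would be squeezed in the n-th normalisation
   to the single jump point, so a n / a m would tend to 0 and h could only take the values
   0 and infinity. *)
lemma tail_limit_attains:
  fixes Fb :: "real \<Rightarrow> real" and a b :: "nat \<Rightarrow> real" and h :: "real \<Rightarrow> ereal"
  assumes anti: "\<And>x y. x \<le> y \<Longrightarrow> Fb y \<le> Fb x" and nonneg: "\<And>x. 0 \<le> Fb x"
    and a: "\<And>n. 0 < a n"
    and lim: "\<And>u. (\<lambda>n. ereal (real n * Fb (u / a n + b n))) \<longlonglongrightarrow> h u"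
    and rc: "\<And>u. (h \<longlongrightarrow> h u) (at_right u)"
    and top: "(h \<longlongrightarrow> 0) at_top" and bot: "(h \<longlongrightarrow> \<infinity>) at_bot"
    and k: "h u0 = ereal k" "0 < k" and y: "0 < y"
  shows "\<exists>v. h v = ereal y"
proof (rule ccontr)
  assume "\<not> ?thesis"
  then have ne: "h v \<noteq> ereal y" for v by auto
  define N where "N n u = real n * Fb (u / a n + b n)" for n u
  have N_anti: "N n v \<le> N n u" if "u \<le> v" for n u v
    unfolding N_def using a[of n] that
    by (intro mult_left_mono anti add_right_mono divide_right_mono) auto
  have limN: "(\<lambda>n. ereal (N n u)) \<longlonglongrightarrow> h u" for u using lim by (simp add: N_def)
  have h_anti: "h v \<le> h u" if "u \<le> v" for u v
    using N_anti[OF that] by (intro LIMSEQ_le[OF limN limN]) auto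
  have h_nonneg: "0 \<le> h u" for u
    by (rule LIMSEQ_le_const[OF limN]) (auto simp: N_def nonneg)
  have get_lo: "\<exists>u. h u < ereal K" if "0 < K" for K
  proof -
    have "\<forall>\<^sub>F u in at_top. h u < ereal K" using that by (intro order_tendstoD(2)[OF top]) auto
    then show ?thesis by (auto simp: eventually_at_top_linorder)
  qed
  have get_hi: "\<exists>u. \<forall>w\<le>u. ereal K < h w" for K
  proof -
    have "\<forall>\<^sub>F u in at_bot. ereal K < h u" by (intro order_tendstoD(1)[OF bot]) auto
    then show ?thesis by (auto simp: eventually_at_bot_linorder)
  qed
  \<comment> \<open>The infimum \<open>v0\<close> of this set is where \<open>h\<close> jumps over
    the missing value: by right continuity \<open>h v0 < y\<close>, while \<open>h > y\<close>
    strictly to the left.\<close>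
  define V where "V = {u. h u \<le> ereal y}"
  obtain v1 where v1: "v1 \<in> V" using get_lo[OF y] by (auto simp: V_def intro: less_imp_le)
  obtain v2 where v2: "\<And>w. w \<le> v2 \<Longrightarrow> ereal y < h w" using get_hi[of y] by auto
  have bdd: "bdd_below V"
    by (rule bdd_belowI[of _ v2]) (metis V_def linear mem_Collect_eq not_less v2)
  define v0 where "v0 = Inf V"
  have "h u \<le> ereal y" if less: "v0 < u" for u
  proof -
    obtain w where "w \<in> V" "w < u" using less v1 bdd cInf_less_iff[of V u] unfolding v0_def by (metis empty_iff)
    then show ?thesis using h_anti[of w u] by (auto simp: V_def)
  qed
  then have "h v0 \<le> ereal y"
    by (intro tendsto_upperbound[OF rc[of v0]]) (auto simp: eventually_at_filter)
  then have v0_lt: "h v0 < ereal y" using ne[of v0] by simp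
  have v0_gt: "ereal y < h u" if "u < v0" for u
  proof -
    have "u \<notin> V" using cInf_lower[OF _ bdd, of u] that by (auto simp: v0_def)
    then show ?thesis by (simp add: V_def)
  qed
  obtain c where c: "h v0 < ereal c" "c < y" using ereal_dense2[OF v0_lt] by auto
  have "0 < c" using c(1) h_nonneg[of v0] by (metis ereal_less(2) le_less_trans)
  obtain d where d: "c < d" "d < y" using dense[OF c(2)] by auto
  \<comment> \<open>With this ratio \<open>k / s\<close> is the midpoint of \<open>c\<close> and
    \<open>d\<close>. Right continuity at \<open>u0\<close> then yields a second point
    \<open>\<beta> > u0\<close> whose value divided by \<open>s\<close> lies between
    \<open>c\<close> and \<open>d\<close> as well.\<close>
  define s where "s = 2 * k / (c + d)"
  have s: "0 < s" using k \<open>0 < c\<close> d by (simp add: s_def)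
  have "k = s * ((c + d) / 2)" using \<open>0 < c\<close> d by (simp add: s_def)
  moreover have "s * c < s * ((c + d) / 2)" "s * ((c + d) / 2) < s * d"
    using d s by (simp_all only: mult_less_cancel_left_pos, simp_all)
  ultimately have ks: "s * c < k" "k < s * d" by simp_all
  have "\<forall>\<^sub>F u in at_right u0. ereal (s * c) < h u"
    using rc[of u0] ks by (intro order_tendstoD(1)) (auto simp: k)
  then obtain w where w: "u0 < w" "\<And>x. u0 < x \<Longrightarrow> x < w \<Longrightarrow> ereal (s * c) < h x"
    unfolding eventually_at_right_field by auto
  obtain \<beta> where "u0 < \<beta>" "\<beta> < w" using dense[OF w(1)] by auto
  with w have \<beta>: "u0 < \<beta>" "ereal (s * c) < h \<beta>" by auto
  have "h \<beta> \<le> ereal k" using h_anti[OF less_imp_le[OF \<beta>(1)]] unfolding k(1) .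
  with \<beta> obtain k' where k': "h \<beta> = ereal k'" "s * c < k'" "k' \<le> k" by (cases "h \<beta>") simp_all
  define m where "m n = nat \<lceil>real n * s\<rceil>" for n
  have m_bounds: "real n * s \<le> real (m n)" "real (m n) \<le> real n * s + 1" for n
    unfolding m_def using s mult_nonneg_nonneg[of "real n" s] by linarith+
  have m_lim: "filterlim m at_top sequentially"
  proof (rule filterlim_at_top_mono)
    show "filterlim (\<lambda>n. nat \<lfloor>real n * s\<rfloor>) at_top sequentially"
      using s by (intro filterlim_compose[OF filterlim_nat_sequentially]
          filterlim_compose[OF filterlim_floor_sequentially] filterlim_at_top_mult_tendsto_pos[OF tendsto_const]
          filterlim_real_sequentially) auto
    show "\<forall>\<^sub>F n in sequentially. nat \<lfloor>real n * s\<rfloor> \<le> m n"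
      unfolding m_def by (intro always_eventually allI nat_mono) linarith
  qed
  have "(\<lambda>n. real (m n) / real n) \<longlonglongrightarrow> s"
  proof (rule tendsto_sandwich[where f = "\<lambda>_. s" and h = "\<lambda>n. s + 1 / real n"])
    have "(\<lambda>n. s + 1 / real n) \<longlonglongrightarrow> s + 0" by (intro tendsto_intros lim_1_over_n)
    then show "(\<lambda>n. s + 1 / real n) \<longlonglongrightarrow> s" by simp
    show "\<forall>\<^sub>F n in sequentially. s \<le> real (m n) / real n"
      using eventually_gt_at_top[of 0] by eventually_elim (use m_bounds in \<open>simp add: field_simps\<close>)
    show "\<forall>\<^sub>F n in sequentially. real (m n) / real n \<le> s + 1 / real n"
      using eventually_gt_at_top[of 0] by eventually_elim (use m_bounds in \<open>simp add: field_simps\<close>)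
  qed simp
  then have "(\<lambda>n. inverse (real (m n) / real n)) \<longlonglongrightarrow> inverse s" using s by (intro tendsto_inverse) auto
  then have m_ratio: "(\<lambda>n. real n / real (m n)) \<longlonglongrightarrow> 1 / s"
    by (simp add: inverse_eq_divide)
  \<comment> \<open>The level \<gamma> of normalisation \<open>m n\<close>, expressed in
    normalisation \<open>n\<close>. As \<open>m n / n\<close> tends to \<open>s\<close>, its mass in
    the new scale tends to \<open>h \<gamma> / s\<close>.\<close>
  define g where "g n \<gamma> = a n * (\<gamma> / a (m n) + b (m n) - b n)" for n \<gamma>
  have Ng: "N n (g n \<gamma>) = real n / real (m n) * N (m n) \<gamma>" if "0 < m n" for n \<gamma>
    using a[of n] that by (simp add: N_def g_def)
  have m_pos: "\<forall>\<^sub>F n in sequentially. 0 < m n"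
    using m_lim filterlim_at_top_gt[of m sequentially 0] eventually_compose_filterlim[OF eventually_gt_at_top[of 0] m_lim] by simp
  have limm: "(\<lambda>n. ereal (N (m n) u)) \<longlonglongrightarrow> h u" for u
    using filterlim_compose[OF limN m_lim] .
  have low: "\<forall>\<^sub>F n in sequentially. r < N n (g n \<gamma>)"
    if "0 < K" "ereal K < h \<gamma>" "r < K / s" for K r \<gamma>
  proof -
    have "(\<lambda>n. real n / real (m n) * K) \<longlonglongrightarrow> 1 / s * K" by (intro tendsto_intros m_ratio)
    then have "\<forall>\<^sub>F n in sequentially. r < real n / real (m n) * K"
      using that by (auto intro: order_tendstoD)
    moreover have "\<forall>\<^sub>F n in sequentially. ereal K < ereal (N (m n) \<gamma>)"
      using that by (intro order_tendstoD[OF limm]) auto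
    ultimately show ?thesis using m_pos
    proof eventually_elim
      case (elim n)
      then have "real n / real (m n) * K \<le> real n / real (m n) * N (m n) \<gamma>"
        by (intro mult_left_mono) auto
      then show ?case using elim Ng by auto
    qed
  qed
  have up: "\<forall>\<^sub>F n in sequentially. N n (g n \<gamma>) < r"
    if "h \<gamma> < ereal K" "K / s < r" for K r \<gamma>
  proof -
    have "(\<lambda>n. real n / real (m n) * K) \<longlonglongrightarrow> 1 / s * K" by (intro tendsto_intros m_ratio)
    then have "\<forall>\<^sub>F n in sequentially. real n / real (m n) * K < r"
      using that by (auto intro: order_tendstoD)
    moreover have "\<forall>\<^sub>F n in sequentially. ereal (N (m n) \<gamma>) < ereal K"
      using that by (intro order_tendstoD[OF limm]) auto
    ultimately show ?thesis using m_pos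
    proof eventually_elim
      case (elim n)
      then have "real n / real (m n) * N (m n) \<gamma> \<le> real n / real (m n) * K"
        by (intro mult_left_mono) auto
      then show ?case using elim Ng by auto
    qed
  qed
  \<comment> \<open>At \<beta> the mass in scale \<open>n\<close> stays above
    \<open>c > h v0\<close>, so \<open>g n \<beta>\<close> lies left of \<open>v0\<close>. At
    \<open>u0\<close> it stays below \<open>d < y\<close>, so \<open>g n u0\<close> eventually
    exceeds every point left of \<open>v0\<close>. This is the squeeze.\<close>
  have ev1: "\<forall>\<^sub>F n in sequentially. g n \<beta> < v0"
  proof -
    obtain K where K: "s * c < K" "K < k'" using dense[OF k'(2)] by auto
    have "0 < K" using K s \<open>0 < c\<close> by (meson less_trans mult_pos_pos)
    have "\<forall>\<^sub>F n in sequentially. c < N n (g n \<beta>)"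
      using K s \<open>0 < K\<close> by (intro low[of K]) (auto simp: k' field_simps)
    moreover have "\<forall>\<^sub>F n in sequentially. ereal (N n v0) < ereal c"
      using c by (intro order_tendstoD[OF limN]) auto
    ultimately show ?thesis
    proof eventually_elim
      case (elim n)
      then show ?case using N_anti[of v0 "g n \<beta>" n] by (cases "v0 \<le> g n \<beta>") auto
    qed
  qed
  have ev2: "\<forall>\<^sub>F n in sequentially. v0 - e < g n u0" if "0 < e" for e
  proof -
    obtain K where K: "k < K" "K < s * d" using dense[OF ks(2)] by auto
    have "\<forall>\<^sub>F n in sequentially. N n (g n u0) < d"
      using K s by (intro up[of _ K]) (auto simp: k field_simps)
    moreover have "\<forall>\<^sub>F n in sequentially. ereal d < ereal (N n (v0 - e))"
    proof (rule order_tendstoD(1)[OF limN])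
      have "ereal d < ereal y" using d by simp
      also have "\<dots> < h (v0 - e)" using v0_gt[of "v0 - e"] that by simp
      finally show "ereal d < h (v0 - e)" .
    qed
    ultimately show ?thesis
    proof eventually_elim
      case (elim n)
      then show ?case using N_anti[of "g n u0" "v0 - e" n] by (cases "g n u0 \<le> v0 - e") auto
    qed
  qed
  have diff: "g n \<gamma> - g n u0 = a n / a (m n) * (\<gamma> - u0)" for n \<gamma>
    by (simp add: g_def diff_divide_distrib algebra_simps)
  have u0_lt: "g n u0 < g n \<beta>" for n
  proof -
    have "0 < a n / a (m n) * (\<beta> - u0)" using a[of n] a[of "m n"] \<beta>(1) by (intro mult_pos_pos divide_pos_pos) auto
    then show ?thesis using diff[of n \<beta>] by linarith
  qed
  have g0: "(\<lambda>n. g n u0) \<longlonglongrightarrow> v0"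
  proof (rule order_tendstoI)
    fix e assume "e < v0"
    then show "\<forall>\<^sub>F n in sequentially. e < g n u0" using ev2[of "v0 - e"] by simp
  next
    fix e assume "v0 < e"
    show "\<forall>\<^sub>F n in sequentially. g n u0 < e"
      using ev1 by eventually_elim (use u0_lt \<open>v0 < e\<close> in \<open>meson less_trans\<close>)
  qed
  have g1: "(\<lambda>n. g n \<beta>) \<longlonglongrightarrow> v0"
  proof (rule tendsto_sandwich[OF _ _ g0 tendsto_const])
    show "\<forall>\<^sub>F n in sequentially. g n u0 \<le> g n \<beta>" by (simp add: less_imp_le u0_lt)
    show "\<forall>\<^sub>F n in sequentially. g n \<beta> \<le> v0" using ev1 by eventually_elim simp
  qed
  \<comment> \<open>\<open>g n\<close> is affine, so convergence to \<open>v0\<close> at two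
    distinct arguments forces it at all arguments: the slope \<open>a n / a (m n)\<close>
    vanishes.\<close>
  have g_lim: "(\<lambda>n. g n \<gamma>) \<longlonglongrightarrow> v0" for \<gamma>
  proof -
    have "(\<lambda>n. g n u0 + (g n \<beta> - g n u0) * ((\<gamma> - u0) / (\<beta> - u0))) \<longlonglongrightarrow> v0 + (v0 - v0) * ((\<gamma> - u0) / (\<beta> - u0))"
      by (intro tendsto_intros g0 g1)
    moreover have "g n u0 + (g n \<beta> - g n u0) * ((\<gamma> - u0) / (\<beta> - u0)) = g n \<gamma>" for n
    proof -
      have "(g n \<beta> - g n u0) * ((\<gamma> - u0) / (\<beta> - u0)) = g n \<gamma> - g n u0"
        unfolding diff using \<beta>(1) by simp
      then show ?thesis by simp
    qed
    ultimately show ?thesis by simp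
  qed
  \<comment> \<open>A point off the jump with finite positive value: \<open>u0\<close>, or \<beta>
    in case \<open>u0 = v0\<close>.\<close>
  obtain x q where x: "x \<noteq> v0" "h x = ereal q" "0 < q"
  proof (cases "u0 = v0")
    case True
    have "0 < k'" using k'(2) s \<open>0 < c\<close> by (meson less_trans mult_pos_pos)
    with True show ?thesis using that[of \<beta> k'] \<beta> k' by auto
  qed (use that[of u0 k] k in auto)
  show False
  proof (cases "v0 < x")
    case True
    \<comment> \<open>\<open>h \<gamma> < K\<close> makes the mass at \<open>g n \<gamma>\<close>
      eventually less than \<open>q / 2\<close>, but \<open>g n \<gamma>\<close> is eventually left
      of \<open>x\<close>, where the mass tends to \<open>q\<close>. The other case is the mirror
      image, with mass above \<open>2 * q\<close>.\<close>
    define K where "K = q / 2 * s / 2"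
    have "0 < K" using x s by (simp add: K_def)
    then obtain \<gamma> where \<gamma>: "h \<gamma> < ereal K" using get_lo by auto
    have e1: "\<forall>\<^sub>F n in sequentially. N n (g n \<gamma>) < q / 2"
      using x s by (intro up[OF \<gamma>]) (auto simp: K_def)
    have e2: "\<forall>\<^sub>F n in sequentially. g n \<gamma> < x" using order_tendstoD(2)[OF g_lim True] .
    have e3: "\<forall>\<^sub>F n in sequentially. ereal (q / 2) < ereal (N n x)"
      using x by (intro order_tendstoD(1)[OF limN]) auto
    have "\<forall>\<^sub>F n::nat in sequentially. False"
      using e1 e2 e3
    proof eventually_elim
      case (elim n)
      then show ?case using N_anti[of "g n \<gamma>" x n] by auto
    qed
    then show False by simp
  next
    case False
    then have "x < v0" using x by auto
    define K where "K = 3 * q * s"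
    have "0 < K" using x s by (simp add: K_def)
    then obtain \<gamma> where \<gamma>: "ereal K < h \<gamma>" using get_hi by auto
    have e1: "\<forall>\<^sub>F n in sequentially. 2 * q < N n (g n \<gamma>)"
      using x s by (intro low[OF \<open>0 < K\<close> \<gamma>]) (auto simp: K_def)
    have e2: "\<forall>\<^sub>F n in sequentially. x < g n \<gamma>" using order_tendstoD(1)[OF g_lim \<open>x < v0\<close>] .
    have e3: "\<forall>\<^sub>F n in sequentially. ereal (N n x) < ereal (2 * q)"
      using x by (intro order_tendstoD(2)[OF limN]) auto
    have "\<forall>\<^sub>F n::nat in sequentially. False"
      using e1 e2 e3
    proof eventually_elim
      case (elim n)
      then show ?case using N_anti[of x "g n \<gamma>" n] by auto
    qed
    then show False by simp
  qed
qed

section \<open>The function \<open>H = - ln G\<close> on the open domain of \<open>G\<close>\<close>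

locale extreme_value_tail =
  fixes G :: "real \<Rightarrow> real" and Fb :: "real \<Rightarrow> real" and a b :: "nat \<Rightarrow> real"
  assumes nondeg: "nondegenerate_df G"
    and Fb_anti: "\<And>x y. x \<le> y \<Longrightarrow> Fb y \<le> Fb x" and Fb_nonneg: "\<And>x. 0 \<le> Fb x"
    and a_pos: "\<And>n. 0 < a n"
    and tail_lim: "\<And>u. (\<lambda>n. ereal (real n * Fb (u / a n + b n))) \<longlonglongrightarrow> neg_log (G u)"
begin

definition H :: "real \<Rightarrow> real" where "H v = - ln (G v)"

lemma G_mono: "u \<le> v \<Longrightarrow> G u \<le> G v"
  using nondeg real_distribution.axioms(1)
  by (auto simp: nondegenerate_df_def intro!: finite_borel_measure.cdf_nondecreasing
      real_distribution.finite_borel_measure_M)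

lemma G_bounds: "0 \<le> G u" "G u \<le> 1"
proof -
  obtain N where N: "real_distribution N" "G = cdf N"
    using nondeg by (auto simp: nondegenerate_df_def)
  interpret N: real_distribution N by fact
  show "0 \<le> G u" "G u \<le> 1" using N(2) N.cdf_nonneg N.cdf_bounded_prob by auto
qed

text \<open>Continuity of the limit law in the form in which it is used: every positive number is
  the asymptotic mass of some level. It is \<open>tail_limit_attains\<close> for the function
  \<open>neg_log (G u)\<close> of \<open>u\<close>.\<close>

lemma H_onto: "0 < y \<Longrightarrow> \<exists>v. 0 < G v \<and> G v < 1 \<and> H v = y"
proof -
  assume y: "0 < y"
  obtain N where N: "real_distribution N" "G = cdf N"
    using nondeg by (auto simp: nondegenerate_df_def)
  interpret N: real_distribution N by fact
  obtain u0 where u0: "0 < G u0" "G u0 < 1" using nondegenerate_df_intermediate[OF nondeg] .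
  have "\<exists>v. neg_log (G v) = ereal y"
  proof (rule tail_limit_attains[where h = "\<lambda>u. neg_log (G u)", OF Fb_anti Fb_nonneg a_pos tail_lim])
    fix u
    have "(G \<longlongrightarrow> G u) (at_right u)"
      using N.cdf_is_right_cont[of u] N(2) by (simp add: continuous_within)
    then show "((\<lambda>u. neg_log (G u)) \<longlongrightarrow> neg_log (G u)) (at_right u)"
      by (rule tendsto_neg_log) (rule G_bounds)
  next
    have "((\<lambda>u. neg_log (G u)) \<longlongrightarrow> neg_log 1) at_top"
      using N.cdf_lim_at_top_prob N(2) by (intro tendsto_neg_log G_bounds) simp
    then show "((\<lambda>u. neg_log (G u)) \<longlongrightarrow> 0) at_top" by (simp add: neg_log_def zero_ereal_def)
    have "((\<lambda>u. neg_log (G u)) \<longlongrightarrow> neg_log 0) at_bot"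
      using N.cdf_lim_at_bot N(2) by (intro tendsto_neg_log G_bounds) simp
    then show "((\<lambda>u. neg_log (G u)) \<longlongrightarrow> \<infinity>) at_bot" by (simp add: neg_log_def)
    show "neg_log (G u0) = ereal (- ln (G u0))" "0 < - ln (G u0)"
      using u0 by (auto simp: neg_log_def)
  qed (use y in auto)
  then obtain v where v: "neg_log (G v) = ereal y" by auto
  then have "G v \<noteq> 0" "- ln (G v) = y" by (auto simp: neg_log_def split: if_splits)
  moreover from this have "G v \<noteq> 1" using y by auto
  ultimately show ?thesis using G_bounds[of v] by (intro exI[of _ v]) (auto simp: H_def)
qed

lemma H_pos: "0 < G v \<Longrightarrow> G v < 1 \<Longrightarrow> 0 < H v"
  by (simp add: H_def)

lemma H_anti: "0 < G u \<Longrightarrow> u \<le> v \<Longrightarrow> H v \<le> H u"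
  using G_mono[of u v] by (simp add: H_def)

text \<open>No point with \<open>0 < G v < 1\<close> can be an end-point, because \<open>H\<close>
  also takes the values \<open>H v + 1\<close> and \<open>H v / 2\<close>, necessarily at points
  strictly to the left and to the right of \<open>v\<close>.\<close>

lemma df_domain_eq: "df_domain G = {v. 0 < G v \<and> G v < 1}"
proof (intro set_eqI iffI)
  fix v assume v: "v \<in> df_domain G"
  then have 1: "Inf (ereal ` {v. 0 < G v}) < ereal v" and 2: "ereal v < Sup (ereal ` {v. G v < 1})"
    by (auto simp: df_domain_def)
  from 1 obtain w where "0 < G w" "w < v" by (auto simp: Inf_less_iff)
  moreover from 2 obtain w' where "G w' < 1" "v < w'" by (auto simp: less_Sup_iff)
  ultimately show "v \<in> {v. 0 < G v \<and> G v < 1}"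
    using G_mono[of w v] G_mono[of v w'] by auto
next
  fix v assume "v \<in> {v. 0 < G v \<and> G v < 1}"
  then have v: "0 < G v" "G v < 1" by auto
  obtain w where w: "0 < G w" "H w = H v + 1" using H_onto[of "H v + 1"] H_pos[OF v] by auto
  have "w < v" using H_anti[OF v(1), of w] w by (cases "w < v") auto
  obtain w' where w': "0 < G w'" "G w' < 1" "H w' = H v / 2" using H_onto[of "H v / 2"] H_pos[OF v] by auto
  have "v < w'" using H_anti[OF w'(1), of v] w' H_pos[OF v] by (cases "v < w'") auto
  have "Inf (ereal ` {v. 0 < G v}) \<le> ereal w" using w by (intro Inf_lower) auto
  also have "\<dots> < ereal v" using \<open>w < v\<close> by simp
  finally have 1: "Inf (ereal ` {v. 0 < G v}) < ereal v" .
  have "ereal v < ereal w'" using \<open>v < w'\<close> by simp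
  also have "\<dots> \<le> Sup (ereal ` {v. G v < 1})" using w' by (intro Sup_upper) auto
  finally show "v \<in> df_domain G" using 1 by (simp add: df_domain_def)
qed

abbreviation "E \<equiv> df_domain G"

lemma E_H_pos: "v \<in> E \<Longrightarrow> 0 < H v"
  by (auto simp: df_domain_eq H_pos)

lemma E_H_anti: "u \<in> E \<Longrightarrow> u \<le> v \<Longrightarrow> H v \<le> H u"
  by (auto simp: df_domain_eq H_anti)

lemma H_image: "H ` E = {0<..}"
  using H_onto by (force simp: df_domain_eq H_pos)

lemma E_interval: "u \<in> E \<Longrightarrow> w \<in> E \<Longrightarrow> u \<le> v \<Longrightarrow> v \<le> w \<Longrightarrow> v \<in> E"
  unfolding df_domain_eq using G_mono[of u v] G_mono[of v w] by auto

lemma E_open: "open E"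
proof -
  have "E = ereal -` {Inf (ereal ` {v. 0 < G v}) <..< Sup (ereal ` {v. G v < 1})}"
    by (auto simp: df_domain_def)
  also have "open \<dots>"
    by (rule open_vimage) (auto intro: continuous_on_ereal)
  finally show ?thesis .
qed

text \<open>A monotone function whose image is an open half-line has no jumps; the sign is flipped
  to make it increasing.\<close>

lemma H_continuous: "continuous_on E H"
proof -
  have "(\<lambda>v. - H v) ` E = {..<0}"
  proof -
    have "(\<lambda>v. - H v) ` E = uminus ` (H ` E)" by (simp add: image_image)
    then show ?thesis by (simp add: H_image)
  qed
  then have "continuous_on E (\<lambda>v. - H v)"
    by (intro continuous_onI_mono) (auto simp: E_H_anti)
  then show ?thesis using continuous_on_minus by fastforce
qed

lemma tail_H: "v \<in> E \<Longrightarrow> (\<lambda>n. real n * Fb (v / a n + b n)) \<longlonglongrightarrow> H v"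
  using tail_lim[of v] by (auto simp: df_domain_eq neg_log_def H_def)

end

section \<open>Stationary sequences\<close>

lemma interval_in_ring: "0 \<le> a \<Longrightarrow> a \<le> b \<Longrightarrow> {a..<b} \<in> interval_ring"
  by (auto simp: interval_ring_def)

lemma max_over_le_iff: "max_over X A \<omega> \<le> c \<longleftrightarrow> (\<forall>i. real i \<in> A \<longrightarrow> X (i + 1) \<omega> \<le> c)"
  by (auto simp: max_over_def SUP_le_iff)

text \<open>Convergence of \<open>n * F n\<close> forces \<open>F n\<close> to 0, and for small
  \<open>F\<close> one has \<open>- F - 2 * F^2 \<le> ln (1 - F) \<le> - F\<close>; both bounds
  times \<open>k n\<close> have the limit \<open>- (\<delta> * x)\<close>.\<close>

lemma tendsto_power_one_minus:
  fixes F :: "nat \<Rightarrow> real" and k :: "nat \<Rightarrow> nat"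
  assumes F: "(\<lambda>n. real n * F n) \<longlonglongrightarrow> x" and nonneg: "\<And>n. 0 \<le> F n"
    and k: "(\<lambda>n. real (k n) / real n) \<longlonglongrightarrow> \<delta>"
  shows "(\<lambda>n. (1 - F n) ^ k n) \<longlonglongrightarrow> exp (- (\<delta> * x))"
proof -
  have "(\<lambda>n. (real n * F n) * (1 / real n)) \<longlonglongrightarrow> x * 0"
    by (intro tendsto_mult F lim_1_over_n)
  moreover have "\<forall>\<^sub>F n in sequentially. (real n * F n) * (1 / real n) = F n"
    using eventually_gt_at_top[of 0] by eventually_elim auto
  ultimately have F0: "F \<longlonglongrightarrow> 0" using Lim_transform_eventually by fastforce
  have "(\<lambda>n. (real (k n) / real n) * (real n * F n)) \<longlonglongrightarrow> \<delta> * x" by (intro tendsto_mult F k)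
  moreover have "\<forall>\<^sub>F n in sequentially. (real (k n) / real n) * (real n * F n) = real (k n) * F n"
    using eventually_gt_at_top[of 0] by eventually_elim auto
  ultimately have kF: "(\<lambda>n. real (k n) * F n) \<longlonglongrightarrow> \<delta> * x" using Lim_transform_eventually by fastforce
  have small: "\<forall>\<^sub>F n in sequentially. F n < 1 / 2" using F0 by (rule order_tendstoD) simp
  have "(\<lambda>n. real (k n) * ln (1 - F n)) \<longlonglongrightarrow> - (\<delta> * x)"
  proof (rule tendsto_sandwich[where f = "\<lambda>n. - (real (k n) * F n) - 2 * (real (k n) * F n) * F n"
        and h = "\<lambda>n. - (real (k n) * F n)"])
    have "(\<lambda>n. - (real (k n) * F n) - 2 * (real (k n) * F n) * F n) \<longlonglongrightarrow> - (\<delta> * x) - 2 * (\<delta> * x) * 0"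
      by (intro tendsto_intros kF F0)
    then show "(\<lambda>n. - (real (k n) * F n) - 2 * (real (k n) * F n) * F n) \<longlonglongrightarrow> - (\<delta> * x)" by simp
    show "(\<lambda>n. - (real (k n) * F n)) \<longlonglongrightarrow> - (\<delta> * x)" by (intro tendsto_intros kF)
    show "\<forall>\<^sub>F n in sequentially. - (real (k n) * F n) - 2 * (real (k n) * F n) * F n \<le> real (k n) * ln (1 - F n)"
      using small
    proof eventually_elim
      case (elim n)
      have "- F n - 2 * (F n)\<^sup>2 \<le> ln (1 - F n)"
        using ln_one_minus_pos_lower_bound[of "F n"] nonneg[of n] elim by auto
      then have "real (k n) * (- F n - 2 * (F n)\<^sup>2) \<le> real (k n) * ln (1 - F n)"
        by (intro mult_left_mono) auto
      then show ?case by (simp add: algebra_simps power2_eq_square)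
    qed
    show "\<forall>\<^sub>F n in sequentially. real (k n) * ln (1 - F n) \<le> - (real (k n) * F n)"
      using small
    proof eventually_elim
      case (elim n)
      have "ln (1 - F n) \<le> - F n" using ln_le_minus_one[of "1 - F n"] elim by auto
      then have "real (k n) * ln (1 - F n) \<le> real (k n) * (- F n)" by (intro mult_left_mono) auto
      then show ?case by simp
    qed
  qed
  then have "(\<lambda>n. exp (real (k n) * ln (1 - F n))) \<longlonglongrightarrow> exp (- (\<delta> * x))" by (rule tendsto_exp)
  moreover have "\<forall>\<^sub>F n in sequentially. exp (real (k n) * ln (1 - F n)) = (1 - F n) ^ k n"
    using small by eventually_elim (simp add: exp_of_nat_mult)
  ultimately show ?thesis by (rule Lim_transform_eventually)
qed

text \<open>Telescoping: the factors lie in \<open>[0,1]\<close>, so no error is amplified and the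
  \<open>k\<close> errors simply add up.\<close>

lemma recursive_product_bound:
  fixes Q c :: "nat \<Rightarrow> real"
  assumes "\<And>p. p < k \<Longrightarrow> \<bar>Q p - c p * Q (Suc p)\<bar> \<le> e" and "\<And>p. 0 \<le> c p" "\<And>p. c p \<le> 1"
  shows "\<bar>Q 0 - (\<Prod>p<k. c p) * Q k\<bar> \<le> real k * e"
  using assms(1)
proof (induction k)
  case (Suc k)
  have c: "0 \<le> (\<Prod>p<k. c p)" "(\<Prod>p<k. c p) \<le> 1"
    using assms(2,3) by (auto intro: prod_nonneg prod_le_1)
  have "Q 0 - (\<Prod>p<Suc k. c p) * Q (Suc k)
      = (Q 0 - (\<Prod>p<k. c p) * Q k) + (\<Prod>p<k. c p) * (Q k - c k * Q (Suc k))"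
    by (simp add: algebra_simps)
  also have "\<bar>\<dots>\<bar> \<le> \<bar>Q 0 - (\<Prod>p<k. c p) * Q k\<bar> + (\<Prod>p<k. c p) * \<bar>Q k - c k * Q (Suc k)\<bar>"
    using c by (metis abs_mult abs_of_nonneg abs_triangle_ineq)
  also have "\<dots> \<le> real k * e + 1 * e"
    using c Suc by (intro add_mono mult_mono Suc.IH) auto
  finally show ?case by (simp add: algebra_simps)
qed simp

text \<open>What is kept of the dynamical system: a measure preserving map and the shift relation.
  The relation starts at index 1, in accordance with \<open>X i\<close> being the observable after
  \<open>i - 1\<close> iterations; index 0 lies outside it.\<close>

locale stationary_sequence = prob_space M for M :: "'w measure" +
  fixes f :: "'w \<Rightarrow> 'w" and X :: "nat \<Rightarrow> 'w \<Rightarrow> ereal"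
  assumes f_meas [measurable]: "f \<in> measurable M M" and f_inv: "distr M M f = M"
    and X_meas [measurable]: "\<And>i. X i \<in> borel_measurable M"
    and X_shift: "\<And>i \<omega>. X (Suc (Suc i)) \<omega> = X (Suc i) (f \<omega>)"
begin

text \<open>Shifting the index is composition with \<open>f\<close>, which preserves the law.
  \<open>\<Phi>\<close> is a property of the whole sequence from index 1 on, so joint events over
  several blocks and levels are shifted at once.\<close>

lemma stationary_events:
  assumes "{\<omega> \<in> space M. \<Phi> (\<lambda>i. X (Suc i) \<omega>)} \<in> events"
  shows "{\<omega> \<in> space M. \<Phi> (\<lambda>i. X (Suc i + p) \<omega>)} \<in> events"
    and "prob {\<omega> \<in> space M. \<Phi> (\<lambda>i. X (Suc i + p) \<omega>)} = prob {\<omega> \<in> space M. \<Phi> (\<lambda>i. X (Suc i) \<omega>)}"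
proof (induction p)
  case (Suc p)
  let ?A = "{\<omega> \<in> space M. \<Phi> (\<lambda>i. X (Suc i + p) \<omega>)}"
  have eq: "{\<omega> \<in> space M. \<Phi> (\<lambda>i. X (Suc i + Suc p) \<omega>)} = f -` ?A \<inter> space M"
    using measurable_space[OF f_meas] by (auto simp: X_shift)
  {
    case 1 show ?case unfolding eq using Suc(1) f_meas by (rule measurable_sets[rotated])
  next
    case 2
    have "prob (f -` ?A \<inter> space M) = measure (distr M M f) ?A"
      using Suc(1) by (simp add: measure_distr)
    then show ?case unfolding eq using Suc(2) f_inv by simp
  }
qed (use assms in auto)

section \<open>Exceedance probabilities and the peeling of one exceedance\<close>

definition tail :: "real \<Rightarrow> real" where
  "tail u = prob {\<omega> \<in> space M. ereal u < X 1 \<omega>}"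

definition pair_tail :: "real \<Rightarrow> nat \<Rightarrow> real" where
  "pair_tail u j = prob {\<omega> \<in> space M. ereal u < X 1 \<omega> \<and> ereal u < X j \<omega>}"

lemma tail_anti: "u \<le> v \<Longrightarrow> tail v \<le> tail u"
  unfolding tail_def by (intro finite_measure_mono) (auto intro: le_less_trans[rotated])

lemma tail_bounds: "0 \<le> tail u" "tail u \<le> 1"
  by (auto simp: tail_def)

lemma pair_tail_nonneg: "0 \<le> pair_tail u j"
  by (simp add: pair_tail_def)

lemma prob_exceed: "1 \<le> j \<Longrightarrow> prob {\<omega> \<in> space M. ereal u < X j \<omega>} = tail u"
  using stationary_events(2)[of "\<lambda>x. ereal u < x 0" "j - 1"] by (simp add: tail_def)

lemma prob_exceed2:
  assumes "1 \<le> j"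
  shows "prob {\<omega> \<in> space M. ereal u < X j \<omega> \<and> ereal u < X (j + l) \<omega>} = pair_tail u (Suc l)"
  using stationary_events(2)[of "\<lambda>x. ereal u < x 0 \<and> ereal u < x l" "j - 1"] assms
  by (simp add: pair_tail_def add.commute)

text \<open>The parameter \<open>p\<close> switches off the conditions at indices up to
  \<open>p\<close>. Increasing it removes the indices from the event one by one, until the whole
  space is left.\<close>

definition below :: "(nat \<Rightarrow> nat) \<Rightarrow> (nat \<Rightarrow> nat) \<Rightarrow> (nat \<Rightarrow> real) \<Rightarrow> nat \<Rightarrow> nat \<Rightarrow> 'w set" where
  "below pl pu lev r p =
    {\<omega> \<in> space M. \<forall>i\<in>{1..r}. \<forall>j\<in>{pl i<..pu i}. p < j \<longrightarrow> X j \<omega> \<le> ereal (lev i)}"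

lemma below_events [measurable]: "below pl pu lev r p \<in> events"
  unfolding below_def by measurable

text \<open>The event for \<open>p\<close> is the one for \<open>Suc p\<close> minus the event that
  index \<open>Suc p\<close> exceeds its level. A gap of \<open>t\<close> indices is opened behind
  \<open>Suc p\<close>, after which the remaining conditions decouple from this exceedance up to
  \<open>g\<close>. Opening the gap costs at most \<open>t * tail L\<close> unconditionally, and at
  most the pair probabilities in the presence of the exceedance. These are the three error terms;
  \<open>L\<close> is a common lower bound of the levels.\<close>

lemma one_step:
  fixes r t :: nat and lev :: "nat \<Rightarrow> real"
  assumes disj: "disjoint_family_on (\<lambda>i. {pl i<..pu i}) {1..r}"
    and low: "\<And>i. i \<in> {1..r} \<Longrightarrow> L \<le> lev i"
    and D: "\<And>A v. (\<forall>i\<in>{1..r}. A i \<in> interval_ring) \<Longrightarrow> disjoint_family_on A {1..r} \<Longrightarrow>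
           (\<forall>i\<in>{0..r}. v i \<in> lev ` {1..r}) \<Longrightarrow>
           \<bar>prob {\<omega>\<in>space M. ereal (v 0) < X 1 \<omega> \<and>
                (\<forall>i\<in>{1..r}. max_over X ((\<lambda>a. a + real t) ` A i) \<omega> \<le> ereal (v i))}
            - prob {\<omega>\<in>space M. ereal (v 0) < X 1 \<omega>} *
              prob {\<omega>\<in>space M. \<forall>i\<in>{1..r}. max_over X (A i) \<omega> \<le> ereal (v i)}\<bar> \<le> g"
    and i0: "i0 \<in> {1..r}" "Suc p \<in> {pl i0<..pu i0}"
  shows "\<bar>prob (below pl pu lev r p) - (1 - tail (lev i0)) * prob (below pl pu lev r (Suc p))\<bar>
    \<le> g + tail L * (real t * tail L) + (\<Sum>l=2..t+1. pair_tail L l)"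
proof -
  define Q where "Q p = prob (below pl pu lev r p)" for p
  let ?E = "{\<omega> \<in> space M. ereal (lev i0) < X (Suc p) \<omega>}"
  let ?B = "below pl pu lev r"
  have uniq: "i = i0" if "i \<in> {1..r}" "Suc p \<in> {pl i<..pu i}" for i
    using disj that i0 unfolding disjoint_family_on_def by (metis IntI empty_iff)
  have "?B p = ?B (Suc p) - ?E"
  proof (intro set_eqI iffI)
    fix \<omega> assume "\<omega> \<in> ?B p"
    then show "\<omega> \<in> ?B (Suc p) - ?E" using i0 by (auto simp: below_def not_less)
  next
    fix \<omega> assume \<omega>: "\<omega> \<in> ?B (Suc p) - ?E"
    show "\<omega> \<in> ?B p"
      unfolding below_def
    proof (safe)
      fix i j assume ij: "i \<in> {1..r}" "j \<in> {pl i<..pu i}" "p < j"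
      show "X j \<omega> \<le> ereal (lev i)"
      proof (cases "j = Suc p")
        case True
        then show ?thesis using uniq[of i] ij \<omega> by (auto simp: below_def not_less)
      next
        case False
        then show ?thesis using ij \<omega> by (auto simp: below_def)
      qed
    qed (use \<omega> in \<open>auto simp: below_def\<close>)
  qed
  then have Qp: "Q p = Q (Suc p) - prob (?B (Suc p) \<inter> ?E)"
    unfolding Q_def by (simp add: finite_measure_Diff')
  \<comment> \<open>Contains every outcome on which dropping the conditions inside the gap makes a
    difference.\<close>
  define W where "W = {\<omega> \<in> space M. \<exists>j\<in>{Suc (Suc p)..Suc p + t}. ereal L < X j \<omega>}"
  have W_meas [measurable]: "W \<in> events" unfolding W_def by measurable
  have sub: "?B (Suc p) \<subseteq> ?B (Suc p + t)" by (auto simp: below_def)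
  have sub2: "?B (Suc p + t) - ?B (Suc p) \<subseteq> W"
  proof
    fix \<omega> assume \<omega>: "\<omega> \<in> ?B (Suc p + t) - ?B (Suc p)"
    then obtain i j where ij: "i \<in> {1..r}" "j \<in> {pl i<..pu i}" "Suc p < j" "\<not> X j \<omega> \<le> ereal (lev i)"
      and s: "\<omega> \<in> space M"
      by (auto simp: below_def)
    have "\<not> Suc p + t < j" using \<omega> ij unfolding below_def by blast
    then have "j \<le> Suc p + t" by simp
    moreover have "ereal L < X j \<omega>" using ij low[of i] by (auto simp: not_le intro: le_less_trans[of _ "ereal (lev i)"])
    ultimately show "\<omega> \<in> W" using ij s by (auto simp: W_def)
  qed
  have QQ: "Q (Suc p) \<le> Q (Suc p + t)" "Q (Suc p + t) \<le> Q (Suc p) + real t * tail L"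
  proof -
    show "Q (Suc p) \<le> Q (Suc p + t)" unfolding Q_def by (intro finite_measure_mono sub) auto
    have "Q (Suc p + t) \<le> prob (?B (Suc p) \<union> W)"
      unfolding Q_def using sub2 by (intro finite_measure_mono) auto
    also have "\<dots> \<le> Q (Suc p) + prob W" unfolding Q_def by (intro measure_Un_le) auto
    also have "prob W \<le> (\<Sum>j\<in>{Suc (Suc p)..Suc p + t}. prob {\<omega> \<in> space M. ereal L < X j \<omega>})"
    proof -
      have "W = (\<Union>j\<in>{Suc (Suc p)..Suc p + t}. {\<omega> \<in> space M. ereal L < X j \<omega>})" by (auto simp: W_def)
      then show ?thesis by (simp only:) (intro finite_measure_subadditive_finite, auto)
    qed
    also have "\<dots> = real t * tail L" by (simp add: prob_exceed)
    finally show "Q (Suc p + t) \<le> Q (Suc p) + real t * tail L" by simp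
  qed
  define A where "A = prob (?B (Suc p) \<inter> ?E)"
  define A' where "A' = prob (?B (Suc p + t) \<inter> ?E)"
  have AA: "A \<le> A'" "A' \<le> A + (\<Sum>l=2..t+1. pair_tail L l)"
  proof -
    show "A \<le> A'" unfolding A_def A'_def using sub by (intro finite_measure_mono) auto
    \<comment> \<open>The index \<open>l\<close> is that of the pair \<open>X 1\<close>,
      \<open>X l\<close> in D', so the second member of the pair sits \<open>l - 1\<close> places
      behind \<open>Suc p\<close>.\<close>
    let ?P = "\<lambda>l. {\<omega> \<in> space M. ereal L < X (Suc p) \<omega> \<and> ereal L < X (Suc p + (l - 1)) \<omega>}"
    have "?B (Suc p + t) \<inter> ?E \<subseteq> (?B (Suc p) \<inter> ?E) \<union> (\<Union>l\<in>{2..t+1}. ?P l)"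
    proof
      fix \<omega> assume \<omega>: "\<omega> \<in> ?B (Suc p + t) \<inter> ?E"
      show "\<omega> \<in> (?B (Suc p) \<inter> ?E) \<union> (\<Union>l\<in>{2..t+1}. ?P l)"
      proof (cases "\<omega> \<in> ?B (Suc p)")
        case False
        then have "\<omega> \<in> W" using \<omega> sub2 by auto
        then obtain j where j: "j \<in> {Suc (Suc p)..Suc p + t}" "ereal L < X j \<omega>" "\<omega> \<in> space M" by (auto simp: W_def)
        have "ereal L < X (Suc p) \<omega>" using \<omega> low[OF i0(1)] by (auto intro: le_less_trans[of _ "ereal (lev i0)"])
        then show ?thesis using j by (intro UnI2 UN_I[of "j - p"]) auto
      qed (use \<omega> in auto)
    qed
    then have "A' \<le> prob ((?B (Suc p) \<inter> ?E) \<union> (\<Union>l\<in>{2..t+1}. ?P l))"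
      unfolding A'_def by (intro finite_measure_mono) auto
    also have "\<dots> \<le> A + prob (\<Union>l\<in>{2..t+1}. ?P l)"
      unfolding A_def by (intro measure_Un_le) auto
    also have "prob (\<Union>l\<in>{2..t+1}. ?P l) \<le> (\<Sum>l\<in>{2..t+1}. prob (?P l))"
      by (intro finite_measure_subadditive_finite) auto
    also have "\<dots> = (\<Sum>l=2..t+1. pair_tail L l)"
    proof (intro sum.cong refl)
      fix l assume "l \<in> {2..t+1}"
      then show "prob (?P l) = pair_tail L l" using prob_exceed2[of "Suc p" L "l - 1"] by simp
    qed
    finally show "A' \<le> A + (\<Sum>l=2..t+1. pair_tail L l)" by simp
  qed
  \<comment> \<open>Real intervals holding exactly the \<open>k\<close> for which index
    \<open>k + 1 + p + t\<close> is in block \<open>i\<close> and behind the gap: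
    \<open>max_over\<close> reads \<open>X (k + 1)\<close>, and the bound 1 excludes
    \<open>Suc p + t\<close>, the last index of the gap. \<open>hi\<close> is at least
    \<open>lo\<close>, so a block that is used up becomes an empty interval.\<close>
  define lo where "lo i = max (real (pl i) - real p - real t) 1" for i
  define hi where "hi i = max (lo i) (real (pu i) - real p - real t)" for i
  define v where "v i = (if i = 0 then lev i0 else lev i)" for i
  have D': "\<bar>A' - tail (lev i0) * Q (Suc p + t)\<bar> \<le> g"
  proof -
    let ?I = "\<lambda>i. {lo i..<hi i}"
    have 1: "disjoint_family_on ?I {1..r}"
    proof (unfold disjoint_family_on_def, safe)
      fix i j x assume ij: "i \<in> {1..r}" "j \<in> {1..r}" "i \<noteq> j" and x: "x \<in> ?I i" "x \<in> ?I j"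
      \<comment> \<open>A real point common to two of the intervals would give an index common to
        two blocks.\<close>
      define q where "q = nat (\<lfloor>x\<rfloor> + int p + int t + 1)"
      have "q \<in> {pl i<..pu i}" "q \<in> {pl j<..pu j}"
        using x by (auto simp: lo_def hi_def q_def less_max_iff_disj) linarith+
      then show "x \<in> {}" using disj ij unfolding disjoint_family_on_def by (metis IntI empty_iff)
    qed
    have e1: "{\<omega>\<in>space M. \<forall>i\<in>{1..r}. max_over X (?I i) \<omega> \<le> ereal (v i)} =
       {\<omega>\<in>space M. \<forall>i\<in>{1..r}. \<forall>k. real k \<in> ?I i \<longrightarrow> X (Suc k) \<omega> \<le> ereal (lev i)}"
      by (auto simp: max_over_le_iff v_def)
    \<comment> \<open>The same intervals are used twice. Moved by \<open>p + t\<close> in time they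
      give the conditions behind the gap; shifted by \<open>t\<close> inside \<open>max_over\<close>
      and moved by \<open>p\<close> they give these conditions together with the exceedance at
      \<open>Suc p\<close>.\<close>
    have "prob {\<omega>\<in>space M. \<forall>i\<in>{1..r}. \<forall>k. real k \<in> ?I i \<longrightarrow> X (Suc k) \<omega> \<le> ereal (lev i)}
      = prob {\<omega>\<in>space M. \<forall>i\<in>{1..r}. \<forall>k. real k \<in> ?I i \<longrightarrow> X (Suc k + (p + t)) \<omega> \<le> ereal (lev i)}"
      by (rule stationary_events(2)[symmetric]) measurable
    also have "{\<omega>\<in>space M. \<forall>i\<in>{1..r}. \<forall>k. real k \<in> ?I i \<longrightarrow> X (Suc k + (p + t)) \<omega> \<le> ereal (lev i)} = ?B (Suc p + t)"
    proof (intro set_eqI iffI)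
      fix \<omega> assume \<omega>: "\<omega> \<in> {\<omega>\<in>space M. \<forall>i\<in>{1..r}. \<forall>k. real k \<in> ?I i \<longrightarrow> X (Suc k + (p + t)) \<omega> \<le> ereal (lev i)}"
      show "\<omega> \<in> ?B (Suc p + t)" unfolding below_def
      proof safe
        fix i j assume ij: "i \<in> {1..r}" "j \<in> {pl i<..pu i}" "Suc p + t < j"
        define k where "k = j - p - t - 1"
        have k: "j = Suc k + (p + t)" "1 \<le> k" using ij by (auto simp: k_def)
        have "real k \<in> ?I i" using ij k by (auto simp: lo_def hi_def less_max_iff_disj)
        then show "X j \<omega> \<le> ereal (lev i)" using \<omega> ij(1) k(1) by auto
      qed (use \<omega> in auto)
    next
      fix \<omega> assume \<omega>: "\<omega> \<in> ?B (Suc p + t)"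
      show "\<omega> \<in> {\<omega>\<in>space M. \<forall>i\<in>{1..r}. \<forall>k. real k \<in> ?I i \<longrightarrow> X (Suc k + (p + t)) \<omega> \<le> ereal (lev i)}"
      proof safe
        fix i k assume ik: "i \<in> {1..r}" "real k \<in> ?I i"
        have "Suc k + (p + t) \<in> {pl i<..pu i}" "Suc p + t < Suc k + (p + t)"
          using ik by (auto simp: lo_def hi_def less_max_iff_disj)
        then show "X (Suc k + (p + t)) \<omega> \<le> ereal (lev i)" using \<omega> ik(1) by (auto simp: below_def)
      qed (use \<omega> in \<open>auto simp: below_def\<close>)
    qed
    finally have e2: "prob {\<omega>\<in>space M. \<forall>i\<in>{1..r}. max_over X (?I i) \<omega> \<le> ereal (v i)} = Q (Suc p + t)"
      unfolding e1 Q_def .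
    have img: "real k \<in> (\<lambda>a. a + real t) ` ?I i \<longleftrightarrow> real k - real t \<in> ?I i" for k i
      by (auto intro: image_eqI[of _ _ "real k - real t"])
    have e3: "{\<omega>\<in>space M. ereal (v 0) < X 1 \<omega> \<and>
          (\<forall>i\<in>{1..r}. max_over X ((\<lambda>a. a + real t) ` ?I i) \<omega> \<le> ereal (v i))} =
       {\<omega>\<in>space M. ereal (lev i0) < X (Suc 0) \<omega> \<and> (\<forall>i\<in>{1..r}. \<forall>k. real k - real t \<in> ?I i \<longrightarrow> X (Suc k) \<omega> \<le> ereal (lev i))}"
      by (auto simp: max_over_le_iff v_def img)
    have "prob {\<omega>\<in>space M. ereal (lev i0) < X (Suc 0) \<omega> \<and> (\<forall>i\<in>{1..r}. \<forall>k. real k - real t \<in> ?I i \<longrightarrow> X (Suc k) \<omega> \<le> ereal (lev i))}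
      = prob {\<omega>\<in>space M. ereal (lev i0) < X (Suc 0 + p) \<omega> \<and> (\<forall>i\<in>{1..r}. \<forall>k. real k - real t \<in> ?I i \<longrightarrow> X (Suc k + p) \<omega> \<le> ereal (lev i))}"
      by (rule stationary_events(2)[symmetric, where \<Phi> = "\<lambda>x. ereal (lev i0) < x 0 \<and> (\<forall>i\<in>{1..r}. \<forall>k. real k - real t \<in> ?I i \<longrightarrow> x k \<le> ereal (lev i))"]) measurable
    also have "{\<omega>\<in>space M. ereal (lev i0) < X (Suc 0 + p) \<omega> \<and> (\<forall>i\<in>{1..r}. \<forall>k. real k - real t \<in> ?I i \<longrightarrow> X (Suc k + p) \<omega> \<le> ereal (lev i))} = ?B (Suc p + t) \<inter> ?E"
    proof (intro set_eqI iffI)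
      fix \<omega> assume \<omega>: "\<omega> \<in> {\<omega>\<in>space M. ereal (lev i0) < X (Suc 0 + p) \<omega> \<and> (\<forall>i\<in>{1..r}. \<forall>k. real k - real t \<in> ?I i \<longrightarrow> X (Suc k + p) \<omega> \<le> ereal (lev i))}"
      have "\<omega> \<in> ?B (Suc p + t)" unfolding below_def
      proof safe
        fix i j assume ij: "i \<in> {1..r}" "j \<in> {pl i<..pu i}" "Suc p + t < j"
        define k where "k = j - p - 1"
        have k: "j = Suc k + p" "1 + t \<le> k" using ij by (auto simp: k_def)
        have "real k - real t \<in> ?I i" using ij k by (auto simp: lo_def hi_def less_max_iff_disj)
        then show "X j \<omega> \<le> ereal (lev i)" using \<omega> ij(1) k(1) by auto
      qed (use \<omega> in auto)
      then show "\<omega> \<in> ?B (Suc p + t) \<inter> ?E" using \<omega> by auto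
    next
      fix \<omega> assume \<omega>: "\<omega> \<in> ?B (Suc p + t) \<inter> ?E"
      show "\<omega> \<in> {\<omega>\<in>space M. ereal (lev i0) < X (Suc 0 + p) \<omega> \<and> (\<forall>i\<in>{1..r}. \<forall>k. real k - real t \<in> ?I i \<longrightarrow> X (Suc k + p) \<omega> \<le> ereal (lev i))}"
      proof safe
        fix i k assume ik: "i \<in> {1..r}" "real k - real t \<in> ?I i"
        have "Suc k + p \<in> {pl i<..pu i}" "Suc p + t < Suc k + p"
          using ik by (auto simp: lo_def hi_def less_max_iff_disj)
        then show "X (Suc k + p) \<omega> \<le> ereal (lev i)" using \<omega> ik(1) by (auto simp: below_def)
      qed (use \<omega> in \<open>auto simp: below_def\<close>)
    qed
    finally have e4: "prob {\<omega>\<in>space M. ereal (v 0) < X 1 \<omega> \<and>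
          (\<forall>i\<in>{1..r}. max_over X ((\<lambda>a. a + real t) ` ?I i) \<omega> \<le> ereal (v i))} = A'"
      unfolding e3 A'_def .
    have e5: "prob {\<omega>\<in>space M. ereal (v 0) < X 1 \<omega>} = tail (lev i0)" by (simp add: v_def tail_def)
    show ?thesis
      using D[of ?I v] 1 i0 unfolding e2 e4 e5
      by (auto simp: interval_in_ring lo_def hi_def v_def)
  qed
  have t: "0 \<le> tail (lev i0)" "tail (lev i0) \<le> tail L" "0 \<le> real t * tail L"
    using tail_bounds tail_anti[OF low[OF i0(1)]] by auto
  have "\<bar>tail (lev i0) * Q (Suc p + t) - tail (lev i0) * Q (Suc p)\<bar> = tail (lev i0) * (Q (Suc p + t) - Q (Suc p))"
    using QQ t by (simp add: abs_mult flip: right_diff_distrib)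
  also have "\<dots> \<le> tail L * (real t * tail L)"
    using QQ t by (intro mult_mono) auto
  finally have "\<bar>A - tail (lev i0) * Q (Suc p)\<bar> \<le> g + tail L * (real t * tail L) + (\<Sum>l=2..t+1. pair_tail L l)"
    using D' AA by linarith
  moreover have "Q p - (1 - tail (lev i0)) * Q (Suc p) = - (A - tail (lev i0) * Q (Suc p))"
    by (simp add: Qp A_def algebra_simps)
  ultimately show ?thesis unfolding Q_def by simp
qed

end

section \<open>Records among independent exponential clocks\<close>

text \<open>\<open>T x\<close> is the integral of
  \<open>K * exp (- K * u) * exp (- \<kappa> * u)\<close> over \<open>u \<ge> x\<close>: the
  probability that a clock of rate \<open>K\<close> rings after \<open>x\<close> and before an
  independent clock of rate \<kappa>. Between \<open>s\<close> and \<open>t\<close> the last factor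
  lies between its end values. The bounds are verified by monotonicity in one end-point instead of
  integration.\<close>

lemma exp_mixed_difference_bounds:
  fixes K \<kappa> s t :: real
  assumes K: "0 < K" and \<kappa>: "0 \<le> \<kappa>" and st: "s \<le> t"
  defines "T \<equiv> \<lambda>x. K / (K + \<kappa>) * exp (- (K + \<kappa>) * x)"
  shows "(exp (- K * s) - exp (- K * t)) * exp (- \<kappa> * t) \<le> T s - T t"
    and "T s - T t \<le> (exp (- K * s) - exp (- K * t)) * exp (- \<kappa> * s)"
proof -
  have K\<kappa>: "K + \<kappa> \<noteq> 0" using K \<kappa> by simp
  have dT: "(T has_real_derivative - K * exp (- (K + \<kappa>) * x)) (at x)" for x
  proof -
    have "((\<lambda>x. K / (K + \<kappa>) * exp (- (K + \<kappa>) * x)) has_real_derivative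
        K / (K + \<kappa>) * (exp (- (K + \<kappa>) * x) * (- (K + \<kappa>)))) (at x)"
      using K\<kappa> by (auto intro!: derivative_eq_intros)
    moreover have "K / (K + \<kappa>) * (exp (- (K + \<kappa>) * x) * (- (K + \<kappa>))) = - K * exp (- (K + \<kappa>) * x)"
    proof -
      have "K / c * (exp (- c * x) * (- c)) = - K * exp (- c * x)" if "c \<noteq> 0" for c using that by simp
      then show ?thesis using K\<kappa> by blast
    qed
    ultimately show ?thesis unfolding T_def by simp
  qed
  have "(\<lambda>x. (exp (- K * s) - exp (- K * x)) * exp (- \<kappa> * s) - (T s - T x)) s
      \<le> (\<lambda>x. (exp (- K * s) - exp (- K * x)) * exp (- \<kappa> * s) - (T s - T x)) t"
  proof (rule DERIV_nonneg_imp_nondecreasing[OF st])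
    fix x assume x: "s \<le> x" "x \<le> t"
    have "((\<lambda>x. (exp (- K * s) - exp (- K * x)) * exp (- \<kappa> * s) - (T s - T x)) has_real_derivative
        K * exp (- K * x) * exp (- \<kappa> * s) - K * exp (- (K + \<kappa>) * x)) (at x)"
      by (auto intro!: derivative_eq_intros dT)
    moreover have "exp (- (K + \<kappa>) * x) \<le> exp (- K * x) * exp (- \<kappa> * s)"
      using \<kappa> x by (auto simp: algebra_simps mult_left_mono simp flip: exp_add)
    then have "0 \<le> K * exp (- K * x) * exp (- \<kappa> * s) - K * exp (- (K + \<kappa>) * x)"
      using K by (simp add: mult.assoc)
    ultimately show "\<exists>y. ((\<lambda>x. (exp (- K * s) - exp (- K * x)) * exp (- \<kappa> * s) - (T s - T x)) has_real_derivative y) (at x) \<and> 0 \<le> y"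
      by blast
  qed
  then show "T s - T t \<le> (exp (- K * s) - exp (- K * t)) * exp (- \<kappa> * s)" by simp
  have "(\<lambda>x. T x - T t - (exp (- K * x) - exp (- K * t)) * exp (- \<kappa> * t)) t
      \<le> (\<lambda>x. T x - T t - (exp (- K * x) - exp (- K * t)) * exp (- \<kappa> * t)) s"
  proof (rule DERIV_nonpos_imp_nonincreasing[OF st])
    fix x assume x: "s \<le> x" "x \<le> t"
    have "((\<lambda>x. T x - T t - (exp (- K * x) - exp (- K * t)) * exp (- \<kappa> * t)) has_real_derivative
        - K * exp (- (K + \<kappa>) * x) + K * exp (- K * x) * exp (- \<kappa> * t)) (at x)"
      by (auto intro!: derivative_eq_intros dT)
    moreover have "exp (- K * x) * exp (- \<kappa> * t) \<le> exp (- (K + \<kappa>) * x)"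
      using \<kappa> x by (auto simp: algebra_simps mult_left_mono simp flip: exp_add)
    then have "- K * exp (- (K + \<kappa>) * x) + K * exp (- K * x) * exp (- \<kappa> * t) \<le> 0"
      using K by (simp add: mult.assoc)
    ultimately show "\<exists>y. ((\<lambda>x. T x - T t - (exp (- K * x) - exp (- K * t)) * exp (- \<kappa> * t)) has_real_derivative y) (at x) \<and> y \<le> 0"
      by blast
  qed
  then show "(exp (- K * s) - exp (- K * t)) * exp (- \<kappa> * t) \<le> T s - T t" by simp
qed

text \<open>Riemann-Stieltjes sums of the same integral. With \<open>(Suc m)^2\<close> cells of
  width \<open>1 / Suc m\<close> the mesh shrinks while the range grows without bound. The last
  summand of the upper sum covers what lies beyond the range.\<close>

lemma exp_mixed_sums_tendsto:
  fixes K \<kappa> z :: real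
  assumes K: "0 < K" and \<kappa>: "0 \<le> \<kappa>"
  defines "s \<equiv> \<lambda>m l. z + real l / real (Suc m)"
  shows "(\<lambda>m. \<Sum>l<(Suc m)\<^sup>2. (exp (- K * s m l) - exp (- K * s m (Suc l))) * exp (- \<kappa> * s m (Suc l)))
      \<longlonglongrightarrow> K / (K + \<kappa>) * exp (- (K + \<kappa>) * z)" (is "?lo \<longlonglongrightarrow> ?T")
    and "(\<lambda>m. (\<Sum>l<(Suc m)\<^sup>2. (exp (- K * s m l) - exp (- K * s m (Suc l))) * exp (- \<kappa> * s m l))
       + exp (- K * s m ((Suc m)\<^sup>2)) * exp (- \<kappa> * z))
      \<longlonglongrightarrow> K / (K + \<kappa>) * exp (- (K + \<kappa>) * z)" (is "?up \<longlonglongrightarrow> _")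
proof -
  define T where "T x = K / (K + \<kappa>) * exp (- (K + \<kappa>) * x)" for x
  define \<eta> where "\<eta> m = 1 / real (Suc m)" for m
  define U where "U m = (\<Sum>l<(Suc m)\<^sup>2. (exp (- K * s m l) - exp (- K * s m (Suc l))) * exp (- \<kappa> * s m l))" for m
  define D where "D m = T z - T (s m ((Suc m)\<^sup>2))" for m
  have mono: "s m l \<le> s m (Suc l)" for m l by (simp add: s_def divide_right_mono)
  have D_eq: "D m = (\<Sum>l<(Suc m)\<^sup>2. T (s m l) - T (s m (Suc l)))" for m
    by (subst sum_lessThan_telescope') (simp add: D_def s_def)
  have lo_le: "?lo m \<le> D m" for m
    unfolding D_eq T_def by (intro sum_mono exp_mixed_difference_bounds K \<kappa> mono)
  have up_ge: "D m \<le> U m" for m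
    unfolding D_eq U_def T_def by (intro sum_mono exp_mixed_difference_bounds K \<kappa> mono)
  \<comment> \<open>The two sums differ by a factor that tends to 1, so squeezing the exact value
    \<open>D m\<close> between them determines the limit of both.\<close>
  have lo_U: "?lo m = exp (- \<kappa> * \<eta> m) * U m" for m
  proof -
    have "exp (- \<kappa> * s m (Suc l)) = exp (- \<kappa> * \<eta> m) * exp (- \<kappa> * s m l)" for l
      by (simp add: s_def \<eta>_def add_divide_distrib algebra_simps flip: exp_add)
    then show ?thesis by (simp add: U_def sum_distrib_left mult_ac)
  qed
  have s_end: "s m ((Suc m)\<^sup>2) = z + real (Suc m)" for m
    unfolding s_def power2_eq_square of_nat_mult by (simp del: of_nat_Suc)
  have \<eta>: "\<eta> \<longlonglongrightarrow> 0" unfolding \<eta>_def by (rule LIMSEQ_Suc[OF lim_1_over_n])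
  have e0: "(\<lambda>m. exp (- c * (z + real (Suc m)))) \<longlonglongrightarrow> 0" if "0 < c" for c
  proof -
    have "filterlim (\<lambda>m. z + real (Suc m)) at_top sequentially"
      by (intro filterlim_tendsto_add_at_top[OF tendsto_const] filterlim_compose[OF filterlim_real_sequentially filterlim_Suc])
    then have "filterlim (\<lambda>m. - (c * (z + real (Suc m)))) at_bot sequentially"
      by (subst filterlim_uminus_at_bot[symmetric, where f = "\<lambda>m. c * (z + real (Suc m))", simplified] | simp add: filterlim_uminus_at_bot filterlim_tendsto_pos_mult_at_top[OF tendsto_const that])+
    then have "((\<lambda>m. exp (- (c * (z + real (Suc m))))) \<longlongrightarrow> 0) sequentially"
      by (rule filterlim_compose[OF exp_at_bot])
    then show ?thesis by simp
  qed
  have "(\<lambda>m. T (s m ((Suc m)\<^sup>2))) \<longlonglongrightarrow> K / (K + \<kappa>) * 0"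
    unfolding T_def s_end using K \<kappa> by (intro tendsto_intros e0) auto
  then have "D \<longlonglongrightarrow> T z - K / (K + \<kappa>) * 0" unfolding D_def by (intro tendsto_intros)
  then have D: "D \<longlonglongrightarrow> ?T" by (simp add: T_def)
  have "(\<lambda>m. exp (- \<kappa> * \<eta> m) * D m) \<longlonglongrightarrow> exp (- \<kappa> * 0) * ?T" by (intro tendsto_intros D \<eta>)
  then have l1: "(\<lambda>m. exp (- \<kappa> * \<eta> m) * D m) \<longlonglongrightarrow> ?T" by simp
  have "(\<lambda>m. exp (\<kappa> * \<eta> m) * D m) \<longlonglongrightarrow> exp (\<kappa> * 0) * ?T" by (intro tendsto_intros D \<eta>)
  then have l2: "(\<lambda>m. exp (\<kappa> * \<eta> m) * D m) \<longlonglongrightarrow> ?T" by simp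
  show "?lo \<longlonglongrightarrow> ?T"
  proof (rule tendsto_sandwich[OF _ _ l1 D])
    show "\<forall>\<^sub>F m in sequentially. exp (- \<kappa> * \<eta> m) * D m \<le> ?lo m"
      unfolding lo_U using up_ge by (intro always_eventually allI mult_left_mono) auto
    show "\<forall>\<^sub>F m in sequentially. ?lo m \<le> D m" using lo_le by simp
  qed
  have "U \<longlonglongrightarrow> ?T"
  proof (rule tendsto_sandwich[OF _ _ D l2])
    show "\<forall>\<^sub>F m in sequentially. D m \<le> U m" using up_ge by simp
    have "U m \<le> exp (\<kappa> * \<eta> m) * D m" for m
    proof -
      have "U m = exp (\<kappa> * \<eta> m) * ?lo m" unfolding lo_U by (simp add: mult.assoc[symmetric] flip: exp_add)
      then show ?thesis using lo_le[of m] by simp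
    qed
    then show "\<forall>\<^sub>F m in sequentially. U m \<le> exp (\<kappa> * \<eta> m) * D m" by simp
  qed
  then have "(\<lambda>m. U m + exp (- K * (z + real (Suc m))) * exp (- \<kappa> * z)) \<longlonglongrightarrow> ?T + 0 * exp (- \<kappa> * z)"
    by (intro tendsto_intros e0 K)
  then show "?up \<longlonglongrightarrow> ?T" by (simp only: U_def s_end) simp
qed

(* The variables W n i behave like decreasing functions of independent exponential variables
   with rates kappa i, seen at the levels lev n y; W n i exceeds all W n j with j < i in the
   limit exactly when the i-th exponential clock rings first. *)
lemma (in prob_space) race_limit:
  fixes W :: "nat \<Rightarrow> nat \<Rightarrow> 'a \<Rightarrow> ereal" and lev :: "nat \<Rightarrow> real \<Rightarrow> ereal" and \<kappa> :: "nat \<Rightarrow> real"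
  assumes W [measurable]: "\<And>n i. W n i \<in> borel_measurable M"
    and anti: "\<And>n y y'. 0 < y \<Longrightarrow> y \<le> y' \<Longrightarrow> lev n y' \<le> lev n y"
    and \<kappa>0: "0 < \<kappa> 0" and \<kappa>: "\<And>i. 0 \<le> \<kappa> i"
    and lim: "\<And>y. (\<And>i. 0 < y i) \<Longrightarrow> (\<And>i. y i \<in> \<rat>) \<Longrightarrow>
      (\<lambda>n. prob {\<omega> \<in> space M. \<forall>i\<le>N. W n i \<omega> \<le> lev n (y i)}) \<longlonglongrightarrow> (\<Prod>i\<le>N. exp (- \<kappa> i * y i))"
    and I: "I \<subseteq> {1..N}"
  shows "(\<lambda>n. prob {\<omega> \<in> space M. \<forall>i\<in>I. \<exists>j<i. W n i \<omega> \<le> W n j \<omega>})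
    \<longlonglongrightarrow> (\<Prod>i\<in>I. (\<Sum>j<i. \<kappa> j) / (\<Sum>j\<le>i. \<kappa> j))"
proof -
  have [simp]: "finite I" using I finite_subset by blast
  define K where "K k = (\<Sum>j\<le>k. \<kappa> j)" for k
  have K_pos: "0 < K k" for k
    unfolding K_def using \<kappa>0 \<kappa> by (intro sum_pos2[of _ 0]) auto
  define P where "P k = (\<Prod>i\<in>I \<inter> {..k}. (\<Sum>j<i. \<kappa> j) / (\<Sum>j\<le>i. \<kappa> j))" for k
  \<comment> \<open>The event for the induction on \<open>k\<close>: the conditions of the race are
    imposed for the indices up to \<open>k\<close>, the variables \<open>0..k\<close> share the
    level of \<open>y k\<close> (hence \<open>max i k\<close>), and each later one still has a level
    of its own. A larger \<open>y\<close> means a lower level.\<close>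
  define Ev where "Ev n k y = {\<omega> \<in> space M. (\<forall>i\<in>I. i \<le> k \<longrightarrow> (\<exists>j<i. W n i \<omega> \<le> W n j \<omega>)) \<and>
      (\<forall>i\<le>N. W n i \<omega> \<le> lev n (y (max i k)))}" for n k and y :: "nat \<Rightarrow> real"
  have Ev_meas [measurable]: "Ev n k y \<in> events" for n k y unfolding Ev_def by measurable
  have claim: "(\<lambda>n. prob (Ev n k y)) \<longlonglongrightarrow> P k * exp (- K k * y k) * (\<Prod>i\<in>{k<..N}. exp (- \<kappa> i * y i))"
    if "k \<le> N" "\<And>i. 0 < y i" "\<And>i. y i \<in> \<rat>" for k y
    using that
  proof (induction k arbitrary: y)
    case 0
    have "Ev n 0 y = {\<omega> \<in> space M. \<forall>i\<le>N. W n i \<omega> \<le> lev n (y i)}" for n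
      using I by (fastforce simp: Ev_def)
    moreover have "{..N} = insert 0 {0<..N}" by auto
    moreover have "I \<inter> {..0} = {}" using I by auto
    ultimately show ?case using lim[OF 0(2,3)] by (simp add: P_def K_def)
  next
    case (Suc k)
    have split: "{k<..N} = insert (Suc k) {Suc k<..N}" using Suc.prems(1) by auto
    have K_Suc: "K (Suc k) = K k + \<kappa> (Suc k)" by (simp add: K_def)
    define R where "R = (\<Prod>i\<in>{Suc k<..N}. exp (- \<kappa> i * y i))"
    have phi: "(\<lambda>n. prob (Ev n k (y(k := s, Suc k := w)))) \<longlonglongrightarrow> P k * exp (- K k * s) * (exp (- \<kappa> (Suc k) * w) * R)"
      if "0 < s" "s \<in> \<rat>" "0 < w" "w \<in> \<rat>" for s w
    proof -
      have "(\<Prod>i\<in>{Suc k<..N}. exp (- \<kappa> i * (y(k := s, Suc k := w)) i)) = R"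
        unfolding R_def by (intro prod.cong) auto
      then show ?thesis
        using Suc.IH[of "y(k := s, Suc k := w)"] Suc.prems that unfolding split by (simp add: fun_upd_def)
    qed
    have Ev_eq: "Ev n k (y(k := s, Suc k := w)) = {\<omega> \<in> space M.
        (\<forall>i\<in>I. i \<le> k \<longrightarrow> (\<exists>j<i. W n i \<omega> \<le> W n j \<omega>)) \<and> (\<forall>i\<le>k. W n i \<omega> \<le> lev n s) \<and>
        W n (Suc k) \<omega> \<le> lev n w \<and> (\<forall>i\<in>{Suc k<..N}. W n i \<omega> \<le> lev n (y i))}" (is "?L = ?R") for n s w
    proof -
      have "(\<forall>i\<le>N. W n i \<omega> \<le> lev n ((y(k := s, Suc k := w)) (max i k))) \<longleftrightarrow>
        (\<forall>i\<le>k. W n i \<omega> \<le> lev n s) \<and> W n (Suc k) \<omega> \<le> lev n w \<and> (\<forall>i\<in>{Suc k<..N}. W n i \<omega> \<le> lev n (y i))" for \<omega>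
      proof -
        have "{..N} = {..k} \<union> {Suc k} \<union> {Suc k<..N}" using Suc.prems(1) by auto
        then have "(\<forall>i\<le>N. Q i) \<longleftrightarrow> (\<forall>i\<le>k. Q i) \<and> Q (Suc k) \<and> (\<forall>i\<in>{Suc k<..N}. Q i)" for Q
          by (metis (no_types, lifting) Un_iff atMost_iff singleton_iff)
        then show ?thesis by (auto simp: max_def)
      qed
      then show ?thesis unfolding Ev_def by simp
    qed
    have EvS: "Ev n (Suc k) y = {\<omega> \<in> space M.
        (\<forall>i\<in>I. i \<le> Suc k \<longrightarrow> (\<exists>j<i. W n i \<omega> \<le> W n j \<omega>)) \<and> (\<forall>i\<le>k. W n i \<omega> \<le> lev n (y (Suc k))) \<and>
        W n (Suc k) \<omega> \<le> lev n (y (Suc k)) \<and> (\<forall>i\<in>{Suc k<..N}. W n i \<omega> \<le> lev n (y i))}" for n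
    proof -
      have "(\<forall>i\<le>N. W n i \<omega> \<le> lev n (y (max i (Suc k)))) \<longleftrightarrow>
        (\<forall>i\<le>k. W n i \<omega> \<le> lev n (y (Suc k))) \<and> W n (Suc k) \<omega> \<le> lev n (y (Suc k)) \<and> (\<forall>i\<in>{Suc k<..N}. W n i \<omega> \<le> lev n (y i))" for \<omega>
      proof -
        have "{..N} = {..k} \<union> {Suc k} \<union> {Suc k<..N}" using Suc.prems(1) by auto
        then have "(\<forall>i\<le>N. Q i) \<longleftrightarrow> (\<forall>i\<le>k. Q i) \<and> Q (Suc k) \<and> (\<forall>i\<in>{Suc k<..N}. Q i)" for Q
          by (metis (no_types, lifting) Un_iff atMost_iff singleton_iff)
        then show ?thesis by (auto simp: max_def)
      qed
      then show ?thesis unfolding Ev_def by simp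
    qed
    define z where "z = y (Suc k)"
    have z: "0 < z" "z \<in> \<rat>" using Suc.prems by (auto simp: z_def)
    show ?case
    proof (cases "Suc k \<in> I")
      case False
      have "(\<forall>i\<in>I. i \<le> Suc k \<longrightarrow> Q i) \<longleftrightarrow> (\<forall>i\<in>I. i \<le> k \<longrightarrow> Q i)" for Q
        using False by (metis le_Suc_eq)
      then have "Ev n (Suc k) y = Ev n k (y(k := z, Suc k := z))" for n
        unfolding Ev_eq EvS z_def by simp
      moreover have "I \<inter> {..Suc k} = I \<inter> {..k}" using False by (auto simp: le_Suc_eq)
      moreover have "exp (- K (Suc k) * z) = exp (- K k * z) * exp (- \<kappa> (Suc k) * z)"
        by (simp add: K_Suc algebra_simps flip: exp_add)
      ultimately show ?thesis using phi[OF z z] by (simp add: P_def R_def z_def mult_ac)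
    next
      case True
      \<comment> \<open>The grid starts at the rational \<open>z\<close> and stays rational, because
        \<open>lim\<close> is given at rational arguments.\<close>
      define s where "s m l = z + real l / real (Suc m)" for m l
      have s: "0 < s m l" "s m l \<in> \<rat>" "z \<le> s m l" for m l
        using z by (auto simp: s_def add_pos_nonneg simp del: of_nat_Suc)
      have s_mono: "s m l \<le> s m l'" if "l \<le> l'" for m l l'
        using that by (simp add: s_def divide_right_mono)
      define \<phi> where "\<phi> n u w = prob (Ev n k (y(k := u, Suc k := w)))" for n u w
      have sub: "Ev n k (y(k := u', Suc k := w)) \<subseteq> Ev n k (y(k := u, Suc k := w))" if "0 < u" "u \<le> u'" for n u u' w
        unfolding Ev_eq using anti[OF that, of n] by (auto intro: order_trans)
      have diff: "prob (Ev n k (y(k := u, Suc k := w)) - Ev n k (y(k := u', Suc k := w))) = \<phi> n u w - \<phi> n u' w"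
        if "0 < u" "u \<le> u'" for n u u' w
        unfolding \<phi>_def using sub[OF that] by (intro finite_measure_Diff) auto
      have P_Suc: "P (Suc k) = P k * (K k / K (Suc k))"
      proof -
        have "I \<inter> {..Suc k} = insert (Suc k) (I \<inter> {..k})" using True by (auto simp: le_Suc_eq)
        then show ?thesis by (simp add: P_def K_def lessThan_Suc_atMost)
      qed
      \<comment> \<open>Each summand is the probability that the maximum of \<open>W n 0\<close>,
        ..., \<open>W n k\<close> lies in the strip between the levels of \<open>s m l\<close> and
        \<open>s m (Suc l)\<close>, with \<open>W n (Suc k)\<close> below the bottom of the strip in
        \<open>lo\<close> and below its top in \<open>up\<close>. The last term of \<open>up\<close>
        covers maxima below the whole grid.\<close>
      define lo where "lo m n = (\<Sum>l<(Suc m)\<^sup>2. \<phi> n (s m l) (s m (Suc l)) - \<phi> n (s m (Suc l)) (s m (Suc l)))" for m n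
      define up where "up m n = (\<Sum>l<(Suc m)\<^sup>2. \<phi> n (s m l) (s m l) - \<phi> n (s m (Suc l)) (s m l)) + \<phi> n (s m ((Suc m)\<^sup>2)) z" for m n
      have "(\<lambda>n. prob (Ev n (Suc k) y)) \<longlonglongrightarrow> P k * R * (K k / (K k + \<kappa> (Suc k)) * exp (- (K k + \<kappa> (Suc k)) * z))"
      proof (rule double_sandwich[where l = lo and u = up])
        fix m
        have "lo m n \<le> prob (Ev n (Suc k) y)" for n
        proof -
          let ?A = "\<lambda>l. Ev n k (y(k := s m l, Suc k := s m (Suc l))) - Ev n k (y(k := s m (Suc l), Suc k := s m (Suc l)))"
          have disj: "disjoint_family ?A"
          proof -
            have "?A l \<inter> ?A l' = {}" if "l < l'" for l l'
            proof -
              have "lev n (s m l') \<le> lev n (s m (Suc l))" using that by (intro anti s s_mono) auto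
              then show ?thesis unfolding Ev_eq by (auto intro: order_trans)
            qed
            then show ?thesis unfolding disjoint_family_on_def by (metis linorder_neqE_nat Int_commute)
          qed
          have "lo m n = (\<Sum>l<(Suc m)\<^sup>2. prob (?A l))"
            unfolding lo_def by (intro sum.cong refl diff[symmetric] s s_mono) auto
          also have "\<dots> = prob (\<Union>l<(Suc m)\<^sup>2. ?A l)"
            using disj by (intro finite_measure_finite_Union[symmetric]) (auto simp: disjoint_family_on_def)
          also have "\<dots> \<le> prob (Ev n (Suc k) y)"
          proof (intro finite_measure_mono UN_least)
            fix l
            have 1: "lev n (s m l) \<le> lev n z" "lev n (s m (Suc l)) \<le> lev n z" using s z by (auto intro!: anti)
            show "?A l \<subseteq> Ev n (Suc k) y"
            proof
              fix \<omega> assume \<omega>: "\<omega> \<in> ?A l"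
              then have "\<not> (\<forall>i\<le>k. W n i \<omega> \<le> lev n (s m (Suc l)))" unfolding Ev_eq by blast
              then obtain j where "j \<le> k" "lev n (s m (Suc l)) < W n j \<omega>" by (auto simp: not_le)
              moreover have "W n (Suc k) \<omega> \<le> lev n (s m (Suc l))" using \<omega> by (auto simp: Ev_eq)
              ultimately have "\<exists>j<Suc k. W n (Suc k) \<omega> \<le> W n j \<omega>"
                by (intro exI[of _ j]) (auto intro: order_trans less_imp_le)
              then show "\<omega> \<in> Ev n (Suc k) y"
                using \<omega> 1 unfolding EvS z_def[symmetric] by (auto simp: Ev_eq le_Suc_eq intro: order_trans)
            qed
          qed auto
          finally show ?thesis .
        qed
        moreover have "prob (Ev n (Suc k) y) \<le> up m n" for n
        proof -
          let ?A = "\<lambda>l. Ev n k (y(k := s m l, Suc k := s m l)) - Ev n k (y(k := s m (Suc l), Suc k := s m l))"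
          let ?B = "Ev n k (y(k := s m ((Suc m)\<^sup>2), Suc k := z))"
          have "Ev n (Suc k) y \<subseteq> (\<Union>l<(Suc m)\<^sup>2. ?A l) \<union> ?B"
          proof
            fix \<omega> assume \<omega>: "\<omega> \<in> Ev n (Suc k) y"
            define h where "h l \<longleftrightarrow> (\<forall>i\<le>k. W n i \<omega> \<le> lev n (s m l))" for l
            show "\<omega> \<in> (\<Union>l<(Suc m)\<^sup>2. ?A l) \<union> ?B"
            proof (cases "h ((Suc m)\<^sup>2)")
              case True
              then show ?thesis using \<omega> unfolding EvS Ev_eq h_def z_def by (auto simp: le_Suc_eq)
            next
              case False
              \<comment> \<open>The strip of the maximum: still below the level of
                \<open>s m l\<close>, no longer below that of \<open>s m (Suc l)\<close>.\<close>
              define l where "l = (LEAST l. \<not> h (Suc l))"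
              have h0: "h 0" using \<omega> by (auto simp: EvS h_def s_def z_def)
              have "(Suc m)\<^sup>2 = Suc (m * m + 2 * m)" by (simp add: power2_eq_square)
              with False have ex: "\<not> h (Suc (m * m + 2 * m))" by metis
              have l1: "\<not> h (Suc l)" unfolding l_def by (rule LeastI[of "\<lambda>l. \<not> h (Suc l)", OF ex])
              have l2: "l \<le> m * m + 2 * m" unfolding l_def by (rule Least_le[of "\<lambda>l. \<not> h (Suc l)", OF ex])
              have l3: "h l"
              proof (cases l)
                case (Suc l')
                then have "l' < l" by simp
                then show ?thesis using not_less_Least[of l' "\<lambda>l. \<not> h (Suc l)"] Suc unfolding l_def by simp
              qed (simp add: h0)
              obtain j where "j < Suc k" "W n (Suc k) \<omega> \<le> W n j \<omega>" using \<omega> True by (auto simp: EvS)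
              then have "W n (Suc k) \<omega> \<le> lev n (s m l)" using l3 by (auto simp: h_def less_Suc_eq_le intro: order_trans)
              then have "\<omega> \<in> ?A l" using \<omega> l1 l3 unfolding EvS Ev_eq h_def by (auto simp: le_Suc_eq)
              moreover have "l < (Suc m)\<^sup>2" using l2 by (simp add: power2_eq_square)
              ultimately show ?thesis by blast
            qed
          qed
          then have "prob (Ev n (Suc k) y) \<le> prob ((\<Union>l<(Suc m)\<^sup>2. ?A l) \<union> ?B)"
            by (intro finite_measure_mono) auto
          also have "\<dots> \<le> prob (\<Union>l<(Suc m)\<^sup>2. ?A l) + prob ?B" by (intro measure_Un_le) auto
          also have "prob (\<Union>l<(Suc m)\<^sup>2. ?A l) \<le> (\<Sum>l<(Suc m)\<^sup>2. prob (?A l))"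
            by (intro finite_measure_subadditive_finite) auto
          also have "(\<Sum>l<(Suc m)\<^sup>2. prob (?A l)) = (\<Sum>l<(Suc m)\<^sup>2. \<phi> n (s m l) (s m l) - \<phi> n (s m (Suc l)) (s m l))"
            by (intro sum.cong refl diff s s_mono) auto
          finally show ?thesis by (simp only: up_def \<phi>_def)
        qed
        ultimately show "\<forall>\<^sub>F n in sequentially. lo m n \<le> prob (Ev n (Suc k) y) \<and> prob (Ev n (Suc k) y) \<le> up m n"
          by simp
      next
        fix m
        have "lo m \<longlonglongrightarrow> (\<Sum>l<(Suc m)\<^sup>2. P k * exp (- K k * s m l) * (exp (- \<kappa> (Suc k) * s m (Suc l)) * R)
            - P k * exp (- K k * s m (Suc l)) * (exp (- \<kappa> (Suc k) * s m (Suc l)) * R))"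
          unfolding lo_def \<phi>_def by (intro tendsto_sum tendsto_diff phi s)
        also have "(\<Sum>l<(Suc m)\<^sup>2. P k * exp (- K k * s m l) * (exp (- \<kappa> (Suc k) * s m (Suc l)) * R)
            - P k * exp (- K k * s m (Suc l)) * (exp (- \<kappa> (Suc k) * s m (Suc l)) * R)) =
          P k * R * (\<Sum>l<(Suc m)\<^sup>2. (exp (- K k * s m l) - exp (- K k * s m (Suc l))) * exp (- \<kappa> (Suc k) * s m (Suc l)))"
          unfolding sum_distrib_left by (intro sum.cong) (auto simp: algebra_simps)
        finally show "lo m \<longlonglongrightarrow> \<dots>" .
        have "up m \<longlonglongrightarrow> (\<Sum>l<(Suc m)\<^sup>2. P k * exp (- K k * s m l) * (exp (- \<kappa> (Suc k) * s m l) * R)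
            - P k * exp (- K k * s m (Suc l)) * (exp (- \<kappa> (Suc k) * s m l) * R)) +
            P k * exp (- K k * s m ((Suc m)\<^sup>2)) * (exp (- \<kappa> (Suc k) * z) * R)"
          unfolding up_def \<phi>_def by (intro tendsto_add tendsto_sum tendsto_diff phi s z)
        also have "(\<Sum>l<(Suc m)\<^sup>2. P k * exp (- K k * s m l) * (exp (- \<kappa> (Suc k) * s m l) * R)
            - P k * exp (- K k * s m (Suc l)) * (exp (- \<kappa> (Suc k) * s m l) * R)) +
            P k * exp (- K k * s m ((Suc m)\<^sup>2)) * (exp (- \<kappa> (Suc k) * z) * R) =
          P k * R * ((\<Sum>l<(Suc m)\<^sup>2. (exp (- K k * s m l) - exp (- K k * s m (Suc l))) * exp (- \<kappa> (Suc k) * s m l))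
            + exp (- K k * s m ((Suc m)\<^sup>2)) * exp (- \<kappa> (Suc k) * z))"
          unfolding sum_distrib_left distrib_left
          by (intro arg_cong2[of _ _ _ _ "(+)"] sum.cong) (auto simp: algebra_simps)
        finally show "up m \<longlonglongrightarrow> \<dots>" .
      next
        show "(\<lambda>m. P k * R * (\<Sum>l<(Suc m)\<^sup>2. (exp (- K k * s m l) - exp (- K k * s m (Suc l))) * exp (- \<kappa> (Suc k) * s m (Suc l))))
          \<longlonglongrightarrow> P k * R * (K k / (K k + \<kappa> (Suc k)) * exp (- (K k + \<kappa> (Suc k)) * z))"
          unfolding s_def by (intro tendsto_mult_left exp_mixed_sums_tendsto K_pos \<kappa>)
        show "(\<lambda>m. P k * R * ((\<Sum>l<(Suc m)\<^sup>2. (exp (- K k * s m l) - exp (- K k * s m (Suc l))) * exp (- \<kappa> (Suc k) * s m l))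
            + exp (- K k * s m ((Suc m)\<^sup>2)) * exp (- \<kappa> (Suc k) * z)))
          \<longlonglongrightarrow> P k * R * (K k / (K k + \<kappa> (Suc k)) * exp (- (K k + \<kappa> (Suc k)) * z))"
          unfolding s_def by (intro tendsto_mult_left exp_mixed_sums_tendsto K_pos \<kappa>)
      qed
      then show ?thesis by (simp add: P_Suc K_Suc R_def z_def mult_ac)
    qed
  qed
  define Av where "Av n = {\<omega> \<in> space M. \<forall>i\<in>I. \<exists>j<i. W n i \<omega> \<le> W n j \<omega>}" for n
  define \<epsilon> where "\<epsilon> m = 1 / real (Suc m)" for m
  have \<epsilon>: "0 < \<epsilon> m" "\<epsilon> m \<in> \<rat>" for m by (auto simp: \<epsilon>_def simp del: of_nat_Suc)
  have \<epsilon>0: "\<epsilon> \<longlonglongrightarrow> 0" unfolding \<epsilon>_def by (rule LIMSEQ_Suc[OF lim_1_over_n])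
  \<comment> \<open>The claim itself carries no level. It is removed by letting
    \<open>\<epsilon> m\<close> tend to 0: the limiting probability that all variables stay below
    that level tends to 1.\<close>
  define B where "B m n = {\<omega> \<in> space M. \<forall>i\<le>N. W n i \<omega> \<le> lev n (\<epsilon> m)}" for m n
  have [measurable]: "Av n \<in> events" "B m n \<in> events" for m n by (auto simp: Av_def B_def)
  have EvN: "Ev n N (\<lambda>_. \<epsilon> m) = Av n \<inter> B m n" for n m
    using I by (auto simp: Ev_def Av_def B_def)
  have PN: "P N = (\<Prod>i\<in>I. (\<Sum>j<i. \<kappa> j) / (\<Sum>j\<le>i. \<kappa> j))"
    unfolding P_def using I by (intro prod.cong) auto
  have "(\<lambda>n. prob (Av n)) \<longlonglongrightarrow> P N"
  proof (rule double_sandwich[where l = "\<lambda>m n. prob (Ev n N (\<lambda>_. \<epsilon> m))"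
        and u = "\<lambda>m n. prob (Ev n N (\<lambda>_. \<epsilon> m)) + (1 - prob (B m n))"])
    fix m
    have "prob (Ev n N (\<lambda>_. \<epsilon> m)) \<le> prob (Av n)" for n unfolding EvN by (intro finite_measure_mono) auto
    moreover have "prob (Av n) \<le> prob (Ev n N (\<lambda>_. \<epsilon> m)) + (1 - prob (B m n))" for n
    proof -
      have "prob (Av n) \<le> prob ((Av n \<inter> B m n) \<union> (space M - B m n))"
        by (intro finite_measure_mono) (auto simp: Av_def)
      also have "\<dots> \<le> prob (Av n \<inter> B m n) + prob (space M - B m n)" by (intro measure_Un_le) auto
      finally show ?thesis by (simp add: EvN prob_compl)
    qed
    ultimately show "\<forall>\<^sub>F n in sequentially. prob (Ev n N (\<lambda>_. \<epsilon> m)) \<le> prob (Av n) \<and>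
        prob (Av n) \<le> prob (Ev n N (\<lambda>_. \<epsilon> m)) + (1 - prob (B m n))" by simp
    show l: "(\<lambda>n. prob (Ev n N (\<lambda>_. \<epsilon> m))) \<longlonglongrightarrow> P N * exp (- K N * \<epsilon> m)"
      using claim[of N "\<lambda>_. \<epsilon> m"] \<epsilon> by simp
    show "(\<lambda>n. prob (Ev n N (\<lambda>_. \<epsilon> m)) + (1 - prob (B m n)))
        \<longlonglongrightarrow> P N * exp (- K N * \<epsilon> m) + (1 - (\<Prod>i\<le>N. exp (- \<kappa> i * \<epsilon> m)))"
      unfolding B_def using lim[of "\<lambda>_. \<epsilon> m"] \<epsilon> by (intro tendsto_add l tendsto_diff tendsto_const) auto
  next
    have "(\<lambda>m. P N * exp (- K N * \<epsilon> m)) \<longlonglongrightarrow> P N * exp (- K N * 0)" by (intro tendsto_intros \<epsilon>0)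
    then show 1: "(\<lambda>m. P N * exp (- K N * \<epsilon> m)) \<longlonglongrightarrow> P N" by simp
    have "(\<lambda>m. P N * exp (- K N * \<epsilon> m) + (1 - (\<Prod>i\<le>N. exp (- \<kappa> i * \<epsilon> m)))) \<longlonglongrightarrow> P N + (1 - (\<Prod>i\<le>N. exp (- \<kappa> i * 0)))"
      by (intro tendsto_intros 1 \<epsilon>0)
    then show "(\<lambda>m. P N * exp (- K N * \<epsilon> m) + (1 - (\<Prod>i\<le>N. exp (- \<kappa> i * \<epsilon> m)))) \<longlonglongrightarrow> P N" by simp
  qed
  then show ?thesis unfolding Av_def PN .
qed

section \<open>Maxima over disjoint blocks\<close>

lemma finite_SUP_attained:
  fixes g :: "'b \<Rightarrow> 'c::complete_linorder"
  assumes "finite A" "A \<noteq> {}"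
  obtains j where "j \<in> A" "(SUP i\<in>A. g i) = g j"
proof -
  have "(SUP i\<in>A. g i) = Max (g ` A)" using assms by (intro Max_Sup[symmetric]) auto
  also have "\<dots> \<in> g ` A" using assms by (intro Max_in) auto
  finally show ?thesis using that by auto
qed

lemma exp_minus_bounds:
  fixes x :: real
  assumes "0 \<le> x"
  shows "1 - x \<le> exp (- x)" and "exp (- x) \<le> 1 - x + x\<^sup>2 / 2"
proof -
  show "1 - x \<le> exp (- x)" using exp_ge_add_one_self[of "- x"] by simp
  have "(\<lambda>x::real. exp (- x) - (1 - x + x\<^sup>2 / 2)) x \<le> (\<lambda>x. exp (- x) - (1 - x + x\<^sup>2 / 2)) 0"
  proof (rule DERIV_nonpos_imp_nonincreasing[OF assms])
    fix y :: real assume "0 \<le> y"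
    have "((\<lambda>x. exp (- x) - (1 - x + x\<^sup>2 / 2)) has_real_derivative - exp (- y) + 1 - y) (at y)"
      by (auto intro!: derivative_eq_intros)
    moreover have "- exp (- y) + 1 - y \<le> 0" using exp_ge_add_one_self[of "- y"] by simp
    ultimately show "\<exists>z. ((\<lambda>x. exp (- x) - (1 - x + x\<^sup>2 / 2)) has_real_derivative z) (at y) \<and> z \<le> 0"
      by blast
  qed
  then show "exp (- x) \<le> 1 - x + x\<^sup>2 / 2" by simp
qed

text \<open>The number of events that occur, minus the indicator that some event occurs, dominates
  the indicator that two of them occur. In the induction a new event contributes its overlap with
  the union of the earlier ones.\<close>

lemma (in prob_space) prob_two_le:
  assumes "finite J" and A: "\<And>j. j \<in> J \<Longrightarrow> A j \<in> events"
  shows "(\<Union>i\<in>J. \<Union>j\<in>J - {i}. A i \<inter> A j) \<in> events"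
    and "prob (\<Union>i\<in>J. \<Union>j\<in>J - {i}. A i \<inter> A j) \<le> (\<Sum>j\<in>J. prob (A j)) - prob (\<Union>j\<in>J. A j)"
proof -
  show "(\<Union>i\<in>J. \<Union>j\<in>J - {i}. A i \<inter> A j) \<in> events"
    using assms by (intro sets.finite_UN) auto
  show "prob (\<Union>i\<in>J. \<Union>j\<in>J - {i}. A i \<inter> A j) \<le> (\<Sum>j\<in>J. prob (A j)) - prob (\<Union>j\<in>J. A j)"
    using assms
  proof (induction J)
    case (insert x J)
    let ?T = "\<lambda>J. \<Union>i\<in>J. \<Union>j\<in>J - {i}. A i \<inter> A j" and ?U = "\<Union>j\<in>J. A j"
    have m: "A x \<in> events" "?U \<in> events" using insert by (auto intro!: sets.finite_UN)
    have T: "?T J \<in> events" by (intro sets.finite_UN sets.Int) (use insert in auto)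
    have "?T (insert x J) \<subseteq> ?T J \<union> (A x \<inter> ?U)" by auto
    then have "prob (?T (insert x J)) \<le> prob (?T J \<union> (A x \<inter> ?U))"
      by (rule finite_measure_mono) (intro sets.Un sets.Int T m)
    also have "\<dots> \<le> prob (?T J) + prob (A x \<inter> ?U)" by (intro measure_Un_le sets.Int T m)
    also have "prob (?T J) \<le> (\<Sum>j\<in>J. prob (A j)) - prob ?U" using insert by auto
    also have "prob (A x \<inter> ?U) = prob (A x) + prob ?U - prob (A x \<union> ?U)"
      using finite_measure_Union'[OF m] finite_measure_Diff'[OF m(2,1)] by (simp add: Int_commute)
    finally show ?case using insert by simp
  qed simp
qed

definition time_index :: "nat \<Rightarrow> real \<Rightarrow> nat" where
  "time_index n t = nat \<lfloor>real n * t\<rfloor>"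

lemma time_index_mono: "s \<le> t \<Longrightarrow> time_index n s \<le> time_index n t"
  unfolding time_index_def by (intro nat_mono floor_mono mult_left_mono) auto

lemma time_index_0 [simp]: "time_index n 0 = 0"
  by (simp add: time_index_def)

lemma le_time_index_iff: "0 \<le> t \<Longrightarrow> j \<le> time_index n t \<longleftrightarrow> real j \<le> real n * t"
proof -
  assume "0 \<le> t"
  then have x: "0 \<le> real n * t" by simp
  show ?thesis unfolding time_index_def
  proof
    assume "j \<le> nat \<lfloor>real n * t\<rfloor>"
    then have "real j \<le> real (nat \<lfloor>real n * t\<rfloor>)" by simp
    also have "\<dots> \<le> real n * t" using x by (rule of_nat_floor)
    finally show "real j \<le> real n * t" .
  qed (rule le_nat_floor)
qed

lemma time_index_ratio:
  assumes "0 \<le> t"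
  shows "(\<lambda>n. real (time_index n t) / real n) \<longlonglongrightarrow> t"
proof (rule tendsto_sandwich[where f = "\<lambda>n. t - 1 / real n" and h = "\<lambda>_. t"])
  have "(\<lambda>n. t - 1 / real n) \<longlonglongrightarrow> t - 0" by (intro tendsto_intros lim_1_over_n)
  then show "(\<lambda>n. t - 1 / real n) \<longlonglongrightarrow> t" by simp
  have b: "real n * t - 1 \<le> real (time_index n t)" "real (time_index n t) \<le> real n * t" for n
    using assms mult_nonneg_nonneg[of "real n" t] unfolding time_index_def by linarith+
  show "\<forall>\<^sub>F n in sequentially. t - 1 / real n \<le> real (time_index n t) / real n"
    using eventually_gt_at_top[of 0]
  proof eventually_elim
    case (elim n)
    then have "(real n * t - 1) / real n \<le> real (time_index n t) / real n"
      using b by (intro divide_right_mono) auto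
    then show ?case using elim by (simp add: diff_divide_distrib)
  qed
  show "\<forall>\<^sub>F n in sequentially. real (time_index n t) / real n \<le> t"
    using eventually_gt_at_top[of 0] by eventually_elim (use b in \<open>simp add: field_simps\<close>)
qed simp

section \<open>Block maxima of a sequence that satisfies the mixing conditions\<close>

locale mixing_extremes = stationary_sequence M f X
  for M :: "'w measure" and f :: "'w \<Rightarrow> 'w" and X :: "nat \<Rightarrow> 'w \<Rightarrow> ereal" +
  fixes a b :: "nat \<Rightarrow> real" and G :: "real \<Rightarrow> real"
  assumes nondegenerate: "nondegenerate_df G" and a_positive: "\<And>n. 0 < a n"
    and tails: "\<And>u. (\<lambda>n. ereal (real n * measure M {\<omega>\<in>space M. ereal (u / a n + b n) < X 1 \<omega>}))
                  \<longlonglongrightarrow> neg_log (G u)"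
    and mixing: "\<And>(r::nat) (x :: nat \<Rightarrow> real) (u :: nat \<Rightarrow> nat \<Rightarrow> real).
        1 \<le> r \<Longrightarrow> 0 < x 1 \<Longrightarrow>
        (\<And>i j. 1 \<le> i \<Longrightarrow> i \<le> j \<Longrightarrow> j \<le> r \<Longrightarrow> x i \<le> x j) \<Longrightarrow>
        (\<And>n i j. 1 \<le> i \<Longrightarrow> i \<le> j \<Longrightarrow> j \<le> r \<Longrightarrow> u j n \<le> u i n) \<Longrightarrow>
        (\<And>k. 1 \<le> k \<Longrightarrow> k \<le> r \<Longrightarrow>
           (\<lambda>n. real n * measure M {w\<in>space M. ereal (u k n) < X 1 w}) \<longlonglongrightarrow> x k) \<Longrightarrow>
        cond_D M X r u \<and> cond_D' M X r u"
begin

sublocale extreme_value_tail G tail a b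
  using nondegenerate a_positive tails tail_anti tail_bounds
  by unfold_locales (auto simp: tail_def)

definition level :: "nat \<Rightarrow> real \<Rightarrow> real" where "level n v = v / a n + b n"

lemma level_mono: "v \<le> w \<Longrightarrow> level n v \<le> level n w"
  using a_positive[of n] by (simp add: level_def divide_right_mono)

lemma tail_level: "v \<in> E \<Longrightarrow> (\<lambda>n. real n * tail (level n v)) \<longlonglongrightarrow> H v"
  unfolding level_def by (rule tail_H)

text \<open>The mixing hypothesis is stated for decreasing levels, whereas blocks carry levels in
  any order. As condition D allows an arbitrary choice from the set of levels, the values can be
  sorted first; afterwards only the set and the smallest level \<open>vm\<close> matter.\<close>

lemma level_conditions:
  fixes v :: "nat \<Rightarrow> real"
  assumes r: "1 \<le> r" and v: "\<And>i. i \<in> {1..r} \<Longrightarrow> v i \<in> E"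
  obtains u vm where "cond_D M X r u" "cond_D' M X r u"
    "\<And>n. (\<lambda>k. u k n) ` {1..r} = (\<lambda>i. level n (v i)) ` {1..r}"
    "vm \<in> E" "\<And>n. u r n = level n vm" "\<And>i. i \<in> {1..r} \<Longrightarrow> vm \<le> v i"
proof -
  define xs where "xs = sort (map v [1..<Suc r])"
  have len: "length xs = r" and set: "set xs = v ` {1..r}"
    by (auto simp: xs_def atLeastLessThanSuc_atLeastAtMost simp del: upt_Suc)
  have sorted: "sorted xs" by (simp add: xs_def)
  \<comment> \<open>The \<open>k\<close>-th largest value, as \<open>xs\<close> is
    increasing.\<close>
  define w where "w k = xs ! (r - k)" for k
  have w_img: "w ` {1..r} = v ` {1..r}"
  proof -
    have "w ` {1..r} = (\<lambda>i. xs ! i) ` {..<r}"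
    proof -
      have "(\<lambda>k. r - k) ` {1..r} = {..<r}"
      proof (intro set_eqI iffI)
        fix i assume "i \<in> {..<r}"
        then show "i \<in> (\<lambda>k. r - k) ` {1..r}" by (intro image_eqI[of _ _ "r - i"]) auto
      qed (use r in auto)
      then show ?thesis by (metis (no_types, lifting) image_cong image_image w_def)
    qed
    also have "\<dots> = set xs" using len by (auto simp: set_conv_nth)
    finally show ?thesis using set by simp
  qed
  have wE: "w k \<in> E" if "k \<in> {1..r}" for k
    using v w_img that by (metis (no_types, lifting) imageE imageI)
  have w_anti: "w j \<le> w i" if "1 \<le> i" "i \<le> j" "j \<le> r" for i j
    unfolding w_def using that len by (intro sorted_nth_mono[OF sorted]) auto
  define u where "u k n = level n (w k)" for k n
  have 1: "cond_D M X r u \<and> cond_D' M X r u"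
  proof (rule mixing[OF r, where x = "\<lambda>k. H (w k)"])
    show "0 < H (w 1)" using wE[of 1] r by (intro E_H_pos) auto
    show "H (w i) \<le> H (w j)" if "1 \<le> i" "i \<le> j" "j \<le> r" for i j
      using w_anti[OF that] wE[of j] that by (intro E_H_anti) auto
    show "u j n \<le> u i n" if "1 \<le> i" "i \<le> j" "j \<le> r" for n i j
      unfolding u_def by (intro level_mono w_anti that)
    show "(\<lambda>n. real n * prob {w \<in> space M. ereal (u k n) < X 1 w}) \<longlonglongrightarrow> H (w k)" if "1 \<le> k" "k \<le> r" for k
      using tail_level[OF wE[of k]] that by (simp add: u_def tail_def)
  qed
  show thesis
  proof (rule that[of u "w r"])
    show "(\<lambda>k. u k n) ` {1..r} = (\<lambda>i. level n (v i)) ` {1..r}" for n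
      using w_img unfolding u_def by (metis (no_types, lifting) image_cong image_image)
    show "w r \<in> E" using wE r by auto
    show "w r \<le> v i" if "i \<in> {1..r}" for i
    proof -
      have "v i \<in> w ` {1..r}" using that w_img by auto
      then show ?thesis using w_anti by auto
    qed
  qed (use 1 in \<open>auto simp: u_def\<close>)
qed

text \<open>For every fixed \<open>q\<close> the gap length \<open>t n = o(n)\<close> eventually
  stays below \<open>n div q\<close>, so the sum over the gap is dominated by the one in D', which
  is small for large \<open>q\<close>.\<close>

lemma clustering_negligible:
  assumes D': "cond_D' M X r u" and r: "1 \<le> r" and u: "\<And>n. u r n = level n vm"
    and t: "(\<lambda>n. real (t n)) \<in> o(\<lambda>n. real n)"
  shows "(\<lambda>n. real n * (\<Sum>l=2..t n + 1. pair_tail (level n vm) l)) \<longlonglongrightarrow> 0"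
proof (rule order_tendstoI)
  fix e :: real assume "0 < e"
  let ?S = "\<lambda>q n. real n * (\<Sum>j=2..n div q. pair_tail (level n vm) j)"
  have "(\<lambda>q. limsup (\<lambda>n. ereal (?S q n))) \<longlonglongrightarrow> 0"
    using bspec[OF D'[unfolded cond_D'_def], of r] r by (simp add: u pair_tail_def)
  then have "\<forall>\<^sub>F q in sequentially. limsup (\<lambda>n. ereal (?S q n)) < ereal e"
    using \<open>0 < e\<close> by (intro order_tendstoD(2)) auto
  then have "\<forall>\<^sub>F q in sequentially. limsup (\<lambda>n. ereal (?S q n)) < ereal e \<and> 1 \<le> q"
    by (intro eventually_conj eventually_ge_at_top)
  then obtain q where q: "limsup (\<lambda>n. ereal (?S q n)) < ereal e" "1 \<le> q" by (auto simp: eventually_sequentially)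
  have e1: "\<forall>\<^sub>F n in sequentially. ereal (?S q n) < ereal e" using q(1) by (rule Limsup_lessD)
  \<comment> \<open>The factor \<open>1 / (2 * q)\<close>, together with
    \<open>n \<ge> 2 * q\<close>, leaves room for the extra 1 in
    \<open>t n + 1 \<le> n div q\<close>.\<close>
  have e2: "\<forall>\<^sub>F n in sequentially. norm (real (t n)) \<le> 1 / (2 * real q) * norm (real n)"
    using landau_o.smallD[OF t, of "1 / (2 * real q)"] q by simp
  show "\<forall>\<^sub>F n in sequentially. real n * (\<Sum>l=2..t n + 1. pair_tail (level n vm) l) < e"
    using e1 e2 eventually_ge_at_top[of "2 * q"]
  proof eventually_elim
    case (elim n)
    have "real (t n) * (2 * real q) \<le> real n" using elim(2) q by (simp add: field_simps)
    then have "real (t n * q * 2) \<le> real n" by (simp add: mult_ac)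
    then have "t n * q * 2 \<le> n" by (simp only: of_nat_le_iff)
    then have "(t n + 1) * q \<le> n" using elim(3) by (simp add: algebra_simps)
    then have "t n + 1 \<le> n div q" using q by (simp add: less_eq_div_iff_mult_less_eq)
    then have "(\<Sum>l=2..t n + 1. pair_tail (level n vm) l) \<le> (\<Sum>j=2..n div q. pair_tail (level n vm) j)"
      by (intro sum_mono2) (auto simp: pair_tail_nonneg)
    then have "real n * (\<Sum>l=2..t n + 1. pair_tail (level n vm) l) \<le> ?S q n" by (intro mult_left_mono) auto
    then show ?case using elim(1) by simp
  qed
next
  fix e :: real assume "e < 0"
  have "0 \<le> real n * (\<Sum>l=2..t n + 1. pair_tail (level n vm) l)" for n
    by (intro mult_nonneg_nonneg sum_nonneg pair_tail_nonneg) auto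
  then show "\<forall>\<^sub>F n in sequentially. e < real n * (\<Sum>l=2..t n + 1. pair_tail (level n vm) l)"
    using \<open>e < 0\<close> by (intro always_eventually allI) (meson less_le_trans)
qed

text \<open>\<open>one_step\<close> is applied at every index below \<open>L n\<close>: an index in
  block \<open>i\<close> contributes the factor \<open>1 - F n i\<close>, any other index the factor
  1. The accumulated error is \<open>L n * err n\<close> with \<open>L n\<close> of order
  \<open>n\<close>, so each part of \<open>err n\<close> has to be \<open>o(1 / n)\<close>.\<close>

lemma block_limit:
  fixes pl pu :: "nat \<Rightarrow> nat \<Rightarrow> nat"
  assumes r: "1 \<le> r" and v: "\<And>i. i \<in> {1..r} \<Longrightarrow> v i \<in> E"
    and disj: "\<And>n. disjoint_family_on (\<lambda>i. {pl n i<..pu n i}) {1..r}"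
    and L: "\<And>n i. i \<in> {1..r} \<Longrightarrow> pu n i \<le> L n" "(\<lambda>n. real (L n) / real n) \<longlonglongrightarrow> Lr"
    and \<delta>: "\<And>i. i \<in> {1..r} \<Longrightarrow> (\<lambda>n. real (pu n i - pl n i) / real n) \<longlonglongrightarrow> \<delta> i"
  shows "(\<lambda>n. prob (below (pl n) (pu n) (\<lambda>i. level n (v i)) r 0)) \<longlonglongrightarrow> (\<Prod>i\<in>{1..r}. exp (- (\<delta> i * H (v i))))"
proof -
  obtain u vm where u: "cond_D M X r u" "cond_D' M X r u"
    "\<And>n. (\<lambda>k. u k n) ` {1..r} = (\<lambda>i. level n (v i)) ` {1..r}"
    "vm \<in> E" "\<And>n. u r n = level n vm" "\<And>i. i \<in> {1..r} \<Longrightarrow> vm \<le> v i"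
    using level_conditions[of r v, OF r v] by blast
  obtain \<gamma> t where \<gamma>: "\<And>n A w. (\<forall>i\<in>{1..r}. A i \<in> interval_ring) \<Longrightarrow> disjoint_family_on A {1..r} \<Longrightarrow>
           (\<forall>i\<in>{0..r}. w i \<in> (\<lambda>k. u k n) ` {1..r}) \<Longrightarrow>
           \<bar>prob {\<omega>\<in>space M. ereal (w 0) < X 1 \<omega> \<and>
                (\<forall>i\<in>{1..r}. max_over X ((\<lambda>a. a + real (t n)) ` A i) \<omega> \<le> ereal (w i))}
            - prob {\<omega>\<in>space M. ereal (w 0) < X 1 \<omega>} *
              prob {\<omega>\<in>space M. \<forall>i\<in>{1..r}. max_over X (A i) \<omega> \<le> ereal (w i)}\<bar> \<le> \<gamma> n (t n)"
    and t: "(\<lambda>n. real (t n)) \<in> o(\<lambda>n. real n)" and \<gamma>0: "(\<lambda>n. real n * \<gamma> n (t n)) \<longlonglongrightarrow> 0"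
    using u(1) unfolding cond_D_def by blast
  define lev where "lev n i = level n (v i)" for n i
  define F where "F n i = tail (lev n i)" for n i
  define err where "err n = \<gamma> n (t n) + tail (level n vm) * (real (t n) * tail (level n vm))
      + (\<Sum>l=2..t n + 1. pair_tail (level n vm) l)" for n
  define c where "c n p = (\<Prod>i\<in>{1..r}. if Suc p \<in> {pl n i<..pu n i} then 1 - F n i else 1)" for n p
  define Q where "Q n p = prob (below (pl n) (pu n) (lev n) r p)" for n p
  have F01: "0 \<le> F n i" "F n i \<le> 1" for n i using tail_bounds by (auto simp: F_def)
  have c01: "0 \<le> c n p" "c n p \<le> 1" for n p
    unfolding c_def using F01 by (auto intro!: prod_nonneg prod_le_1)
  have err_nonneg: "0 \<le> err n" for n
  proof -
    have "(\<forall>i\<in>{0..r}. level n (v 1) \<in> (\<lambda>k. u k n) ` {1..r})" using u(3)[of n] r by auto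
    then have "0 \<le> \<gamma> n (t n)"
      using \<gamma>[of "\<lambda>_. {0..<0}" "\<lambda>_. level n (v 1)" n] interval_in_ring[of 0 0]
      by (auto simp: disjoint_family_on_def intro: order_trans[OF abs_ge_zero])
    moreover have "0 \<le> (\<Sum>l=2..t n + 1. pair_tail (level n vm) l)" by (intro sum_nonneg pair_tail_nonneg)
    ultimately show ?thesis unfolding err_def using tail_bounds by auto
  qed
  have step: "\<bar>Q n p - c n p * Q n (Suc p)\<bar> \<le> err n" for n p
  proof (cases "\<exists>i\<in>{1..r}. Suc p \<in> {pl n i<..pu n i}")
    case True
    then obtain i where i: "i \<in> {1..r}" "Suc p \<in> {pl n i<..pu n i}" by auto
    have uniq: "j = i" if "j \<in> {1..r}" "Suc p \<in> {pl n j<..pu n j}" for j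
      using disj[of n] that i unfolding disjoint_family_on_def by (metis IntI empty_iff)
    have "c n p = (\<Prod>j\<in>{1..r}. if j = i then 1 - F n i else 1)"
      unfolding c_def
    proof (intro prod.cong refl)
      fix j assume "j \<in> {1..r}"
      then have e: "Suc p \<in> {pl n j<..pu n j} \<longleftrightarrow> j = i" using uniq[of j] i by blast
      then show "(if Suc p \<in> {pl n j<..pu n j} then 1 - F n j else 1) = (if j = i then 1 - F n i else 1)"
        unfolding e by simp
    qed
    then have "c n p = 1 - F n i" using i by (simp add: prod.delta)
    moreover have "\<bar>prob (below (pl n) (pu n) (lev n) r p) - (1 - tail (lev n i)) * prob (below (pl n) (pu n) (lev n) r (Suc p))\<bar>
       \<le> \<gamma> n (t n) + tail (level n vm) * (real (t n) * tail (level n vm)) + (\<Sum>l=2..t n + 1. pair_tail (level n vm) l)"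
    proof (rule one_step[OF disj _ _ i])
      show "level n vm \<le> lev n i" if "i \<in> {1..r}" for i unfolding lev_def by (intro level_mono u(6) that)
      show "\<bar>prob {\<omega>\<in>space M. ereal (w 0) < X 1 \<omega> \<and>
                (\<forall>i\<in>{1..r}. max_over X ((\<lambda>a. a + real (t n)) ` A i) \<omega> \<le> ereal (w i))}
            - prob {\<omega>\<in>space M. ereal (w 0) < X 1 \<omega>} *
              prob {\<omega>\<in>space M. \<forall>i\<in>{1..r}. max_over X (A i) \<omega> \<le> ereal (w i)}\<bar> \<le> \<gamma> n (t n)"
        if "(\<forall>i\<in>{1..r}. A i \<in> interval_ring)" "disjoint_family_on A {1..r}" "(\<forall>i\<in>{0..r}. w i \<in> lev n ` {1..r})" for A w
        using that unfolding lev_def[abs_def] u(3)[symmetric] by (intro \<gamma>)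
    qed
    ultimately show ?thesis by (simp add: Q_def err_def F_def)
  next
    case False
    then have "c n p = 1" by (auto simp: c_def intro!: prod.neutral)
    moreover have "below (pl n) (pu n) (lev n) r p = below (pl n) (pu n) (lev n) r (Suc p)"
    proof -
      have "(p < j) = (Suc p < j)" if "i \<in> {1..r}" "j \<in> {pl n i<..pu n i}" for i j
        using False that by (metis Suc_lessI Suc_lessD)
      then show ?thesis unfolding below_def by (intro Collect_cong) blast
    qed
    ultimately show ?thesis using err_nonneg by (simp add: Q_def)
  qed
  \<comment> \<open>No block reaches beyond \<open>L n\<close>, so the recursion ends at probability
    1.\<close>
  have QL: "Q n (L n) = 1" for n
  proof -
    have "below (pl n) (pu n) (lev n) r (L n) = space M"
    proof -
      have "\<not> L n < j" if "i \<in> {1..r}" "j \<in> {pl n i<..pu n i}" for i j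
        using L(1)[OF that(1), of n] that(2) by simp
      then show ?thesis unfolding below_def by blast
    qed
    then show ?thesis by (simp add: Q_def prob_space)
  qed
  have prod_eq: "(\<Prod>p<L n. c n p) = (\<Prod>i\<in>{1..r}. (1 - F n i) ^ (pu n i - pl n i))" for n
  proof -
    have "(\<Prod>p<L n. c n p) = (\<Prod>i\<in>{1..r}. \<Prod>p<L n. if Suc p \<in> {pl n i<..pu n i} then 1 - F n i else 1)"
      unfolding c_def by (rule prod.swap)
    also have "\<dots> = (\<Prod>i\<in>{1..r}. (1 - F n i) ^ (pu n i - pl n i))"
    proof (intro prod.cong refl)
      fix i assume i: "i \<in> {1..r}"
      have "(\<Prod>p<L n. if Suc p \<in> {pl n i<..pu n i} then 1 - F n i else 1)
          = (\<Prod>p\<in>{p\<in>{..<L n}. Suc p \<in> {pl n i<..pu n i}}. 1 - F n i)"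
        by (rule prod.inter_filter[symmetric]) simp
      also have "{p\<in>{..<L n}. Suc p \<in> {pl n i<..pu n i}} = {pl n i..<pu n i}"
        using L(1)[OF i, of n] by auto
      finally show "(\<Prod>p<L n. if Suc p \<in> {pl n i<..pu n i} then 1 - F n i else 1) = (1 - F n i) ^ (pu n i - pl n i)"
        by simp
    qed
    finally show ?thesis .
  qed
  have bound: "\<bar>Q n 0 - (\<Prod>p<L n. c n p)\<bar> \<le> real (L n) * err n" for n
    using recursive_product_bound[of "L n" "Q n" "c n" "err n", OF step c01] QL by simp
  have main: "(\<lambda>n. \<Prod>p<L n. c n p) \<longlonglongrightarrow> (\<Prod>i\<in>{1..r}. exp (- (\<delta> i * H (v i))))"
    unfolding prod_eq
  proof (intro tendsto_prod tendsto_power_one_minus)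
    fix i assume "i \<in> {1..r}"
    then show "(\<lambda>n. real n * F n i) \<longlonglongrightarrow> H (v i)" "(\<lambda>n. real (pu n i - pl n i) / real n) \<longlonglongrightarrow> \<delta> i"
      unfolding F_def lev_def by (intro tail_level v \<delta>; assumption)+
  qed (use F01 in auto)
  have tn: "(\<lambda>n. real (t n) / real n) \<longlonglongrightarrow> 0"
    using smalloD_tendsto[OF t] by simp
  \<comment> \<open>The middle part of the error becomes \<open>(n * tail)^2 * (t n / n)\<close>:
    besides the clustering term, it too relies on \<open>t n = o(n)\<close>.\<close>
  have "(\<lambda>n. real (L n) / real n * (real n * \<gamma> n (t n) + (real n * tail (level n vm)) * (real n * tail (level n vm)) * (real (t n) / real n)
      + real n * (\<Sum>l=2..t n + 1. pair_tail (level n vm) l))) \<longlonglongrightarrow> Lr * (0 + H vm * H vm * 0 + 0)"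
    by (intro tendsto_intros L(2) \<gamma>0 tail_level u(4) tn clustering_negligible[OF u(2) r u(5) t])
  moreover have "\<forall>\<^sub>F n in sequentially. real (L n) / real n * (real n * \<gamma> n (t n) + (real n * tail (level n vm)) * (real n * tail (level n vm)) * (real (t n) / real n)
      + real n * (\<Sum>l=2..t n + 1. pair_tail (level n vm) l)) = real (L n) * err n"
    using eventually_gt_at_top[of 0] by eventually_elim (simp add: err_def field_simps)
  ultimately have e0: "(\<lambda>n. real (L n) * err n) \<longlonglongrightarrow> 0"
    using Lim_transform_eventually by fastforce
  have "(\<lambda>n. Q n 0 - (\<Prod>p<L n. c n p)) \<longlonglongrightarrow> 0"
    using bound by (intro Lim_null_comparison[OF _ e0]) auto
  from tendsto_add[OF this main] show ?thesis by (simp add: Q_def lev_def[abs_def])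
qed

text \<open>The passage to rescaled time: \<open>sep\<close> keeps the blocks of indices disjoint,
  and the sum of all right end-points serves as common horizon.\<close>

lemma block_limit_time:
  fixes I :: "'i set" and s t :: "'i \<Rightarrow> real"
  assumes fin: "finite I" and v: "\<And>i. i \<in> I \<Longrightarrow> v i \<in> E"
    and st: "\<And>i. i \<in> I \<Longrightarrow> 0 \<le> s i" "\<And>i. i \<in> I \<Longrightarrow> s i \<le> t i"
    and sep: "\<And>i j. i \<in> I \<Longrightarrow> j \<in> I \<Longrightarrow> i \<noteq> j \<Longrightarrow> t i \<le> s j \<or> t j \<le> s i"
  shows "(\<lambda>n. prob {\<omega> \<in> space M. \<forall>i\<in>I. \<forall>j\<in>{time_index n (s i)<..time_index n (t i)}. X j \<omega> \<le> ereal (level n (v i))})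
    \<longlonglongrightarrow> (\<Prod>i\<in>I. exp (- ((t i - s i) * H (v i))))"
proof (cases "I = {}")
  case False
  define r where "r = card I"
  have r: "1 \<le> r" using False fin by (simp add: r_def Suc_leI card_gt_0_iff)
  obtain h where h: "bij_betw h {1..r} I" using ex_bij_betw_nat_finite_1[OF fin] by (auto simp: r_def)
  have hI: "h i \<in> I" if "i \<in> {1..r}" for i using h that by (auto simp: bij_betw_def)
  define T where "T = (\<Sum>i\<in>I. t i)"
  have tT: "t i \<le> T" if "i \<in> I" for i
    unfolding T_def using st fin that by (intro member_le_sum) (auto intro: order_trans)
  have T0: "0 \<le> T" using False st tT by (meson ex_in_conv order_trans)
  have "(\<lambda>n. prob (below (\<lambda>i. time_index n (s (h i))) (\<lambda>i. time_index n (t (h i))) (\<lambda>i. level n (v (h i))) r 0))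
    \<longlonglongrightarrow> (\<Prod>i\<in>{1..r}. exp (- ((t (h i) - s (h i)) * H (v (h i)))))"
  proof (rule block_limit[OF r, where L = "\<lambda>n. time_index n T" and Lr = T])
    show "v (h i) \<in> E" if "i \<in> {1..r}" for i using v hI that by blast
    show "disjoint_family_on (\<lambda>i. {time_index n (s (h i))<..time_index n (t (h i))}) {1..r}" for n
    proof (unfold disjoint_family_on_def, intro ballI impI)
      fix i j assume ij: "i \<in> {1..r}" "j \<in> {1..r}" "i \<noteq> j"
      then have "h i \<noteq> h j" using h by (metis bij_betw_imp_inj_on inj_onD)
      then have "t (h i) \<le> s (h j) \<or> t (h j) \<le> s (h i)" using sep hI ij by blast
      then show "{time_index n (s (h i))<..time_index n (t (h i))} \<inter> {time_index n (s (h j))<..time_index n (t (h j))} = {}"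
        using time_index_mono[of "t (h i)" "s (h j)" n] time_index_mono[of "t (h j)" "s (h i)" n] by auto
    qed
    show "time_index n (t (h i)) \<le> time_index n T" if "i \<in> {1..r}" for n i
      using tT hI that by (intro time_index_mono) auto
    show "(\<lambda>n. real (time_index n T) / real n) \<longlonglongrightarrow> T" using T0 by (rule time_index_ratio)
    show "(\<lambda>n. real (time_index n (t (h i)) - time_index n (s (h i))) / real n) \<longlonglongrightarrow> t (h i) - s (h i)"
      if "i \<in> {1..r}" for i
    proof -
      have "0 \<le> s (h i)" "s (h i) \<le> t (h i)" using st hI that by auto
      then have "(\<lambda>n. real (time_index n (t (h i))) / real n - real (time_index n (s (h i))) / real n) \<longlonglongrightarrow> t (h i) - s (h i)"
        by (intro tendsto_diff time_index_ratio) auto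
      moreover have "real (time_index n (t (h i)) - time_index n (s (h i))) = real (time_index n (t (h i))) - real (time_index n (s (h i)))" for n
        using time_index_mono[OF \<open>s (h i) \<le> t (h i)\<close>] by (simp add: of_nat_diff)
      ultimately show ?thesis by (simp add: diff_divide_distrib)
    qed
  qed
  moreover have "below (\<lambda>i. time_index n (s (h i))) (\<lambda>i. time_index n (t (h i))) (\<lambda>i. level n (v (h i))) r 0
     = {\<omega> \<in> space M. \<forall>i\<in>I. \<forall>j\<in>{time_index n (s i)<..time_index n (t i)}. X j \<omega> \<le> ereal (level n (v i))}" for n
  proof -
    have "I = h ` {1..r}" using h by (simp add: bij_betw_def)
    then show ?thesis by (auto simp: below_def)
  qed
  moreover have "(\<Prod>i\<in>{1..r}. exp (- ((t (h i) - s (h i)) * H (v (h i))))) = (\<Prod>i\<in>I. exp (- ((t i - s i) * H (v i))))"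
    using h by (rule prod.reindex_bij_betw)
  ultimately show ?thesis by simp
qed (simp add: prob_space)

end

section \<open>First visits to disjoint level bins\<close>

context mixing_extremes
begin

text \<open>By \<open>prob_two_le\<close> the bound is the expected number of exceedances minus the
  probability of at least one. Its limit \<open>x - 1 + exp (- x)\<close>, with
  \<open>x = (t - s) * H v\<close>, is quadratic in the block length, which makes double exceedances
  in short blocks negligible.\<close>

lemma two_exceedances_bound:
  assumes st: "0 \<le> s" "s \<le> t" and v: "v \<in> E"
  obtains g where
    "\<And>n. prob {\<omega> \<in> space M. \<exists>i\<in>{time_index n s<..time_index n t}. \<exists>j\<in>{time_index n s<..time_index n t}.
        i \<noteq> j \<and> ereal (level n v) < X i \<omega> \<and> ereal (level n v) < X j \<omega>} \<le> g n"
    "g \<longlonglongrightarrow> (t - s) * H v - 1 + exp (- ((t - s) * H v))"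
proof
  define J where "J n = {time_index n s<..time_index n t}" for n
  define A where "A n j = {\<omega> \<in> space M. ereal (level n v) < X j \<omega>}" for n j
  have [measurable]: "A n j \<in> events" for n j unfolding A_def by measurable
  \<comment> \<open>The index set \<open>{()}\<close> brings a single block into the form of
    \<open>block_limit_time\<close>.\<close>
  define g where "g n = real (card (J n)) * tail (level n v)
      - (1 - prob {\<omega> \<in> space M. \<forall>i\<in>{()}. \<forall>j\<in>J n. X j \<omega> \<le> ereal (level n v)})" for n
  show "prob {\<omega> \<in> space M. \<exists>i\<in>{time_index n s<..time_index n t}. \<exists>j\<in>{time_index n s<..time_index n t}.
        i \<noteq> j \<and> ereal (level n v) < X i \<omega> \<and> ereal (level n v) < X j \<omega>} \<le> g n" for n
  proof -
    have "prob (\<Union>i\<in>J n. \<Union>j\<in>J n - {i}. A n i \<inter> A n j) \<le> (\<Sum>j\<in>J n. prob (A n j)) - prob (\<Union>j\<in>J n. A n j)"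
      by (intro prob_two_le) (auto simp: J_def)
    moreover have "(\<Union>i\<in>J n. \<Union>j\<in>J n - {i}. A n i \<inter> A n j) = {\<omega> \<in> space M. \<exists>i\<in>J n. \<exists>j\<in>J n.
        i \<noteq> j \<and> ereal (level n v) < X i \<omega> \<and> ereal (level n v) < X j \<omega>}"
      by (auto simp: A_def)
    moreover have "(\<Sum>j\<in>J n. prob (A n j)) = real (card (J n)) * tail (level n v)"
      by (simp add: A_def J_def prob_exceed)
    moreover have "prob (\<Union>j\<in>J n. A n j) = 1 - prob {\<omega> \<in> space M. \<forall>i\<in>{()}. \<forall>j\<in>J n. X j \<omega> \<le> ereal (level n v)}"
    proof -
      have "(\<Union>j\<in>J n. A n j) = space M - {\<omega> \<in> space M. \<forall>i\<in>{()}. \<forall>j\<in>J n. X j \<omega> \<le> ereal (level n v)}"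
        by (auto simp: A_def not_le)
      then show ?thesis by (simp add: prob_compl J_def)
    qed
    ultimately show ?thesis by (simp add: g_def J_def)
  qed
  have "(\<lambda>n. (real (time_index n t) / real n - real (time_index n s) / real n) * (real n * tail (level n v))) \<longlonglongrightarrow> (t - s) * H v"
    using st by (intro tendsto_intros time_index_ratio tail_level v) auto
  moreover have "\<forall>\<^sub>F n in sequentially. (real (time_index n t) / real n - real (time_index n s) / real n) * (real n * tail (level n v))
      = real (card (J n)) * tail (level n v)"
    using eventually_gt_at_top[of 0]
  proof eventually_elim
    case (elim n)
    have "real (card (J n)) = real (time_index n t) - real (time_index n s)"
      using time_index_mono[OF st(2), of n] by (simp add: J_def of_nat_diff)
    moreover have "(real (time_index n t) / real n - real (time_index n s) / real n) * (real n * tail (level n v))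
        = (real (time_index n t) - real (time_index n s)) * tail (level n v)"
      using elim by (simp add: field_simps)
    ultimately show ?case by (simp only:)
  qed
  ultimately have c: "(\<lambda>n. real (card (J n)) * tail (level n v)) \<longlonglongrightarrow> (t - s) * H v"
    by (rule Lim_transform_eventually)
  have "(\<lambda>n. prob {\<omega> \<in> space M. \<forall>i\<in>{()}. \<forall>j\<in>J n. X j \<omega> \<le> ereal (level n v)}) \<longlonglongrightarrow> (\<Prod>i\<in>{()}. exp (- ((t - s) * H v)))"
    unfolding J_def using st v by (intro block_limit_time[where s = "\<lambda>_. s" and t = "\<lambda>_. t" and v = "\<lambda>_. v"]) auto
  then have "g \<longlonglongrightarrow> (t - s) * H v - (1 - (\<Prod>i\<in>{()}. exp (- ((t - s) * H v))))"
    unfolding g_def by (intro tendsto_intros c)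
  then show "g \<longlonglongrightarrow> (t - s) * H v - 1 + exp (- ((t - s) * H v))" by (simp add: algebra_simps)
qed

text \<open>A decreasing sequence \<open>vs\<close> of levels cuts the values above \<open>vs N\<close> into the bins
  \<open>(vs 0, \<infinity>]\<close> and \<open>(vs i, vs (i - 1)]\<close> for \<open>1 \<le> i \<le> N\<close>.\<close>

definition in_bin :: "(nat \<Rightarrow> real) \<Rightarrow> nat \<Rightarrow> nat \<Rightarrow> ereal \<Rightarrow> bool" where
  "in_bin vs n i x \<longleftrightarrow> ereal (level n (vs i)) < x \<and> (0 < i \<longrightarrow> x \<le> ereal (level n (vs (i - 1))))"

text \<open>Limit of the expected number of visits to bin \<open>i\<close> per unit of rescaled
  time.\<close>

definition bin_rate :: "(nat \<Rightarrow> real) \<Rightarrow> nat \<Rightarrow> real" where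
  "bin_rate vs i = (if i = 0 then H (vs 0) else H (vs i) - H (vs (i - 1)))"

lemma sum_bin_rate: "(\<Sum>j\<le>i. bin_rate vs j) = H (vs i)"
  by (induction i) (auto simp: bin_rate_def)

lemma in_bin_measurable [measurable]:
  "(\<lambda>\<omega>. Y \<omega>) \<in> borel_measurable M \<Longrightarrow> Measurable.pred M (\<lambda>\<omega>. in_bin vs n i (Y \<omega>))"
  unfolding in_bin_def by (cases "i = 0"; simp; measurable)

text \<open>Limiting probability that the maximum over a block of rescaled length \<delta> falls
  into bin \<open>i\<close>.\<close>

definition bin_weight :: "(nat \<Rightarrow> real) \<Rightarrow> real \<Rightarrow> nat \<Rightarrow> real" where
  "bin_weight vs \<delta> i = (if i = 0 then 1 else exp (- (\<delta> * H (vs (i - 1))))) - exp (- (\<delta> * H (vs i)))"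

definition time_block :: "real \<Rightarrow> nat \<Rightarrow> nat \<Rightarrow> nat set" where
  "time_block \<delta> n q = {time_index n (real (q - 1) * \<delta>)<..time_index n (real q * \<delta>)}"

context
  fixes vs :: "nat \<Rightarrow> real" and N :: nat
  assumes vsE: "\<And>i. i \<le> N \<Longrightarrow> vs i \<in> E" and vs_Suc: "\<And>i. i < N \<Longrightarrow> vs (Suc i) \<le> vs i"
begin

lemma vs_anti: "i \<le> j \<Longrightarrow> j \<le> N \<Longrightarrow> vs j \<le> vs i"
proof (induction j)
  case (Suc j)
  then show ?case using vs_Suc[of j] by (cases "i = Suc j") (auto intro: order_trans)
qed simp

lemma bin_rate_nonneg: "i \<le> N \<Longrightarrow> 0 \<le> bin_rate vs i"
  using E_H_pos[OF vsE, of 0] E_H_anti[OF vsE, of i "vs (i - 1)"] vs_Suc[of "i - 1"]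
  by (auto simp: bin_rate_def)

lemma in_bin_disjoint: "i \<le> N \<Longrightarrow> i' \<le> N \<Longrightarrow> in_bin vs n i x \<Longrightarrow> in_bin vs n i' x \<Longrightarrow> i = i'"
proof (induction i i' rule: linorder_wlog)
  case (le i i')
  show ?case
  proof (rule ccontr)
    assume "i \<noteq> i'"
    then have "i \<le> i' - 1" "0 < i'" using le by auto
    then have "level n (vs (i' - 1)) \<le> level n (vs i)" using le by (intro level_mono vs_anti) auto
    then show False using le \<open>0 < i'\<close> by (auto simp: in_bin_def dest: less_le_trans)
  qed
qed (simp add: eq_commute)

lemma in_bin_above: "i \<le> N \<Longrightarrow> in_bin vs n i x \<Longrightarrow> ereal (level n (vs N)) < x"
  using level_mono[OF vs_anti[of i N], of n] by (auto simp: in_bin_def intro: le_less_trans[rotated])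

text \<open>Conditions that a block maximum is at most a level are replaced, block after block, by
  the condition that it is in none of the bins \<open>A q\<close>. A bin is the difference of two
  level conditions and the bins are disjoint, so the factor of the block becomes 1 minus the sum of
  its weights.\<close>

lemma block_bins_limit:
  fixes A :: "nat \<Rightarrow> nat set"
  assumes \<delta>: "0 < \<delta>" and A: "\<And>q. A q \<subseteq> {..N}"
  shows "(\<lambda>n. prob {\<omega> \<in> space M. \<forall>q\<in>{1..B}. \<forall>i\<in>A q. \<not> in_bin vs n i (SUP j\<in>time_block \<delta> n q. X j \<omega>)})
    \<longlonglongrightarrow> (\<Prod>q\<in>{1..B}. 1 - (\<Sum>i\<in>A q. bin_weight vs \<delta> i))"
proof -
  have finA [simp]: "finite (A q)" for q using A finite_subset by blast
  define mx where "mx n q \<omega> = (SUP j\<in>time_block \<delta> n q. X j \<omega>)" for n q \<omega>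
  have [measurable]: "mx n q \<in> borel_measurable M" for n q
    unfolding mx_def[abs_def] by (intro borel_measurable_SUP) (auto simp: time_block_def)
  define qq where "qq opt = (case opt of None \<Rightarrow> 1 | Some v \<Rightarrow> exp (- (\<delta> * H v)))" for opt
  \<comment> \<open>The first \<open>k\<close> blocks already carry bin conditions; each later one
    carries a level, or no condition in case of \<open>None\<close>.\<close>
  define F where "F n k \<rho> = {\<omega> \<in> space M. (\<forall>q\<in>{1..k}. \<forall>i\<in>A q. \<not> in_bin vs n i (mx n q \<omega>)) \<and>
      (\<forall>q\<in>{k<..B}. \<rho> q \<noteq> None \<longrightarrow> mx n q \<omega> \<le> ereal (level n (the (\<rho> q))))}" for n k and \<rho> :: "nat \<Rightarrow> real option"
  have [measurable]: "F n k \<rho> \<in> events" for n k \<rho> unfolding F_def by measurable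
  have "(\<lambda>n. prob (F n k \<rho>)) \<longlonglongrightarrow> (\<Prod>q\<in>{1..k}. 1 - (\<Sum>i\<in>A q. bin_weight vs \<delta> i)) * (\<Prod>q\<in>{k<..B}. qq (\<rho> q))"
    if "k \<le> B" "\<And>q v. \<rho> q = Some v \<Longrightarrow> v \<in> E" for k \<rho>
    using that
  proof (induction k arbitrary: \<rho>)
    case 0
    define I where "I = {q\<in>{0<..B}. \<rho> q \<noteq> None}"
    have "(\<lambda>n. prob {\<omega> \<in> space M. \<forall>q\<in>I. \<forall>j\<in>{time_index n (real (q - 1) * \<delta>)<..time_index n (real q * \<delta>)}. X j \<omega> \<le> ereal (level n (the (\<rho> q)))})
      \<longlonglongrightarrow> (\<Prod>q\<in>I. exp (- ((real q * \<delta> - real (q - 1) * \<delta>) * H (the (\<rho> q)))))"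
    proof (rule block_limit_time)
      show "real q * \<delta> \<le> real (q' - 1) * \<delta> \<or> real q' * \<delta> \<le> real (q - 1) * \<delta>" if "q \<in> I" "q' \<in> I" "q \<noteq> q'" for q q'
        using that \<delta> by (auto simp: I_def)
    qed (use 0 \<delta> in \<open>auto simp: I_def\<close>)
    moreover have "{\<omega> \<in> space M. \<forall>q\<in>I. \<forall>j\<in>{time_index n (real (q - 1) * \<delta>)<..time_index n (real q * \<delta>)}. X j \<omega> \<le> ereal (level n (the (\<rho> q)))}
        = F n 0 \<rho>" for n
      by (auto simp: F_def I_def mx_def time_block_def SUP_le_iff)
    moreover have "(\<Prod>q\<in>I. exp (- ((real q * \<delta> - real (q - 1) * \<delta>) * H (the (\<rho> q))))) = (\<Prod>q\<in>{0<..B}. qq (\<rho> q))"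
    proof (rule prod.mono_neutral_cong_left)
      show "exp (- ((real q * \<delta> - real (q - 1) * \<delta>) * H (the (\<rho> q)))) = qq (\<rho> q)" if "q \<in> I" for q
        using that by (auto simp: I_def qq_def of_nat_diff algebra_simps)
    qed (auto simp: I_def qq_def split: option.splits)
    ultimately show ?case by simp
  next
    case (Suc k)
    \<comment> \<open>The upper end of bin \<open>i\<close>; bin 0 is unbounded above.\<close>
    define up where "up i = (if i = 0 then None else Some (vs (i - 1)))" for i
    let ?F = "\<lambda>n opt. F n k (\<rho>(Suc k := opt))"
    have split: "{k<..B} = insert (Suc k) {Suc k<..B}" using Suc.prems by auto
    define P where "P = (\<Prod>q\<in>{1..k}. 1 - (\<Sum>i\<in>A q. bin_weight vs \<delta> i))"
    define R where "R = (\<Prod>q\<in>{Suc k<..B}. qq (\<rho> q))"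
    have lim: "(\<lambda>n. prob (?F n opt)) \<longlonglongrightarrow> P * (qq opt * R)" if "\<And>v. opt = Some v \<Longrightarrow> v \<in> E" for opt
    proof -
      have "(\<Prod>q\<in>{Suc k<..B}. qq ((\<rho>(Suc k := opt)) q)) = R" unfolding R_def by (intro prod.cong) auto
      then show ?thesis using Suc.IH[of "\<rho>(Suc k := opt)"] Suc.prems that
        by (auto simp: P_def split fun_upd_def split: if_splits)
    qed
    have F_iff: "\<omega> \<in> ?F n opt \<longleftrightarrow> \<omega> \<in> ?F n None \<and> (opt \<noteq> None \<longrightarrow> mx n (Suc k) \<omega> \<le> ereal (level n (the opt)))" for n opt \<omega>
      unfolding F_def split by auto
    let ?D = "\<lambda>n i. ?F n (up i) - ?F n (Some (vs i))"
    have D_iff: "\<omega> \<in> ?D n i \<longleftrightarrow> \<omega> \<in> ?F n None \<and> in_bin vs n i (mx n (Suc k) \<omega>)" for n i \<omega>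
      unfolding Diff_iff F_iff[of \<omega> n "up i"] F_iff[of \<omega> n "Some (vs i)"] by (auto simp: up_def in_bin_def not_le)
    have F_Suc: "F n (Suc k) \<rho> = ?F n None - (\<Union>i\<in>A (Suc k). ?D n i)" for n
    proof (intro set_eqI)
      fix \<omega>
      have "\<omega> \<in> F n (Suc k) \<rho> \<longleftrightarrow> \<omega> \<in> ?F n None \<and> (\<forall>i\<in>A (Suc k). \<not> in_bin vs n i (mx n (Suc k) \<omega>))"
        unfolding F_def split by (auto simp: atLeastAtMostSuc_conv)
      also have "\<dots> \<longleftrightarrow> \<omega> \<in> ?F n None - (\<Union>i\<in>A (Suc k). ?D n i)" using D_iff by blast
      finally show "\<omega> \<in> F n (Suc k) \<rho> \<longleftrightarrow> \<omega> \<in> ?F n None - (\<Union>i\<in>A (Suc k). ?D n i)" .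
    qed
    have "prob (F n (Suc k) \<rho>) = prob (?F n None) - (\<Sum>i\<in>A (Suc k). prob (?F n (up i)) - prob (?F n (Some (vs i))))" for n
    proof -
      have "prob (F n (Suc k) \<rho>) = prob (?F n None) - prob (\<Union>i\<in>A (Suc k). ?D n i)"
        unfolding F_Suc using D_iff by (intro finite_measure_Diff) (auto intro!: sets.finite_UN)
      also have "prob (\<Union>i\<in>A (Suc k). ?D n i) = (\<Sum>i\<in>A (Suc k). prob (?D n i))"
      proof (intro finite_measure_finite_Union)
        show "disjoint_family_on (?D n) (A (Suc k))"
          unfolding disjoint_family_on_def using D_iff in_bin_disjoint A[of "Suc k"] by blast
      qed auto
      also have "\<dots> = (\<Sum>i\<in>A (Suc k). prob (?F n (up i)) - prob (?F n (Some (vs i))))"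
      proof (intro sum.cong refl finite_measure_Diff)
        fix i assume i: "i \<in> A (Suc k)"
        then have "0 < i \<Longrightarrow> ereal (level n (vs i)) \<le> ereal (level n (vs (i - 1)))"
          using A[of "Suc k"] by (simp only: ereal_less_eq) (intro level_mono vs_anti, auto)
        note le = this
        show "?F n (Some (vs i)) \<subseteq> ?F n (up i)"
        proof
          fix \<omega> assume "\<omega> \<in> ?F n (Some (vs i))"
          then have 1: "\<omega> \<in> ?F n None" "mx n (Suc k) \<omega> \<le> ereal (level n (vs i))"
            using F_iff[of \<omega> n "Some (vs i)"] by simp_all
          show "\<omega> \<in> ?F n (up i)"
            unfolding F_iff[of \<omega> n "up i"] using 1(1) order_trans[OF 1(2) le] by (auto simp: up_def)
        qed
      qed auto
      finally show ?thesis .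
    qed
    moreover have "(\<lambda>n. prob (?F n None) - (\<Sum>i\<in>A (Suc k). prob (?F n (up i)) - prob (?F n (Some (vs i)))))
      \<longlonglongrightarrow> P * (qq None * R) - (\<Sum>i\<in>A (Suc k). P * (qq (up i) * R) - P * (qq (Some (vs i)) * R))"
      using A[of "Suc k"] by (intro tendsto_diff tendsto_sum lim) (force simp: up_def split: if_splits intro: vsE)+
    moreover have "P * (qq None * R) - (\<Sum>i\<in>A (Suc k). P * (qq (up i) * R) - P * (qq (Some (vs i)) * R))
      = P * (1 - (\<Sum>i\<in>A (Suc k). bin_weight vs \<delta> i)) * R"
    proof -
      have "P * (qq (up i) * R) - P * (qq (Some (vs i)) * R) = P * R * bin_weight vs \<delta> i" for i
        by (simp add: qq_def up_def bin_weight_def algebra_simps)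
      then show ?thesis by (simp add: qq_def sum_distrib_left[symmetric] algebra_simps)
    qed
    ultimately show ?case by (simp add: P_def R_def atLeastAtMostSuc_conv mult_ac)
  qed
  from this[of B "\<lambda>_. None"] show ?thesis by (simp add: F_def mx_def)
qed

text \<open>By second order expansion of the exponential, with remainder \<open>\<theta>\<close>, a
  weight is \<open>\<delta> * bin_rate vs i\<close> up to half the square of
  \<open>\<delta> * H (vs N)\<close>. At most \<open>N + 1\<close> weights and the exponential of
  the sum account for \<open>N + 2\<close>; the factor 1/2 is given away.\<close>

lemma bin_weight_bounds:
  assumes \<delta>: "0 \<le> \<delta>" and A: "A \<subseteq> {..N}"
  shows "\<bar>(1 - (\<Sum>i\<in>A. bin_weight vs \<delta> i)) - exp (- (\<delta> * (\<Sum>i\<in>A. bin_rate vs i)))\<bar> \<le> real (N + 2) * (\<delta> * H (vs N))\<^sup>2"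
    and "\<bar>1 - (\<Sum>i\<in>A. bin_weight vs \<delta> i)\<bar> \<le> 1"
proof -
  have fin: "finite A" using A finite_subset by blast
  define h where "h = H (vs N)"
  have Hh: "0 < H (vs i)" "H (vs i) \<le> h" if "i \<le> N" for i
    using E_H_pos[OF vsE[OF that]] E_H_anti[OF vsE[of N] vs_anti[OF that]] by (auto simp: h_def)
  have h: "0 < h" using Hh[of N] by simp
  define \<theta> where "\<theta> x = exp (- x) - (1 - x)" for x :: real
  have \<theta>: "0 \<le> \<theta> x" "\<theta> x \<le> (\<delta> * h)\<^sup>2 / 2" if "0 \<le> x" "x \<le> \<delta> * h" for x
  proof -
    show "0 \<le> \<theta> x" using exp_minus_bounds(1)[OF that(1)] by (simp add: \<theta>_def)
    have "x\<^sup>2 \<le> (\<delta> * h)\<^sup>2" using that by (intro power_mono) auto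
    then show "\<theta> x \<le> (\<delta> * h)\<^sup>2 / 2" using exp_minus_bounds(2)[OF that(1)] by (simp add: \<theta>_def)
  qed
  have w_nonneg: "0 \<le> bin_weight vs \<delta> i" if "i \<le> N" for i
  proof (cases "i = 0")
    case True
    have "0 \<le> \<delta> * H (vs 0)" using \<delta> Hh[of 0] by (intro mult_nonneg_nonneg) auto
    then show ?thesis using True by (simp add: bin_weight_def)
  next
    case False
    have "\<delta> * H (vs (i - 1)) \<le> \<delta> * H (vs i)"
      using \<delta> that by (intro mult_left_mono E_H_anti[OF vsE[OF that]] vs_anti) auto
    then show ?thesis using False by (simp add: bin_weight_def)
  qed
  have w_sum: "(\<Sum>i\<le>k. bin_weight vs \<delta> i) = 1 - exp (- (\<delta> * H (vs k)))" for k
    by (induction k) (auto simp: bin_weight_def)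
  have "(\<Sum>i\<in>A. bin_weight vs \<delta> i) \<le> (\<Sum>i\<le>N. bin_weight vs \<delta> i)"
    using A w_nonneg by (intro sum_mono2) auto
  also have "\<dots> \<le> 1" by (simp add: w_sum)
  finally have "(\<Sum>i\<in>A. bin_weight vs \<delta> i) \<le> 1" .
  moreover have "0 \<le> (\<Sum>i\<in>A. bin_weight vs \<delta> i)" using A w_nonneg by (intro sum_nonneg) auto
  ultimately show "\<bar>1 - (\<Sum>i\<in>A. bin_weight vs \<delta> i)\<bar> \<le> 1" by simp
  have w: "\<bar>bin_weight vs \<delta> i - \<delta> * bin_rate vs i\<bar> \<le> (\<delta> * h)\<^sup>2 / 2" if "i \<le> N" for i
  proof (cases "i = 0")
    case True
    have "bin_weight vs \<delta> i - \<delta> * bin_rate vs i = - \<theta> (\<delta> * H (vs 0))"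
      using True by (simp add: bin_weight_def bin_rate_def \<theta>_def)
    then show ?thesis using \<theta>[of "\<delta> * H (vs 0)"] Hh[of 0] \<delta> by (simp add: mult_left_mono)
  next
    case False
    have "bin_weight vs \<delta> i - \<delta> * bin_rate vs i = \<theta> (\<delta> * H (vs (i - 1))) - \<theta> (\<delta> * H (vs i))"
      using False by (simp add: bin_weight_def bin_rate_def \<theta>_def algebra_simps)
    moreover have "0 \<le> \<delta> * H (vs j)" "\<delta> * H (vs j) \<le> \<delta> * h" if "j \<le> N" for j
      using Hh[OF that] \<delta> by (auto intro: mult_left_mono)
    then have "0 \<le> \<theta> (\<delta> * H (vs j))" "\<theta> (\<delta> * H (vs j)) \<le> (\<delta> * h)\<^sup>2 / 2" if "j \<le> N" for j
      using \<theta> that by blast+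
    then have "0 \<le> \<theta> (\<delta> * H (vs (i - 1)))" "\<theta> (\<delta> * H (vs (i - 1))) \<le> (\<delta> * h)\<^sup>2 / 2"
      "0 \<le> \<theta> (\<delta> * H (vs i))" "\<theta> (\<delta> * H (vs i)) \<le> (\<delta> * h)\<^sup>2 / 2"
      using that by auto
    ultimately show ?thesis unfolding abs_le_iff by linarith
  qed
  define \<kappa> where "\<kappa> = (\<Sum>i\<in>A. bin_rate vs i)"
  have \<kappa>: "0 \<le> \<kappa>" "\<kappa> \<le> h"
  proof -
    show "0 \<le> \<kappa>" unfolding \<kappa>_def using A bin_rate_nonneg by (intro sum_nonneg) auto
    have "\<kappa> \<le> (\<Sum>i\<le>N. bin_rate vs i)" unfolding \<kappa>_def using A bin_rate_nonneg by (intro sum_mono2) auto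
    then show "\<kappa> \<le> h" by (simp add: sum_bin_rate h_def)
  qed
  have "\<bar>(\<Sum>i\<in>A. bin_weight vs \<delta> i - \<delta> * bin_rate vs i)\<bar> \<le> (\<Sum>i\<in>A. (\<delta> * h)\<^sup>2 / 2)"
    using A w by (intro order_trans[OF sum_abs] sum_mono) auto
  also have "\<dots> = real (card A) * ((\<delta> * h)\<^sup>2 / 2)" by simp
  also have "\<dots> \<le> real (N + 1) * ((\<delta> * h)\<^sup>2 / 2)"
    using card_mono[OF _ A] by (intro mult_right_mono) auto
  finally have 1: "\<bar>(\<Sum>i\<in>A. bin_weight vs \<delta> i) - \<delta> * \<kappa>\<bar> \<le> real (N + 1) * ((\<delta> * h)\<^sup>2 / 2)"
    by (simp add: sum_subtractf sum_distrib_left \<kappa>_def)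
  have 2: "0 \<le> \<theta> (\<delta> * \<kappa>)" "\<theta> (\<delta> * \<kappa>) \<le> (\<delta> * h)\<^sup>2 / 2"
  proof -
    have "0 \<le> \<delta> * \<kappa>" "\<delta> * \<kappa> \<le> \<delta> * h" using \<kappa> \<delta> by (auto intro: mult_left_mono)
    then show "0 \<le> \<theta> (\<delta> * \<kappa>)" "\<theta> (\<delta> * \<kappa>) \<le> (\<delta> * h)\<^sup>2 / 2" by (rule \<theta>)+
  qed
  have "(1 - (\<Sum>i\<in>A. bin_weight vs \<delta> i)) - exp (- (\<delta> * \<kappa>)) = - ((\<Sum>i\<in>A. bin_weight vs \<delta> i) - \<delta> * \<kappa>) - \<theta> (\<delta> * \<kappa>)"
    by (simp add: \<theta>_def)
  then have "\<bar>(1 - (\<Sum>i\<in>A. bin_weight vs \<delta> i)) - exp (- (\<delta> * \<kappa>))\<bar> \<le> real (N + 1) * ((\<delta> * h)\<^sup>2 / 2) + (\<delta> * h)\<^sup>2 / 2"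
    using 1 2 by linarith
  also have "\<dots> = real (N + 2) * ((\<delta> * h)\<^sup>2 / 2)" by (simp add: algebra_simps)
  also have "\<dots> \<le> real (N + 2) * (\<delta> * h)\<^sup>2" by (intro mult_left_mono) auto
  finally show "\<bar>(1 - (\<Sum>i\<in>A. bin_weight vs \<delta> i)) - exp (- (\<delta> * (\<Sum>i\<in>A. bin_rate vs i)))\<bar> \<le> real (N + 2) * (\<delta> * H (vs N))\<^sup>2"
    by (simp add: \<kappa>_def h_def)
qed

end

end

lemma (in prob_space) prob_differ_le:
  assumes [measurable]: "A \<in> events" "B \<in> events" "C \<in> events"
    and eq: "\<And>\<omega>. \<omega> \<in> space M \<Longrightarrow> \<omega> \<notin> C \<Longrightarrow> \<omega> \<in> A \<longleftrightarrow> \<omega> \<in> B"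
  shows "\<bar>prob A - prob B\<bar> \<le> prob C"
proof -
  have *: "prob A' \<le> prob B' + prob C" if [measurable]: "A' \<in> events" "B' \<in> events" and "A' \<subseteq> B' \<union> C" for A' B'
    using that by (intro order_trans[OF finite_measure_mono measure_Un_le]) auto
  have "A \<subseteq> B \<union> C" "B \<subseteq> A \<union> C" using eq sets.sets_into_space[of A M] sets.sets_into_space[of B M] by auto
  then show ?thesis using *[of A B] *[of B A] by auto
qed

text \<open>Provides a block length of which all the times \<open>y i\<close> are multiples; hence
  the rational times in \<open>bin_limit\<close> and in \<open>race_limit\<close>.\<close>

lemma common_denominator:
  fixes y :: "'i \<Rightarrow> real"
  assumes "finite I" "\<And>i. i \<in> I \<Longrightarrow> 0 \<le> y i" "\<And>i. i \<in> I \<Longrightarrow> y i \<in> \<rat>"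
  obtains q :: nat and k :: "'i \<Rightarrow> nat" where "0 < q" "\<And>i. i \<in> I \<Longrightarrow> real q * y i = real (k i)"
proof -
  have "\<exists>q::nat. 0 < q \<and> (\<forall>i\<in>I. \<exists>k::nat. real q * y i = real k)"
    using assms
  proof (induction I)
    case (insert x I)
    then obtain q :: nat where q: "0 < q" "\<forall>i\<in>I. \<exists>k::nat. real q * y i = real k" by auto
    have "y x \<in> \<rat>" using insert.prems by auto
    then obtain m n :: nat where mn: "n \<noteq> 0" "\<bar>y x\<bar> = real m / real n" "coprime m n"
      by (rule Rats_abs_nat_div_natE)
    have "y x = real m / real n" using mn insert.prems(1)[of x] by simp
    then have "real (q * n) * y x = real (q * m)" using mn by simp
    moreover have "\<exists>k::nat. real (q * n) * y i = real k" if iI: "i \<in> I" for i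
    proof -
      obtain k :: nat where "real q * y i = real k" using q iI by auto
      then have "real (q * n) * y i = real (n * k)" by (simp add: mult_ac)
      then show ?thesis by blast
    qed
    ultimately have "\<forall>i\<in>insert x I. \<exists>k::nat. real (q * n) * y i = real k" by blast
    then show ?case using q mn by (intro exI[of _ "q * n"]) auto
  qed auto
  then obtain q :: nat where q: "0 < q" "\<forall>i\<in>I. \<exists>k::nat. real q * y i = real k" by auto
  then obtain k :: "'i \<Rightarrow> nat" where "\<And>i. i \<in> I \<Longrightarrow> real q * y i = real (k i)" by metis
  then show ?thesis using that q by blast
qed

lemma tendsto_of_bound_over_Suc:
  fixes f :: "nat \<Rightarrow> real"
  assumes "\<And>m. \<bar>f m - l\<bar> \<le> C * (1 / real (Suc m))"
  shows "f \<longlonglongrightarrow> l"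
proof -
  have "(\<lambda>m. C * (1 / real (Suc m))) \<longlonglongrightarrow> C * 0" by (intro tendsto_intros LIMSEQ_Suc[OF lim_1_over_n])
  then have "(\<lambda>m. C * (1 / real (Suc m))) \<longlonglongrightarrow> 0" by (simp only: mult_zero_right)
  then have "(\<lambda>m. f m - l) \<longlonglongrightarrow> 0"
    by (rule Lim_null_comparison[rotated]) (unfold real_norm_def, intro always_eventually allI assms)
  then show ?thesis by (simp add: LIM_zero_iff)
qed

section \<open>Visits to bins by single values instead of block maxima\<close>

context mixing_extremes
begin

lemma time_block_cover:
  assumes \<delta>: "0 \<le> \<delta>" and j: "1 \<le> j" "j \<le> time_index n (real k * \<delta>)"
  obtains q where "q \<in> {1..k}" "j \<in> time_block \<delta> n q"
proof -
  define q where "q = (LEAST q. j \<le> time_index n (real q * \<delta>))"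
  have q1: "j \<le> time_index n (real q * \<delta>)"
    unfolding q_def by (rule LeastI[of "\<lambda>q. j \<le> time_index n (real q * \<delta>)", OF j(2)])
  have q2: "q \<le> k" unfolding q_def by (rule Least_le[of "\<lambda>q. j \<le> time_index n (real q * \<delta>)", OF j(2)])
  have "q \<noteq> 0" using q1 j(1) by (intro notI) simp
  then have "q - 1 < q" by simp
  then have "\<not> j \<le> time_index n (real (q - 1) * \<delta>)"
    using not_less_Least[of "q - 1" "\<lambda>q. j \<le> time_index n (real q * \<delta>)"] by (simp add: q_def)
  with q1 have "j \<in> time_block \<delta> n q" unfolding time_block_def greaterThanAtMost_iff by linarith
  moreover have "q \<in> {1..k}" using q2 \<open>q \<noteq> 0\<close> by simp
  ultimately show thesis using that by blast
qed

text \<open>The first visits to the bins behave like independent exponential times with rates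
  \<open>bin_rate vs i\<close>. A visit can be missed by the block maximum only if its block
  contains a second exceedance of the lowest level \<open>vs N\<close>. There are of order
  \<open>1 / \<delta>\<close> blocks, each with a double exceedance of probability of order
  \<open>\<delta>^2\<close>, so the error vanishes with \<delta>.\<close>

lemma bin_limit:
  fixes vs :: "nat \<Rightarrow> real" and N :: nat and y :: "nat \<Rightarrow> real"
  assumes vsE: "\<And>i. i \<le> N \<Longrightarrow> vs i \<in> E" and vs_Suc: "\<And>i. i < N \<Longrightarrow> vs (Suc i) \<le> vs i"
    and y: "\<And>i. i \<le> N \<Longrightarrow> 0 \<le> y i" "\<And>i. i \<le> N \<Longrightarrow> y i \<in> \<rat>"
  shows "(\<lambda>n. prob {\<omega> \<in> space M. \<forall>i\<le>N. \<forall>j\<in>{1..time_index n (y i)}. \<not> in_bin vs n i (X j \<omega>)})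
    \<longlonglongrightarrow> (\<Prod>i\<le>N. exp (- bin_rate vs i * y i))"
proof -
  have weights: "\<bar>(1 - (\<Sum>i\<in>A. bin_weight vs \<delta> i)) - exp (- (\<delta> * (\<Sum>i\<in>A. bin_rate vs i)))\<bar> \<le> real (N + 2) * (\<delta> * H (vs N))\<^sup>2"
    "\<bar>1 - (\<Sum>i\<in>A. bin_weight vs \<delta> i)\<bar> \<le> 1" if "0 \<le> \<delta>" "A \<subseteq> {..N}" for \<delta> A
    using vsE vs_Suc that by (rule bin_weight_bounds; blast)+
  have above: "ereal (level n (vs N)) < x" if "i \<le> N" "in_bin vs n i x" for i n x
    using vsE vs_Suc that by (rule in_bin_above)
  have rate: "0 \<le> bin_rate vs i" if "i \<le> N" for i
    using vsE vs_Suc that by (rule bin_rate_nonneg)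
  obtain q k where q: "0 < q" and k: "\<And>i. i \<in> {..N} \<Longrightarrow> real q * y i = real (k i)"
    using common_denominator[of "{..N}" y] y by (metis atMost_iff finite_atMost)
  define h where "h = H (vs N)"
  have h: "0 < h" unfolding h_def using vsE by (intro E_H_pos) auto
  \<comment> \<open>Every \<open>y i\<close> is a multiple of this length, as \<open>q\<close> is a
    common denominator; \<open>kk m i\<close> is the number of blocks up to
    \<open>y i\<close>.\<close>
  define \<delta> where "\<delta> m = 1 / (real q * real (Suc m))" for m
  have \<delta>: "0 < \<delta> m" for m using q by (simp add: \<delta>_def del: of_nat_Suc)
  define kk where "kk m i = k i * Suc m" for m i
  have y_eq: "y i = real (kk m i) * \<delta> m" if "i \<le> N" for i m
  proof -
    have "real (kk m i) * \<delta> m = real (k i) / real q" using q unfolding kk_def \<delta>_def of_nat_mult by (simp del: of_nat_Suc)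
    also have "\<dots> = y i" using k[of i] that q by (simp add: field_simps)
    finally show ?thesis by simp
  qed
  \<comment> \<open>The sum of the \<open>k i\<close> stands for their maximum: \<open>B m\<close>
    only has to bound the number of blocks.\<close>
  define S where "S = (\<Sum>i\<le>N. k i)"
  define B where "B m = S * Suc m" for m
  have kkB: "kk m i \<le> B m" if "i \<le> N" for m i
    unfolding kk_def B_def S_def using that by (intro mult_right_mono member_le_sum) auto
  \<comment> \<open>The bins that block \<open>p\<close> has to avoid, namely those whose time
    \<open>y i\<close> has not yet run out.\<close>
  define A where "A m p = {i. i \<in> {..N} \<and> p \<le> kk m i}" for m p
  define V where "V n = {\<omega> \<in> space M. \<forall>i\<le>N. \<forall>j\<in>{1..time_index n (y i)}. \<not> in_bin vs n i (X j \<omega>)}" for n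
  define C where "C m n = {\<omega> \<in> space M. \<forall>p\<in>{1..B m}. \<forall>i\<in>A m p. \<not> in_bin vs n i (SUP j\<in>time_block (\<delta> m) n p. X j \<omega>)}" for m n
  define T where "T m p n = {\<omega> \<in> space M. \<exists>i\<in>{time_index n (real (p - 1) * \<delta> m)<..time_index n (real p * \<delta> m)}.
        \<exists>j\<in>{time_index n (real (p - 1) * \<delta> m)<..time_index n (real p * \<delta> m)}.
        i \<noteq> j \<and> ereal (level n (vs N)) < X i \<omega> \<and> ereal (level n (vs N)) < X j \<omega>}" for m p n
  have V_sets [measurable]: "V n \<in> events" for n
  proof -
    have "{\<omega> \<in> space M. \<forall>i\<in>{..N}. \<forall>j\<in>{1..time_index n (y i)}. \<not> in_bin vs n i (X j \<omega>)} \<in> events" by measurable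
    then show ?thesis by (simp add: V_def)
  qed
  have A_fin [simp]: "finite (A m p)" for m p by (simp add: A_def)
  have [measurable]: "(\<lambda>\<omega>. SUP j\<in>time_block (\<delta> m) n p. X j \<omega>) \<in> borel_measurable M" for m n p
    by (intro borel_measurable_SUP) (auto simp: time_block_def)
  have C_sets [measurable]: "C m n \<in> events" for m n unfolding C_def by measurable
  have T_sets [measurable]: "T m p n \<in> events" for m p n unfolding T_def by measurable
  define Bd where "Bd m p g \<longleftrightarrow> (\<forall>n. prob (T m p n) \<le> g n) \<and> g \<longlonglongrightarrow> \<delta> m * h - 1 + exp (- (\<delta> m * h))"
    for m p and g :: "nat \<Rightarrow> real"
  have Bd_ex: "\<exists>g. Bd m p g" if "1 \<le> p" for m p
  proof -
    have s: "0 \<le> real (p - 1) * \<delta> m" "real (p - 1) * \<delta> m \<le> real p * \<delta> m"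
      using less_imp_le[OF \<delta>[of m]] by (auto intro!: mult_right_mono)
    have d: "real p * \<delta> m - real (p - 1) * \<delta> m = \<delta> m" using that by (simp add: of_nat_diff algebra_simps)
    obtain g where "\<And>n. prob (T m p n) \<le> g n" "g \<longlonglongrightarrow> \<delta> m * h - 1 + exp (- (\<delta> m * h))"
      using two_exceedances_bound[OF s vsE[OF order_refl]] unfolding T_def d h_def by blast
    then show ?thesis unfolding Bd_def by blast
  qed
  define g where "g m p = (SOME g. Bd m p g)" for m p
  have "Bd m p (g m p)" if "1 \<le> p" for m p
    unfolding g_def using Bd_ex[OF that] by (rule someI_ex)
  then have g: "\<And>m p n. 1 \<le> p \<Longrightarrow> prob (T m p n) \<le> g m p n"
    "\<And>m p. 1 \<le> p \<Longrightarrow> g m p \<longlonglongrightarrow> \<delta> m * h - 1 + exp (- (\<delta> m * h))" unfolding Bd_def by blast+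
  have near: "\<bar>prob (V n) - prob (C m n)\<bar> \<le> (\<Sum>p\<in>{1..B m}. g m p n)" for m n
  proof -
    have "\<bar>prob (V n) - prob (C m n)\<bar> \<le> prob (\<Union>p\<in>{1..B m}. T m p n)"
    proof (rule prob_differ_le)
      fix \<omega> assume \<omega>: "\<omega> \<in> space M" "\<omega> \<notin> (\<Union>p\<in>{1..B m}. T m p n)"
      show "\<omega> \<in> V n \<longleftrightarrow> \<omega> \<in> C m n"
      proof
        assume v: "\<omega> \<in> V n"
        show "\<omega> \<in> C m n" unfolding C_def
        proof (safe)
          fix p i assume p: "p \<in> {1..B m}" and i: "i \<in> A m p" and b: "in_bin vs n i (SUP j\<in>time_block (\<delta> m) n p. X j \<omega>)"
          have "time_block (\<delta> m) n p \<noteq> {}"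
          proof
            assume "time_block (\<delta> m) n p = {}"
            then show False using b by (simp add: in_bin_def bot_ereal_def)
          qed
          moreover have "finite (time_block (\<delta> m) n p)" by (simp add: time_block_def)
          ultimately obtain j where j: "j \<in> time_block (\<delta> m) n p" "(SUP j\<in>time_block (\<delta> m) n p. X j \<omega>) = X j \<omega>"
            using finite_SUP_attained[of "time_block (\<delta> m) n p" "\<lambda>j. X j \<omega>"] by blast
          have "time_index n (real p * \<delta> m) \<le> time_index n (y i)"
            using i less_imp_le[OF \<delta>[of m]] by (auto simp: A_def y_eq[of i m] intro!: time_index_mono mult_right_mono)
          then have "j \<in> {1..time_index n (y i)}" using j(1) by (auto simp: time_block_def)
          then show False using v b j(2) i by (auto simp: V_def A_def)
        qed (use \<omega> in auto)
      next
        assume c: "\<omega> \<in> C m n"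
        show "\<omega> \<in> V n" unfolding V_def
        proof (safe)
          fix i j assume i: "i \<le> N" and j: "j \<in> {1..time_index n (y i)}" and b: "in_bin vs n i (X j \<omega>)"
          obtain p where p: "p \<in> {1..kk m i}" "j \<in> time_block (\<delta> m) n p"
            using time_block_cover[of "\<delta> m" j n "kk m i"] j less_imp_le[OF \<delta>[of m]] y_eq[OF i, of m] by auto
          have pB: "p \<in> {1..B m}" using p(1) kkB[OF i, of m] by auto
          have iA: "i \<in> A m p" using p(1) i by (auto simp: A_def)
          obtain j' where j': "j' \<in> time_block (\<delta> m) n p" "(SUP j\<in>time_block (\<delta> m) n p. X j \<omega>) = X j' \<omega>"
          proof (rule finite_SUP_attained[of "time_block (\<delta> m) n p" "\<lambda>j. X j \<omega>"])
            show "finite (time_block (\<delta> m) n p)" by (simp add: time_block_def)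
            show "time_block (\<delta> m) n p \<noteq> {}" using p(2) by blast
          qed
          have le: "X j \<omega> \<le> X j' \<omega>" using p(2) unfolding j'(2)[symmetric] by (rule SUP_upper)
          have ab: "ereal (level n (vs N)) < X j \<omega>" using i b by (rule above)
          \<comment> \<open>Both the visiting value and the block maximum exceed the lowest level;
            outside \<open>T m p n\<close> they must sit at the same index.\<close>
          have "j = j'"
          proof (rule ccontr)
            assume "j \<noteq> j'"
            then have "\<omega> \<in> T m p n" using \<omega>(1) p(2) j'(1) ab less_le_trans[OF ab le]
              unfolding T_def time_block_def by blast
            then show False using \<omega>(2) pB by blast
          qed
          have "in_bin vs n i (SUP j\<in>time_block (\<delta> m) n p. X j \<omega>)"
            unfolding j'(2) using b by (simp only: \<open>j = j'\<close>)
          moreover have "\<forall>p\<in>{1..B m}. \<forall>i\<in>A m p. \<not> in_bin vs n i (SUP j\<in>time_block (\<delta> m) n p. X j \<omega>)"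
            using c unfolding C_def by blast
          ultimately show False using pB iA by blast
        qed (use \<omega> in auto)
      qed
    qed auto
    also have "\<dots> \<le> (\<Sum>p\<in>{1..B m}. prob (T m p n))" by (intro finite_measure_subadditive_finite) auto
    also have "\<dots> \<le> (\<Sum>p\<in>{1..B m}. g m p n)" by (intro sum_mono g) auto
    finally show ?thesis .
  qed
  define R where "R = (\<Prod>i\<le>N. exp (- bin_rate vs i * y i))"
  define P where "P m = (\<Prod>p\<in>{1..B m}. 1 - (\<Sum>i\<in>A m p. bin_weight vs (\<delta> m) i))" for m
  define \<epsilon> where "\<epsilon> m = real (B m) * (\<delta> m * h - 1 + exp (- (\<delta> m * h)))" for m
  have PC: "(\<lambda>n. prob (C m n)) \<longlonglongrightarrow> P m" for m
    unfolding C_def P_def by (rule block_bins_limit[of N vs]) (use vsE vs_Suc \<delta> in \<open>auto simp: A_def\<close>)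
  have G: "(\<lambda>n. \<Sum>p\<in>{1..B m}. g m p n) \<longlonglongrightarrow> \<epsilon> m" for m
  proof -
    have "(\<lambda>n. \<Sum>p\<in>{1..B m}. g m p n) \<longlonglongrightarrow> (\<Sum>p\<in>{1..B m}. \<delta> m * h - 1 + exp (- (\<delta> m * h)))"
      by (intro tendsto_sum g) auto
    then show ?thesis by (simp add: \<epsilon>_def)
  qed
  have B\<delta>: "real (B m) * (\<delta> m * h)\<^sup>2 = (real S * h\<^sup>2 / (real q)\<^sup>2) * (1 / real (Suc m))" for m
    unfolding B_def \<delta>_def of_nat_mult using q
    by (simp add: power2_eq_square field_simps del: of_nat_Suc)
  have PR: "\<bar>P m - R\<bar> \<le> real (N + 2) * (real (B m) * (\<delta> m * h)\<^sup>2)" for m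
  proof -
    let ?E = "\<lambda>p. exp (- (\<delta> m * (\<Sum>i\<in>A m p. bin_rate vs i)))"
    \<comment> \<open>Exchange of summation: bin \<open>i\<close> occurs in exactly
      \<open>kk m i\<close> blocks, of total length \<open>y i\<close>.\<close>
    have "(\<Sum>p\<in>{1..B m}. \<Sum>i\<in>A m p. bin_rate vs i) = (\<Sum>i\<le>N. real (kk m i) * bin_rate vs i)"
    proof -
      have "(\<Sum>p\<in>{1..B m}. \<Sum>i\<in>A m p. bin_rate vs i) = (\<Sum>i\<in>{..N}. \<Sum>p\<in>{p. p \<in> {1..B m} \<and> p \<le> kk m i}. bin_rate vs i)"
        unfolding A_def by (rule sum.swap_restrict) auto
      also have "\<dots> = (\<Sum>i\<le>N. real (kk m i) * bin_rate vs i)"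
      proof (intro sum.cong refl)
        fix i assume "i \<in> {..N}"
        then have "{p. p \<in> {1..B m} \<and> p \<le> kk m i} = {1..kk m i}" using kkB[of i m] by auto
        then show "(\<Sum>p\<in>{p. p \<in> {1..B m} \<and> p \<le> kk m i}. bin_rate vs i) = real (kk m i) * bin_rate vs i" by simp
      qed
      finally show ?thesis .
    qed
    then have "(\<Sum>p\<in>{1..B m}. \<delta> m * (\<Sum>i\<in>A m p. bin_rate vs i)) = (\<Sum>i\<le>N. bin_rate vs i * y i)"
      unfolding sum_distrib_left[symmetric] using y_eq[of _ m]
      by (simp add: sum_distrib_left) (auto intro!: sum.cong)
    then have R_eq: "R = (\<Prod>p\<in>{1..B m}. ?E p)"
      by (simp add: R_def sum_negf flip: exp_sum)
    have "norm (P m - R) \<le> (\<Sum>p\<in>{1..B m}. norm ((1 - (\<Sum>i\<in>A m p. bin_weight vs (\<delta> m) i)) - ?E p))"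
      unfolding P_def R_eq
    proof (rule norm_prod_diff)
      show "norm (1 - (\<Sum>i\<in>A m p. bin_weight vs (\<delta> m) i)) \<le> 1" for p
        using weights(2)[of "\<delta> m" "A m p"] less_imp_le[OF \<delta>] by (auto simp: A_def)
      have "0 \<le> (\<Sum>i\<in>A m p. bin_rate vs i)" for p by (intro sum_nonneg rate) (simp add: A_def)
      then show "norm (?E p) \<le> 1" for p using less_imp_le[OF \<delta>[of m]] by simp
    qed
    also have "\<dots> \<le> (\<Sum>p\<in>{1..B m}. real (N + 2) * (\<delta> m * h)\<^sup>2)"
      unfolding h_def real_norm_def using less_imp_le[OF \<delta>] by (intro sum_mono weights(1)) (auto simp: A_def)
    also have "\<dots> = real (N + 2) * (real (B m) * (\<delta> m * h)\<^sup>2)" by simp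
    finally show ?thesis by simp
  qed
  have \<epsilon>_bound: "\<bar>\<epsilon> m\<bar> \<le> real (B m) * (\<delta> m * h)\<^sup>2" for m
  proof -
    have x: "0 \<le> \<delta> m * h" using \<delta>[of m] h by simp
    have "0 \<le> \<delta> m * h - 1 + exp (- (\<delta> m * h))" "\<delta> m * h - 1 + exp (- (\<delta> m * h)) \<le> (\<delta> m * h)\<^sup>2"
      using exp_minus_bounds[OF x] zero_le_power2[of "\<delta> m * h"] by linarith+
    then show ?thesis unfolding \<epsilon>_def by (simp add: abs_mult mult_left_mono)
  qed
  \<comment> \<open>The factor \<open>N + 2\<close> comes from \<open>PR\<close>, one more from
    \<open>\<epsilon>_bound\<close>; the rest is the constant in \<open>B\<delta>\<close>.\<close>
  define D where "D = real (N + 3) * (real S * h\<^sup>2 / (real q)\<^sup>2)"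
  have D: "real (N + 2) * (real (B m) * (\<delta> m * h)\<^sup>2) + real (B m) * (\<delta> m * h)\<^sup>2 = D * (1 / real (Suc m))" for m
  proof -
    have "real (N + 2) * x + x = real (N + 3) * x" for x by (simp add: algebra_simps)
    then show ?thesis unfolding B\<delta> D_def by (simp only: mult.assoc)
  qed
  have "(\<lambda>n. prob (V n)) \<longlonglongrightarrow> R"
  proof (rule double_sandwich[where l = "\<lambda>m n. prob (C m n) - (\<Sum>p\<in>{1..B m}. g m p n)"
        and u = "\<lambda>m n. prob (C m n) + (\<Sum>p\<in>{1..B m}. g m p n)"])
    show "\<forall>\<^sub>F n in sequentially. prob (C m n) - (\<Sum>p\<in>{1..B m}. g m p n) \<le> prob (V n) \<and>
        prob (V n) \<le> prob (C m n) + (\<Sum>p\<in>{1..B m}. g m p n)" for m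
    proof (intro always_eventually allI)
      fix n
      show "prob (C m n) - (\<Sum>p\<in>{1..B m}. g m p n) \<le> prob (V n) \<and> prob (V n) \<le> prob (C m n) + (\<Sum>p\<in>{1..B m}. g m p n)"
        using near[of n m] by (intro conjI; linarith)
    qed
    show "(\<lambda>n. prob (C m n) - (\<Sum>p\<in>{1..B m}. g m p n)) \<longlonglongrightarrow> P m - \<epsilon> m" for m by (intro tendsto_diff PC G)
    show "(\<lambda>n. prob (C m n) + (\<Sum>p\<in>{1..B m}. g m p n)) \<longlonglongrightarrow> P m + \<epsilon> m" for m by (intro tendsto_add PC G)
    have "\<bar>P m - \<epsilon> m - R\<bar> \<le> D * (1 / real (Suc m))" for m
      using PR[of m] \<epsilon>_bound[of m] D[of m] by linarith
    then show "(\<lambda>m. P m - \<epsilon> m) \<longlonglongrightarrow> R" by (rule tendsto_of_bound_over_Suc)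
    have "\<bar>P m + \<epsilon> m - R\<bar> \<le> D * (1 / real (Suc m))" for m
      using PR[of m] \<epsilon>_bound[of m] D[of m] by linarith
    then show "(\<lambda>m. P m + \<epsilon> m) \<longlonglongrightarrow> R" by (rule tendsto_of_bound_over_Suc)
  qed
  then show ?thesis by (simp add: V_def R_def)
qed

text \<open>As in \<open>two_exceedances_bound\<close>, the expected number of visits to the bin
  between \<open>c\<close> and \<open>d\<close> minus the probability of a visit. The latter
  probability comes from \<open>bin_limit\<close>, hence the rational horizon.\<close>

lemma two_visits_bound:
  assumes c: "c \<in> E" and d: "d \<in> E" and cd: "c \<le> d" and T: "0 \<le> T" "T \<in> \<rat>"
  obtains g where
    "\<And>n. prob {\<omega> \<in> space M. \<exists>i\<in>{1..time_index n T}. \<exists>j\<in>{1..time_index n T}. i \<noteq> j \<and>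
        ereal (level n c) < X i \<omega> \<and> X i \<omega> \<le> ereal (level n d) \<and>
        ereal (level n c) < X j \<omega> \<and> X j \<omega> \<le> ereal (level n d)} \<le> g n"
    "g \<longlonglongrightarrow> T * (H c - H d) - 1 + exp (- (T * (H c - H d)))"
proof
  define vs where "vs i = (if i = 0 then d else c)" for i :: nat
  \<comment> \<open>Time 0 imposes nothing on bin 0, the values above \<open>d\<close>; only the bin
    between \<open>c\<close> and \<open>d\<close> is watched.\<close>
  define y where "y i = (if i = 0 then 0 else T)" for i :: nat
  define J where "J n = {1..time_index n T}" for n
  define A where "A n j = {\<omega> \<in> space M. in_bin vs n 1 (X j \<omega>)}" for n j
  have in1: "in_bin vs n 1 x \<longleftrightarrow> ereal (level n c) < x \<and> x \<le> ereal (level n d)" for n x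
    by (simp add: in_bin_def vs_def)
  have [measurable]: "A n j \<in> events" for n j unfolding A_def by measurable
  define V where "V n = {\<omega> \<in> space M. \<forall>i\<le>1. \<forall>j\<in>{1..time_index n (y i)}. \<not> in_bin vs n i (X j \<omega>)}" for n
  have V_eq: "V n = {\<omega> \<in> space M. \<forall>j\<in>J n. \<not> in_bin vs n 1 (X j \<omega>)}" for n
    by (auto simp: V_def J_def y_def le_Suc_eq)
  define g where "g n = real (card (J n)) * (tail (level n c) - tail (level n d)) - (1 - prob (V n))" for n
  have pA: "prob (A n j) = tail (level n c) - tail (level n d)" if "1 \<le> j" for n j
  proof -
    have m: "{\<omega> \<in> space M. ereal u < X j \<omega>} \<in> events" for u by measurable
    have "A n j = {\<omega> \<in> space M. ereal (level n c) < X j \<omega>} - {\<omega> \<in> space M. ereal (level n d) < X j \<omega>}"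
      unfolding A_def in1 by (auto simp: not_less)
    moreover have le: "ereal (level n c) \<le> ereal (level n d)" using level_mono[OF cd] by simp
    have "prob ({\<omega> \<in> space M. ereal (level n c) < X j \<omega>} - {\<omega> \<in> space M. ereal (level n d) < X j \<omega>})
        = prob {\<omega> \<in> space M. ereal (level n c) < X j \<omega>} - prob {\<omega> \<in> space M. ereal (level n d) < X j \<omega>}"
      by (rule finite_measure_Diff[OF m m]) (use le_less_trans[OF le] in blast)
    ultimately show ?thesis by (simp only: prob_exceed[OF that])
  qed
  show "prob {\<omega> \<in> space M. \<exists>i\<in>{1..time_index n T}. \<exists>j\<in>{1..time_index n T}. i \<noteq> j \<and>
        ereal (level n c) < X i \<omega> \<and> X i \<omega> \<le> ereal (level n d) \<and>
        ereal (level n c) < X j \<omega> \<and> X j \<omega> \<le> ereal (level n d)} \<le> g n" for n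
  proof -
    have "prob (\<Union>i\<in>J n. \<Union>j\<in>J n - {i}. A n i \<inter> A n j) \<le> (\<Sum>j\<in>J n. prob (A n j)) - prob (\<Union>j\<in>J n. A n j)"
      by (intro prob_two_le) (auto simp: J_def)
    moreover have "(\<Union>i\<in>J n. \<Union>j\<in>J n - {i}. A n i \<inter> A n j) = {\<omega> \<in> space M. \<exists>i\<in>{1..time_index n T}. \<exists>j\<in>{1..time_index n T}. i \<noteq> j \<and>
        ereal (level n c) < X i \<omega> \<and> X i \<omega> \<le> ereal (level n d) \<and>
        ereal (level n c) < X j \<omega> \<and> X j \<omega> \<le> ereal (level n d)}"
      unfolding J_def A_def in1 by blast
    moreover have "(\<Sum>j\<in>J n. prob (A n j)) = real (card (J n)) * (tail (level n c) - tail (level n d))"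
      using pA by (simp add: J_def)
    moreover have "prob (\<Union>j\<in>J n. A n j) = 1 - prob (V n)"
    proof -
      have "(\<Union>j\<in>J n. A n j) = space M - V n" by (auto simp: A_def V_eq)
      moreover have "V n \<in> events" unfolding V_eq J_def by measurable
      ultimately show ?thesis by (simp add: prob_compl)
    qed
    ultimately show ?thesis by (simp add: g_def)
  qed
  have "(\<lambda>n. (real (time_index n T) / real n) * (real n * tail (level n c) - real n * tail (level n d))) \<longlonglongrightarrow> T * (H c - H d)"
    using T by (intro tendsto_intros time_index_ratio tail_level c d)
  moreover have "\<forall>\<^sub>F n in sequentially. (real (time_index n T) / real n) * (real n * tail (level n c) - real n * tail (level n d))
      = real (card (J n)) * (tail (level n c) - tail (level n d))"
    using eventually_gt_at_top[of 0] by eventually_elim (simp add: J_def flip: right_diff_distrib)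
  ultimately have 1: "(\<lambda>n. real (card (J n)) * (tail (level n c) - tail (level n d))) \<longlonglongrightarrow> T * (H c - H d)"
    by (rule Lim_transform_eventually)
  have "(\<lambda>n. prob (V n)) \<longlonglongrightarrow> (\<Prod>i\<le>1. exp (- bin_rate vs i * y i))"
    unfolding V_def using c d cd T by (intro bin_limit) (auto simp: vs_def y_def)
  then have "g \<longlonglongrightarrow> T * (H c - H d) - (1 - (\<Prod>i\<le>1. exp (- bin_rate vs i * y i)))"
    unfolding g_def by (intro tendsto_diff 1 tendsto_const)
  then show "g \<longlonglongrightarrow> T * (H c - H d) - 1 + exp (- (T * (H c - H d)))"
    by (simp add: bin_rate_def vs_def y_def algebra_simps)
qed

end

section \<open>Weak convergence from avoidance probabilities\<close>

text \<open>\<open>point_process\<close> without finiteness on compact sets, which the record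
  processes need not have at a fixed \<open>n\<close>.\<close>

definition counting_process :: "'w measure \<Rightarrow> real set \<Rightarrow> ('w \<Rightarrow> real measure) \<Rightarrow> bool" where
  "counting_process M S \<xi> \<longleftrightarrow>
     (\<forall>\<omega>\<in>space M. sets (\<xi> \<omega>) = sets (restrict_space borel S) \<and>
        (\<forall>A\<in>sets (restrict_space borel S). emeasure (\<xi> \<omega>) A \<in> insert \<infinity> (range of_nat))) \<and>
     (\<forall>A\<in>sets (restrict_space borel S). (\<lambda>\<omega>. emeasure (\<xi> \<omega>) A) \<in> borel_measurable M)"

lemma point_process_counting: "point_process M S \<xi> \<Longrightarrow> counting_process M S \<xi>"
  by (auto simp: point_process_def counting_process_def)

lemma counting_processD:
  assumes "counting_process M S \<xi>"
  shows "\<omega> \<in> space M \<Longrightarrow> sets (\<xi> \<omega>) = sets (restrict_space borel S)"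
    and "\<omega> \<in> space M \<Longrightarrow> A \<in> sets (restrict_space borel S) \<Longrightarrow> emeasure (\<xi> \<omega>) A \<in> insert \<infinity> (range of_nat)"
    and "A \<in> sets (restrict_space borel S) \<Longrightarrow> (\<lambda>\<omega>. emeasure (\<xi> \<omega>) A) \<in> borel_measurable M"
  using assms unfolding counting_process_def by blast+

lemma point_process_finite:
  "point_process M S \<xi> \<Longrightarrow> \<omega> \<in> space M \<Longrightarrow> compact K \<Longrightarrow> K \<subseteq> S \<Longrightarrow> emeasure (\<xi> \<omega>) K < \<infinity>"
  unfolding point_process_def by blast

lemma sets_restrict_open: "open S \<Longrightarrow> A \<in> sets (restrict_space borel S) \<longleftrightarrow> A \<in> sets borel \<and> A \<subseteq> (S :: real set)"
  by (subst sets_restrict_space_iff) auto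

text \<open>Inclusion-exclusion: the probabilities of intersections determine those of every exact
  pattern, and their limits do likewise. \<open>J\<close> collects the indices whose event fails;
  these are removed one at a time by subtraction.\<close>

lemma pattern_limit:
  fixes e :: "nat \<Rightarrow> 'i \<Rightarrow> 'w set" and e' :: "'i \<Rightarrow> 'v set"
  assumes M: "prob_space M" and \<Omega>: "prob_space \<Omega>"
    and ev: "\<And>n i. i \<in> A \<Longrightarrow> e n i \<in> sets M" "\<And>i. i \<in> A \<Longrightarrow> e' i \<in> sets \<Omega>"
    and lim: "\<And>I. I \<subseteq> A \<Longrightarrow> (\<lambda>n. measure M {\<omega>\<in>space M. \<forall>i\<in>I. \<omega> \<in> e n i})
        \<longlonglongrightarrow> measure \<Omega> {\<omega>\<in>space \<Omega>. \<forall>i\<in>I. \<omega> \<in> e' i}"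
    and A: "finite A" and J: "J \<subseteq> A"
  shows "(\<lambda>n. measure M {\<omega>\<in>space M. \<forall>i\<in>A. \<omega> \<in> e n i \<longleftrightarrow> i \<notin> J})
        \<longlonglongrightarrow> measure \<Omega> {\<omega>\<in>space \<Omega>. \<forall>i\<in>A. \<omega> \<in> e' i \<longleftrightarrow> i \<notin> J}"
proof -
  interpret M: prob_space M by fact
  interpret \<Omega>: prob_space \<Omega> by fact
  have finA: "finite I" if "I \<subseteq> A" for I using that A finite_subset by blast
  have claim: "(\<lambda>n. measure M {\<omega>\<in>space M. (\<forall>i\<in>I. \<omega> \<in> e n i) \<and> (\<forall>i\<in>K. \<omega> \<notin> e n i)})
        \<longlonglongrightarrow> measure \<Omega> {\<omega>\<in>space \<Omega>. (\<forall>i\<in>I. \<omega> \<in> e' i) \<and> (\<forall>i\<in>K. \<omega> \<notin> e' i)}"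
    if "finite K" "K \<subseteq> A" "I \<subseteq> A" for I K
    using that
  proof (induction K arbitrary: I)
    case (insert k K)
    let ?E = "\<lambda>n I K. {\<omega>\<in>space M. (\<forall>i\<in>I. \<omega> \<in> e n i) \<and> (\<forall>i\<in>K. \<omega> \<notin> e n i)}"
    let ?E' = "\<lambda>I K. {\<omega>\<in>space \<Omega>. (\<forall>i\<in>I. \<omega> \<in> e' i) \<and> (\<forall>i\<in>K. \<omega> \<notin> e' i)}"
    have m: "?E n I' K' \<in> sets M" "?E' I' K' \<in> sets \<Omega>" if "I' \<subseteq> A" "K' \<subseteq> A" for n I' K'
      using that ev finA by (auto intro!: sets.sets_Collect_conj sets.sets_Collect_finite_All' sets.sets_Collect_neg simp: subset_eq)
    have "measure M (?E n I (insert k K)) = measure M (?E n I K) - measure M (?E n (insert k I) K)" for n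
    proof -
      have "?E n I (insert k K) = ?E n I K - ?E n (insert k I) K" by auto
      moreover have "measure M (?E n I K - ?E n (insert k I) K) = measure M (?E n I K) - measure M (?E n (insert k I) K)"
        by (rule M.finite_measure_Diff[OF m(1) m(1)]) (use insert.prems in auto)
      ultimately show ?thesis by simp
    qed
    moreover have "measure \<Omega> (?E' I (insert k K)) = measure \<Omega> (?E' I K) - measure \<Omega> (?E' (insert k I) K)"
    proof -
      have "?E' I (insert k K) = ?E' I K - ?E' (insert k I) K" by auto
      moreover have "measure \<Omega> (?E' I K - ?E' (insert k I) K) = measure \<Omega> (?E' I K) - measure \<Omega> (?E' (insert k I) K)"
        by (rule \<Omega>.finite_measure_Diff[OF m(2) m(2)]) (use insert.prems in auto)
      ultimately show ?thesis by simp
    qed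
    moreover have "(\<lambda>n. measure M (?E n I K) - measure M (?E n (insert k I) K))
        \<longlonglongrightarrow> measure \<Omega> (?E' I K) - measure \<Omega> (?E' (insert k I) K)"
      using insert.prems by (intro tendsto_diff insert.IH) auto
    ultimately show ?case by (simp only:)
  qed (use lim in simp)
  have "{\<omega>\<in>space M. \<forall>i\<in>A. \<omega> \<in> e n i \<longleftrightarrow> i \<notin> J} = {\<omega>\<in>space M. (\<forall>i\<in>A - J. \<omega> \<in> e n i) \<and> (\<forall>i\<in>J. \<omega> \<notin> e n i)}" for n
    using J by auto
  moreover have "{\<omega>\<in>space \<Omega>. \<forall>i\<in>A. \<omega> \<in> e' i \<longleftrightarrow> i \<notin> J} = {\<omega>\<in>space \<Omega>. (\<forall>i\<in>A - J. \<omega> \<in> e' i) \<and> (\<forall>i\<in>J. \<omega> \<notin> e' i)}"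
    using J by auto
  ultimately show ?thesis using claim[of J "A - J"] J finA by auto
qed

section \<open>Regular grids of half-open cells\<close>

definition grid_point :: "real \<Rightarrow> real \<Rightarrow> nat \<Rightarrow> nat \<Rightarrow> real" where
  "grid_point c d N i = c + (d - c) * real i / real N"

definition grid_cell :: "real \<Rightarrow> real \<Rightarrow> nat \<Rightarrow> nat \<Rightarrow> real set" where
  "grid_cell c d N i = {grid_point c d N i<..grid_point c d N (Suc i)}"

lemma grid_point_strict: "c < d \<Longrightarrow> 0 < N \<Longrightarrow> grid_point c d N i < grid_point c d N j \<longleftrightarrow> i < j"
  by (simp add: grid_point_def divide_strict_right_mono divide_less_cancel)

lemma grid_point_le: "c < d \<Longrightarrow> 0 < N \<Longrightarrow> grid_point c d N i \<le> grid_point c d N j \<longleftrightarrow> i \<le> j"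
  using grid_point_strict[of c d N j i] by (metis not_less)

lemma grid_point_0 [simp]: "grid_point c d N 0 = c"
  by (simp add: grid_point_def)

lemma grid_point_N [simp]: "0 < N \<Longrightarrow> grid_point c d N N = d"
  by (simp add: grid_point_def)

lemma grid_point_between: "c < d \<Longrightarrow> 0 < N \<Longrightarrow> i \<le> N \<Longrightarrow> grid_point c d N i \<in> {c..d}"
  using grid_point_le[of c d N 0 i] grid_point_le[of c d N i N] by simp

lemma grid_cell_subset: "c < d \<Longrightarrow> 0 < N \<Longrightarrow> i < N \<Longrightarrow> grid_cell c d N i \<subseteq> {c<..d}"
  using grid_point_le[of c d N 0 i] grid_point_le[of c d N "Suc i" N] by (auto simp: grid_cell_def)

lemma grid_cell_disjoint:
  assumes "c < d" "0 < N"
  shows "disjoint_family (grid_cell c d N)"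
proof -
  have "grid_cell c d N i \<inter> grid_cell c d N j = {}" if "i < j" for i j
    using that grid_point_le[OF assms, of "Suc i" j] by (auto simp: grid_cell_def)
  then show ?thesis unfolding disjoint_family_on_def by (metis linorder_neqE_nat Int_commute)
qed

lemma grid_cell_cover:
  assumes "c < d" "0 < N"
  shows "(\<Union>i<N. grid_cell c d N i) = {c<..d}"
proof
  show "(\<Union>i<N. grid_cell c d N i) \<subseteq> {c<..d}" using grid_cell_subset[OF assms] by auto
  show "{c<..d} \<subseteq> (\<Union>i<N. grid_cell c d N i)"
  proof
    fix x assume x: "x \<in> {c<..d}"
    define k where "k = (LEAST k. x \<le> grid_point c d N k)"
    have ex: "x \<le> grid_point c d N N" using x assms by simp
    have k: "x \<le> grid_point c d N k" unfolding k_def by (rule LeastI[of "\<lambda>k. x \<le> grid_point c d N k", OF ex])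
    have kN: "k \<le> N" unfolding k_def by (rule Least_le[of "\<lambda>k. x \<le> grid_point c d N k", OF ex])
    have "k \<noteq> 0" using k x by (auto intro: ccontr)
    then obtain i where i: "k = Suc i" by (cases k) auto
    then have "\<not> x \<le> grid_point c d N i" using not_less_Least[of i "\<lambda>k. x \<le> grid_point c d N k"] by (simp add: k_def)
    then show "x \<in> (\<Union>i<N. grid_cell c d N i)" using i k kN by (auto simp: grid_cell_def intro!: bexI[of _ i])
  qed
qed

lemma grid_cell_width:
  assumes "c < d" "0 < N" "x \<in> grid_cell c d N i" "y \<in> grid_cell c d N i"
  shows "\<bar>x - y\<bar> \<le> (d - c) / real N"
proof -
  have "grid_point c d N (Suc i) - grid_point c d N i = (d - c) / real N"
    unfolding grid_point_def of_nat_Suc distrib_left add_divide_distrib by simp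
  then show ?thesis using assms by (auto simp: grid_cell_def)
qed

text \<open>Compact neighbourhoods of \<open>F\<close> shrink to \<open>F\<close>. By local
  finiteness their counts converge to the count of \<open>F\<close>, which is 0 almost surely; being
  integers, they vanish from some neighbourhood on. So the probability that a neighbourhood is
  charged tends to 0.\<close>

lemma null_compact_approximation:
  assumes \<Omega>: "prob_space \<Omega>" and pp: "point_process \<Omega> S \<xi>" and S: "open S"
    and F: "compact F" "F \<subseteq> {c..d}" and cd: "{c..d} \<subseteq> S"
    and null: "AE \<omega> in \<Omega>. emeasure (\<xi> \<omega>) F = 0" and e: "0 < e" and r: "0 < r"
  shows "\<forall>\<^sub>F N in sequentially. \<exists>V\<in>sets borel. V \<subseteq> {c..d} \<and> {x\<in>{c..d}. \<exists>y\<in>F. \<bar>x - y\<bar> \<le> r / real N} \<subseteq> V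
      \<and> measure \<Omega> {\<omega>\<in>space \<Omega>. emeasure (\<xi> \<omega>) V \<noteq> 0} \<le> e"
proof (cases "F = {}")
  case False
  interpret \<Omega>: prob_space \<Omega> by fact
  define V where "V N = {c..d} \<inter> {x. infdist x F \<le> r / real (Suc N)}" for N
  have V_closed: "closed (V N)" for N
    unfolding V_def by (intro closed_Int closed_Collect_le continuous_intros) auto
  have V_sub: "V N \<subseteq> {c..d}" for N by (auto simp: V_def)
  have V_compact: "compact (V N)" for N
    using V_closed V_sub[of N] bounded_subset[OF bounded_closed_interval[of c d]] by (simp add: compact_eq_bounded_closed)
  have V_sets: "V N \<in> sets (restrict_space borel S)" for N
    using V_closed V_sub[of N] cd S by (auto simp: sets_restrict_open)
  have V_dec: "decseq V"
  proof (rule decseq_SucI)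
    fix N
    have "r / real (Suc (Suc N)) \<le> r / real (Suc N)" using r by (intro divide_left_mono) auto
    then show "V (Suc N) \<subseteq> V N" by (auto simp: V_def)
  qed
  have V_INT: "(\<Inter>N. V N) = F"
  proof
    show "F \<subseteq> (\<Inter>N. V N)" using F r by (auto simp: V_def)
    show "(\<Inter>N. V N) \<subseteq> F"
    proof
      fix x assume x: "x \<in> (\<Inter>N. V N)"
      have "infdist x F \<le> 0"
      proof (rule LIMSEQ_le_const)
        show "(\<lambda>N. r / real (Suc N)) \<longlonglongrightarrow> 0" using LIMSEQ_Suc[OF lim_const_over_n[of r]] .
        show "\<exists>N. \<forall>n\<ge>N. infdist x F \<le> r / real (Suc n)" using x by (auto simp: V_def)
      qed
      then have "infdist x F = 0" using infdist_nonneg[of x F] by simp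
      then show "x \<in> F" using False F in_closed_iff_infdist_zero[OF compact_imp_closed] by blast
    qed
  qed
  define Ev where "Ev N = {\<omega>\<in>space \<Omega>. emeasure (\<xi> \<omega>) (V N) \<noteq> 0}" for N
  have cnt: "(\<lambda>\<omega>. emeasure (\<xi> \<omega>) A) \<in> borel_measurable \<Omega>" if "A \<in> sets (restrict_space borel S)" for A
    using counting_processD(3)[OF point_process_counting[OF pp] that] .
  have Ev_meas: "Ev N \<in> sets \<Omega>" for N
    unfolding Ev_def using cnt[OF V_sets[of N]] by measurable
  have sets_\<xi>: "sets (\<xi> \<omega>) = sets (restrict_space borel S)" if "\<omega> \<in> space \<Omega>" for \<omega>
    using counting_processD(1)[OF point_process_counting[OF pp] that] .
  have Ev_dec: "decseq Ev"
    unfolding decseq_def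
  proof safe
    fix N N' \<omega> assume "N \<le> N'" "\<omega> \<in> Ev N'"
    moreover from this have "emeasure (\<xi> \<omega>) (V N') \<le> emeasure (\<xi> \<omega>) (V N)"
      using V_dec sets_\<xi> V_sets by (intro emeasure_mono) (auto simp: decseq_def Ev_def)
    ultimately show "\<omega> \<in> Ev N" by (auto simp: Ev_def)
  qed
  have "(\<lambda>N. measure \<Omega> (Ev N)) \<longlonglongrightarrow> measure \<Omega> (\<Inter>N. Ev N)"
    using Ev_meas Ev_dec by (intro \<Omega>.finite_Lim_measure_decseq) auto
  also have "measure \<Omega> (\<Inter>N. Ev N) = 0"
  proof -
    have "AE \<omega> in \<Omega>. \<omega> \<notin> (\<Inter>N. Ev N)"
      using null AE_space
    proof eventually_elim
      case (elim \<omega>)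
      have "(\<lambda>N. emeasure (\<xi> \<omega>) (V N)) \<longlonglongrightarrow> emeasure (\<xi> \<omega>) (\<Inter>N. V N)"
      proof (rule Lim_emeasure_decseq[OF _ V_dec])
        show "range V \<subseteq> sets (\<xi> \<omega>)" using V_sets sets_\<xi>[OF elim(2)] by auto
        show "emeasure (\<xi> \<omega>) (V N) \<noteq> \<infinity>" for N
          using point_process_finite[OF pp elim(2) V_compact[of N] order_trans[OF V_sub[of N] cd]] by simp
      qed
      then have "(\<lambda>N. emeasure (\<xi> \<omega>) (V N)) \<longlonglongrightarrow> 0" using elim(1) V_INT by simp
      then have "\<forall>\<^sub>F N in sequentially. emeasure (\<xi> \<omega>) (V N) < 1" by (rule order_tendstoD) simp
      then obtain N where N: "emeasure (\<xi> \<omega>) (V N) < 1" by (auto simp: eventually_sequentially)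
      have "emeasure (\<xi> \<omega>) (V N) \<in> insert \<infinity> (range of_nat)"
        using counting_processD(2)[OF point_process_counting[OF pp] elim(2) V_sets] .
      with N have "emeasure (\<xi> \<omega>) (V N) = 0" by auto
      then show ?case by (auto simp: Ev_def)
    qed
    then show ?thesis using Ev_meas by (intro measure_eq_0_null_sets) (auto simp: AE_iff_null_sets)
  qed
  finally have "\<forall>\<^sub>F N in sequentially. measure \<Omega> (Ev N) < e" using e by (intro order_tendstoD) auto
  then obtain N0 where N0: "\<And>N. N0 \<le> N \<Longrightarrow> measure \<Omega> (Ev N) < e" by (auto simp: eventually_sequentially)
  show ?thesis
    unfolding eventually_sequentially
  proof (intro exI[of _ "Suc N0"] allI impI)
    fix N assume "Suc N0 \<le> N"
    then obtain N' where N': "N = Suc N'" "N0 \<le> N'" by (cases N) auto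
    show "\<exists>V\<in>sets borel. V \<subseteq> {c..d} \<and> {x\<in>{c..d}. \<exists>y\<in>F. \<bar>x - y\<bar> \<le> r / real N} \<subseteq> V
      \<and> measure \<Omega> {\<omega>\<in>space \<Omega>. emeasure (\<xi> \<omega>) V \<noteq> 0} \<le> e"
    proof (intro bexI[of _ "V N'"] conjI)
      show "{x\<in>{c..d}. \<exists>y\<in>F. \<bar>x - y\<bar> \<le> r / real N} \<subseteq> V N'"
        by (auto simp: V_def N' dist_real_def intro: infdist_le[THEN order_trans])
      show "measure \<Omega> {\<omega>\<in>space \<Omega>. emeasure (\<xi> \<omega>) (V N') \<noteq> 0} \<le> e"
        using N0[OF N'(2)] by (simp add: Ev_def)
    qed (use V_sub V_closed in auto)
  qed
qed (use e in auto)

section \<open>From convergence of count probabilities to convergence in distribution\<close>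

definition lift_counts :: "nat \<Rightarrow> (nat \<Rightarrow> nat) \<Rightarrow> nat \<Rightarrow> ennreal" where
  "lift_counts m k = (\<lambda>i. if i < m then of_nat (k i) else 0)"

text \<open>Off the events \<open>e k\<close> with \<open>k\<close> in \<open>K\<close> the
  integrand is merely bounded by \<open>C\<close>, so the error is at most \<open>C\<close> times
  the missing mass. Extensionality of the elements of \<open>K\<close> makes the events of different
  \<open>k\<close> disjoint.\<close>

lemma (in prob_space) expectation_counts_approx:
  fixes Y :: "'a \<Rightarrow> nat \<Rightarrow> ennreal" and g :: "(nat \<Rightarrow> ennreal) \<Rightarrow> real"
  assumes Y: "\<And>i. (\<lambda>\<omega>. Y \<omega> i) \<in> borel_measurable M" and Y0: "\<And>\<omega> i. m \<le> i \<Longrightarrow> Y \<omega> i = 0"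
    and g [measurable]: "g \<in> borel_measurable borel" and C: "\<And>x. \<bar>g x\<bar> \<le> C"
    and K: "finite K" "K \<subseteq> extensional {..<m}"
  defines "e \<equiv> \<lambda>k. {\<omega>\<in>space M. \<forall>i<m. Y \<omega> i = of_nat (k i)}"
  shows "\<bar>expectation (\<lambda>\<omega>. g (Y \<omega>)) - (\<Sum>k\<in>K. g (lift_counts m k) * prob (e k))\<bar> \<le> C * (1 - (\<Sum>k\<in>K. prob (e k)))"
proof -
  have [measurable]: "Y \<in> borel_measurable M" by (rule measurable_coordinatewise_then_product) (rule Y)
  have e_sets [measurable]: "e k \<in> events" for k
  proof -
    note [measurable] = Y
    have "{\<omega>\<in>space M. \<forall>i\<in>{..<m}. Y \<omega> i = of_nat (k i)} \<in> events" by measurable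
    then show ?thesis by (simp add: e_def)
  qed
  define U where "U = (\<Union>k\<in>K. e k)"
  have U_sets [measurable]: "U \<in> events" unfolding U_def using K by auto
  have uniq: "k = k'" if "k \<in> K" "k' \<in> K" "\<omega> \<in> e k" "\<omega> \<in> e k'" for k k' \<omega>
  proof (rule extensionalityI[of _ "{..<m}"])
    fix i assume "i \<in> {..<m}"
    then have "(of_nat (k i) :: ennreal) = of_nat (k' i)" using that unfolding e_def by (metis (mono_tags, lifting) lessThan_iff mem_Collect_eq)
    then show "k i = k' i" by simp
  qed (use that K in auto)
  have PU: "prob U = (\<Sum>k\<in>K. prob (e k))"
    unfolding U_def using K uniq by (intro finite_measure_finite_Union) (auto simp: disjoint_family_on_def)
  have Ye: "Y \<omega> = lift_counts m k" if "\<omega> \<in> e k" for \<omega> k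
    using that Y0[of _ \<omega>] by (auto simp: e_def lift_counts_def fun_eq_iff)
  define D where "D \<omega> = g (Y \<omega>) - (\<Sum>k\<in>K. g (lift_counts m k) * indicator (e k) \<omega>)" for \<omega>
  have D_bound: "\<bar>D \<omega>\<bar> \<le> C * indicator (space M - U) \<omega>" if "\<omega> \<in> space M" for \<omega>
  proof (cases "\<omega> \<in> U")
    case True
    then obtain k where k: "k \<in> K" "\<omega> \<in> e k" by (auto simp: U_def)
    have "(\<Sum>k'\<in>K. g (lift_counts m k') * indicator (e k') \<omega>) = (\<Sum>k'\<in>K. if k' = k then g (lift_counts m k) else 0)"
    proof (intro sum.cong refl)
      fix k' assume "k' \<in> K"
      show "g (lift_counts m k') * indicator (e k') \<omega> = (if k' = k then g (lift_counts m k) else 0)"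
      proof (cases "\<omega> \<in> e k'")
        case True
        then have "k' = k" using uniq[OF \<open>k' \<in> K\<close> k(1) True k(2)] by blast
        then show ?thesis using True by simp
      next
        case False
        then have "k' \<noteq> k" using k(2) by blast
        then show ?thesis using False by simp
      qed
    qed
    also have "\<dots> = g (Y \<omega>)" using k K Ye[OF k(2)] by simp
    finally show ?thesis using True by (simp add: D_def)
  next
    case False
    then have "(\<Sum>k\<in>K. g (lift_counts m k) * indicator (e k) \<omega>) = 0" by (intro sum.neutral) (auto simp: U_def)
    then show ?thesis using C[of "Y \<omega>"] False that by (simp add: D_def)
  qed
  have int_g: "integrable M (\<lambda>\<omega>. g (Y \<omega>))"
    by (rule integrable_const_bound[where B = C]) (auto simp: C)
  have int_s: "integrable M (\<lambda>\<omega>. \<Sum>k\<in>K. g (lift_counts m k) * indicator (e k) \<omega>)"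
    by (intro Bochner_Integration.integrable_sum integrable_mult_right integrable_real_indicator) (auto simp: emeasure_eq_measure)
  have "expectation D = expectation (\<lambda>\<omega>. g (Y \<omega>)) - (\<Sum>k\<in>K. g (lift_counts m k) * prob (e k))"
  proof -
    have "expectation D = expectation (\<lambda>\<omega>. g (Y \<omega>)) - expectation (\<lambda>\<omega>. \<Sum>k\<in>K. g (lift_counts m k) * indicator (e k) \<omega>)"
      unfolding D_def by (rule Bochner_Integration.integral_diff[OF int_g int_s])
    also have "expectation (\<lambda>\<omega>. \<Sum>k\<in>K. g (lift_counts m k) * indicator (e k) \<omega>) = (\<Sum>k\<in>K. g (lift_counts m k) * prob (e k))"
      by (subst Bochner_Integration.integral_sum) (auto simp: emeasure_eq_measure)
    finally show ?thesis .
  qed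
  moreover have "\<bar>expectation D\<bar> \<le> expectation (\<lambda>\<omega>. \<bar>D \<omega>\<bar>)" by (rule integral_abs_bound)
  moreover have "expectation (\<lambda>\<omega>. \<bar>D \<omega>\<bar>) \<le> expectation (\<lambda>\<omega>. C * indicator (space M - U) \<omega>)"
  proof (rule integral_mono)
    show "integrable M (\<lambda>\<omega>. \<bar>D \<omega>\<bar>)" unfolding D_def by (intro integrable_abs Bochner_Integration.integrable_diff int_g int_s)
    show "integrable M (\<lambda>\<omega>. C * indicator (space M - U) \<omega>)"
      by (intro integrable_mult_right integrable_real_indicator) (auto simp: emeasure_eq_measure)
  qed (rule D_bound)
  moreover have "expectation (\<lambda>\<omega>. C * indicator (space M - U) \<omega>) = C * (1 - (\<Sum>k\<in>K. prob (e k)))"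
    by (simp add: prob_compl PU)
  ultimately show ?thesis by linarith
qed

text \<open>The limit puts mass close to 1 on a finite box of count vectors. There the point
  probabilities converge, hence so does the missing mass of \<open>Z n\<close>, and tightness comes
  for free. Measurability is asked for positive \<open>n\<close>, as the record times are divided by
  \<open>n\<close>.\<close>

lemma counts_converge_in_distribution:
  fixes Z :: "nat \<Rightarrow> 'w \<Rightarrow> nat \<Rightarrow> ennreal" and W :: "'v \<Rightarrow> nat \<Rightarrow> ennreal"
  assumes M: "prob_space M" and \<Omega>: "prob_space \<Omega>"
    and Z: "\<And>n i. 0 < n \<Longrightarrow> (\<lambda>\<omega>. Z n \<omega> i) \<in> borel_measurable M" "\<And>n \<omega> i. m \<le> i \<Longrightarrow> Z n \<omega> i = 0"
    and W: "\<And>i. (\<lambda>\<omega>. W \<omega> i) \<in> borel_measurable \<Omega>" "\<And>\<omega> i. m \<le> i \<Longrightarrow> W \<omega> i = 0"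
    and W_int: "\<And>\<omega> i. \<omega> \<in> space \<Omega> \<Longrightarrow> i < m \<Longrightarrow> W \<omega> i \<in> range of_nat"
    and lim: "\<And>k :: nat \<Rightarrow> nat. (\<lambda>n. measure M {\<omega>\<in>space M. \<forall>i<m. Z n \<omega> i = of_nat (k i)})
        \<longlonglongrightarrow> measure \<Omega> {\<omega>\<in>space \<Omega>. \<forall>i<m. W \<omega> i = of_nat (k i)}"
  shows "converges_in_distribution M Z \<Omega> W"
  unfolding converges_in_distribution_def
proof (intro allI impI)
  interpret M: prob_space M by fact
  interpret \<Omega>: prob_space \<Omega> by fact
  fix g :: "(nat \<Rightarrow> ennreal) \<Rightarrow> real"
  assume cont: "continuous_on UNIV g" and bdd: "bounded (range g)"
  have g: "g \<in> borel_measurable borel" using cont by (rule borel_measurable_continuous_onI)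
  obtain C where C: "\<And>x. \<bar>g x\<bar> \<le> C" using bdd by (auto simp: bounded_iff)
  define K where "K R = PiE {..<m} (\<lambda>_. {..R})" for R :: nat
  have K: "finite (K R)" "K R \<subseteq> extensional {..<m}" for R
    unfolding K_def by (rule finite_PiE; simp) (simp add: PiE_def)
  define e where "e n k = {\<omega>\<in>space M. \<forall>i<m. Z n \<omega> i = of_nat (k i)}" for n and k :: "nat \<Rightarrow> nat"
  define e' where "e' k = {\<omega>\<in>space \<Omega>. \<forall>i<m. W \<omega> i = of_nat (k i)}" for k :: "nat \<Rightarrow> nat"
  define A where "A R = (\<Sum>k\<in>K R. g (lift_counts m k) * \<Omega>.prob (e' k))" for R
  define s where "s R = (\<Sum>k\<in>K R. \<Omega>.prob (e' k))" for R
  \<comment> \<open>The limiting counts are finite, so the boxes with entries up to \<open>R\<close>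
    exhaust the sample space.\<close>
  have s1: "s \<longlonglongrightarrow> 1"
  proof -
    define F where "F R = {\<omega>\<in>space \<Omega>. \<forall>i<m. W \<omega> i \<le> of_nat R}" for R :: nat
    have F_sets: "F R \<in> \<Omega>.events" for R
    proof -
      note [measurable] = W(1)
      have "{\<omega>\<in>space \<Omega>. \<forall>i\<in>{..<m}. W \<omega> i \<le> of_nat R} \<in> \<Omega>.events" by measurable
      then show ?thesis by (simp add: F_def)
    qed
    have e'_sets: "e' k \<in> \<Omega>.events" for k
    proof -
      note [measurable] = W(1)
      have "{\<omega>\<in>space \<Omega>. \<forall>i\<in>{..<m}. W \<omega> i = of_nat (k i)} \<in> \<Omega>.events" by measurable
      then show ?thesis by (simp add: e'_def)
    qed
    have "s = (\<lambda>R. \<Omega>.prob (F R))"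
    proof
      fix R
      have "F R = (\<Union>k\<in>K R. e' k)"
      proof (intro set_eqI iffI)
        fix \<omega> assume \<omega>: "\<omega> \<in> F R"
        then have "\<forall>i\<in>{..<m}. \<exists>q::nat. W \<omega> i = of_nat q" using W_int by (fastforce simp: F_def)
        then obtain q :: "nat \<Rightarrow> nat" where q: "\<And>i. i < m \<Longrightarrow> W \<omega> i = of_nat (q i)" by (metis lessThan_iff)
        have "q i \<le> R" if "i < m" for i
        proof -
          have "W \<omega> i \<le> of_nat R" using \<omega> that by (simp add: F_def)
          then show ?thesis unfolding q[OF that] by simp
        qed
        then show "\<omega> \<in> (\<Union>k\<in>K R. e' k)" using \<omega> q
          by (intro UN_I[of "restrict q {..<m}"]) (auto simp: K_def e'_def F_def)
      next
        fix \<omega> assume "\<omega> \<in> (\<Union>k\<in>K R. e' k)"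
        then obtain k where "k \<in> K R" "\<omega> \<in> e' k" by auto
        moreover from this have "k i \<le> R" if "i < m" for i using that by (auto simp: K_def PiE_iff)
        ultimately show "\<omega> \<in> F R" by (auto simp: F_def e'_def)
      qed
      moreover have "disjoint_family_on e' (K R)"
        unfolding disjoint_family_on_def
      proof (intro ballI impI)
        fix k k' assume k: "k \<in> K R" "k' \<in> K R" "k \<noteq> k'"
        then obtain i where i: "i \<in> {..<m}" "k i \<noteq> k' i" unfolding K_def using PiE_ext[of k "{..<m}" _ k'] by blast
        then have "(of_nat (k i) :: ennreal) \<noteq> of_nat (k' i)" by simp
        then show "e' k \<inter> e' k' = {}" using i(1) unfolding e'_def by auto
      qed
      ultimately show "s R = \<Omega>.prob (F R)" unfolding s_def using K e'_sets
        by (simp only:) (intro \<Omega>.finite_measure_finite_Union[symmetric], auto)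
    qed
    moreover have "(\<lambda>R. \<Omega>.prob (F R)) \<longlonglongrightarrow> \<Omega>.prob (\<Union>R. F R)"
    proof (rule \<Omega>.finite_Lim_measure_incseq)
      show "incseq F"
      proof (rule incseq_SucI, rule subsetI)
        fix R \<omega> assume "\<omega> \<in> F R"
        moreover have "(of_nat R :: ennreal) \<le> of_nat (Suc R)" by (rule of_nat_mono) simp
        ultimately show "\<omega> \<in> F (Suc R)" unfolding F_def by (auto intro: order_trans simp del: of_nat_Suc)
      qed
    qed (use F_sets in auto)
    moreover have "(\<Union>R. F R) = space \<Omega>"
    proof (intro equalityI subsetI)
      fix \<omega> assume \<omega>: "\<omega> \<in> space \<Omega>"
      then have "\<forall>i\<in>{..<m}. \<exists>q::nat. W \<omega> i = of_nat q" using W_int by fastforce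
      then obtain q :: "nat \<Rightarrow> nat" where q: "\<And>i. i < m \<Longrightarrow> W \<omega> i = of_nat (q i)" by (metis lessThan_iff)
      have "W \<omega> i \<le> of_nat (\<Sum>i<m. q i)" if "i < m" for i
        unfolding q[OF that] using that by (intro of_nat_mono member_le_sum) auto
      then show "\<omega> \<in> (\<Union>R. F R)" using \<omega> unfolding F_def by blast
    qed (auto simp: F_def)
    ultimately show ?thesis by (simp add: \<Omega>.prob_space)
  qed
  have A_bound: "\<bar>\<Omega>.expectation (\<lambda>\<omega>. g (W \<omega>)) - A R\<bar> \<le> C * (1 - s R)" for R
    unfolding A_def s_def e'_def by (rule \<Omega>.expectation_counts_approx[OF W g C K])
  have Cs: "(\<lambda>R. C * (1 - s R)) \<longlonglongrightarrow> 0"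
  proof -
    have "(\<lambda>R. C * (1 - s R)) \<longlonglongrightarrow> C * (1 - 1)" by (intro tendsto_intros s1)
    then show ?thesis by simp
  qed
  have A: "A \<longlonglongrightarrow> \<Omega>.expectation (\<lambda>\<omega>. g (W \<omega>))"
  proof -
    have "(\<lambda>R. A R - \<Omega>.expectation (\<lambda>\<omega>. g (W \<omega>))) \<longlonglongrightarrow> 0"
      using A_bound by (intro Lim_null_comparison[OF _ Cs]) (auto simp: abs_minus_commute)
    then show ?thesis by (simp add: LIM_zero_iff)
  qed
  have e_lim: "(\<lambda>n. M.prob (e n k)) \<longlonglongrightarrow> \<Omega>.prob (e' k)" for k using lim by (simp add: e_def e'_def)
  show "(\<lambda>n. M.expectation (\<lambda>\<omega>. g (Z n \<omega>))) \<longlonglongrightarrow> \<Omega>.expectation (\<lambda>\<omega>. g (W \<omega>))"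
  proof (rule double_sandwich[where
        l = "\<lambda>R n. (\<Sum>k\<in>K R. g (lift_counts m k) * M.prob (e n k)) - C * (1 - (\<Sum>k\<in>K R. M.prob (e n k)))"
        and u = "\<lambda>R n. (\<Sum>k\<in>K R. g (lift_counts m k) * M.prob (e n k)) + C * (1 - (\<Sum>k\<in>K R. M.prob (e n k)))"])
    fix R
    show "\<forall>\<^sub>F n in sequentially. (\<Sum>k\<in>K R. g (lift_counts m k) * M.prob (e n k)) - C * (1 - (\<Sum>k\<in>K R. M.prob (e n k))) \<le> M.expectation (\<lambda>\<omega>. g (Z n \<omega>)) \<and>
        M.expectation (\<lambda>\<omega>. g (Z n \<omega>)) \<le> (\<Sum>k\<in>K R. g (lift_counts m k) * M.prob (e n k)) + C * (1 - (\<Sum>k\<in>K R. M.prob (e n k)))"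
      using eventually_gt_at_top[of 0]
    proof eventually_elim
      case (elim n)
      have "\<bar>M.expectation (\<lambda>\<omega>. g (Z n \<omega>)) - (\<Sum>k\<in>K R. g (lift_counts m k) * M.prob (e n k))\<bar> \<le> C * (1 - (\<Sum>k\<in>K R. M.prob (e n k)))"
        unfolding e_def by (rule M.expectation_counts_approx[OF Z(1)[OF elim] Z(2) g C K])
      then show ?case unfolding abs_le_iff by linarith
    qed
    show "(\<lambda>n. (\<Sum>k\<in>K R. g (lift_counts m k) * M.prob (e n k)) - C * (1 - (\<Sum>k\<in>K R. M.prob (e n k)))) \<longlonglongrightarrow> A R - C * (1 - s R)"
      unfolding A_def s_def by (intro tendsto_intros e_lim)
    show "(\<lambda>n. (\<Sum>k\<in>K R. g (lift_counts m k) * M.prob (e n k)) + C * (1 - (\<Sum>k\<in>K R. M.prob (e n k)))) \<longlonglongrightarrow> A R + C * (1 - s R)"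
      unfolding A_def s_def by (intro tendsto_intros e_lim)
  next
    show "(\<lambda>R. A R - C * (1 - s R)) \<longlonglongrightarrow> \<Omega>.expectation (\<lambda>\<omega>. g (W \<omega>))" using tendsto_diff[OF A Cs] by simp
    show "(\<lambda>R. A R + C * (1 - s R)) \<longlonglongrightarrow> \<Omega>.expectation (\<lambda>\<omega>. g (W \<omega>))" using tendsto_add[OF A Cs] by simp
  qed
qed

text \<open>A criterion in the style of Kallenberg: the probabilities that finite unions of
  half-open cells are empty converge, and cells with two points disappear under refinement, for the
  processes and for the limit. The second part is what gives access to counts, since emptiness does
  not see multiplicities.\<close>

locale avoidance_convergence =
  M: prob_space M + \<Omega>: prob_space \<Omega> for M :: "'w measure" and \<Omega> :: "'v measure" +
  fixes S :: "real set" and \<xi>s :: "nat \<Rightarrow> 'w \<Rightarrow> real measure" and \<xi> :: "'v \<Rightarrow> real measure"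
  assumes S_open: "open S" and S_ne: "S \<noteq> {}"
    and S_interval: "\<And>x y z. x \<in> S \<Longrightarrow> z \<in> S \<Longrightarrow> x \<le> y \<Longrightarrow> y \<le> z \<Longrightarrow> y \<in> S"
    and counting: "\<And>n. 0 < n \<Longrightarrow> counting_process M S (\<xi>s n)"
    and limit_pp: "point_process \<Omega> S \<xi>"
    and avoidance: "\<And>(t :: nat \<Rightarrow> real) N I. (\<And>i. i \<le> N \<Longrightarrow> t i \<in> S) \<Longrightarrow> (\<And>i. i < N \<Longrightarrow> t i < t (Suc i)) \<Longrightarrow>
        I \<subseteq> {..<N} \<Longrightarrow>
        (\<lambda>n. M.prob {\<omega>\<in>space M. \<forall>i\<in>I. emeasure (\<xi>s n \<omega>) {t i<..t (Suc i)} = 0})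
          \<longlonglongrightarrow> \<Omega>.prob {\<omega>\<in>space \<Omega>. \<forall>i\<in>I. emeasure (\<xi> \<omega>) {t i<..t (Suc i)} = 0}"
    and simple: "\<And>c d e. c \<in> S \<Longrightarrow> d \<in> S \<Longrightarrow> c < d \<Longrightarrow> 0 < e \<Longrightarrow>
        \<forall>\<^sub>F N in sequentially. \<forall>\<^sub>F n in sequentially.
          M.prob {\<omega>\<in>space M. \<exists>i<N. 2 \<le> emeasure (\<xi>s n \<omega>) (grid_cell c d N i)} \<le> e"
    and limit_simple: "\<And>c d e. c \<in> S \<Longrightarrow> d \<in> S \<Longrightarrow> c < d \<Longrightarrow> 0 < e \<Longrightarrow>
        \<forall>\<^sub>F N in sequentially.
          \<Omega>.prob {\<omega>\<in>space \<Omega>. \<exists>i<N. 2 \<le> emeasure (\<xi> \<omega>) (grid_cell c d N i)} \<le> e"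
begin

text \<open>A compact subset of an open interval has room on both sides; the room on the left is
  needed because the grid cells are open there.\<close>

lemma bounded_window:
  assumes "compact K" "K \<subseteq> S"
  obtains c d where "c \<in> S" "d \<in> S" "c < d" "K \<subseteq> {c<..d}" "{c..d} \<subseteq> S"
proof -
  obtain x0 where x0: "x0 \<in> S" using S_ne by auto
  define K' where "K' = insert x0 K"
  have K': "compact K'" "K' \<noteq> {}" "K' \<subseteq> S" using assms x0 by (auto simp: K'_def)
  obtain p where p: "p \<in> K'" "\<And>x. x \<in> K' \<Longrightarrow> p \<le> x" using compact_attains_inf[OF K'(1,2)] by auto
  obtain q where q: "q \<in> K'" "\<And>x. x \<in> K' \<Longrightarrow> x \<le> q" using compact_attains_sup[OF K'(1,2)] by auto
  have "p \<in> S" "q \<in> S" using p q K' by auto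
  obtain r where r: "0 < r" "cball p r \<subseteq> S" using S_open \<open>p \<in> S\<close> by (meson open_contains_cball)
  obtain r' where r': "0 < r'" "cball q r' \<subseteq> S" using S_open \<open>q \<in> S\<close> by (meson open_contains_cball)
  have c: "p - r \<in> S" using r by (auto simp: dist_real_def)
  have d: "q + r' \<in> S" using r' by (auto simp: dist_real_def)
  have "p \<le> q" using p q by auto
  show thesis
  proof (rule that[OF c d])
    show "p - r < q + r'" using r r' \<open>p \<le> q\<close> by simp
    show "K \<subseteq> {p - r<..q + r'}"
    proof
      fix x assume "x \<in> K"
      then have "p \<le> x" "x \<le> q" using p q by (auto simp: K'_def)
      then show "x \<in> {p - r<..q + r'}" using r r' by auto
    qed
    show "{p - r..q + r'} \<subseteq> S" using S_interval[OF c d] by auto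
  qed
qed

context
  fixes B :: "nat \<Rightarrow> real set" and m :: nat
  assumes B: "\<And>i. i < m \<Longrightarrow> B i \<in> sets borel" "\<And>i. i < m \<Longrightarrow> compact (closure (B i))"
      "\<And>i. i < m \<Longrightarrow> closure (B i) \<subseteq> S"
      "\<And>i. i < m \<Longrightarrow> AE \<omega> in \<Omega>. emeasure (\<xi> \<omega>) (frontier (B i)) = 0"
begin

text \<open>Up to a small probability, every cell of a fine grid holds at most one point and no
  point lies in a cell that meets the boundary of some \<open>B j\<close>. All other cells lie
  inside or outside each \<open>B j\<close>. So the counts are functions of the pattern of empty
  cells, and the law of the pattern converges by \<open>pattern_limit\<close>.\<close>

lemma counts_limit:
  fixes k :: "nat \<Rightarrow> nat"
  shows "(\<lambda>n. M.prob {\<omega>\<in>space M. \<forall>i<m. emeasure (\<xi>s n \<omega>) (B i) = of_nat (k i)})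
    \<longlonglongrightarrow> \<Omega>.prob {\<omega>\<in>space \<Omega>. \<forall>i<m. emeasure (\<xi> \<omega>) (B i) = of_nat (k i)}"
proof (rule LIMSEQ_I)
  fix \<epsilon> :: real assume "0 < \<epsilon>"
  \<comment> \<open>Six errors of size \<open>e\<close> will occur: three for \<open>Z\<close>
    against \<open>Y\<close>, one for \<open>Y\<close> against \<open>Y'\<close>, two for
    \<open>Z'\<close> against \<open>Y'\<close>. The seventh makes the estimate strict.\<close>
  define e where "e = \<epsilon> / 7"
  have e: "0 < e" using \<open>0 < \<epsilon>\<close> by (simp add: e_def)
  define K where "K = (\<Union>i<m. closure (B i))"
  have K: "compact K" "K \<subseteq> S" unfolding K_def using B by (auto intro!: compact_UN)
  obtain c d where cd: "c \<in> S" "d \<in> S" "c < d" "K \<subseteq> {c<..d}" "{c..d} \<subseteq> S"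
    using bounded_window[OF K] .
  define F where "F = (\<Union>i<m. frontier (B i))"
  have fr_sub: "frontier (B i) \<subseteq> closure (B i)" for i by (auto simp: frontier_def)
  have F_closed: "closed F" unfolding F_def by (intro closed_UN) auto
  have FK: "F \<subseteq> K" using fr_sub by (auto simp: F_def K_def)
  have F: "compact F" "F \<subseteq> {c..d}"
    using compact_Int_closed[OF K(1) F_closed] FK cd(4) by (auto simp: Int_absorb1)
  have sets_\<xi>: "sets (\<xi> \<omega>) = sets (restrict_space borel S)" if "\<omega> \<in> space \<Omega>" for \<omega>
    using counting_processD(1)[OF point_process_counting[OF limit_pp] that] .
  have F_null: "AE \<omega> in \<Omega>. emeasure (\<xi> \<omega>) F = 0"
  proof -
    have "AE \<omega> in \<Omega>. \<forall>i\<in>{..<m}. emeasure (\<xi> \<omega>) (frontier (B i)) = 0"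
      using B(4) by (intro AE_finite_allI) auto
    then show ?thesis using AE_space
    proof eventually_elim
      case (elim \<omega>)
      have "frontier (B i) \<in> sets (\<xi> \<omega>)" if "i < m" for i
        using B(3)[OF that] fr_sub[of i] sets_\<xi>[OF elim(2)] S_open by (auto simp: sets_restrict_open)
      then have "F \<in> null_sets (\<xi> \<omega>)" unfolding F_def using elim(1)
        by (intro null_sets_UN') (auto simp: null_sets_def)
      then show ?case by auto
    qed
  qed
  have "\<forall>\<^sub>F N in sequentially. 0 < N \<and>
      (\<forall>\<^sub>F n in sequentially. M.prob {\<omega>\<in>space M. \<exists>i<N. 2 \<le> emeasure (\<xi>s n \<omega>) (grid_cell c d N i)} \<le> e) \<and>
      \<Omega>.prob {\<omega>\<in>space \<Omega>. \<exists>i<N. 2 \<le> emeasure (\<xi> \<omega>) (grid_cell c d N i)} \<le> e \<and>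
      (\<exists>V\<in>sets borel. V \<subseteq> {c..d} \<and> {x\<in>{c..d}. \<exists>y\<in>F. \<bar>x - y\<bar> \<le> (d - c) / real N} \<subseteq> V
      \<and> \<Omega>.prob {\<omega>\<in>space \<Omega>. emeasure (\<xi> \<omega>) V \<noteq> 0} \<le> e)"
    using cd by (intro eventually_conj eventually_gt_at_top simple limit_simple e
        null_compact_approximation[OF \<Omega>.prob_space_axioms limit_pp S_open F cd(5) F_null e]) auto
  then have "\<exists>N. 0 < N \<and>
      (\<forall>\<^sub>F n in sequentially. M.prob {\<omega>\<in>space M. \<exists>i<N. 2 \<le> emeasure (\<xi>s n \<omega>) (grid_cell c d N i)} \<le> e) \<and>
      \<Omega>.prob {\<omega>\<in>space \<Omega>. \<exists>i<N. 2 \<le> emeasure (\<xi> \<omega>) (grid_cell c d N i)} \<le> e \<and>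
      (\<exists>V\<in>sets borel. V \<subseteq> {c..d} \<and> {x\<in>{c..d}. \<exists>y\<in>F. \<bar>x - y\<bar> \<le> (d - c) / real N} \<subseteq> V
      \<and> \<Omega>.prob {\<omega>\<in>space \<Omega>. emeasure (\<xi> \<omega>) V \<noteq> 0} \<le> e)"
    by (rule eventually_happens'[rotated]) simp
  then obtain N where N: "0 < N"
    and N1: "\<forall>\<^sub>F n in sequentially. M.prob {\<omega>\<in>space M. \<exists>i<N. 2 \<le> emeasure (\<xi>s n \<omega>) (grid_cell c d N i)} \<le> e"
    and N2: "\<Omega>.prob {\<omega>\<in>space \<Omega>. \<exists>i<N. 2 \<le> emeasure (\<xi> \<omega>) (grid_cell c d N i)} \<le> e"
    and N3: "\<exists>V\<in>sets borel. V \<subseteq> {c..d} \<and> {x\<in>{c..d}. \<exists>y\<in>F. \<bar>x - y\<bar> \<le> (d - c) / real N} \<subseteq> V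
      \<and> \<Omega>.prob {\<omega>\<in>space \<Omega>. emeasure (\<xi> \<omega>) V \<noteq> 0} \<le> e"
    by blast
  obtain V where V: "V \<in> sets borel" "V \<subseteq> {c..d}" "{x\<in>{c..d}. \<exists>y\<in>F. \<bar>x - y\<bar> \<le> (d - c) / real N} \<subseteq> V"
    "\<Omega>.prob {\<omega>\<in>space \<Omega>. emeasure (\<xi> \<omega>) V \<noteq> 0} \<le> e" using N3 by auto
  define C where "C = grid_cell c d N"
  \<comment> \<open>The cells touched by a boundary. By connectedness every other cell is inside or
    outside each \<open>B j\<close>.\<close>
  define D where "D = {i. i < N \<and> C i \<inter> F \<noteq> {}}"
  have C_sub: "C i \<subseteq> {c<..d}" if "i < N" for i using grid_cell_subset[OF cd(3) N that] by (simp add: C_def)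
  have C_sets: "C i \<in> sets (restrict_space borel S)" if "i < N" for i
  proof -
    have "C i \<subseteq> S" by (rule order_trans[OF C_sub[OF that] order_trans[OF _ cd(5)]]) auto
    then show ?thesis using S_open by (simp add: sets_restrict_open) (simp add: C_def grid_cell_def)
  qed
  have B_sets: "B i \<in> sets (restrict_space borel S)" if "i < m" for i
    using B(1,3)[OF that] closure_subset[of "B i"] S_open by (auto simp: sets_restrict_open)
  have dichotomy: "C i \<subseteq> B j \<or> C i \<inter> B j = {}" if "i < N" "i \<notin> D" "j < m" for i j
  proof (rule ccontr)
    assume "\<not> ?thesis"
    moreover have "connected (C i)" by (simp add: C_def grid_cell_def)
    ultimately have "C i \<inter> frontier (B j) \<noteq> {}" using connected_Int_frontier[of "C i" "B j"] by auto
    then show False using that by (auto simp: D_def F_def)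
  qed
  \<comment> \<open>The count of \<open>B j\<close> predicted by the set \<open>J\<close> of
    occupied cells.\<close>
  define h where "h J j = card {i\<in>J. i \<notin> D \<and> C i \<subseteq> B j}" for J j
  have key: "emeasure \<nu> (B j) = of_nat (h {i. i < N \<and> emeasure \<nu> (C i) \<noteq> 0} j)"
    if s: "sets \<nu> = sets (restrict_space borel S)"
      and int: "\<And>A. A \<in> sets (restrict_space borel S) \<Longrightarrow> emeasure \<nu> A \<in> insert \<infinity> (range of_nat)"
      and good: "\<not> (\<exists>i<N. 2 \<le> emeasure \<nu> (C i))" "\<forall>i\<in>D. emeasure \<nu> (C i) = 0" and j: "j < m" for \<nu> :: "real measure" and j
  proof -
    have Bj: "B j = (\<Union>i<N. B j \<inter> C i)"
    proof -
      have "B j \<subseteq> {c<..d}" using cd(4) j closure_subset[of "B j"] by (auto simp: K_def)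
      then show ?thesis using grid_cell_cover[OF cd(3) N] unfolding C_def by blast
    qed
    have "emeasure \<nu> (B j) = (\<Sum>i<N. emeasure \<nu> (B j \<inter> C i))"
    proof (subst Bj, rule sum_emeasure[symmetric])
      show "(\<lambda>i. B j \<inter> C i) ` {..<N} \<subseteq> sets \<nu>" using B_sets[OF j] C_sets s by auto
      show "disjoint_family_on (\<lambda>i. B j \<inter> C i) {..<N}"
        using grid_cell_disjoint[OF cd(3) N] unfolding C_def disjoint_family_on_def by blast
    qed simp
    also have "\<dots> = (\<Sum>i<N. if emeasure \<nu> (C i) \<noteq> 0 \<and> i \<notin> D \<and> C i \<subseteq> B j then 1 else 0)"
    proof (intro sum.cong refl)
      fix i assume i: "i \<in> {..<N}"
      have le: "emeasure \<nu> (B j \<inter> C i) \<le> emeasure \<nu> (C i)"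
        using C_sets i s by (intro emeasure_mono) auto
      have "emeasure \<nu> (C i) \<in> insert \<infinity> (range of_nat)" using int C_sets i by auto
      moreover have "\<not> 2 \<le> emeasure \<nu> (C i)" using good(1) i by auto
      ultimately have "emeasure \<nu> (C i) = 0 \<or> emeasure \<nu> (C i) = 1"
      proof -
        assume a: "emeasure \<nu> (C i) \<in> insert \<infinity> (range of_nat)" "\<not> 2 \<le> emeasure \<nu> (C i)"
        then obtain q :: nat where q: "emeasure \<nu> (C i) = of_nat q" by auto
        have "\<not> 2 \<le> q"
        proof
          assume "2 \<le> q"
          then have "(of_nat 2 :: ennreal) \<le> of_nat q" by (rule of_nat_mono)
          then show False using a q by simp
        qed
        then have "q = 0 \<or> q = 1" by auto
        then show ?thesis using q by auto
      qed
      moreover have "B j \<inter> C i = C i" if "C i \<subseteq> B j" using that by auto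
      moreover have "B j \<inter> C i = {}" if "\<not> C i \<subseteq> B j" "i \<notin> D" using that dichotomy[of i j] i j by auto
      ultimately show "emeasure \<nu> (B j \<inter> C i) = (if emeasure \<nu> (C i) \<noteq> 0 \<and> i \<notin> D \<and> C i \<subseteq> B j then 1 else 0)"
        using le good(2) by (cases "i \<in> D") auto
    qed
    also have "\<dots> = (\<Sum>i\<in>{i\<in>{..<N}. emeasure \<nu> (C i) \<noteq> 0 \<and> i \<notin> D \<and> C i \<subseteq> B j}. 1)"
      by (intro sum.inter_filter[symmetric]) simp
    also have "\<dots> = of_nat (h {i. i < N \<and> emeasure \<nu> (C i) \<noteq> 0} j)"
    proof -
      have "{i\<in>{..<N}. emeasure \<nu> (C i) \<noteq> 0 \<and> i \<notin> D \<and> C i \<subseteq> B j}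
          = {i\<in>{i. i < N \<and> emeasure \<nu> (C i) \<noteq> 0}. i \<notin> D \<and> C i \<subseteq> B j}" by blast
      then show ?thesis by (simp add: h_def)
    qed
    finally show ?thesis .
  qed
  define \<J> where "\<J> = {J. J \<subseteq> {..<N} \<and> (\<forall>j<m. h J j = k j)}"
  have fin\<J>: "finite \<J>" unfolding \<J>_def by (rule finite_subset[of _ "Pow {..<N}"]) auto
  have Cm: "(\<lambda>\<omega>. emeasure (\<xi>s n \<omega>) A) \<in> borel_measurable M" if "0 < n" "A \<in> sets (restrict_space borel S)" for n A
    using counting_processD(3)[OF counting[OF that(1)] that(2)] .
  have Cm': "(\<lambda>\<omega>. emeasure (\<xi> \<omega>) A) \<in> borel_measurable \<Omega>" if "A \<in> sets (restrict_space borel S)" for A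
    using counting_processD(3)[OF point_process_counting[OF limit_pp] that] .
  define pat where "pat n J = {\<omega>\<in>space M. \<forall>i\<in>{..<N}. (emeasure (\<xi>s n \<omega>) (C i) = 0) \<longleftrightarrow> i \<notin> J}" for n J
  define pat' where "pat' J = {\<omega>\<in>space \<Omega>. \<forall>i\<in>{..<N}. (emeasure (\<xi> \<omega>) (C i) = 0) \<longleftrightarrow> i \<notin> J}" for J
  \<comment> \<open>From here on \<open>Suc n\<close> stands in place of \<open>n\<close>, because
    the processes are controlled for positive \<open>n\<close>.\<close>
  have av: "(\<lambda>n. M.prob {\<omega>\<in>space M. \<forall>i\<in>I. emeasure (\<xi>s (Suc n) \<omega>) (C i) = 0})
          \<longlonglongrightarrow> \<Omega>.prob {\<omega>\<in>space \<Omega>. \<forall>i\<in>I. emeasure (\<xi> \<omega>) (C i) = 0}" if "I \<subseteq> {..<N}" for I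
    unfolding C_def grid_cell_def
    using grid_point_between[OF cd(3) N] cd(5) grid_point_strict[OF cd(3) N] that
    by (intro LIMSEQ_Suc avoidance[of N]) auto
  have pat_lim: "(\<lambda>n. M.prob (pat (Suc n) J)) \<longlonglongrightarrow> \<Omega>.prob (pat' J)" if "J \<subseteq> {..<N}" for J
  proof -
    have "(\<lambda>n. M.prob {\<omega>\<in>space M. \<forall>i\<in>{..<N}. \<omega> \<in> {\<omega>\<in>space M. emeasure (\<xi>s (Suc n) \<omega>) (C i) = 0} \<longleftrightarrow> i \<notin> J})
        \<longlonglongrightarrow> \<Omega>.prob {\<omega>\<in>space \<Omega>. \<forall>i\<in>{..<N}. \<omega> \<in> {\<omega>\<in>space \<Omega>. emeasure (\<xi> \<omega>) (C i) = 0} \<longleftrightarrow> i \<notin> J}"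
    proof (rule pattern_limit[OF M.prob_space_axioms \<Omega>.prob_space_axioms _ _ _ _ that])
      show "{\<omega>\<in>space M. emeasure (\<xi>s (Suc n) \<omega>) (C i) = 0} \<in> M.events" if "i \<in> {..<N}" for n i
        using measurable_sets[OF Cm[of "Suc n" "C i"], of "{0}"] C_sets that by (simp add: vimage_def Int_def conj_commute)
      show "{\<omega>\<in>space \<Omega>. emeasure (\<xi> \<omega>) (C i) = 0} \<in> \<Omega>.events" if "i \<in> {..<N}" for i
        using measurable_sets[OF Cm'[of "C i"], of "{0}"] C_sets that by (simp add: vimage_def Int_def conj_commute)
      show "(\<lambda>n. M.prob {\<omega>\<in>space M. \<forall>i\<in>I. \<omega> \<in> {\<omega>\<in>space M. emeasure (\<xi>s (Suc n) \<omega>) (C i) = 0}})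
        \<longlonglongrightarrow> \<Omega>.prob {\<omega>\<in>space \<Omega>. \<forall>i\<in>I. \<omega> \<in> {\<omega>\<in>space \<Omega>. emeasure (\<xi> \<omega>) (C i) = 0}}" if "I \<subseteq> {..<N}" for I
        using av[OF that] by (simp cong: conj_cong)
    qed simp
    then show ?thesis unfolding pat_def pat'_def by (simp cong: conj_cong)
  qed
  define T where "T n = {\<omega>\<in>space M. \<exists>i<N. 2 \<le> emeasure (\<xi>s n \<omega>) (C i)}" for n
  define T' where "T' = {\<omega>\<in>space \<Omega>. \<exists>i<N. 2 \<le> emeasure (\<xi> \<omega>) (C i)}"
  define U where "U n = {\<omega>\<in>space M. \<forall>i\<in>D. emeasure (\<xi>s n \<omega>) (C i) = 0}" for n
  define U' where "U' = {\<omega>\<in>space \<Omega>. \<forall>i\<in>D. emeasure (\<xi> \<omega>) (C i) = 0}"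
  define Z where "Z n = {\<omega>\<in>space M. \<forall>i<m. emeasure (\<xi>s n \<omega>) (B i) = of_nat (k i)}" for n
  define Z' where "Z' = {\<omega>\<in>space \<Omega>. \<forall>i<m. emeasure (\<xi> \<omega>) (B i) = of_nat (k i)}"
  have finD: "finite D" and D_sub: "D \<subseteq> {..<N}" by (auto simp: D_def)
  have mM: "T n \<in> M.events" "U n \<in> M.events" "Z n \<in> M.events" "pat n J \<in> M.events" if n: "0 < n" for n J
  proof -
    have a: "{\<omega>\<in>space M. P (emeasure (\<xi>s n \<omega>) A)} \<in> M.events"
      if "A \<in> sets (restrict_space borel S)" "Measurable.pred borel P" for A and P :: "ennreal \<Rightarrow> bool"
      using measurable_compose[OF Cm[OF n that(1)] that(2)] by simp
    have "{\<omega>\<in>space M. 2 \<le> emeasure (\<xi>s n \<omega>) (C i)} \<in> M.events" if "i < N" for i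
      using a[OF C_sets[OF that], of "\<lambda>v. 2 \<le> v"] by simp
    then have "{\<omega>\<in>space M. \<exists>i\<in>{..<N}. 2 \<le> emeasure (\<xi>s n \<omega>) (C i)} \<in> M.events"
      by (intro sets.sets_Collect_finite_Ex) auto
    moreover have "{\<omega>\<in>space M. \<exists>i\<in>{..<N}. 2 \<le> emeasure (\<xi>s n \<omega>) (C i)} = T n"
      unfolding T_def by blast
    ultimately show "T n \<in> M.events" by (simp only:)
    have z: "{\<omega>\<in>space M. emeasure (\<xi>s n \<omega>) (C i) = 0} \<in> M.events" if "i < N" for i
      using a[OF C_sets[OF that], of "\<lambda>v. v = 0"] by simp
    show "U n \<in> M.events" unfolding U_def using finD D_sub
      by (intro sets.sets_Collect_finite_All z) auto
    have "{\<omega>\<in>space M. (emeasure (\<xi>s n \<omega>) (C i) = 0) \<longleftrightarrow> i \<notin> J} \<in> M.events" if "i < N" for i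
      using z[OF that] sets.sets_Collect_neg[OF z[OF that]] by (cases "i \<in> J") simp_all
    then show "pat n J \<in> M.events" unfolding pat_def
      by (intro sets.sets_Collect_finite_All) auto
    have "{\<omega>\<in>space M. emeasure (\<xi>s n \<omega>) (B i) = of_nat (k i)} \<in> M.events" if "i < m" for i
      using a[OF B_sets[OF that], of "\<lambda>v. v = of_nat (k i)"] by simp
    then have "{\<omega>\<in>space M. \<forall>i\<in>{..<m}. emeasure (\<xi>s n \<omega>) (B i) = of_nat (k i)} \<in> M.events"
      by (intro sets.sets_Collect_finite_All) auto
    moreover have "{\<omega>\<in>space M. \<forall>i\<in>{..<m}. emeasure (\<xi>s n \<omega>) (B i) = of_nat (k i)} = Z n"
      unfolding Z_def by blast
    ultimately show "Z n \<in> M.events" by (simp only:)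
  qed
  have m\<Omega>: "T' \<in> \<Omega>.events" "U' \<in> \<Omega>.events" "Z' \<in> \<Omega>.events" "pat' J \<in> \<Omega>.events" for J
  proof -
    have a: "{\<omega>\<in>space \<Omega>. P (emeasure (\<xi> \<omega>) A)} \<in> \<Omega>.events"
      if "A \<in> sets (restrict_space borel S)" "Measurable.pred borel P" for A and P :: "ennreal \<Rightarrow> bool"
      using measurable_compose[OF Cm'[OF that(1)] that(2)] by simp
    have "{\<omega>\<in>space \<Omega>. 2 \<le> emeasure (\<xi> \<omega>) (C i)} \<in> \<Omega>.events" if "i < N" for i
      using a[OF C_sets[OF that], of "\<lambda>v. 2 \<le> v"] by simp
    then have "{\<omega>\<in>space \<Omega>. \<exists>i\<in>{..<N}. 2 \<le> emeasure (\<xi> \<omega>) (C i)} \<in> \<Omega>.events"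
      by (intro sets.sets_Collect_finite_Ex) auto
    moreover have "{\<omega>\<in>space \<Omega>. \<exists>i\<in>{..<N}. 2 \<le> emeasure (\<xi> \<omega>) (C i)} = T'"
      unfolding T'_def by blast
    ultimately show "T' \<in> \<Omega>.events" by (simp only:)
    have z: "{\<omega>\<in>space \<Omega>. emeasure (\<xi> \<omega>) (C i) = 0} \<in> \<Omega>.events" if "i < N" for i
      using a[OF C_sets[OF that], of "\<lambda>v. v = 0"] by simp
    show "U' \<in> \<Omega>.events" unfolding U'_def using finD D_sub
      by (intro sets.sets_Collect_finite_All z) auto
    have "{\<omega>\<in>space \<Omega>. (emeasure (\<xi> \<omega>) (C i) = 0) \<longleftrightarrow> i \<notin> J} \<in> \<Omega>.events" if "i < N" for i
      using z[OF that] sets.sets_Collect_neg[OF z[OF that]] by (cases "i \<in> J") simp_all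
    then show "pat' J \<in> \<Omega>.events" unfolding pat'_def
      by (intro sets.sets_Collect_finite_All) auto
    have "{\<omega>\<in>space \<Omega>. emeasure (\<xi> \<omega>) (B i) = of_nat (k i)} \<in> \<Omega>.events" if "i < m" for i
      using a[OF B_sets[OF that], of "\<lambda>v. v = of_nat (k i)"] by simp
    then have "{\<omega>\<in>space \<Omega>. \<forall>i\<in>{..<m}. emeasure (\<xi> \<omega>) (B i) = of_nat (k i)} \<in> \<Omega>.events"
      by (intro sets.sets_Collect_finite_All) auto
    moreover have "{\<omega>\<in>space \<Omega>. \<forall>i\<in>{..<m}. emeasure (\<xi> \<omega>) (B i) = of_nat (k i)} = Z'"
      unfolding Z'_def by blast
    ultimately show "Z' \<in> \<Omega>.events" by (simp only:)
  qed
  define Y where "Y n = (\<Union>J\<in>\<J>. pat n J)" for n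
  define Y' where "Y' = (\<Union>J\<in>\<J>. pat' J)"
  have Y_lim: "(\<lambda>n. M.prob (Y (Suc n))) \<longlonglongrightarrow> \<Omega>.prob Y'"
  proof -
    have "M.prob (Y (Suc n)) = (\<Sum>J\<in>\<J>. M.prob (pat (Suc n) J))" for n
      unfolding Y_def
    proof (rule M.finite_measure_finite_Union[OF fin\<J>])
      show "disjoint_family_on (pat (Suc n)) \<J>"
        unfolding disjoint_family_on_def pat_def \<J>_def by (auto simp: subset_eq set_eq_iff)
    qed (use mM in auto)
    moreover have "\<Omega>.prob Y' = (\<Sum>J\<in>\<J>. \<Omega>.prob (pat' J))"
      unfolding Y'_def
    proof (rule \<Omega>.finite_measure_finite_Union[OF fin\<J>])
      show "disjoint_family_on pat' \<J>"
        unfolding disjoint_family_on_def pat'_def \<J>_def by (auto simp: subset_eq set_eq_iff)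
    qed (use m\<Omega> in auto)
    ultimately show ?thesis using pat_lim by (auto intro!: tendsto_sum simp: \<J>_def)
  qed
  have ZY: "\<bar>M.prob (Z n) - M.prob (Y n)\<bar> \<le> M.prob (T n) + (1 - M.prob (U n))" if n: "0 < n" for n
  proof -
    have "\<bar>M.prob (Z n) - M.prob (Y n)\<bar> \<le> M.prob (T n \<union> (space M - U n))"
    proof (rule M.prob_differ_le)
      fix \<omega> assume \<omega>: "\<omega> \<in> space M" "\<omega> \<notin> T n \<union> (space M - U n)"
      define J where "J = {i. i < N \<and> emeasure (\<xi>s n \<omega>) (C i) \<noteq> 0}"
      have "emeasure (\<xi>s n \<omega>) (B j) = of_nat (h J j)" if "j < m" for j
        unfolding J_def
        using counting_processD(1,2)[OF counting[OF n] \<omega>(1)] \<omega> that by (intro key) (auto simp: T_def U_def)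
      moreover have "\<omega> \<in> Y n \<longleftrightarrow> J \<in> \<J>"
      proof
        assume "\<omega> \<in> Y n"
        then obtain J' where J': "J' \<in> \<J>" "\<omega> \<in> pat n J'" by (auto simp: Y_def)
        then have "J' = J" by (auto simp: pat_def J_def \<J>_def)
        then show "J \<in> \<J>" using J' by simp
      next
        assume "J \<in> \<J>"
        then show "\<omega> \<in> Y n" using \<omega> by (auto simp: Y_def pat_def J_def intro!: bexI[of _ J])
      qed
      ultimately show "\<omega> \<in> Z n \<longleftrightarrow> \<omega> \<in> Y n" using \<omega> by (auto simp: Z_def \<J>_def J_def)
    qed (use mM[OF n] fin\<J> in \<open>auto simp: Y_def\<close>)
    also have "\<dots> \<le> M.prob (T n) + M.prob (space M - U n)" using mM[OF n] by (intro measure_Un_le) auto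
    finally show ?thesis using mM[OF n] by (simp add: M.prob_compl)
  qed
  have ZY': "\<bar>\<Omega>.prob Z' - \<Omega>.prob Y'\<bar> \<le> \<Omega>.prob T' + (1 - \<Omega>.prob U')"
  proof -
    have "\<bar>\<Omega>.prob Z' - \<Omega>.prob Y'\<bar> \<le> \<Omega>.prob (T' \<union> (space \<Omega> - U'))"
    proof (rule \<Omega>.prob_differ_le)
      fix \<omega> assume \<omega>: "\<omega> \<in> space \<Omega>" "\<omega> \<notin> T' \<union> (space \<Omega> - U')"
      define J where "J = {i. i < N \<and> emeasure (\<xi> \<omega>) (C i) \<noteq> 0}"
      have "emeasure (\<xi> \<omega>) (B j) = of_nat (h J j)" if "j < m" for j
        unfolding J_def
        using counting_processD(1,2)[OF point_process_counting[OF limit_pp] \<omega>(1)] \<omega> that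
        by (intro key) (auto simp: T'_def U'_def)
      moreover have "\<omega> \<in> Y' \<longleftrightarrow> J \<in> \<J>"
      proof
        assume "\<omega> \<in> Y'"
        then obtain J' where J': "J' \<in> \<J>" "\<omega> \<in> pat' J'" by (auto simp: Y'_def)
        then have "J' = J" by (auto simp: pat'_def J_def \<J>_def)
        then show "J \<in> \<J>" using J' by simp
      next
        assume "J \<in> \<J>"
        then show "\<omega> \<in> Y'" using \<omega> by (auto simp: Y'_def pat'_def J_def intro!: bexI[of _ J])
      qed
      ultimately show "\<omega> \<in> Z' \<longleftrightarrow> \<omega> \<in> Y'" using \<omega> by (auto simp: Z'_def \<J>_def J_def)
    qed (use m\<Omega> fin\<J> in \<open>auto simp: Y'_def\<close>)
    also have "\<dots> \<le> \<Omega>.prob T' + \<Omega>.prob (space \<Omega> - U')" using m\<Omega> by (intro measure_Un_le) auto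
    finally show ?thesis using m\<Omega> by (simp add: \<Omega>.prob_compl)
  qed
  \<comment> \<open>A cell touched by a boundary lies within one cell width of it and so inside
    \<open>V\<close>, which the limit rarely charges. For \<open>\<xi>s\<close> the corresponding
    bound will follow from convergence of the probability that the cells of \<open>D\<close> are
    empty.\<close>
  have U'_ge: "1 - \<Omega>.prob U' \<le> e"
  proof -
    have V_sets: "V \<in> sets (restrict_space borel S)" using V cd(5) S_open by (auto simp: sets_restrict_open)
    have "C i \<subseteq> V" if iD: "i \<in> D" for i
    proof -
      have i: "i < N" using iD by (simp add: D_def)
      obtain y where y: "y \<in> C i" "y \<in> F" using iD unfolding D_def by blast
      have "C i \<subseteq> {x\<in>{c..d}. \<exists>y\<in>F. \<bar>x - y\<bar> \<le> (d - c) / real N}"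
        using grid_cell_width[OF cd(3) N _ y(1)[unfolded C_def]] y C_sub[OF i] by (force simp: C_def)
      then show ?thesis using V(3) by auto
    qed
    then have CV: "emeasure (\<xi> \<omega>) (C i) \<le> emeasure (\<xi> \<omega>) V" if "\<omega> \<in> space \<Omega>" "i \<in> D" for \<omega> i
      using that V_sets sets_\<xi> by (intro emeasure_mono) auto
    have sub: "space \<Omega> - U' \<subseteq> {\<omega>\<in>space \<Omega>. emeasure (\<xi> \<omega>) V \<noteq> 0}"
    proof
      fix \<omega> assume "\<omega> \<in> space \<Omega> - U'"
      then obtain i where i: "\<omega> \<in> space \<Omega>" "i \<in> D" "emeasure (\<xi> \<omega>) (C i) \<noteq> 0" by (auto simp: U'_def)
      then show "\<omega> \<in> {\<omega>\<in>space \<Omega>. emeasure (\<xi> \<omega>) V \<noteq> 0}" using CV[OF i(1,2)] by auto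
    qed
    have "{\<omega>\<in>space \<Omega>. emeasure (\<xi> \<omega>) V \<noteq> 0} \<in> \<Omega>.events" using Cm'[OF V_sets] by measurable
    with sub have "\<Omega>.prob (space \<Omega> - U') \<le> \<Omega>.prob {\<omega>\<in>space \<Omega>. emeasure (\<xi> \<omega>) V \<noteq> 0}"
      by (rule \<Omega>.finite_measure_mono)
    then show ?thesis using V(4) m\<Omega> by (simp add: \<Omega>.prob_compl)
  qed
  have T'_le: "\<Omega>.prob T' \<le> e" using N2 by (simp add: T'_def C_def)
  have "\<forall>\<^sub>F n in sequentially. \<Omega>.prob U' - e < M.prob (U (Suc n))"
    using av[OF D_sub] e by (intro order_tendstoD(1)) (auto simp: U_def U'_def)
  moreover have "\<forall>\<^sub>F n in sequentially. M.prob (T (Suc n)) \<le> e"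
    using N1 by (subst eventually_sequentially_Suc) (simp add: T_def C_def)
  moreover have "\<forall>\<^sub>F n in sequentially. \<bar>M.prob (Y (Suc n)) - \<Omega>.prob Y'\<bar> < e"
    using tendstoD[OF Y_lim e] by (simp add: dist_real_def)
  ultimately have "\<forall>\<^sub>F n in sequentially. \<bar>M.prob (Z (Suc n)) - \<Omega>.prob Z'\<bar> < \<epsilon>"
  proof eventually_elim
    case (elim n)
    have "\<bar>M.prob (Z (Suc n)) - \<Omega>.prob Z'\<bar> \<le> \<bar>M.prob (Z (Suc n)) - M.prob (Y (Suc n))\<bar>
       + \<bar>M.prob (Y (Suc n)) - \<Omega>.prob Y'\<bar> + \<bar>\<Omega>.prob Z' - \<Omega>.prob Y'\<bar>" by linarith
    also have "\<dots> < 6 * e"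
      using ZY[of "Suc n"] ZY' elim U'_ge T'_le by linarith
    also have "\<dots> < \<epsilon>" using e by (simp add: e_def)
    finally show ?case .
  qed
  then have "\<forall>\<^sub>F n in sequentially. \<bar>M.prob (Z n) - \<Omega>.prob Z'\<bar> < \<epsilon>"
    by (subst (asm) eventually_sequentially_Suc)
  then show "\<exists>no. \<forall>n\<ge>no. norm (M.prob {\<omega>\<in>space M. \<forall>i<m. emeasure (\<xi>s n \<omega>) (B i) = of_nat (k i)}
      - \<Omega>.prob {\<omega>\<in>space \<Omega>. \<forall>i<m. emeasure (\<xi> \<omega>) (B i) = of_nat (k i)}) < \<epsilon>"
    by (simp add: eventually_sequentially Z_def Z'_def)
qed

end

lemma weak_convergence: "pp_weak_convergence S M \<xi>s \<Omega> \<xi>"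
  unfolding pp_weak_convergence_def
proof (intro allI impI)
  fix m :: nat and B :: "nat \<Rightarrow> real set"
  assume "\<forall>i<m. B i \<in> sets borel \<and> compact (closure (B i)) \<and> closure (B i) \<subseteq> S \<and>
               (AE \<omega> in \<Omega>. emeasure (\<xi> \<omega>) (frontier (B i)) = 0)"
  then have B: "\<And>i. i < m \<Longrightarrow> B i \<in> sets borel" "\<And>i. i < m \<Longrightarrow> compact (closure (B i))"
      "\<And>i. i < m \<Longrightarrow> closure (B i) \<subseteq> S"
      "\<And>i. i < m \<Longrightarrow> AE \<omega> in \<Omega>. emeasure (\<xi> \<omega>) (frontier (B i)) = 0"
    by blast+
  have B_sets: "B i \<in> sets (restrict_space borel S)" if "i < m" for i
    using B(1,3)[OF that] closure_subset[of "B i"] S_open by (auto simp: sets_restrict_open)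
  show "converges_in_distribution M (\<lambda>n. counts_vector (\<xi>s n) B m) \<Omega> (counts_vector \<xi> B m)"
  proof (rule counts_converge_in_distribution[OF M.prob_space_axioms \<Omega>.prob_space_axioms, where m = m])
    show "(\<lambda>\<omega>. counts_vector (\<xi>s n) B m \<omega> i) \<in> borel_measurable M" if "0 < n" for n i
      using counting_processD(3)[OF counting[OF that] B_sets] by (cases "i < m") (simp_all add: counts_vector_def)
    show "(\<lambda>\<omega>. counts_vector \<xi> B m \<omega> i) \<in> borel_measurable \<Omega>" for i
      using counting_processD(3)[OF point_process_counting[OF limit_pp] B_sets] by (cases "i < m") (simp_all add: counts_vector_def)
    show "counts_vector \<xi> B m \<omega> i \<in> range of_nat" if \<omega>: "\<omega> \<in> space \<Omega>" and i: "i < m" for \<omega> i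
    proof -
      have K: "closure (B i) \<in> sets (\<xi> \<omega>)"
        using counting_processD(1)[OF point_process_counting[OF limit_pp] \<omega>] B(3)[OF i] S_open
        by (simp add: sets_restrict_open)
      have "emeasure (\<xi> \<omega>) (B i) \<le> emeasure (\<xi> \<omega>) (closure (B i))"
        using K closure_subset by (intro emeasure_mono)
      also have "\<dots> < \<infinity>" using point_process_finite[OF limit_pp \<omega> B(2,3)[OF i]] .
      finally show ?thesis
        using counting_processD(2)[OF point_process_counting[OF limit_pp] \<omega> B_sets[OF i]] i by (auto simp: counts_vector_def)
    qed
    show "(\<lambda>n. M.prob {\<omega>\<in>space M. \<forall>i<m. counts_vector (\<xi>s n) B m \<omega> i = of_nat (k i)})
        \<longlonglongrightarrow> \<Omega>.prob {\<omega>\<in>space \<Omega>. \<forall>i<m. counts_vector \<xi> B m \<omega> i = of_nat (k i)}" for k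
      using counts_limit[of m B k, OF B] by (simp add: counts_vector_def cong: conj_cong imp_cong)
  qed (simp_all add: counts_vector_def)
qed

end

section \<open>Poisson random measures on the line\<close>

definition poisson_mass :: "real \<Rightarrow> nat \<Rightarrow> real" where
  "poisson_mass r n = r ^ n / fact n * exp (- r)"

lemma poisson_mass_0: "poisson_mass 0 n = (if n = 0 then 1 else 0)"
  by (simp add: poisson_mass_def)

lemma poisson_mass_sums: "poisson_mass r sums 1"
proof -
  have "(\<lambda>n. r ^ n /\<^sub>R fact n) sums exp r" by (rule exp_converges)
  then have "(\<lambda>n. (r ^ n /\<^sub>R fact n) * exp (- r)) sums (exp r * exp (- r))" by (rule sums_mult2)
  then show ?thesis by (simp add: poisson_mass_def[abs_def] divide_inverse mult_ac flip: exp_add)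
qed

lemma poisson_mass_convolution:
  "(\<Sum>l\<le>n. poisson_mass r (n - l) * poisson_mass s l) = poisson_mass (r + s) n"
proof -
  have "(s + r) ^ n = (\<Sum>l\<le>n. real (n choose l) * s ^ l * r ^ (n - l))" by (rule binomial_ring)
  also have "\<dots> = (\<Sum>l\<le>n. fact n * (s ^ l / fact l * (r ^ (n - l) / fact (n - l))))"
    by (intro sum.cong) (auto simp: binomial_fact)
  also have "\<dots> = fact n * (\<Sum>l\<le>n. s ^ l / fact l * (r ^ (n - l) / fact (n - l)))"
    by (rule sum_distrib_left[symmetric])
  finally have "(r + s) ^ n / fact n = (\<Sum>l\<le>n. s ^ l / fact l * (r ^ (n - l) / fact (n - l)))"
    by (simp add: add.commute)
  moreover have "exp (- (r + s)) = exp (- r) * exp (- s)" by (simp add: mult_exp_exp)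
  ultimately show ?thesis unfolding poisson_mass_def by (simp only: sum_distrib_right) (simp add: mult_ac)
qed

text \<open>Distribution functions are preferred to point masses because the event of at most
  \<open>n\<close> points decreases as the window grows; its probability therefore passes to the
  limit, also when the mean becomes infinite.\<close>

definition poisson_cdf :: "real \<Rightarrow> nat \<Rightarrow> real" where
  "poisson_cdf r n = (\<Sum>l\<le>n. poisson_mass r l)"

lemma tendsto_poisson_cdf: "(f \<longlongrightarrow> r) F \<Longrightarrow> ((\<lambda>x. poisson_cdf (f x) n) \<longlongrightarrow> poisson_cdf r n) F"
  unfolding poisson_cdf_def poisson_mass_def by (intro tendsto_intros) auto

lemma poisson_cdf_at_top: "filterlim f at_top F \<Longrightarrow> ((\<lambda>x. poisson_cdf (f x) n) \<longlongrightarrow> 0) F"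
proof -
  assume f: "filterlim f at_top F"
  have "((\<lambda>r. poisson_mass r l) \<longlongrightarrow> 0) at_top" for l
  proof -
    have "((\<lambda>r::real. r ^ l / exp r) \<longlongrightarrow> 0) at_top" by (rule tendsto_power_div_exp_0)
    then have "((\<lambda>r::real. r ^ l / exp r * (1 / fact l)) \<longlongrightarrow> 0 * (1 / fact l)) at_top" by (rule tendsto_mult_right)
    moreover have "r ^ l / exp r * (1 / fact l) = poisson_mass r l" for r
      by (simp add: poisson_mass_def exp_minus divide_inverse mult_ac)
    ultimately show ?thesis by simp
  qed
  then have "((\<lambda>r. poisson_cdf r n) \<longlongrightarrow> (\<Sum>l\<le>n. 0)) at_top" unfolding poisson_cdf_def by (intro tendsto_sum)
  then show ?thesis using filterlim_compose[OF _ f] by fastforce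
qed

text \<open>The sample space carries for every \<open>k\<close> a Poisson(1) variable, at coordinate \<open>(k, 0)\<close>, and
  independent uniform variables, at the coordinates \<open>(k, i + 1)\<close>; they put a Poisson number
  of uniform points into the \<open>k\<close>-th unit interval with integer end points.\<close>

definition sample_marginal :: "nat \<Rightarrow> real measure" where
  "sample_marginal j = (if snd (prod_decode j) = 0 then distr (measure_pmf (poisson_pmf 1)) borel real
     else uniform_measure lborel {0..1})"

lemma prob_space_sample_marginal: "prob_space (sample_marginal j)"
  unfolding sample_marginal_def
  by (auto intro!: prob_space_uniform_measure measure_pmf.prob_space_distr)

lemma sets_sample_marginal [measurable_cong, simp]: "sets (sample_marginal j) = sets borel"
  by (simp add: sample_marginal_def)

lemma space_sample_marginal [simp]: "space (sample_marginal j) = UNIV"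
  by (simp add: sample_marginal_def)

interpretation sample: product_prob_space sample_marginal UNIV
  by (simp add: product_prob_space_def product_prob_space_axioms_def product_sigma_finite_def
      prob_space_sample_marginal prob_space_imp_sigma_finite)

abbreviation sample_space :: "(nat \<Rightarrow> real) measure" where
  "sample_space \<equiv> PiM UNIV sample_marginal"

lemma sample_indep_coordinates: "sample.indep_vars sample_marginal (\<lambda>i \<omega>. \<omega> i) UNIV"
proof (subst sample.indep_vars_iff_distr_eq_PiM)
  have "distr sample_space (PiM UNIV sample_marginal) (\<lambda>x. \<lambda>i\<in>UNIV. x i) = sample_space"
    by (simp add: restrict_UNIV distr_id2)
  moreover have "distr sample_space (sample_marginal i) (\<lambda>\<omega>. \<omega> i) = sample_marginal i" for i
    by (rule sample.PiM_component) simp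
  ultimately show "distr sample_space (PiM UNIV sample_marginal) (\<lambda>x. \<lambda>i\<in>UNIV. x i) =
      PiM UNIV (\<lambda>i. distr sample_space (sample_marginal i) (\<lambda>\<omega>. \<omega> i))" by simp
qed auto

text \<open>Product structure of the sample space. Dependence on the coordinates in
  \<open>J1\<close> alone is expressed by invariance under \<open>restrict\<close>, so that one
  predicate serves both on the product over \<open>J1\<close> and on the whole space.\<close>

lemma sample_indep_events:
  assumes disj: "J1 \<inter> J2 = {}"
    and Q1: "Measurable.pred (PiM J1 sample_marginal) Q1" and Q2: "Measurable.pred (PiM J2 sample_marginal) Q2"
    and dep: "\<And>\<omega>. Q1 (restrict \<omega> J1) = Q1 \<omega>" "\<And>\<omega>. Q2 (restrict \<omega> J2) = Q2 \<omega>"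
  shows "sample.P.prob {\<omega>\<in>space sample_space. Q1 \<omega> \<and> Q2 \<omega>} =
     sample.P.prob {\<omega>\<in>space sample_space. Q1 \<omega>} * sample.P.prob {\<omega>\<in>space sample_space. Q2 \<omega>}"
proof -
  have i: "sample.indep_var (PiM J1 sample_marginal) (\<lambda>\<omega>. \<lambda>i\<in>J1. \<omega> i) (PiM J2 sample_marginal) (\<lambda>\<omega>. \<lambda>i\<in>J2. \<omega> i)"
    using sample.indep_var_restrict[OF sample_indep_coordinates disj] by simp
  let ?A = "{x\<in>space (PiM J1 sample_marginal). Q1 x}" and ?B = "{x\<in>space (PiM J2 sample_marginal). Q2 x}"
  have "sample.P.prob ((\<lambda>\<omega>. (\<lambda>i\<in>J1. \<omega> i, \<lambda>i\<in>J2. \<omega> i)) -` (?A \<times> ?B) \<inter> space sample_space) =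
     sample.P.prob ((\<lambda>\<omega>. \<lambda>i\<in>J1. \<omega> i) -` ?A \<inter> space sample_space) * sample.P.prob ((\<lambda>\<omega>. \<lambda>i\<in>J2. \<omega> i) -` ?B \<inter> space sample_space)"
    using Q1 Q2 by (intro sample.indep_varD[OF i]) auto
  moreover have "(\<lambda>\<omega>. (\<lambda>i\<in>J1. \<omega> i, \<lambda>i\<in>J2. \<omega> i)) -` (?A \<times> ?B) \<inter> space sample_space = {\<omega>\<in>space sample_space. Q1 \<omega> \<and> Q2 \<omega>}"
    using dep by (auto simp: space_PiM)
  moreover have "(\<lambda>\<omega>. \<lambda>i\<in>J1. \<omega> i) -` ?A \<inter> space sample_space = {\<omega>\<in>space sample_space. Q1 \<omega>}"
    using dep by (auto simp: space_PiM)
  moreover have "(\<lambda>\<omega>. \<lambda>i\<in>J2. \<omega> i) -` ?B \<inter> space sample_space = {\<omega>\<in>space sample_space. Q2 \<omega>}"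
    using dep by (auto simp: space_PiM)
  ultimately show ?thesis by simp
qed

section \<open>Random points in the unit cells of the line\<close>

definition cell_number :: "nat \<Rightarrow> (nat \<Rightarrow> real) \<Rightarrow> nat" where
  "cell_number k \<omega> = nat \<lfloor>\<omega> (prod_encode (k, 0))\<rfloor>"

text \<open>\<open>frac\<close> puts the point into the half-open unit cell for every outcome and
  not just almost surely; \<open>int_decode\<close> enumerates the integers.\<close>

definition cell_point :: "nat \<Rightarrow> nat \<Rightarrow> (nat \<Rightarrow> real) \<Rightarrow> real" where
  "cell_point k i \<omega> = of_int (int_decode k) + frac (\<omega> (prod_encode (k, Suc i)))"

definition unit_cell :: "nat \<Rightarrow> real set" where
  "unit_cell k = {of_int (int_decode k)..<of_int (int_decode k) + 1}"

definition partial_count :: "nat \<Rightarrow> nat \<Rightarrow> real set \<Rightarrow> (nat \<Rightarrow> real) \<Rightarrow> nat" where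
  "partial_count k l A \<omega> = card {i. i < l \<and> cell_point k i \<omega> \<in> A}"

definition cell_count :: "nat \<Rightarrow> real set \<Rightarrow> (nat \<Rightarrow> real) \<Rightarrow> nat" where
  "cell_count k A \<omega> = partial_count k (cell_number k \<omega>) A \<omega>"

definition cell_mass :: "nat \<Rightarrow> real set \<Rightarrow> real" where
  "cell_mass k A = measure lborel (A \<inter> unit_cell k)"

lemma cell_point_in_cell: "cell_point k i \<omega> \<in> unit_cell k"
  by (simp add: cell_point_def unit_cell_def frac_lt_1)

lemma cell_number_measurable:
  "prod_encode (k, 0) \<in> J \<Longrightarrow> cell_number k \<in> measurable (PiM J sample_marginal) (count_space UNIV)"
  unfolding cell_number_def[abs_def] by measurable

lemma cell_point_measurable:
  "prod_encode (k, Suc i) \<in> J \<Longrightarrow> cell_point k i \<in> borel_measurable (PiM J sample_marginal)"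
  unfolding cell_point_def[abs_def] frac_def by measurable

lemma partial_count_Suc:
  "partial_count k (Suc l) A \<omega> = partial_count k l A \<omega> + (if cell_point k l \<omega> \<in> A then 1 else 0)"
proof -
  have "{i. i < Suc l \<and> cell_point k i \<omega> \<in> A} = (if cell_point k l \<omega> \<in> A
     then insert l {i. i < l \<and> cell_point k i \<omega> \<in> A} else {i. i < l \<and> cell_point k i \<omega> \<in> A})"
    by (auto simp: less_Suc_eq)
  then show ?thesis by (simp add: partial_count_def)
qed

lemma partial_count_measurable:
  assumes "A \<in> sets borel" "\<And>i. prod_encode (k, Suc i) \<in> J"
  shows "partial_count k l A \<in> measurable (PiM J sample_marginal) (count_space UNIV)"
proof (induction l)
  case 0
  then show ?case by (simp add: partial_count_def[abs_def])
next
  case (Suc l)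
  note [measurable] = Suc cell_point_measurable[OF assms(2)] assms(1)
  show ?case unfolding partial_count_Suc[abs_def] by measurable
qed

lemma partial_count_measurable':
  assumes "A \<in> sets borel" "\<And>i. i < l \<Longrightarrow> prod_encode (k, Suc i) \<in> J"
  shows "partial_count k l A \<in> measurable (PiM J sample_marginal) (count_space UNIV)"
  using assms(2)
proof (induction l)
  case 0
  then show ?case by (simp add: partial_count_def[abs_def])
next
  case (Suc l)
  have [measurable]: "cell_point k l \<in> borel_measurable (PiM J sample_marginal)"
    using Suc.prems by (intro cell_point_measurable) auto
  have [measurable]: "partial_count k l A \<in> measurable (PiM J sample_marginal) (count_space UNIV)"
    using Suc by auto
  note [measurable] = assms(1)
  show ?case unfolding partial_count_Suc[abs_def] by measurable
qed

lemma cell_count_measurable: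
  assumes A: "A \<in> sets borel" and J: "\<And>i. prod_encode (k, i) \<in> J"
  shows "cell_count k A \<in> measurable (PiM J sample_marginal) (count_space UNIV)"
proof -
  have "(\<lambda>\<omega>. partial_count k (cell_number k \<omega>) A \<omega>) \<in> measurable (PiM J sample_marginal) (count_space UNIV)"
    by (rule measurable_compose_countable'[OF partial_count_measurable[OF A J] cell_number_measurable[OF J]]) auto
  then show ?thesis by (simp add: cell_count_def[abs_def])
qed

lemma prob_cell_number: "sample.P.prob {\<omega>\<in>space sample_space. cell_number k \<omega> = l} = exp (- 1) / fact l"
proof -
  let ?j = "prod_encode (k, 0)"
  have "sample.P.prob {\<omega>\<in>space sample_space. cell_number k \<omega> = l} = sample.P.prob ((\<lambda>\<omega>. \<omega> ?j) -` {x. nat \<lfloor>x\<rfloor> = l} \<inter> space sample_space)"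
    by (intro arg_cong[where f = sample.P.prob]) (auto simp: cell_number_def)
  also have "\<dots> = measure (distr sample_space (sample_marginal ?j) (\<lambda>\<omega>. \<omega> ?j)) {x. nat \<lfloor>x\<rfloor> = l}"
    by (intro measure_distr[symmetric]) auto
  also have "\<dots> = measure (sample_marginal ?j) {x. nat \<lfloor>x\<rfloor> = l}"
    by (simp add: sample.PiM_component)
  also have "\<dots> = measure (measure_pmf (poisson_pmf 1)) (real -` {x. nat \<lfloor>x\<rfloor> = l} \<inter> space (measure_pmf (poisson_pmf 1)))"
    unfolding sample_marginal_def by (simp add: measure_distr)
  also have "real -` {x. nat \<lfloor>x\<rfloor> = l} \<inter> space (measure_pmf (poisson_pmf 1)) = {l}" by auto
  also have "measure (measure_pmf (poisson_pmf 1)) {l} = exp (- 1) / fact l"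
    by (simp add: measure_pmf_single)
  finally show ?thesis .
qed

lemma prob_cell_point:
  assumes A: "A \<in> sets borel"
  shows "sample.P.prob {\<omega>\<in>space sample_space. cell_point k i \<omega> \<in> A} = cell_mass k A"
proof -
  let ?j = "prod_encode (k, Suc i)" and ?c = "of_int (int_decode k) :: real"
  define A' where "A' = {x. ?c + frac x \<in> A}"
  have A': "A' \<in> sets borel"
    using A unfolding A'_def frac_def by measurable
  have "sample.P.prob {\<omega>\<in>space sample_space. cell_point k i \<omega> \<in> A} = sample.P.prob ((\<lambda>\<omega>. \<omega> ?j) -` A' \<inter> space sample_space)"
    by (intro arg_cong[where f = sample.P.prob]) (auto simp: cell_point_def A'_def)
  also have "\<dots> = measure (distr sample_space (sample_marginal ?j) (\<lambda>\<omega>. \<omega> ?j)) A'"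
    using A' by (intro measure_distr[symmetric]) auto
  also have "\<dots> = measure (sample_marginal ?j) A'" by (simp add: sample.PiM_component)
  also have "\<dots> = measure (uniform_measure lborel {0..1}) A'" by (simp add: sample_marginal_def)
  also have "\<dots> = measure lborel ({0..1} \<inter> A')"
    using A' by (subst measure_uniform_measure) auto
  \<comment> \<open>The end-point 1, which \<open>frac\<close> folds back to 0, is discarded as a
    null set; on the rest \<open>frac\<close> is the identity.\<close>
  also have "\<dots> = measure lborel ({0..<1} \<inter> A')"
  proof (rule measure_eq_AE)
    show "AE x in lborel. (x \<in> {0..1} \<inter> A') = (x \<in> {0..<1} \<inter> A')"
      using AE_lborel_singleton[of "1::real"] by eventually_elim auto
  qed (use A' in auto)
  also have "{0..<1} \<inter> A' = (\<lambda>x. ?c + x) -` (A \<inter> unit_cell k)"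
    by (auto simp: A'_def unit_cell_def frac_eq[THEN iffD2])
  also have "measure lborel \<dots> = measure (distr lborel borel (\<lambda>x. ?c + x)) (A \<inter> unit_cell k)"
    using A by (subst measure_distr) (auto simp: unit_cell_def)
  also have "\<dots> = cell_mass k A" by (simp add: cell_mass_def lborel_distr_plus)
  finally show ?thesis .
qed

lemma cell_mass_bounds: "0 \<le> cell_mass k A"
  by (simp add: cell_mass_def)

text \<open>Multinomial law of the first \<open>l\<close> points, by induction on \<open>l\<close>:
  the last point is independent of the earlier ones and lies in exactly one \<open>A i\<close>,
  whose count among the earlier points is then \<open>n i - 1\<close>.\<close>

lemma prob_partial_count:
  fixes A :: "nat \<Rightarrow> real set" and n :: "nat \<Rightarrow> nat"
  assumes fin: "finite I" and A: "\<And>i. i \<in> I \<Longrightarrow> A i \<in> sets borel" and disj: "disjoint_family_on A I" and cover: "(\<Union>i\<in>I. A i) = UNIV"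
  shows "sample.P.prob {\<omega>\<in>space sample_space. \<forall>i\<in>I. partial_count k l (A i) \<omega> = n i} =
    (if (\<Sum>i\<in>I. n i) = l then fact l * (\<Prod>i\<in>I. cell_mass k (A i) ^ n i / fact (n i)) else 0)"
proof (induction l arbitrary: n)
  case 0
  have "{\<omega>\<in>space sample_space. \<forall>i\<in>I. partial_count k 0 (A i) \<omega> = n i} = (if \<forall>i\<in>I. n i = 0 then space sample_space else {})"
    by (auto simp: partial_count_def)
  moreover have "(\<Sum>i\<in>I. n i) = 0 \<longleftrightarrow> (\<forall>i\<in>I. n i = 0)" using fin by simp
  ultimately show ?case by (simp add: sample.P.prob_space)
next
  case (Suc l)
  define p where "p i = cell_mass k (A i)" for i
  \<comment> \<open>A set with \<open>n i = 0\<close> cannot contain the last point; excluding it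
    keeps the truncated difference \<open>n i - 1\<close> correct.\<close>
  define I' where "I' = {i\<in>I. 0 < n i}"
  have fin': "finite I'" using fin by (simp add: I'_def)
  have uniq: "\<exists>!i. i \<in> I \<and> x \<in> A i" for x
  proof -
    obtain i where "i \<in> I" "x \<in> A i" using cover by blast
    then show ?thesis using disj by (intro ex1I[of _ i]) (auto simp: disjoint_family_on_def)
  qed
  let ?E = "\<lambda>i. {\<omega>\<in>space sample_space. cell_point k l \<omega> \<in> A i \<and> (\<forall>j\<in>I. partial_count k l (A j) \<omega> = (n(i := n i - 1)) j)}"
  have "{\<omega>\<in>space sample_space. \<forall>i\<in>I. partial_count k (Suc l) (A i) \<omega> = n i} = (\<Union>i\<in>I'. ?E i)"
  proof (intro set_eqI iffI)
    fix \<omega> assume \<omega>: "\<omega> \<in> {\<omega>\<in>space sample_space. \<forall>i\<in>I. partial_count k (Suc l) (A i) \<omega> = n i}"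
    obtain i where i: "i \<in> I" "cell_point k l \<omega> \<in> A i" using uniq by blast
    have other: "cell_point k l \<omega> \<notin> A j" if "j \<in> I" "j \<noteq> i" for j using uniq i that by blast
    have "n i = partial_count k l (A i) \<omega> + 1" using \<omega> i by (auto simp: partial_count_Suc)
    moreover have "n j = partial_count k l (A j) \<omega>" if "j \<in> I" "j \<noteq> i" for j
      using \<omega> other[OF that] that by (auto simp: partial_count_Suc)
    ultimately show "\<omega> \<in> (\<Union>i\<in>I'. ?E i)" using i \<omega> by (auto simp: I'_def intro!: bexI[of _ i])
  next
    fix \<omega> assume "\<omega> \<in> (\<Union>i\<in>I'. ?E i)"
    then obtain i where i: "i \<in> I" "0 < n i" "\<omega> \<in> ?E i" by (auto simp: I'_def)
    have other: "cell_point k l \<omega> \<notin> A j" if "j \<in> I" "j \<noteq> i" for j using uniq i that by blast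
    show "\<omega> \<in> {\<omega>\<in>space sample_space. \<forall>i\<in>I. partial_count k (Suc l) (A i) \<omega> = n i}"
      using i other by (auto simp: partial_count_Suc)
  qed
  moreover {
  have E_sets: "?E i \<in> sets sample_space" if "i \<in> I'" for i
  proof -
    have [measurable]: "cell_point k l \<in> borel_measurable sample_space" by (rule cell_point_measurable) simp
    have [measurable]: "partial_count k l (A j) \<in> measurable sample_space (count_space UNIV)" if "j \<in> I" for j
      using A[OF that] by (rule partial_count_measurable) simp
    have [measurable]: "A i \<in> sets borel" using A that by (simp add: I'_def)
    show ?thesis using fin by measurable
  qed
  have "disjoint_family_on ?E I'"
    using disj unfolding disjoint_family_on_def I'_def by blast
  moreover have "?E ` I' \<subseteq> sets sample_space" using E_sets by (rule image_subsetI)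
  ultimately have "sample.P.prob (\<Union>i\<in>I'. ?E i) = (\<Sum>i\<in>I'. sample.P.prob (?E i))"
    by (intro sample.P.finite_measure_finite_Union fin') }
  ultimately have "sample.P.prob {\<omega>\<in>space sample_space. \<forall>i\<in>I. partial_count k (Suc l) (A i) \<omega> = n i} = (\<Sum>i\<in>I'. sample.P.prob (?E i))"
    by (simp only:)
  also have "\<dots> = (\<Sum>i\<in>I'. if (\<Sum>j\<in>I. n j) = Suc l then fact l * real (n i) * (\<Prod>j\<in>I. p j ^ n j / fact (n j)) else 0)"
  proof (intro sum.cong refl)
    fix i assume i: "i \<in> I'"
    then have iI: "i \<in> I" "0 < n i" by (auto simp: I'_def)
    let ?n = "n(i := n i - 1)"
    let ?J1 = "{prod_encode (k, Suc l)}" and ?J2 = "(\<lambda>i. prod_encode (k, Suc i)) ` {..<l}"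
    have "sample.P.prob (?E i) = sample.P.prob {\<omega>\<in>space sample_space. cell_point k l \<omega> \<in> A i} *
        sample.P.prob {\<omega>\<in>space sample_space. \<forall>j\<in>I. partial_count k l (A j) \<omega> = ?n j}"
    proof (rule sample_indep_events[where ?J1.0 = ?J1 and ?J2.0 = ?J2])
      show "?J1 \<inter> ?J2 = {}" by auto
      show "Measurable.pred (PiM ?J1 sample_marginal) (\<lambda>\<omega>. cell_point k l \<omega> \<in> A i)"
        using cell_point_measurable[of k l ?J1] A[OF iI(1)] by measurable
      have [measurable]: "partial_count k l (A j) \<in> measurable (PiM ?J2 sample_marginal) (count_space UNIV)" if "j \<in> I" for j
        using A[OF that] by (rule partial_count_measurable') auto
      show "Measurable.pred (PiM ?J2 sample_marginal) (\<lambda>\<omega>. \<forall>j\<in>I. partial_count k l (A j) \<omega> = ?n j)"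
        using fin by measurable
    qed (auto simp: cell_point_def partial_count_def cong: conj_cong)
    also have "\<dots> = p i * (if (\<Sum>j\<in>I. ?n j) = l then fact l * (\<Prod>j\<in>I. p j ^ ?n j / fact (?n j)) else 0)"
      using prob_cell_point[OF A[OF iI(1)]] Suc[of ?n] by (simp add: p_def del: fun_upd_apply)
    also have "(\<Sum>j\<in>I. ?n j) = l \<longleftrightarrow> (\<Sum>j\<in>I. n j) = Suc l"
    proof -
      have "(\<Sum>j\<in>I. ?n j) = (n i - 1) + (\<Sum>j\<in>I - {i}. n j)" using fin iI by (subst sum.remove[of _ i]) (auto intro!: sum.cong)
      moreover have "(\<Sum>j\<in>I. n j) = n i + (\<Sum>j\<in>I - {i}. n j)" using fin iI by (subst sum.remove[of _ i]) auto
      ultimately show ?thesis using iI by auto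
    qed
    also have "p i * (if (\<Sum>j\<in>I. n j) = Suc l then fact l * (\<Prod>j\<in>I. p j ^ ?n j / fact (?n j)) else 0)
       = (if (\<Sum>j\<in>I. n j) = Suc l then fact l * real (n i) * (\<Prod>j\<in>I. p j ^ n j / fact (n j)) else 0)"
    proof -
      define R where "R = (\<Prod>j\<in>I - {i}. p j ^ n j / fact (n j))"
      have e1: "(\<Prod>j\<in>I. p j ^ ?n j / fact (?n j)) = p i ^ (n i - 1) / fact (n i - 1) * R"
        unfolding R_def using fin iI by (subst prod.remove[of _ i]) (auto intro!: prod.cong)
      have e2: "(\<Prod>j\<in>I. p j ^ n j / fact (n j)) = p i ^ n i / fact (n i) * R"
        unfolding R_def using fin iI by (subst prod.remove[of _ i]) auto
      have e3: "p i * (p i ^ (n i - 1) / fact (n i - 1)) = real (n i) * (p i ^ n i / fact (n i))"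
        using iI(2) by (cases "n i") (simp_all del: of_nat_Suc)
      have "p i * (fact l * (\<Prod>j\<in>I. p j ^ ?n j / fact (?n j))) = fact l * (p i * (p i ^ (n i - 1) / fact (n i - 1))) * R"
        unfolding e1 by (simp only: mult_ac)
      also have "\<dots> = fact l * real (n i) * (\<Prod>j\<in>I. p j ^ n j / fact (n j))"
        unfolding e2 e3 by (simp only: mult_ac)
      finally show ?thesis by (simp del: fun_upd_apply)
    qed
    finally show "sample.P.prob (?E i) = \<dots>" .
  qed
  also have "\<dots> = (if (\<Sum>j\<in>I. n j) = Suc l then fact l * real (\<Sum>i\<in>I'. n i) * (\<Prod>j\<in>I. p j ^ n j / fact (n j)) else 0)"
    by (simp add: sum_distrib_left sum_distrib_right)
  \<comment> \<open>The total is \<open>Suc l\<close>, which turns \<open>fact l\<close> into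
    \<open>fact (Suc l)\<close>.\<close>
  also have "(\<Sum>i\<in>I'. n i) = (\<Sum>i\<in>I. n i)"
    unfolding I'_def using fin by (intro sum.mono_neutral_left) auto
  finally show ?case by (auto simp: p_def algebra_simps)
qed

text \<open>Poissonisation: a total of \<open>L\<close> has probability
  \<open>exp (- 1) / fact L\<close>, the factorial cancels against the multinomial coefficient, and
  \<open>exp (- 1)\<close> splits into factors \<open>exp (- cell_mass k (A i))\<close> because the
  masses of a partition add up to 1.\<close>

lemma prob_cell_count_partition:
  fixes A :: "nat \<Rightarrow> real set" and n :: "nat \<Rightarrow> nat"
  assumes fin: "finite I" and A: "\<And>i. i \<in> I \<Longrightarrow> A i \<in> sets borel" and disj: "disjoint_family_on A I" and cover: "(\<Union>i\<in>I. A i) = UNIV"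
  shows "sample.P.prob {\<omega>\<in>space sample_space. \<forall>i\<in>I. cell_count k (A i) \<omega> = n i} = (\<Prod>i\<in>I. poisson_mass (cell_mass k (A i)) (n i))"
proof -
  define L where "L = (\<Sum>i\<in>I. n i)"
  have tot: "(\<Sum>i\<in>I. partial_count k l (A i) \<omega>) = l" for l \<omega>
  proof -
    have "(\<Sum>i\<in>I. card {j. j < l \<and> cell_point k j \<omega> \<in> A i}) = card (\<Union>i\<in>I. {j. j < l \<and> cell_point k j \<omega> \<in> A i})"
      using fin disj by (intro card_UN_disjoint[symmetric]) (auto simp: disjoint_family_on_def)
    also have "(\<Union>i\<in>I. {j. j < l \<and> cell_point k j \<omega> \<in> A i}) = {..<l}" using cover by auto
    finally show ?thesis by (simp add: partial_count_def)
  qed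
  have "{\<omega>\<in>space sample_space. \<forall>i\<in>I. cell_count k (A i) \<omega> = n i} =
     {\<omega>\<in>space sample_space. cell_number k \<omega> = L \<and> (\<forall>i\<in>I. partial_count k L (A i) \<omega> = n i)}"
  proof (intro Collect_cong conj_cong refl)
    fix \<omega>
    show "(\<forall>i\<in>I. cell_count k (A i) \<omega> = n i) \<longleftrightarrow> (cell_number k \<omega> = L \<and> (\<forall>i\<in>I. partial_count k L (A i) \<omega> = n i))"
    proof
      assume a: "\<forall>i\<in>I. cell_count k (A i) \<omega> = n i"
      have "cell_number k \<omega> = (\<Sum>i\<in>I. cell_count k (A i) \<omega>)" by (simp add: cell_count_def tot)
      also have "\<dots> = L" unfolding L_def using a by (intro sum.cong) auto
      finally show "cell_number k \<omega> = L \<and> (\<forall>i\<in>I. partial_count k L (A i) \<omega> = n i)" using a by (auto simp: cell_count_def)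
    qed (auto simp: cell_count_def)
  qed
  moreover have "sample.P.prob {\<omega>\<in>space sample_space. cell_number k \<omega> = L \<and> (\<forall>i\<in>I. partial_count k L (A i) \<omega> = n i)} =
     sample.P.prob {\<omega>\<in>space sample_space. cell_number k \<omega> = L} * sample.P.prob {\<omega>\<in>space sample_space. \<forall>i\<in>I. partial_count k L (A i) \<omega> = n i}"
  proof (rule sample_indep_events[where ?J1.0 = "{prod_encode (k, 0)}" and ?J2.0 = "(\<lambda>i. prod_encode (k, Suc i)) ` UNIV"])
    show "Measurable.pred (PiM {prod_encode (k, 0)} sample_marginal) (\<lambda>\<omega>. cell_number k \<omega> = L)"
      using cell_number_measurable[of k "{prod_encode (k, 0)}"] by measurable
    have [measurable]: "partial_count k L (A j) \<in> measurable (PiM ((\<lambda>i. prod_encode (k, Suc i)) ` UNIV) sample_marginal) (count_space UNIV)" if "j \<in> I" for j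
      using A[OF that] by (rule partial_count_measurable) auto
    show "Measurable.pred (PiM ((\<lambda>i. prod_encode (k, Suc i)) ` UNIV) sample_marginal) (\<lambda>\<omega>. \<forall>j\<in>I. partial_count k L (A j) \<omega> = n j)"
      using fin by measurable
  qed (auto simp: cell_number_def cell_point_def partial_count_def cong: conj_cong)
  moreover have "(\<Sum>i\<in>I. cell_mass k (A i)) = 1"
  proof -
    have "(\<Sum>i\<in>I. measure lborel (A i \<inter> unit_cell k)) = measure lborel (\<Union>i\<in>I. A i \<inter> unit_cell k)"
    proof (rule measure_finite_Union[symmetric])
      show "emeasure lborel (A i \<inter> unit_cell k) \<noteq> \<infinity>" if "i \<in> I" for i
      proof -
        have "emeasure lborel (A i \<inter> unit_cell k) \<le> emeasure lborel (unit_cell k)"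
          using A[OF that] by (intro emeasure_mono) (auto simp: unit_cell_def)
        also have "\<dots> < \<infinity>" by (simp add: unit_cell_def)
        finally show ?thesis by simp
      qed
    qed (use fin A disj in \<open>auto simp: disjoint_family_on_def unit_cell_def\<close>)
    also have "(\<Union>i\<in>I. A i \<inter> unit_cell k) = unit_cell k" using cover by auto
    finally show ?thesis by (simp add: cell_mass_def unit_cell_def)
  qed
  then have "exp (- 1) = (\<Prod>i\<in>I. exp (- cell_mass k (A i)))" using fin by (simp add: sum_negf flip: exp_sum)
  moreover have "sample.P.prob {\<omega>\<in>space sample_space. \<forall>i\<in>I. partial_count k L (A i) \<omega> = n i}
      = fact L * (\<Prod>i\<in>I. cell_mass k (A i) ^ n i / fact (n i))"
    using prob_partial_count[of I A k L n, OF fin A disj cover] by (simp add: L_def)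
  ultimately show ?thesis
    by (simp add: prob_cell_number poisson_mass_def prod.distrib[symmetric] mult_ac)
qed

text \<open>The family is completed to a partition by the complement of its union, under a fresh
  index \<open>c\<close>; the count of the complement is then summed out.\<close>

lemma prob_cell_count:
  fixes A :: "nat \<Rightarrow> real set" and n :: "nat \<Rightarrow> nat"
  assumes fin: "finite I" and A: "\<And>i. i \<in> I \<Longrightarrow> A i \<in> sets borel" and disj: "disjoint_family_on A I"
  shows "sample.P.prob {\<omega>\<in>space sample_space. \<forall>i\<in>I. cell_count k (A i) \<omega> = n i} = (\<Prod>i\<in>I. poisson_mass (cell_mass k (A i)) (n i))"
proof -
  obtain c where c: "c \<notin> I" using ex_new_if_finite[OF infinite_UNIV_nat fin] by blast
  define A' where "A' = A(c := - (\<Union>i\<in>I. A i))"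
  have A'I: "A' i = A i" if "i \<in> I" for i using that c by (auto simp: A'_def)
  have A'c: "A' c = - (\<Union>i\<in>I. A i)" by (simp add: A'_def)
  have A'_sets: "A' i \<in> sets borel" if "i \<in> insert c I" for i
  proof (cases "i = c")
    case True
    have "(\<Union>i\<in>I. A i) \<in> sets borel" using A fin by (intro sets.finite_UN) auto
    then show ?thesis unfolding True A'c by (rule borel_comp)
  qed (use that A A'I in auto)
  have A'_disj: "disjoint_family_on A' (insert c I)"
    using disj unfolding disjoint_family_on_def by (auto simp: A'I A'c c)
  have A'_cover: "(\<Union>i\<in>insert c I. A' i) = UNIV" using A'I A'c by auto
  let ?E = "{\<omega>\<in>space sample_space. \<forall>i\<in>I. cell_count k (A i) \<omega> = n i}"
  let ?F = "\<lambda>q. {\<omega>\<in>space sample_space. \<forall>i\<in>insert c I. cell_count k (A' i) \<omega> = (n(c := q)) i}"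
  have F_eq: "?F q = {\<omega>\<in>?E. cell_count k (A' c) \<omega> = q}" for q using c by (auto simp: A'I)
  have m: "cell_count k (A' i) \<in> measurable sample_space (count_space UNIV)" if "i \<in> insert c I" for i
    using A'_sets[OF that] by (rule cell_count_measurable) simp
  have F_sets: "?F q \<in> sets sample_space" for q
    using fin m by (intro sets.sets_Collect_finite_All) auto
  have "(\<lambda>q. sample.P.prob (?F q)) sums sample.P.prob (\<Union>q. ?F q)"
  proof (rule sample.P.finite_measure_UNION)
    show "disjoint_family ?F" unfolding F_eq disjoint_family_on_def by auto
    show "range ?F \<subseteq> sets sample_space" by (rule image_subsetI) (rule F_sets)
  qed
  moreover have "(\<Union>q. ?F q) = ?E" unfolding F_eq by auto
  moreover have "sample.P.prob (?F q) = (\<Prod>i\<in>I. poisson_mass (cell_mass k (A i)) (n i)) * poisson_mass (cell_mass k (A' c)) q" for q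
  proof -
    have "(\<Prod>i\<in>I. poisson_mass (cell_mass k (A' i)) ((n(c := q)) i)) = (\<Prod>i\<in>I. poisson_mass (cell_mass k (A i)) (n i))"
      using c by (intro prod.cong) (auto simp: A'I)
    then show ?thesis
      using prob_cell_count_partition[OF _ A'_sets A'_disj A'_cover, of k "n(c := q)"] fin c by simp
  qed
  moreover have "(\<lambda>q. (\<Prod>i\<in>I. poisson_mass (cell_mass k (A i)) (n i)) * poisson_mass (cell_mass k (A' c)) q) sums
     ((\<Prod>i\<in>I. poisson_mass (cell_mass k (A i)) (n i)) * 1)"
    by (intro sums_mult poisson_mass_sums)
  ultimately show ?thesis using sums_unique2 by fastforce
qed

definition window_count :: "nat \<Rightarrow> real set \<Rightarrow> (nat \<Rightarrow> real) \<Rightarrow> nat" where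
  "window_count K A \<omega> = (\<Sum>k<K. cell_count k A \<omega>)"

lemma window_count_measurable:
  assumes "A \<in> sets borel" "\<And>k i. k < K \<Longrightarrow> prod_encode (k, i) \<in> J"
  shows "window_count K A \<in> measurable (PiM J sample_marginal) (count_space UNIV)"
proof -
  have "cell_count k A \<in> measurable (PiM J sample_marginal) (count_space UNIV)" if "k < K" for k
    using assms that by (intro cell_count_measurable) auto
  then have "(\<lambda>\<omega>. \<Sum>k\<in>{..<K}. cell_count k A \<omega>) \<in> measurable (PiM J sample_marginal) (count_space UNIV)"
  proof (induction K)
    case (Suc K)
    have [measurable]: "(\<lambda>\<omega>. \<Sum>k\<in>{..<K}. cell_count k A \<omega>) \<in> measurable (PiM J sample_marginal) (count_space UNIV)"
      "cell_count K A \<in> measurable (PiM J sample_marginal) (count_space UNIV)"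
      using Suc by auto
    show ?case unfolding sum.lessThan_Suc by measurable
  qed simp
  then show ?thesis by (simp add: window_count_def[abs_def])
qed

text \<open>Induction over the cells: different cells use disjoint coordinates, and Poisson masses
  convolve. The sum runs over all possible counts \<open>l\<close> in the newest cell.\<close>

lemma prob_window_count:
  fixes A :: "nat \<Rightarrow> real set" and n :: "nat \<Rightarrow> nat"
  assumes fin: "finite I" and A: "\<And>i. i \<in> I \<Longrightarrow> A i \<in> sets borel" and disj: "disjoint_family_on A I"
  shows "sample.P.prob {\<omega>\<in>space sample_space. \<forall>i\<in>I. window_count K (A i) \<omega> = n i} =
    (\<Prod>i\<in>I. poisson_mass (\<Sum>k<K. cell_mass k (A i)) (n i))"
proof (induction K arbitrary: n)
  case 0
  have "{\<omega>\<in>space sample_space. \<forall>i\<in>I. window_count 0 (A i) \<omega> = n i} = (if \<forall>i\<in>I. n i = 0 then space sample_space else {})"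
    by (auto simp: window_count_def)
  then show ?case using fin by (auto simp: poisson_mass_0 sample.P.prob_space)
next
  case (Suc K)
  let ?P = "PiE I (\<lambda>i. {..n i})"
  have finP: "finite ?P" using fin by (intro finite_PiE) auto
  let ?E = "\<lambda>l. {\<omega>\<in>space sample_space. (\<forall>i\<in>I. window_count K (A i) \<omega> = n i - l i) \<and> (\<forall>i\<in>I. cell_count K (A i) \<omega> = l i)}"
  have mc: "cell_count k (A i) \<in> measurable sample_space (count_space UNIV)" if "i \<in> I" for i k
    using A[OF that] by (rule cell_count_measurable) simp
  have mw: "window_count K (A i) \<in> measurable sample_space (count_space UNIV)" if "i \<in> I" for i
    using A[OF that] by (rule window_count_measurable) simp
  have E_sets: "?E l \<in> sets sample_space" for l
    using fin mc mw by (intro sets.sets_Collect_conj sets.sets_Collect_finite_All) auto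
  have "{\<omega>\<in>space sample_space. \<forall>i\<in>I. window_count (Suc K) (A i) \<omega> = n i} = (\<Union>l\<in>?P. ?E l)"
  proof (intro set_eqI iffI)
    fix \<omega> assume \<omega>: "\<omega> \<in> {\<omega>\<in>space sample_space. \<forall>i\<in>I. window_count (Suc K) (A i) \<omega> = n i}"
    then have s: "window_count K (A i) \<omega> + cell_count K (A i) \<omega> = n i" if "i \<in> I" for i
      using that by (auto simp: window_count_def)
    define l where "l = (\<lambda>i\<in>I. cell_count K (A i) \<omega>)"
    have "l \<in> ?P" using s by (force simp: l_def)
    moreover have "\<omega> \<in> ?E l" using \<omega> s by (force simp: l_def)
    ultimately show "\<omega> \<in> (\<Union>l\<in>?P. ?E l)" by blast
  next
    fix \<omega> assume "\<omega> \<in> (\<Union>l\<in>?P. ?E l)"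
    then show "\<omega> \<in> {\<omega>\<in>space sample_space. \<forall>i\<in>I. window_count (Suc K) (A i) \<omega> = n i}"
      by (fastforce simp: window_count_def PiE_iff)
  qed
  moreover {
  have "disjoint_family_on ?E ?P"
    unfolding disjoint_family_on_def
  proof (intro ballI impI)
    fix l l' assume l: "l \<in> ?P" "l' \<in> ?P" "l \<noteq> l'"
    then obtain i where "i \<in> I" "l i \<noteq> l' i" using PiE_ext[of l I _ l'] by blast
    then show "?E l \<inter> ?E l' = {}" by auto
  qed
  moreover have "?E ` ?P \<subseteq> sets sample_space" using E_sets by (rule image_subsetI)
  ultimately have "sample.P.prob (\<Union>l\<in>?P. ?E l) = (\<Sum>l\<in>?P. sample.P.prob (?E l))"
    by (intro sample.P.finite_measure_finite_Union finP) }
  ultimately have "sample.P.prob {\<omega>\<in>space sample_space. \<forall>i\<in>I. window_count (Suc K) (A i) \<omega> = n i} = (\<Sum>l\<in>?P. sample.P.prob (?E l))"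
    by (simp only:)
  also have "\<dots> = (\<Sum>l\<in>?P. \<Prod>i\<in>I. poisson_mass (\<Sum>k<K. cell_mass k (A i)) (n i - l i) * poisson_mass (cell_mass K (A i)) (l i))"
  proof (intro sum.cong refl)
    fix l
    let ?J1 = "{j. fst (prod_decode j) < K}" and ?J2 = "{j. fst (prod_decode j) = K}"
    have "sample.P.prob (?E l) = sample.P.prob {\<omega>\<in>space sample_space. \<forall>i\<in>I. window_count K (A i) \<omega> = n i - l i} *
       sample.P.prob {\<omega>\<in>space sample_space. \<forall>i\<in>I. cell_count K (A i) \<omega> = l i}"
    proof (rule sample_indep_events[where ?J1.0 = ?J1 and ?J2.0 = ?J2])
      have [measurable]: "window_count K (A j) \<in> measurable (PiM ?J1 sample_marginal) (count_space UNIV)" if "j \<in> I" for j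
        using A[OF that] by (rule window_count_measurable) auto
      show "Measurable.pred (PiM ?J1 sample_marginal) (\<lambda>\<omega>. \<forall>i\<in>I. window_count K (A i) \<omega> = n i - l i)"
        using fin by measurable
      have [measurable]: "cell_count K (A j) \<in> measurable (PiM ?J2 sample_marginal) (count_space UNIV)" if "j \<in> I" for j
        using A[OF that] by (rule cell_count_measurable) auto
      show "Measurable.pred (PiM ?J2 sample_marginal) (\<lambda>\<omega>. \<forall>i\<in>I. cell_count K (A i) \<omega> = l i)"
        using fin by measurable
    qed (auto simp: window_count_def cell_count_def cell_number_def cell_point_def partial_count_def)
    then show "sample.P.prob (?E l) = (\<Prod>i\<in>I. poisson_mass (\<Sum>k<K. cell_mass k (A i)) (n i - l i) * poisson_mass (cell_mass K (A i)) (l i))"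
      using Suc[of "\<lambda>i. n i - l i"] prob_cell_count[OF fin A disj, of K l] by (simp add: prod.distrib)
  qed
  also have "\<dots> = (\<Prod>i\<in>I. \<Sum>l\<le>n i. poisson_mass (\<Sum>k<K. cell_mass k (A i)) (n i - l) * poisson_mass (cell_mass K (A i)) l)"
    using fin by (intro prod_sum_PiE[symmetric]) auto
  finally show ?case by (simp add: poisson_mass_convolution)
qed

section \<open>The unit rate Poisson process on the whole line\<close>

definition base_process :: "(nat \<Rightarrow> real) \<Rightarrow> real measure" where
  "base_process \<omega> = distr (count_space {e. snd e < cell_number (fst e) \<omega>}) borel (\<lambda>e. cell_point (fst e) (snd e) \<omega>)"

lemma sets_base_process [simp]: "sets (base_process \<omega>) = sets borel"
  by (simp add: base_process_def)

lemma space_base_process [simp]: "space (base_process \<omega>) = UNIV"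
  by (simp add: base_process_def)

lemma emeasure_base_process:
  assumes A: "A \<in> sets borel"
  shows "emeasure (base_process \<omega>) A = emeasure (count_space UNIV) {e. snd e < cell_number (fst e) \<omega> \<and> cell_point (fst e) (snd e) \<omega> \<in> A}"
    and "emeasure (base_process \<omega>) A = (\<Sum>k. of_nat (cell_count k A \<omega>))"
proof -
  let ?J = "{e. snd e < cell_number (fst e) \<omega>}"
  let ?B = "{e. snd e < cell_number (fst e) \<omega> \<and> cell_point (fst e) (snd e) \<omega> \<in> A}"
  have "emeasure (base_process \<omega>) A = emeasure (count_space ?J) ((\<lambda>e. cell_point (fst e) (snd e) \<omega>) -` A \<inter> space (count_space ?J))"
    unfolding base_process_def using A by (intro emeasure_distr) auto
  also have "(\<lambda>e. cell_point (fst e) (snd e) \<omega>) -` A \<inter> space (count_space ?J) = ?B" by auto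
  also have "emeasure (count_space ?J) ?B = emeasure (count_space UNIV) ?B"
  proof -
    have "?B \<subseteq> ?J" by auto
    then show ?thesis by (simp add: emeasure_count_space)
  qed
  finally show 1: "emeasure (base_process \<omega>) A = emeasure (count_space UNIV) ?B" .
  define D where "D k = {i. i < cell_number k \<omega> \<and> cell_point k i \<omega> \<in> A}" for k
  have "?B = (\<Union>k. {k} \<times> D k)" by (auto simp: D_def)
  moreover have "(\<Sum>k. emeasure (count_space UNIV) ({k} \<times> D k)) = emeasure (count_space UNIV) (\<Union>k. {k} \<times> D k)"
    by (rule suminf_emeasure) (auto simp: disjoint_family_on_def)
  moreover have "emeasure (count_space UNIV) ({k} \<times> D k) = of_nat (cell_count k A \<omega>)" for k
  proof -
    have "finite (D k)" by (simp add: D_def)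
    then have "emeasure (count_space UNIV) ({k} \<times> D k) = of_nat (card ({k} \<times> D k))"
      by (intro emeasure_count_space_finite) auto
    also have "card ({k} \<times> D k) = cell_count k A \<omega>"
      by (simp add: card_cartesian_product cell_count_def partial_count_def D_def)
    finally show ?thesis .
  qed
  ultimately show "emeasure (base_process \<omega>) A = (\<Sum>k. of_nat (cell_count k A \<omega>))"
    using 1 by simp
qed

lemma base_process_integer:
  assumes "A \<in> sets borel"
  shows "emeasure (base_process \<omega>) A \<in> insert \<infinity> (range of_nat)"
  unfolding emeasure_base_process(1)[OF assms] by (simp add: emeasure_count_space)

text \<open>A bounded set meets only finitely many unit cells, and each of them holds finitely many
  points.\<close>

lemma base_process_finite:
  assumes A: "A \<in> sets borel" and bdd: "bounded A"
  shows "emeasure (base_process \<omega>) A < \<infinity>"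
proof -
  obtain R where R: "\<And>x. x \<in> A \<Longrightarrow> \<bar>x\<bar> \<le> R" using bdd by (auto simp: bounded_iff)
  define Z where "Z = {\<lfloor>- R - 1\<rfloor>..\<lceil>R + 1\<rceil>}"
  let ?K = "{k. int_decode k \<in> Z}"
  have "finite ?K"
  proof -
    have "?K = int_decode -` Z \<inter> UNIV" by auto
    moreover have "finite (int_decode -` Z)" by (intro finite_vimageI) (auto simp: Z_def inj_int_decode)
    ultimately show ?thesis by simp
  qed
  moreover have "{e. snd e < cell_number (fst e) \<omega> \<and> cell_point (fst e) (snd e) \<omega> \<in> A} \<subseteq> (SIGMA k:?K. {..<cell_number k \<omega>})"
  proof
    fix e assume e: "e \<in> {e. snd e < cell_number (fst e) \<omega> \<and> cell_point (fst e) (snd e) \<omega> \<in> A}"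
    obtain k i where ki: "e = (k, i)" by (cases e)
    have "\<bar>cell_point k i \<omega>\<bar> \<le> R" using e R ki by auto
    moreover have "of_int (int_decode k) \<le> cell_point k i \<omega>" "cell_point k i \<omega> < of_int (int_decode k) + 1"
      using cell_point_in_cell[of k i \<omega>] by (auto simp: unit_cell_def)
    ultimately have "int_decode k \<in> Z" unfolding Z_def by simp linarith
    then show "e \<in> (SIGMA k:?K. {..<cell_number k \<omega>})" using e ki by auto
  qed
  ultimately have "finite {e. snd e < cell_number (fst e) \<omega> \<and> cell_point (fst e) (snd e) \<omega> \<in> A}"
    by (meson finite_SigmaI finite_lessThan finite_subset)
  then show ?thesis unfolding emeasure_base_process(1)[OF A] by (simp add: emeasure_count_space of_nat_less_top)
qed

lemma base_process_measurable:
  assumes A: "A \<in> sets borel"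
  shows "(\<lambda>\<omega>. emeasure (base_process \<omega>) A) \<in> borel_measurable sample_space"
proof -
  have [measurable]: "cell_count k A \<in> measurable sample_space (count_space UNIV)" for k
    using A by (rule cell_count_measurable) simp
  show ?thesis unfolding emeasure_base_process(2)[OF A] by measurable
qed

lemma base_process_le_iff:
  assumes A: "A \<in> sets borel"
  shows "emeasure (base_process \<omega>) A \<le> of_nat n \<longleftrightarrow> (\<forall>K. window_count K A \<omega> \<le> n)"
proof -
  have "(\<Sum>k. of_nat (cell_count k A \<omega>) :: ennreal) = (SUP K. of_nat (window_count K A \<omega>))"
    unfolding suminf_eq_SUP by (simp add: window_count_def)
  then show ?thesis unfolding emeasure_base_process(2)[OF A] by (simp add: SUP_le_iff)
qed

text \<open>The value 0 for infinite mass is the distribution function of a count that is almost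
  surely infinite.\<close>

definition limit_cdf :: "real set \<Rightarrow> nat \<Rightarrow> real" where
  "limit_cdf A n = (if emeasure lborel A < \<infinity> then poisson_cdf (measure lborel A) n else 0)"

lemma limit_cdf:
  assumes A: "A \<in> sets borel"
  shows "(\<lambda>K. poisson_cdf (\<Sum>k<K. cell_mass k A) n) \<longlonglongrightarrow> limit_cdf A n"
proof -
  have fin: "emeasure lborel (A \<inter> unit_cell k) < \<infinity>" for k
  proof -
    have "emeasure lborel (A \<inter> unit_cell k) \<le> emeasure lborel (unit_cell k)"
      by (intro emeasure_mono) (auto simp: unit_cell_def)
    also have "\<dots> < \<infinity>" by (simp add: unit_cell_def)
    finally show ?thesis .
  qed
  have cell: "emeasure lborel (A \<inter> unit_cell k) = ennreal (cell_mass k A)" for k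
    unfolding cell_mass_def using fin[of k] by (intro emeasure_eq_ennreal_measure) simp
  have "unit_cell k \<inter> unit_cell k' = {}" if "k \<noteq> k'" for k k'
  proof -
    have ne: "int_decode k \<noteq> int_decode k'" using that by (simp add: inj_eq[OF inj_int_decode])
    have False if "x \<in> unit_cell k" "x \<in> unit_cell k'" for x
    proof -
      have "\<lfloor>x\<rfloor> = int_decode k" "\<lfloor>x\<rfloor> = int_decode k'" using that by (auto simp: unit_cell_def floor_eq_iff)
      then show False using ne by simp
    qed
    then show ?thesis by auto
  qed
  then have disj: "disjoint_family (\<lambda>k. A \<inter> unit_cell k)" unfolding disjoint_family_on_def by blast
  have "(\<Union>k. A \<inter> unit_cell k) = A"
  proof -
    have "x \<in> unit_cell (int_encode \<lfloor>x\<rfloor>)" for x by (simp add: unit_cell_def)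
    then show ?thesis by blast
  qed
  moreover have "range (\<lambda>k. A \<inter> unit_cell k) \<subseteq> sets lborel" using A by (auto simp: unit_cell_def)
  ultimately have "(\<lambda>k. emeasure lborel (A \<inter> unit_cell k)) sums emeasure lborel A"
    using suminf_emeasure[OF _ disj, of lborel] by (simp add: sums_iff)
  then have "(\<lambda>K. \<Sum>k<K. ennreal (cell_mass k A)) \<longlonglongrightarrow> emeasure lborel A" by (simp add: sums_def cell)
  then have lim: "(\<lambda>K. ennreal (\<Sum>k<K. cell_mass k A)) \<longlonglongrightarrow> emeasure lborel A"
    by (simp add: sum_ennreal cell_mass_bounds)
  show ?thesis
  proof (cases "emeasure lborel A < \<infinity>")
    case True
    then have "emeasure lborel A = ennreal (measure lborel A)" by (intro emeasure_eq_ennreal_measure) simp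
    then have "(\<lambda>K. \<Sum>k<K. cell_mass k A) \<longlonglongrightarrow> measure lborel A"
      using lim by (intro tendsto_ennrealD) (auto intro!: always_eventually sum_nonneg cell_mass_bounds)
    then show ?thesis using True by (simp add: limit_cdf_def tendsto_poisson_cdf)
  next
    case False
    have "filterlim (\<lambda>K. \<Sum>k<K. cell_mass k A) at_top sequentially"
      unfolding filterlim_at_top
    proof
      fix Z :: real
      have "\<forall>\<^sub>F K in sequentially. ennreal Z < ennreal (\<Sum>k<K. cell_mass k A)"
      proof (rule order_tendstoD(1)[OF lim])
        have "emeasure lborel A = top" using False by (simp add: less_top[symmetric])
        then show "ennreal Z < emeasure lborel A" by simp
      qed
      then show "\<forall>\<^sub>F K in sequentially. Z \<le> (\<Sum>k<K. cell_mass k A)"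
        by eventually_elim (metis ennreal_leI linorder_not_less linear)
    qed
    then show ?thesis using False poisson_cdf_at_top by (simp add: limit_cdf_def)
  qed
qed

text \<open>The windows grow to the whole line, so the events \<open>D K\<close> decrease to the
  event in question. Their probabilities are products of Poisson distribution functions, which
  converge factor by factor.\<close>

lemma prob_base_process_le:
  fixes A :: "nat \<Rightarrow> real set" and n :: "nat \<Rightarrow> nat"
  assumes fin: "finite I" and A: "\<And>i. i \<in> I \<Longrightarrow> A i \<in> sets borel" and disj: "disjoint_family_on A I"
  shows "sample.P.prob {\<omega>\<in>space sample_space. \<forall>i\<in>I. emeasure (base_process \<omega>) (A i) \<le> of_nat (n i)} = (\<Prod>i\<in>I. limit_cdf (A i) (n i))"
proof -
  define D where "D K = {\<omega>\<in>space sample_space. \<forall>i\<in>I. window_count K (A i) \<omega> \<le> n i}" for K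
  have mw: "window_count K (A i) \<in> measurable sample_space (count_space UNIV)" if "i \<in> I" for i K
    using A[OF that] by (rule window_count_measurable) simp
  have prob_D: "sample.P.prob (D K) = (\<Prod>i\<in>I. poisson_cdf (\<Sum>k<K. cell_mass k (A i)) (n i))" for K
  proof -
    let ?P = "PiE I (\<lambda>i. {..n i})"
    let ?E = "\<lambda>l. {\<omega>\<in>space sample_space. \<forall>i\<in>I. window_count K (A i) \<omega> = l i}"
    have "D K = (\<Union>l\<in>?P. ?E l)"
    proof (intro set_eqI iffI)
      fix \<omega> assume "\<omega> \<in> D K"
      then show "\<omega> \<in> (\<Union>l\<in>?P. ?E l)"
        by (intro UN_I[of "\<lambda>i\<in>I. window_count K (A i) \<omega>"]) (auto simp: D_def)
    qed (auto simp: D_def PiE_iff)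
    moreover have "disjoint_family_on ?E ?P"
      unfolding disjoint_family_on_def
    proof (intro ballI impI)
      fix l l' assume l: "l \<in> ?P" "l' \<in> ?P" "l \<noteq> l'"
      then obtain i where "i \<in> I" "l i \<noteq> l' i" using PiE_ext[of l I _ l'] by blast
      then show "?E l \<inter> ?E l' = {}" by auto
    qed
    moreover have "?E l \<in> sets sample_space" for l
      using fin mw by (intro sets.sets_Collect_finite_All) auto
    ultimately have "sample.P.prob (D K) = (\<Sum>l\<in>?P. sample.P.prob (?E l))"
      using fin by (simp only:) (intro sample.P.finite_measure_finite_Union finite_PiE, auto)
    also have "\<dots> = (\<Sum>l\<in>?P. \<Prod>i\<in>I. poisson_mass (\<Sum>k<K. cell_mass k (A i)) (l i))"
      by (intro sum.cong refl prob_window_count[OF fin A disj])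
    also have "\<dots> = (\<Prod>i\<in>I. poisson_cdf (\<Sum>k<K. cell_mass k (A i)) (n i))"
      unfolding poisson_cdf_def using fin by (intro prod_sum_PiE[symmetric]) auto
    finally show ?thesis .
  qed
  have "(\<lambda>K. sample.P.prob (D K)) \<longlonglongrightarrow> sample.P.prob (\<Inter>K. D K)"
  proof (rule sample.P.finite_Lim_measure_decseq)
    show "range D \<subseteq> sets sample_space"
    proof -
      have "D K \<in> sets sample_space" for K
      proof (cases "I = {}")
        case False
        then show ?thesis unfolding D_def using fin mw by (intro sets.sets_Collect_finite_All) auto
      qed (simp add: D_def)
      then show ?thesis by auto
    qed
    have "window_count K B \<omega> \<le> window_count (Suc K) B \<omega>" for K B \<omega> by (simp add: window_count_def)
    then show "decseq D" unfolding D_def by (intro decseq_SucI Collect_mono) (meson order_trans)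
  qed
  moreover have "(\<lambda>K. sample.P.prob (D K)) \<longlonglongrightarrow> (\<Prod>i\<in>I. limit_cdf (A i) (n i))"
    unfolding prob_D using A by (intro tendsto_prod limit_cdf) auto
  moreover have "(\<Inter>K. D K) = {\<omega>\<in>space sample_space. \<forall>i\<in>I. emeasure (base_process \<omega>) (A i) \<le> of_nat (n i)}"
    using base_process_le_iff[OF A] by (auto simp: D_def)
  ultimately show ?thesis using LIMSEQ_unique by metis
qed

lemma borel_ennreal_atMost: "sets (borel :: ennreal measure) = sigma_sets UNIV (range atMost)"
proof -
  have "sets (borel :: ennreal measure) = sigma_sets UNIV (range greaterThan)"
    by (simp add: borel_Ioi)
  also have "\<dots> = sigma_sets UNIV (range atMost)"
  proof (rule sigma_sets_eqI)
    fix a assume "a \<in> range (greaterThan :: ennreal \<Rightarrow> _)"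
    then obtain x where "a = {x<..}" by auto
    then have "a = UNIV - {..x}" by auto
    then show "a \<in> sigma_sets UNIV (range atMost)" by (auto intro: sigma_sets.Compl)
  next
    fix a assume "a \<in> range (atMost :: ennreal \<Rightarrow> _)"
    then obtain x where "a = {..x}" by auto
    then have "a = UNIV - {x<..}" by auto
    then show "a \<in> sigma_sets UNIV (range greaterThan)" by (auto intro: sigma_sets.Compl)
  qed
  finally show ?thesis .
qed

text \<open>Counts are integers or \<infinity>, so a finite threshold can be rounded down. This
  reduces the half-lines in \<open>base_process_indep\<close> to those with integer ends.\<close>

lemma ennreal_integer_le:
  assumes "x \<noteq> (\<infinity> :: ennreal)"
  obtains n :: nat where "\<And>v. v \<in> insert \<infinity> (range of_nat) \<Longrightarrow> v \<le> x \<longleftrightarrow> v \<le> of_nat n"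
proof -
  obtain r where r: "x = ennreal r" "0 \<le> r" using assms by (cases x) auto
  show thesis
  proof (rule that[of "nat \<lfloor>r\<rfloor>"])
    fix v :: ennreal assume "v \<in> insert \<infinity> (range of_nat)"
    then consider "v = \<infinity>" | q :: nat where "v = of_nat q" by auto
    then show "v \<le> x \<longleftrightarrow> v \<le> of_nat (nat \<lfloor>r\<rfloor>)"
    proof cases
      case 1
      then show ?thesis using assms by (simp add: top_unique)
    next
      case (2 q)
      have "v \<le> x \<longleftrightarrow> real q \<le> r" using r 2 by (simp add: ennreal_of_nat_eq_real_of_nat)
      also have "\<dots> \<longleftrightarrow> q \<le> nat \<lfloor>r\<rfloor>"
      proof
        assume "q \<le> nat \<lfloor>r\<rfloor>"
        then have "real q \<le> real (nat \<lfloor>r\<rfloor>)" by simp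
        also have "\<dots> \<le> r" using r(2) by (rule of_nat_floor)
        finally show "real q \<le> r" .
      qed (rule le_nat_floor)
      also have "\<dots> \<longleftrightarrow> v \<le> of_nat (nat \<lfloor>r\<rfloor>)" using 2 by simp
      finally show ?thesis .
    qed
  qed
qed

text \<open>Independence is tested on the half-lines \<open>{..x}\<close>, which are stable under
  intersection and generate the Borel sets. A finite \<open>x\<close> is rounded to an integer and
  covered by \<open>prob_base_process_le\<close>; an infinite \<open>x\<close> is no condition and
  contributes the factor 1.\<close>

lemma base_process_indep:
  fixes A :: "nat \<Rightarrow> real set"
  assumes fin: "finite I" and A: "\<And>i. i \<in> I \<Longrightarrow> A i \<in> sets borel" and disj: "disjoint_family_on A I"
  shows "sample.P.indep_vars (\<lambda>_. borel) (\<lambda>i \<omega>. emeasure (base_process \<omega>) (A i)) I"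
proof (cases "I = {}")
  case True
  then show ?thesis unfolding sample.P.indep_vars_def sample.P.indep_sets_def by simp
next
  case False
  let ?V = "\<lambda>i \<omega>. emeasure (base_process \<omega>) (A i)"
  show ?thesis
  proof (subst sample.P.indep_vars_finite[OF False fin, where E = "\<lambda>_. range atMost"])
    show "sets borel = sigma_sets (space borel) (range (atMost :: ennreal \<Rightarrow> _))"
      by (simp add: borel_ennreal_atMost)
    show "?V i \<in> borel_measurable sample_space" if "i \<in> I" for i
      using base_process_measurable[OF A[OF that]] .
    show "Int_stable (range (atMost :: ennreal \<Rightarrow> _))"
    proof (rule Int_stableI_image)
      fix i j :: ennreal
      show "\<exists>k\<in>UNIV. {..i} \<inter> {..j} = {..k}" by (intro bexI[of _ "min i j"]) auto
    qed
    show "space borel \<in> range (atMost :: ennreal \<Rightarrow> _)"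
      by (intro image_eqI[of _ _ top]) auto
    show "\<forall>B\<in>I \<rightarrow> range atMost. sample.P.prob (\<Inter>j\<in>I. ?V j -` B j \<inter> space sample_space) =
        (\<Prod>j\<in>I. sample.P.prob (?V j -` B j \<inter> space sample_space))"
    proof
      fix B :: "nat \<Rightarrow> ennreal set" assume B: "B \<in> I \<rightarrow> range atMost"
      then have "\<forall>i\<in>I. \<exists>x. B i = {..x}" by (auto simp: Pi_iff)
      then obtain x where x: "\<And>i. i \<in> I \<Longrightarrow> B i = {..x i}" by metis
      define I' where "I' = {i\<in>I. x i \<noteq> \<infinity>}"
      have "\<forall>i\<in>I'. \<exists>n::nat. \<forall>v\<in>insert \<infinity> (range of_nat). v \<le> x i \<longleftrightarrow> v \<le> of_nat n"
        unfolding I'_def using ennreal_integer_le by (metis (mono_tags, lifting) mem_Collect_eq)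
      then obtain n :: "nat \<Rightarrow> nat" where n: "\<And>i v. i \<in> I' \<Longrightarrow> v \<in> insert \<infinity> (range of_nat) \<Longrightarrow> v \<le> x i \<longleftrightarrow> v \<le> of_nat (n i)"
        by metis
      have le: "?V i \<omega> \<le> x i \<longleftrightarrow> ?V i \<omega> \<le> of_nat (n i)" if "i \<in> I'" for i \<omega>
        using n[OF that base_process_integer] A that by (auto simp: I'_def)
      have 1: "(\<Inter>j\<in>I. ?V j -` B j \<inter> space sample_space) = {\<omega>\<in>space sample_space. \<forall>i\<in>I'. ?V i \<omega> \<le> of_nat (n i)}"
      proof -
        have "(\<Inter>j\<in>I. ?V j -` B j \<inter> space sample_space) = {\<omega>\<in>space sample_space. \<forall>i\<in>I. ?V i \<omega> \<le> x i}"
          using False x by auto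
        also have "\<dots> = {\<omega>\<in>space sample_space. \<forall>i\<in>I'. ?V i \<omega> \<le> x i}" by (force simp: I'_def)
        finally show ?thesis using le by auto
      qed
      have 2: "sample.P.prob (?V j -` B j \<inter> space sample_space) = limit_cdf (A j) (n j)" if "j \<in> I'" for j
      proof -
        have j: "j \<in> I" using that by (simp add: I'_def)
        have "?V j -` B j \<inter> space sample_space = {\<omega>\<in>space sample_space. \<forall>i\<in>{j}. ?V i \<omega> \<le> of_nat (n i)}"
          using x[OF j] le[OF that] by auto
        then show ?thesis
          using prob_base_process_le[of "{j}" A n] A[OF j] by (simp add: disjoint_family_on_def)
      qed
      have 3: "sample.P.prob (?V j -` B j \<inter> space sample_space) = 1" if "j \<in> I - I'" for j
      proof -
        have "?V j -` B j \<inter> space sample_space = space sample_space" using x[of j] that by (auto simp: I'_def)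
        then show ?thesis by (simp only: sample.P.prob_space)
      qed
      have "sample.P.prob {\<omega>\<in>space sample_space. \<forall>i\<in>I'. ?V i \<omega> \<le> of_nat (n i)} = (\<Prod>i\<in>I'. limit_cdf (A i) (n i))"
        using fin A disj by (intro prob_base_process_le) (auto simp: I'_def disjoint_family_on_def)
      also have "\<dots> = (\<Prod>j\<in>I'. sample.P.prob (?V j -` B j \<inter> space sample_space))" using 2 by simp
      also have "\<dots> = (\<Prod>j\<in>I. sample.P.prob (?V j -` B j \<inter> space sample_space))"
        using fin 3 by (intro prod.mono_neutral_left) (auto simp: I'_def)
      finally show "sample.P.prob (\<Inter>j\<in>I. ?V j -` B j \<inter> space sample_space) =
        (\<Prod>j\<in>I. sample.P.prob (?V j -` B j \<inter> space sample_space))" unfolding 1 .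
    qed
  qed auto
qed

lemma prob_base_process_eq:
  assumes A: "A \<in> sets borel" and fin: "emeasure lborel A < \<infinity>"
  shows "sample.P.prob {\<omega>\<in>space sample_space. emeasure (base_process \<omega>) A = of_nat k} = poisson_mass (measure lborel A) k"
proof -
  let ?L = "\<lambda>n::nat. {\<omega>\<in>space sample_space. emeasure (base_process \<omega>) A \<le> of_nat n}"
  note [measurable] = base_process_measurable[OF A]
  have cdf: "sample.P.prob (?L n) = poisson_cdf (measure lborel A) n" for n
    using prob_base_process_le[of "{0}" "\<lambda>_. A" "\<lambda>_. n"] A fin by (simp add: disjoint_family_on_def limit_cdf_def)
  show ?thesis
  proof (cases k)
    case 0
    have "{\<omega>\<in>space sample_space. emeasure (base_process \<omega>) A = of_nat k} = ?L 0" using 0 by auto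
    then show ?thesis using cdf[of 0] 0 by (simp add: poisson_cdf_def)
  next
    case (Suc j)
    have "{\<omega>\<in>space sample_space. emeasure (base_process \<omega>) A = of_nat k} = ?L (Suc j) - ?L j"
    proof -
      have "(v = of_nat (Suc j)) \<longleftrightarrow> (v \<le> of_nat (Suc j) \<and> \<not> v \<le> of_nat j)"
        if v: "v \<in> insert \<infinity> (range of_nat)" for v :: ennreal
      proof -
        consider "v = \<infinity>" | q :: nat where "v = of_nat q" using v by auto
        then show ?thesis
        proof cases
          case 1
          then show ?thesis by (simp add: top_unique del: of_nat_Suc)
        next
          case (2 q)
          then show ?thesis by (simp only: of_nat_le_iff of_nat_eq_iff) auto
        qed
      qed
      then show ?thesis using base_process_integer[OF A] Suc by auto
    qed
    moreover have "?L j \<subseteq> ?L (Suc j)" by (auto intro: order_trans)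
    ultimately have "sample.P.prob {\<omega>\<in>space sample_space. emeasure (base_process \<omega>) A = of_nat k}
        = sample.P.prob (?L (Suc j)) - sample.P.prob (?L j)"
      by (simp only:) (intro sample.P.finite_measure_Diff, measurable)
    then show ?thesis unfolding cdf using Suc by (simp add: poisson_cdf_def)
  qed
qed

lemma base_process_infinite:
  assumes A: "A \<in> sets borel" and inf: "emeasure lborel A = \<infinity>"
  shows "AE \<omega> in sample_space. emeasure (base_process \<omega>) A = \<infinity>"
proof -
  note [measurable] = base_process_measurable[OF A]
  have "AE \<omega> in sample_space. \<not> emeasure (base_process \<omega>) A \<le> of_nat n" for n
  proof -
    have "sample.P.prob {\<omega>\<in>space sample_space. emeasure (base_process \<omega>) A \<le> of_nat n} = 0"
      using prob_base_process_le[of "{0}" "\<lambda>_. A" "\<lambda>_. n"] A inf by (simp add: disjoint_family_on_def limit_cdf_def)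
    then show ?thesis by (subst (asm) sample.P.prob_eq_0) auto
  qed
  then have "AE \<omega> in sample_space. \<forall>n::nat. \<not> emeasure (base_process \<omega>) A \<le> of_nat n" by (simp add: AE_all_countable)
  then show ?thesis
  proof eventually_elim
    case (elim \<omega>)
    then show ?case using base_process_integer[OF A, of \<omega>] by auto
  qed
qed

text \<open>The mapping theorem: the image of the unit rate process under \<open>g\<close> has the
  image of Lebesgue measure as its mean measure. \<open>bdd\<close> prevents infinitely many points
  from being mapped into one compact set.\<close>

lemma poisson_random_measure_exists:
  fixes S :: "real set"
  assumes g: "g \<in> measurable borel (restrict_space borel S)"
    and bdd: "\<And>K. compact K \<Longrightarrow> K \<subseteq> S \<Longrightarrow> bounded (g -` K)"
  shows "poisson_random_measure sample_space S (distr lborel (restrict_space borel S) g)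
     (\<lambda>\<omega>. distr (base_process \<omega>) (restrict_space borel S) g)"
proof -
  let ?N = "restrict_space borel S"
  have gA: "g -` A \<in> sets borel" if "A \<in> sets ?N" for A
    using measurable_sets[OF g that] by simp
  have em: "emeasure (distr (base_process \<omega>) ?N g) A = emeasure (base_process \<omega>) (g -` A)" if "A \<in> sets ?N" for A \<omega>
    using g that by (subst emeasure_distr) (auto simp: measurable_def)
  have el: "emeasure (distr lborel ?N g) A = emeasure lborel (g -` A)" if "A \<in> sets ?N" for A
    using g that by (subst emeasure_distr) (auto simp: measurable_def)
  have ml: "measure (distr lborel ?N g) A = measure lborel (g -` A)" if "A \<in> sets ?N" for A
    using el[OF that] by (simp add: measure_def)
  have pp: "point_process sample_space S (\<lambda>\<omega>. distr (base_process \<omega>) ?N g)"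
    unfolding point_process_def
  proof (intro conjI ballI allI impI)
    fix A \<omega> assume "A \<in> sets ?N"
    then show "emeasure (distr (base_process \<omega>) ?N g) A \<in> insert \<infinity> (range of_nat)"
      unfolding em[OF \<open>A \<in> sets ?N\<close>] by (intro base_process_integer gA)
  next
    fix \<omega> K assume K: "compact K" "K \<subseteq> S"
    then have "K \<in> sets ?N" by (auto simp: sets_restrict_space borel_compact intro!: image_eqI[of _ _ K])
    then show "emeasure (distr (base_process \<omega>) ?N g) K < \<infinity>"
      unfolding em[OF \<open>K \<in> sets ?N\<close>] by (intro base_process_finite gA bdd K)
  next
    fix A assume A: "A \<in> sets ?N"
    show "(\<lambda>\<omega>. emeasure (distr (base_process \<omega>) ?N g) A) \<in> borel_measurable sample_space"
      unfolding em[OF A] by (intro base_process_measurable gA A)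
  qed simp
  show ?thesis
    unfolding poisson_random_measure_def
  proof (intro conjI ballI allI impI)
    fix A and k :: nat assume A: "A \<in> sets (distr lborel ?N g)" "emeasure (distr lborel ?N g) A < \<infinity>"
    then have A': "A \<in> sets ?N" by simp
    show "sample.P.prob {\<omega>\<in>space sample_space. emeasure (distr (base_process \<omega>) ?N g) A = of_nat k} =
       measure (distr lborel ?N g) A ^ k / fact k * exp (- measure (distr lborel ?N g) A)"
      using prob_base_process_eq[OF gA[OF A'], of k] A(2) by (simp add: em[OF A'] el[OF A'] ml[OF A'] poisson_mass_def)
  next
    fix A assume A: "A \<in> sets (distr lborel ?N g)" "emeasure (distr lborel ?N g) A = \<infinity>"
    then have A': "A \<in> sets ?N" by simp
    show "AE \<omega> in sample_space. emeasure (distr (base_process \<omega>) ?N g) A = \<infinity>"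
      using base_process_infinite[OF gA[OF A']] A(2) by (simp add: em[OF A'] el[OF A'])
  next
    fix m :: nat and A assume A: "\<forall>i<m. A i \<in> sets (distr lborel ?N g)" "disjoint_family_on A {..<m}"
    have "sample.P.indep_vars (\<lambda>_. borel) (\<lambda>i \<omega>. emeasure (base_process \<omega>) (g -` A i)) {..<m}"
      using A gA by (intro base_process_indep) (auto simp: disjoint_family_on_def)
    then show "sample.P.indep_vars (\<lambda>_. borel) (\<lambda>i \<omega>. emeasure (distr (base_process \<omega>) ?N g) (A i)) {..<m}"
      using A em by (subst sample.P.indep_vars_cong[OF refl]) auto
  qed (use pp sample.P.prob_space_axioms in auto)
qed

section \<open>Records\<close>

definition is_record :: "(nat \<Rightarrow> 'w \<Rightarrow> ereal) \<Rightarrow> 'w \<Rightarrow> nat \<Rightarrow> bool" where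
  "is_record X \<omega> j \<longleftrightarrow> 1 \<le> j \<and> running_max X (j - 1) \<omega> < X j \<omega>"

lemma running_max_upper: "1 \<le> i \<Longrightarrow> i \<le> n \<Longrightarrow> X i \<omega> \<le> running_max X n \<omega>"
  by (auto simp: running_max_def intro: SUP_upper)

lemma running_max_mono: "m \<le> n \<Longrightarrow> running_max X m \<omega> \<le> running_max X n \<omega>"
  unfolding running_max_def by (intro SUP_subset_mono) auto

lemma running_max_le_iff: "running_max X n \<omega> \<le> c \<longleftrightarrow> (\<forall>i\<in>{1..n}. X i \<omega> \<le> c)"
  by (simp add: running_max_def SUP_le_iff)

lemma running_max_record: "is_record X \<omega> j \<Longrightarrow> running_max X j \<omega> = X j \<omega>"
proof (rule antisym)
  assume r: "is_record X \<omega> j"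
  show "running_max X j \<omega> \<le> X j \<omega>"
    unfolding running_max_le_iff
  proof
    fix i assume i: "i \<in> {1..j}"
    show "X i \<omega> \<le> X j \<omega>"
    proof (cases "i = j")
      case False
      then have "X i \<omega> \<le> running_max X (j - 1) \<omega>" using i by (intro running_max_upper) auto
      then show ?thesis using r unfolding is_record_def by (meson le_less_trans less_imp_le)
    qed simp
  qed
qed (auto simp: is_record_def intro: running_max_upper)

text \<open>Without a record the running maximum keeps its value at \<open>p\<close>. This turns the
  absence of records into a comparison of maxima over blocks.\<close>

lemma no_record_iff:
  assumes "p \<le> p'"
  shows "(\<forall>j\<in>{p<..p'}. \<not> is_record X \<omega> j) \<longleftrightarrow> (\<forall>j\<in>{p<..p'}. X j \<omega> \<le> running_max X p \<omega>)"
proof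
  assume no: "\<forall>j\<in>{p<..p'}. \<not> is_record X \<omega> j"
  have "X j \<omega> \<le> running_max X p \<omega>" if "j \<in> {p<..p'}" for j
    using that
  proof (induction j rule: less_induct)
    case (less j)
    have "running_max X (j - 1) \<omega> \<le> running_max X p \<omega>"
      unfolding running_max_le_iff
    proof
      fix i assume i: "i \<in> {1..j - 1}"
      show "X i \<omega> \<le> running_max X p \<omega>"
      proof (cases "i \<le> p")
        case True
        then show ?thesis using i by (intro running_max_upper) auto
      next
        case False
        then show ?thesis using i less by auto
      qed
    qed
    moreover have "\<not> running_max X (j - 1) \<omega> < X j \<omega>" using no less.prems by (auto simp: is_record_def)
    ultimately show ?case by simp
  qed
  then show "\<forall>j\<in>{p<..p'}. X j \<omega> \<le> running_max X p \<omega>" by blast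
next
  assume le: "\<forall>j\<in>{p<..p'}. X j \<omega> \<le> running_max X p \<omega>"
  show "\<forall>j\<in>{p<..p'}. \<not> is_record X \<omega> j"
  proof
    fix j assume j: "j \<in> {p<..p'}"
    have "X j \<omega> \<le> running_max X p \<omega>" using le j by auto
    also have "\<dots> \<le> running_max X (j - 1) \<omega>" using j by (intro running_max_mono) auto
    finally show "\<not> is_record X \<omega> j" by (auto simp: is_record_def)
  qed
qed

lemma emeasure_distr_count_space:
  assumes "\<And>j. j \<in> J \<Longrightarrow> p j \<in> space N" "A \<in> sets N"
  shows "emeasure (distr (count_space J) N p) A = emeasure (count_space UNIV) {j\<in>J. p j \<in> A}"
proof -
  have "emeasure (distr (count_space J) N p) A = emeasure (count_space J) (p -` A \<inter> space (count_space J))"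
    using assms by (intro emeasure_distr) auto
  also have "p -` A \<inter> space (count_space J) = {j\<in>J. p j \<in> A}" by auto
  also have "emeasure (count_space J) {j\<in>J. p j \<in> A} = emeasure (count_space UNIV) {j\<in>J. p j \<in> A}"
  proof -
    have "{j\<in>J. p j \<in> A} \<subseteq> J" by auto
    then show ?thesis by (simp add: emeasure_count_space)
  qed
  finally show ?thesis .
qed

lemma emeasure_count_space_inj:
  assumes "inj_on h A"
  shows "emeasure (count_space UNIV) (h ` A) = emeasure (count_space UNIV) A"
  using assms by (simp add: emeasure_count_space finite_image_iff card_image)

lemma emeasure_count_space_ge_2:
  assumes "2 \<le> emeasure (count_space UNIV) A"
  obtains i j where "i \<in> A" "j \<in> A" "i \<noteq> j"
proof -
  have "\<exists>i\<in>A. \<exists>j\<in>A. i \<noteq> j"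
  proof (rule ccontr)
    assume no: "\<not> (\<exists>i\<in>A. \<exists>j\<in>A. i \<noteq> j)"
    obtain x where x: "A \<subseteq> {x}"
    proof (cases "A = {}")
      case False
      then obtain x where "x \<in> A" by blast
      then show thesis using no by (intro that[of x]) blast
    qed simp
    have "emeasure (count_space UNIV) A \<le> emeasure (count_space UNIV) {x}" using x by (intro emeasure_mono) auto
    also have "\<dots> = 1" by simp
    finally have "(2::ennreal) \<le> 1" using assms by (rule order_trans[rotated])
    then show False by simp
  qed
  then show thesis using that by blast
qed

lemma emeasure_count_space_0_iff: "emeasure (count_space UNIV) A = 0 \<longleftrightarrow> A = {}"
  by (auto simp: emeasure_count_space)

lemma emeasure_count_space_integer: "emeasure (count_space UNIV) A \<in> insert \<infinity> (range of_nat)"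
  by (simp add: emeasure_count_space)

lemma emeasure_count_space_measurable:
  fixes Q :: "'w \<Rightarrow> nat \<Rightarrow> bool"
  assumes [measurable]: "\<And>j. Measurable.pred M (\<lambda>\<omega>. Q \<omega> j)"
  shows "(\<lambda>\<omega>. emeasure (count_space UNIV) {j. Q \<omega> j}) \<in> borel_measurable M"
proof -
  have "emeasure (count_space UNIV) {j. Q \<omega> j} = (\<Sum>j. if Q \<omega> j then 1 else 0)" for \<omega>
  proof -
    have "emeasure (count_space UNIV) {j. Q \<omega> j} = (\<integral>\<^sup>+j. indicator {j. Q \<omega> j} j \<partial>count_space UNIV)" by simp
    also have "\<dots> = (\<Sum>j. indicator {j. Q \<omega> j} j)" by (rule nn_integral_count_space_nat)
    also have "(\<lambda>j. indicator {j. Q \<omega> j} j) = (\<lambda>j. if Q \<omega> j then 1 else 0 :: ennreal)" by (auto simp: indicator_def)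
    finally show ?thesis .
  qed
  then show ?thesis by simp
qed

section \<open>The record times enumerate the records\<close>

lemma record_time_Suc_eq:
  assumes "record_time X \<omega> (Suc k) = enat j"
  shows "record_time X \<omega> k < enat j" "running_max X (j - 1) \<omega> < X j \<omega>"
    and "\<And>i. record_time X \<omega> k < enat i \<Longrightarrow> running_max X (i - 1) \<omega> < X i \<omega> \<Longrightarrow> j \<le> i"
proof -
  let ?A = "{j. record_time X \<omega> k < enat j \<and> running_max X (j - 1) \<omega> < X j \<omega>}"
  have inf: "Inf (enat ` ?A) = enat j" using assms by simp
  have ne: "?A \<noteq> {}"
  proof
    assume "?A = {}"
    then have "Inf (enat ` ?A) = \<infinity>" by (simp only: image_empty Inf_empty top_enat_def)
    then show False using inf by simp
  qed
  have "enat j \<in> enat ` ?A"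
  proof -
    have "Inf (enat ` ?A) = (LEAST x. x \<in> enat ` ?A)" using ne unfolding Inf_enat_def by (simp only: image_is_empty if_False)
    also have "\<dots> \<in> enat ` ?A"
    proof -
      obtain i where "i \<in> ?A" using ne by blast
      then have "enat i \<in> enat ` ?A" by (rule imageI)
      then show ?thesis by (rule LeastI)
    qed
    finally show ?thesis using inf by simp
  qed
  then show "record_time X \<omega> k < enat j" "running_max X (j - 1) \<omega> < X j \<omega>" by auto
  fix i assume "record_time X \<omega> k < enat i" "running_max X (i - 1) \<omega> < X i \<omega>"
  then have "Inf (enat ` ?A) \<le> enat i" by (intro Inf_lower) auto
  then show "j \<le> i" using inf by simp
qed

text \<open>\<open>record_time\<close> starts at 1 by definition, whereas \<open>is_record\<close>
  at 1 demands a value above the empty maximum -\<infinity>; hence the hypothesis on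
  \<open>X 1\<close>.\<close>

lemma record_time_is_record:
  assumes "X 1 \<omega> \<noteq> -\<infinity>" "record_time X \<omega> k = enat j"
  shows "is_record X \<omega> j"
proof (cases k)
  case 0
  then have "j = 1" using assms by (simp add: one_enat_def)
  then show ?thesis using assms(1) by (simp add: is_record_def running_max_def bot_ereal_def)
next
  case (Suc k')
  have j: "record_time X \<omega> (Suc k') = enat j" using assms(2) Suc by simp
  have "record_time X \<omega> k' < enat j" by (rule record_time_Suc_eq(1)[OF j])
  then have "1 \<le> j" by (cases j) (auto simp: zero_enat_def[symmetric])
  then show ?thesis using record_time_Suc_eq(2)[OF j] by (simp add: is_record_def)
qed

lemma record_time_strict: "record_time X \<omega> l \<noteq> \<infinity> \<Longrightarrow> k < l \<Longrightarrow> record_time X \<omega> k < record_time X \<omega> l"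
proof (induction l)
  case (Suc l)
  then obtain j where j: "record_time X \<omega> (Suc l) = enat j" by (cases "record_time X \<omega> (Suc l)") auto
  have 1: "record_time X \<omega> l < enat j" using record_time_Suc_eq(1)[OF j] .
  show ?case
  proof (cases "k = l")
    case True
    then show ?thesis using 1 j by simp
  next
    case False
    then have "k < l" using Suc.prems(2) by simp
    moreover have "record_time X \<omega> l \<noteq> \<infinity>" using 1 by (cases "record_time X \<omega> l") auto
    ultimately have "record_time X \<omega> k < record_time X \<omega> l" by (rule Suc.IH[rotated])
    then show ?thesis using 1 unfolding j by (rule less_trans)
  qed
qed simp

text \<open>Induction through the preceding record, the largest one before \<open>j\<close>: no
  index in between is a record, so the next record time is \<open>j\<close>.\<close>

lemma record_is_record_time:
  assumes X1: "X 1 \<omega> \<noteq> -\<infinity>"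
  shows "is_record X \<omega> j \<Longrightarrow> \<exists>k. record_time X \<omega> k = enat j"
proof (induction j rule: less_induct)
  case (less j)
  show ?case
  proof (cases "j = 1")
    case True
    then show ?thesis by (intro exI[of _ 0]) (simp add: one_enat_def)
  next
    case False
    then have "1 < j" using less.prems by (auto simp: is_record_def)
    define R where "R = {i. i < j \<and> is_record X \<omega> i}"
    have "1 \<in> R" using \<open>1 < j\<close> X1 by (simp add: R_def is_record_def running_max_def bot_ereal_def)
    have finR: "finite R" by (simp add: R_def)
    define i where "i = Max R"
    have iR: "i \<in> R" unfolding i_def using finR \<open>1 \<in> R\<close> by (intro Max_in) auto
    obtain k where k: "record_time X \<omega> k = enat i" using less.IH[of i] iR by (auto simp: R_def)
    let ?A = "{j. record_time X \<omega> k < enat j \<and> running_max X (j - 1) \<omega> < X j \<omega>}"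
    have jA: "j \<in> ?A" using iR k less.prems by (auto simp: R_def is_record_def)
    have "j \<le> j'" if j': "j' \<in> ?A" for j'
    proof (rule ccontr)
      assume "\<not> j \<le> j'"
      then have "j' \<in> R" using j' k by (auto simp: R_def is_record_def)
      then have "j' \<le> i" unfolding i_def using finR by (intro Max_ge)
      then show False using j' k by simp
    qed
    then have "Inf (enat ` ?A) = enat j"
      using jA by (intro antisym Inf_lower Inf_greatest) auto
    then have "record_time X \<omega> (Suc k) = enat j" by simp
    then show ?thesis by blast
  qed
qed

lemma scaled_record_eq:
  assumes "X 1 \<omega> \<noteq> -\<infinity>" "record_time X \<omega> k = enat j" "0 < n"
  shows "scaled_record X a b n \<omega> k = ereal (a n) * (X j \<omega> - ereal (b n))"
proof -
  have r: "is_record X \<omega> j" using assms(1,2) by (rule record_time_is_record)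
  then have "1 \<le> j" by (simp add: is_record_def)
  then have "1 / real n \<le> real j / real n" using assms(3) by (simp add: divide_right_mono)
  moreover have "nat \<lfloor>real n * (real j / real n)\<rfloor> = j" using assms(3) by simp
  ultimately show ?thesis
    using running_max_record[OF r] assms(2) by (simp add: scaled_record_def max_process_def)
qed

lemma emeasure_record_time_process:
  assumes n: "0 < n" and A: "A \<in> sets (restrict_space borel {0<..})"
  shows "emeasure (record_time_process X n \<omega>) A = emeasure (count_space UNIV) {j. is_record X \<omega> j \<and> real j / real n \<in> A}"
  unfolding record_time_process_def using n
  by (subst emeasure_distr_count_space[OF _ A]) (auto simp: is_record_def space_restrict_space conj_assoc)

text \<open>The number \<open>k\<close> of a record is exchanged for its time, which is injective
  because record times increase strictly. Both record processes are thereby indexed by the same set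
  of records.\<close>

lemma emeasure_record_value_process:
  assumes X1: "X 1 \<omega> \<noteq> -\<infinity>" and n: "0 < n" and A: "A \<in> sets (restrict_space borel S)"
  shows "emeasure (record_value_process X a b S n \<omega>) A =
    emeasure (count_space UNIV) {j. is_record X \<omega> j \<and> ereal (a n) * (X j \<omega> - ereal (b n)) \<in> ereal ` A}"
proof -
  let ?K = "{k. record_time X \<omega> k \<noteq> \<infinity> \<and> scaled_record X a b n \<omega> k \<in> ereal ` S}"
  let ?L = "{k\<in>?K. real_of_ereal (scaled_record X a b n \<omega> k) \<in> A}"
  have AS: "A \<subseteq> S" using A by (auto simp: sets_restrict_space)
  have "emeasure (record_value_process X a b S n \<omega>) A = emeasure (count_space UNIV) ?L"
    unfolding record_value_process_def
    by (rule emeasure_distr_count_space[OF _ A]) (auto simp: space_restrict_space)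
  also have "\<dots> = emeasure (count_space UNIV) ((\<lambda>k. the_enat (record_time X \<omega> k)) ` ?L)"
  proof (rule emeasure_count_space_inj[symmetric], rule inj_onI)
    fix k l assume kl: "k \<in> ?L" "l \<in> ?L" "the_enat (record_time X \<omega> k) = the_enat (record_time X \<omega> l)"
    then have "record_time X \<omega> k = record_time X \<omega> l"
      by (cases "record_time X \<omega> k"; cases "record_time X \<omega> l") auto
    then show "k = l" using record_time_strict[of X \<omega> k l] record_time_strict[of X \<omega> l k] kl
      by (cases k l rule: linorder_cases) auto
  qed
  also have "(\<lambda>k. the_enat (record_time X \<omega> k)) ` ?L = {j. is_record X \<omega> j \<and> ereal (a n) * (X j \<omega> - ereal (b n)) \<in> ereal ` A}"
  proof (intro set_eqI iffI)
    fix j assume "j \<in> (\<lambda>k. the_enat (record_time X \<omega> k)) ` ?L"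
    then obtain k where k: "k \<in> ?L" "j = the_enat (record_time X \<omega> k)" by auto
    then have kj: "record_time X \<omega> k = enat j" by (cases "record_time X \<omega> k") auto
    obtain x where x: "scaled_record X a b n \<omega> k = ereal x" "x \<in> A" using k(1) by auto
    then have "ereal (a n) * (X j \<omega> - ereal (b n)) = ereal x" using scaled_record_eq[of X \<omega>, OF X1 kj n] by simp
    then show "j \<in> {j. is_record X \<omega> j \<and> ereal (a n) * (X j \<omega> - ereal (b n)) \<in> ereal ` A}"
      using x(2) record_time_is_record[of X \<omega>, OF X1 kj] by simp
  next
    fix j assume j: "j \<in> {j. is_record X \<omega> j \<and> ereal (a n) * (X j \<omega> - ereal (b n)) \<in> ereal ` A}"
    then obtain k where k: "record_time X \<omega> k = enat j" using record_is_record_time[of X \<omega>, OF X1] by blast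
    obtain x where x: "ereal (a n) * (X j \<omega> - ereal (b n)) = ereal x" "x \<in> A" using j by blast
    then have "scaled_record X a b n \<omega> k = ereal x" using scaled_record_eq[of X \<omega>, OF X1 k n] by simp
    then have "k \<in> ?L" using x(2) AS k by auto
    then show "j \<in> (\<lambda>k. the_enat (record_time X \<omega> k)) ` ?L"
      by (rule image_eqI[rotated]) (simp add: k)
  qed
  finally show ?thesis .
qed

lemma scaled_value_in_interval_iff:
  assumes "0 < (\<alpha>::real)"
  shows "ereal \<alpha> * (x - ereal \<beta>) \<in> ereal ` {c<..d} \<longleftrightarrow> ereal (c / \<alpha> + \<beta>) < x \<and> x \<le> ereal (d / \<alpha> + \<beta>)"
proof (cases x)
  case (real r)
  then show ?thesis using assms by (auto simp: field_simps)
qed (use assms in auto)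

section \<open>Avoidance probabilities of the record processes\<close>

context mixing_extremes
begin

lemma quantile_exists: "0 < y \<Longrightarrow> \<exists>v\<in>E. H v = y"
  using H_image by (metis greaterThan_iff imageE)

text \<open>An inverse of \<open>H\<close> picked by choice, since what is known of \<open>H\<close>
  on \<open>E\<close> is monotonicity and surjectivity; \<open>quantile_anti\<close> makes every
  such choice decreasing.\<close>

definition quantile :: "real \<Rightarrow> real" where
  "quantile y = (SOME v. v \<in> E \<and> H v = y)"

lemma quantile: "0 < y \<Longrightarrow> quantile y \<in> E" "0 < y \<Longrightarrow> H (quantile y) = y"
  using someI_ex[of "\<lambda>v. v \<in> E \<and> H v = y"] quantile_exists[of y] by (auto simp: quantile_def)

lemma quantile_anti:
  assumes "0 < y" "y \<le> y'"
  shows "quantile y' \<le> quantile y"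
proof (cases "y = y'")
  case False
  show ?thesis
  proof (rule ccontr)
    assume "\<not> ?thesis"
    then have "H (quantile y') \<le> H (quantile y)" using quantile[of y] assms by (intro E_H_anti) auto
    then show False using quantile[of y] quantile[of y'] assms False by auto
  qed
qed simp

text \<open>Block \<open>i\<close> contains no record exactly if some earlier block has a maximum at
  least as large. In the race a block is a clock whose rate is its rescaled length, and the rates up
  to \<open>i\<close> add up to \<open>t i\<close>.\<close>

lemma record_time_avoidance:
  fixes t :: "nat \<Rightarrow> real"
  assumes t0: "0 < t 0" and t: "\<And>i. i < N \<Longrightarrow> t i < t (Suc i)" and I: "I \<subseteq> {1..N}"
  shows "(\<lambda>n. prob {\<omega> \<in> space M. \<forall>i\<in>I. \<forall>j\<in>{time_index n (t (i - 1))<..time_index n (t i)}. \<not> is_record X \<omega> j})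
     \<longlonglongrightarrow> (\<Prod>i\<in>I. t (i - 1) / t i)"
proof -
  have t_mono: "t i \<le> t j" if "i \<le> j" "j \<le> N" for i j
    using that
  proof (induction j)
    case (Suc j)
    then show ?case using t[of j] by (cases "i = Suc j") auto
  qed simp
  have t_pos: "0 < t i" if "i \<le> N" for i using t_mono[of 0 i] that t0 by simp
  \<comment> \<open>Block 0 is the time up to \<open>t 0\<close> and provides the earlier maximum
    for block 1. The rates \<kappa> are continued by 0 beyond \<open>N\<close>, as
    \<open>race_limit\<close> asks for rates at all indices.\<close>
  define s where "s i = (if i = 0 then 0 else t (i - 1))" for i
  define \<kappa> where "\<kappa> i = (if i \<le> N then t i - s i else 0)" for i
  define W where "W n i \<omega> = (SUP j\<in>{time_index n (s i)<..time_index n (t i)}. X j \<omega>)" for n i \<omega>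
  have s0: "0 \<le> s i" "s i \<le> t i" if "i \<le> N" for i
  proof -
    have "i - 1 \<le> N" using that by simp
    then have "0 < t (i - 1)" by (rule t_pos)
    moreover have "t (i - 1) \<le> t i" using that by (intro t_mono) auto
    ultimately show "0 \<le> s i" "s i \<le> t i" using t0 by (auto simp: s_def)
  qed
  have \<kappa>_sum: "(\<Sum>j\<le>i. \<kappa> j) = t i" if "i \<le> N" for i
    using that by (induction i) (auto simp: \<kappa>_def s_def)
  have "(\<lambda>n. prob {\<omega> \<in> space M. \<forall>i\<in>I. \<exists>j<i. W n i \<omega> \<le> W n j \<omega>}) \<longlonglongrightarrow> (\<Prod>i\<in>I. (\<Sum>j<i. \<kappa> j) / (\<Sum>j\<le>i. \<kappa> j))"
  proof (rule race_limit[where lev = "\<lambda>n y. ereal (level n (quantile y))" and N = N])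
    show "W n i \<in> borel_measurable M" for n i unfolding W_def[abs_def] by (intro borel_measurable_SUP) auto
    show "ereal (level n (quantile y')) \<le> ereal (level n (quantile y))" if "0 < y" "y \<le> y'" for n y y'
      using level_mono[OF quantile_anti[OF that]] by simp
    show "0 < \<kappa> 0" using t0 by (simp add: \<kappa>_def s_def)
    show "0 \<le> \<kappa> i" for i using s0[of i] by (simp add: \<kappa>_def)
    show "(\<lambda>n. prob {\<omega> \<in> space M. \<forall>i\<le>N. W n i \<omega> \<le> ereal (level n (quantile (y i)))}) \<longlonglongrightarrow> (\<Prod>i\<le>N. exp (- \<kappa> i * y i))"
      if y: "\<And>i. 0 < y i" "\<And>i. y i \<in> \<rat>" for y
    proof -
      have "(\<lambda>n. prob {\<omega> \<in> space M. \<forall>i\<in>{..N}. \<forall>j\<in>{time_index n (s i)<..time_index n (t i)}. X j \<omega> \<le> ereal (level n (quantile (y i)))})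
        \<longlonglongrightarrow> (\<Prod>i\<in>{..N}. exp (- ((t i - s i) * H (quantile (y i)))))"
      proof (rule block_limit_time)
        show "t i \<le> s j \<or> t j \<le> s i" if "i \<in> {..N}" "j \<in> {..N}" "i \<noteq> j" for i j
          using that t_mono[of i "j - 1"] t_mono[of j "i - 1"] by (cases i j rule: linorder_cases) (auto simp: s_def)
      qed (use s0 y quantile in auto)
      moreover have "(\<Prod>i\<in>{..N}. exp (- ((t i - s i) * H (quantile (y i))))) = (\<Prod>i\<le>N. exp (- \<kappa> i * y i))"
        using y quantile by (intro prod.cong) (auto simp: \<kappa>_def algebra_simps)
      ultimately show ?thesis by (simp add: W_def SUP_le_iff Ball_def)
    qed
  qed (rule I)
  moreover have "(\<Prod>i\<in>I. (\<Sum>j<i. \<kappa> j) / (\<Sum>j\<le>i. \<kappa> j)) = (\<Prod>i\<in>I. t (i - 1) / t i)"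
  proof (intro prod.cong refl)
    fix i assume "i \<in> I"
    then have i: "1 \<le> i" "i \<le> N" using I by auto
    then have "{..<i} = {..i - 1}" by auto
    then show "(\<Sum>j<i. \<kappa> j) / (\<Sum>j\<le>i. \<kappa> j) = t (i - 1) / t i" using \<kappa>_sum[of i] \<kappa>_sum[of "i - 1"] i by simp
  qed
  moreover have "(\<exists>l<i. W n i \<omega> \<le> W n l \<omega>) \<longleftrightarrow> (\<forall>j\<in>{time_index n (t (i - 1))<..time_index n (t i)}. \<not> is_record X \<omega> j)"
    if i: "i \<in> I" for n i \<omega>
  proof -
    have i': "1 \<le> i" "i \<le> N" using I i by auto
    have max: "running_max X (time_index n (t k)) \<omega> = (SUP l\<in>{..k}. W n l \<omega>)" if "k \<le> N" for k
      using that
    proof (induction k)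
      case 0
      have "{1..time_index n (t 0)} = {0<..time_index n (t 0)}" by auto
      then show ?case by (simp add: running_max_def W_def s_def)
    next
      case (Suc k)
      have "time_index n (t k) \<le> time_index n (t (Suc k))" using Suc t_mono by (intro time_index_mono) auto
      then have "{1..time_index n (t (Suc k))} = {1..time_index n (t k)} \<union> {time_index n (t k)<..time_index n (t (Suc k))}" by auto
      then have "running_max X (time_index n (t (Suc k))) \<omega> = sup (running_max X (time_index n (t k)) \<omega>) (W n (Suc k) \<omega>)"
        by (simp add: running_max_def W_def s_def SUP_union)
      also have "\<dots> = (SUP l\<in>{..Suc k}. W n l \<omega>)" using Suc by (simp add: atMost_Suc sup_commute max.commute)
      finally show ?case .
    qed
    have "(\<exists>l<i. W n i \<omega> \<le> W n l \<omega>) \<longleftrightarrow> W n i \<omega> \<le> (SUP l\<in>{..i - 1}. W n l \<omega>)"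
    proof
      assume "\<exists>l<i. W n i \<omega> \<le> W n l \<omega>"
      then obtain l where "l < i" "W n i \<omega> \<le> W n l \<omega>" by auto
      then show "W n i \<omega> \<le> (SUP l\<in>{..i - 1}. W n l \<omega>)" by (intro SUP_upper2[of l]) auto
    next
      assume le: "W n i \<omega> \<le> (SUP l\<in>{..i - 1}. W n l \<omega>)"
      obtain l where "l \<in> {..i - 1}" "(SUP l\<in>{..i - 1}. W n l \<omega>) = W n l \<omega>"
        by (rule finite_SUP_attained[of "{..i - 1}" "\<lambda>l. W n l \<omega>"]) auto
      then show "\<exists>l<i. W n i \<omega> \<le> W n l \<omega>" using le i' by (intro exI[of _ l]) auto
    qed
    also have "\<dots> \<longleftrightarrow> (\<forall>j\<in>{time_index n (t (i - 1))<..time_index n (t i)}. X j \<omega> \<le> running_max X (time_index n (t (i - 1))) \<omega>)"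
    proof -
      have iN: "i - 1 \<le> N" and si: "s i = t (i - 1)" using i' by (simp_all add: s_def)
      show ?thesis unfolding max[OF iN, symmetric] unfolding W_def si SUP_le_iff ..
    qed
    also have "\<dots> \<longleftrightarrow> (\<forall>j\<in>{time_index n (t (i - 1))<..time_index n (t i)}. \<not> is_record X \<omega> j)"
      using i' t_mono[of "i - 1" i] by (intro no_record_iff[symmetric] time_index_mono) auto
    finally show ?thesis .
  qed
  ultimately show ?thesis by (simp cong: conj_cong)
qed

text \<open>The bin belongs to the first level that lies below \<open>x\<close>.\<close>

lemma in_bin_cover: "ereal (level n (vs i)) < x \<Longrightarrow> \<exists>l\<le>i. in_bin vs n l x"
proof -
  assume x: "ereal (level n (vs i)) < x"
  define l where "l = (LEAST l. ereal (level n (vs l)) < x)"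
  have 1: "ereal (level n (vs l)) < x" unfolding l_def by (rule LeastI[of "\<lambda>l. ereal (level n (vs l)) < x", OF x])
  have 2: "l \<le> i" unfolding l_def by (rule Least_le[of "\<lambda>l. ereal (level n (vs l)) < x", OF x])
  have "\<not> ereal (level n (vs (l - 1))) < x" if "0 < l"
    using not_less_Least[of "l - 1" "\<lambda>l. ereal (level n (vs l)) < x"] that by (simp add: l_def)
  then have "in_bin vs n l x" using 1 by (auto simp: in_bin_def not_less)
  then show ?thesis using 2 by blast
qed

text \<open>Bin \<open>i\<close> contains a record value exactly if it is visited strictly before
  all higher bins \<open>0\<close>, ..., \<open>i - 1\<close>; its first visitor is then a record.
  The race is thus one between first visit times, with rates whose partial sums are
  \<open>H (vs i)\<close>.\<close>

lemma record_value_avoidance: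
  fixes vs :: "nat \<Rightarrow> real"
  assumes vsE: "\<And>i. i \<le> N \<Longrightarrow> vs i \<in> E" and vs_Suc: "\<And>i. i < N \<Longrightarrow> vs (Suc i) \<le> vs i" and I: "I \<subseteq> {1..N}"
  shows "(\<lambda>n. prob {\<omega> \<in> space M. \<forall>i\<in>I. \<forall>j. is_record X \<omega> j \<longrightarrow> \<not> in_bin vs n i (X j \<omega>)})
     \<longlonglongrightarrow> (\<Prod>i\<in>I. H (vs (i - 1)) / H (vs i))"
proof -
  have anti: "vs j \<le> vs i" if "i \<le> j" "j \<le> N" for i j
    using vsE vs_Suc that by (rule vs_anti)
  have rate: "0 \<le> bin_rate vs i" if "i \<le> N" for i
    using vsE vs_Suc that by (rule bin_rate_nonneg)
  define \<kappa> where "\<kappa> i = (if i \<le> N then bin_rate vs i else 0)" for i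
  \<comment> \<open>The first visit time to bin \<open>i\<close>, infinite if there is none. As
    \<open>race_limit\<close> bounds its variables from above, \<open>- S\<close> is used. The level
    involves \<open>Suc (time_index n y)\<close> because \<open>S\<close> is at least this number
    exactly if no visit occurs up to \<open>time_index n y\<close>.\<close>
  define S where "S n i \<omega> = (INF j\<in>{1..}. if in_bin vs n i (X j \<omega>) then ereal (real j) else \<infinity>)" for n i \<omega>
  have \<kappa>_sum: "(\<Sum>j\<le>i. \<kappa> j) = H (vs i)" if "i \<le> N" for i
  proof -
    have "(\<Sum>j\<le>i. \<kappa> j) = (\<Sum>j\<le>i. bin_rate vs j)" using that by (intro sum.cong) (auto simp: \<kappa>_def)
    then show ?thesis by (simp add: sum_bin_rate)
  qed
  have S_ge: "ereal (real q) \<le> S n i \<omega> \<longleftrightarrow> (\<forall>j\<ge>1. in_bin vs n i (X j \<omega>) \<longrightarrow> q \<le> j)" for n i \<omega> q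
    unfolding S_def le_INF_iff by auto
  have S_le: "S n i \<omega> \<le> ereal (real j)" if "1 \<le> j" "in_bin vs n i (X j \<omega>)" for n i j \<omega>
    unfolding S_def using that by (intro INF_lower2[of j]) auto
  have "(\<lambda>n. prob {\<omega> \<in> space M. \<forall>i\<in>I. \<exists>j<i. - S n i \<omega> \<le> - S n j \<omega>}) \<longlonglongrightarrow> (\<Prod>i\<in>I. (\<Sum>j<i. \<kappa> j) / (\<Sum>j\<le>i. \<kappa> j))"
  proof (rule race_limit[where lev = "\<lambda>n y. - ereal (real (Suc (time_index n y)))" and N = N])
    show "(\<lambda>\<omega>. - S n i \<omega>) \<in> borel_measurable M" for n i
      unfolding S_def by (intro borel_measurable_uminus_ereal borel_measurable_INF) auto
    show "- ereal (real (Suc (time_index n y'))) \<le> - ereal (real (Suc (time_index n y)))" if "y \<le> y'" for n y y'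
      using time_index_mono[OF that] by simp
    show "0 < \<kappa> 0" using vsE[of 0] E_H_pos by (simp add: \<kappa>_def bin_rate_def)
    show "0 \<le> \<kappa> i" for i
      using rate by (simp add: \<kappa>_def)
    show "(\<lambda>n. prob {\<omega> \<in> space M. \<forall>i\<le>N. - S n i \<omega> \<le> - ereal (real (Suc (time_index n (y i))))}) \<longlonglongrightarrow> (\<Prod>i\<le>N. exp (- \<kappa> i * y i))"
      if y: "\<And>i. 0 < y i" "\<And>i. y i \<in> \<rat>" for y
    proof -
      have "(\<lambda>n. prob {\<omega> \<in> space M. \<forall>i\<le>N. \<forall>j\<in>{1..time_index n (y i)}. \<not> in_bin vs n i (X j \<omega>)})
        \<longlonglongrightarrow> (\<Prod>i\<le>N. exp (- bin_rate vs i * y i))"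
        using y by (intro bin_limit vsE vs_Suc) (auto intro: less_imp_le)
      moreover have "(\<Prod>i\<le>N. exp (- bin_rate vs i * y i)) = (\<Prod>i\<le>N. exp (- \<kappa> i * y i))"
        by (intro prod.cong) (auto simp: \<kappa>_def)
      moreover have "- S n i \<omega> \<le> - ereal (real (Suc q)) \<longleftrightarrow> (\<forall>j\<in>{1..q}. \<not> in_bin vs n i (X j \<omega>))" for n i q \<omega>
        unfolding ereal_minus_le_minus S_ge by (auto simp: not_less_eq_eq) (meson not_less_eq_eq)
      ultimately show ?thesis by simp
    qed
  qed (rule I)
  moreover have "(\<Prod>i\<in>I. (\<Sum>j<i. \<kappa> j) / (\<Sum>j\<le>i. \<kappa> j)) = (\<Prod>i\<in>I. H (vs (i - 1)) / H (vs i))"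
  proof (intro prod.cong refl)
    fix i assume "i \<in> I"
    then have i: "1 \<le> i" "i \<le> N" using I by auto
    then have "{..<i} = {..i - 1}" by auto
    then show "(\<Sum>j<i. \<kappa> j) / (\<Sum>j\<le>i. \<kappa> j) = H (vs (i - 1)) / H (vs i)" using \<kappa>_sum[of i] \<kappa>_sum[of "i - 1"] i by simp
  qed
  moreover have "(\<exists>l<i. - S n i \<omega> \<le> - S n l \<omega>) \<longleftrightarrow> (\<forall>j. is_record X \<omega> j \<longrightarrow> \<not> in_bin vs n i (X j \<omega>))"
    if i: "i \<in> I" for n i \<omega>
  proof -
    have i': "1 \<le> i" "i \<le> N" using I i by auto
    have "(\<forall>l<i. S n i \<omega> < S n l \<omega>) \<longleftrightarrow> (\<exists>j. is_record X \<omega> j \<and> in_bin vs n i (X j \<omega>))"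
    proof
      assume less: "\<forall>l<i. S n i \<omega> < S n l \<omega>"
      then have "S n i \<omega> < S n 0 \<omega>" using i' by auto
      then have fin: "S n i \<omega> \<noteq> \<infinity>" by auto
      have "\<exists>j\<ge>1. in_bin vs n i (X j \<omega>)"
      proof (rule ccontr)
        assume "\<not> ?thesis"
        then have "S n i \<omega> = (INF j\<in>{1::nat..}. \<infinity>)" unfolding S_def by (intro INF_cong) auto
        then show False using fin by simp
      qed
      define j where "j = (LEAST j. 1 \<le> j \<and> in_bin vs n i (X j \<omega>))"
      have j: "1 \<le> j" "in_bin vs n i (X j \<omega>)"
        using LeastI_ex[OF \<open>\<exists>j\<ge>1. in_bin vs n i (X j \<omega>)\<close>] by (auto simp: j_def)
      have j_least: "\<not> in_bin vs n i (X k \<omega>)" if "1 \<le> k" "k < j" for k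
        using not_less_Least[of k "\<lambda>j. 1 \<le> j \<and> in_bin vs n i (X j \<omega>)"] that by (auto simp: j_def)
      have Sj: "ereal (real j) \<le> S n i \<omega>" unfolding S_ge using j_least by (meson not_less)
      \<comment> \<open>A larger value before \<open>j\<close> would be a visit to one of the bins
        \<open>0\<close>, ..., \<open>i\<close>, none of which is visited before
        \<open>j\<close>.\<close>
      have "X k \<omega> \<le> ereal (level n (vs i))" if k: "k \<in> {1..j - 1}" for k
      proof (rule ccontr)
        assume "\<not> ?thesis"
        then obtain l where l: "l \<le> i" "in_bin vs n l (X k \<omega>)" using in_bin_cover[of n vs i "X k \<omega>"] by (auto simp: not_le)
        then have "l \<noteq> i" using j_least[of k] k j by auto
        then have "S n i \<omega> < S n l \<omega>" using less l by auto
        also have "S n l \<omega> \<le> ereal (real k)" using k l by (intro S_le) auto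
        also have "\<dots> \<le> ereal (real j)" using k by auto
        finally show False using Sj by simp
      qed
      then have "running_max X (j - 1) \<omega> \<le> ereal (level n (vs i))" unfolding running_max_le_iff by blast
      also have "\<dots> < X j \<omega>" using j by (simp add: in_bin_def)
      finally have "is_record X \<omega> j" using j by (simp add: is_record_def)
      then show "\<exists>j. is_record X \<omega> j \<and> in_bin vs n i (X j \<omega>)" using j by blast
    next
      assume "\<exists>j. is_record X \<omega> j \<and> in_bin vs n i (X j \<omega>)"
      then obtain j where j: "is_record X \<omega> j" "in_bin vs n i (X j \<omega>)" by blast
      have j1: "1 \<le> j" using j by (simp add: is_record_def)
      show "\<forall>l<i. S n i \<omega> < S n l \<omega>"
      proof (intro allI impI)
        fix l assume l: "l < i"
        have "Suc j \<le> k" if k: "1 \<le> k" "in_bin vs n l (X k \<omega>)" for k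
        proof (rule ccontr)
          assume "\<not> Suc j \<le> k"
          then have "k \<le> j" by simp
          have "X k \<omega> \<le> X j \<omega>"
            using running_max_upper[OF k(1) \<open>k \<le> j\<close>, of X \<omega>] running_max_record[OF j(1)] by simp
          also have "X j \<omega> \<le> ereal (level n (vs (i - 1)))" using j(2) i' by (simp add: in_bin_def)
          also have "\<dots> \<le> ereal (level n (vs l))"
            using level_mono[OF anti[of l "i - 1"], of n] l i' by simp
          also have "\<dots> < X k \<omega>" using k(2) by (simp add: in_bin_def)
          finally show False by simp
        qed
        then have "ereal (real (Suc j)) \<le> S n l \<omega>" unfolding S_ge by blast
        moreover have "S n i \<omega> \<le> ereal (real j)" using j1 j(2) by (rule S_le)
        moreover have "ereal (real j) < ereal (real (Suc j))" by simp
        ultimately show "S n i \<omega> < S n l \<omega>" by (meson le_less_trans less_le_trans)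
      qed
    qed
    then show ?thesis unfolding ereal_minus_le_minus by (auto simp: not_less[symmetric])
  qed
  ultimately show ?thesis by (simp cong: conj_cong)
qed

end

section \<open>Poisson processes with continuous intensity\<close>

lemma grid_increments_small:
  fixes L :: "real \<Rightarrow> real"
  assumes L: "continuous_on {c..d} L" and cd: "c < d" and e: "0 < e"
  shows "\<forall>\<^sub>F N in sequentially. 0 < N \<and> (\<forall>i<N. \<bar>L (grid_point c d N (Suc i)) - L (grid_point c d N i)\<bar> < e)"
proof -
  have "uniformly_continuous_on {c..d} L" using L by (intro compact_uniformly_continuous) auto
  then obtain \<delta> where \<delta>: "0 < \<delta>" "\<And>x y. x \<in> {c..d} \<Longrightarrow> y \<in> {c..d} \<Longrightarrow> dist y x < \<delta> \<Longrightarrow> dist (L y) (L x) < e"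
    unfolding uniformly_continuous_on_def using e by metis
  have "(\<lambda>N. (d - c) / real N) \<longlonglongrightarrow> 0" by (rule lim_const_over_n)
  then have "\<forall>\<^sub>F N in sequentially. (d - c) / real N < \<delta>" using \<delta>(1) by (rule order_tendstoD)
  then show ?thesis using eventually_gt_at_top[of 0]
  proof eventually_elim
    case (elim N)
    have "\<bar>L (grid_point c d N (Suc i)) - L (grid_point c d N i)\<bar> < e" if i: "i < N" for i
    proof -
      have "grid_point c d N (Suc i) - grid_point c d N i = (d - c) / real N"
        unfolding grid_point_def of_nat_Suc distrib_left add_divide_distrib by simp
      then show ?thesis
        using \<delta>(2)[of "grid_point c d N i" "grid_point c d N (Suc i)"] grid_point_between[OF cd elim(2), of i]
          grid_point_between[OF cd elim(2), of "Suc i"] i elim cd by (simp add: dist_real_def)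
    qed
    then show ?case using elim by blast
  qed
qed

text \<open>Errors that are quadratic in each cell add up to at most the mesh times the total
  increment; this is how cells with two points are excluded simultaneously.\<close>

lemma sum_squares_telescope_le:
  fixes u :: "nat \<Rightarrow> real"
  assumes "\<And>i. i < N \<Longrightarrow> u i \<le> u (Suc i)" "\<And>i. i < N \<Longrightarrow> u (Suc i) - u i \<le> e"
  shows "(\<Sum>i<N. (u (Suc i) - u i)\<^sup>2) \<le> e * (u N - u 0)"
proof -
  have "(\<Sum>i<N. (u (Suc i) - u i)\<^sup>2) \<le> (\<Sum>i<N. e * (u (Suc i) - u i))"
    unfolding power2_eq_square using assms by (intro sum_mono mult_right_mono) auto
  also have "\<dots> = e * (u N - u 0)" by (simp add: sum_distrib_left[symmetric] sum_lessThan_telescope)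
  finally show ?thesis .
qed

lemma poisson_random_measureD:
  assumes "poisson_random_measure \<Omega> S lam \<xi>"
  shows "prob_space \<Omega>" "point_process \<Omega> S \<xi>" "sets lam = sets (restrict_space borel S)"
    and "\<And>A k. A \<in> sets lam \<Longrightarrow> emeasure lam A < \<infinity> \<Longrightarrow>
      measure \<Omega> {\<omega>\<in>space \<Omega>. emeasure (\<xi> \<omega>) A = of_nat k} = measure lam A ^ k / fact k * exp (- measure lam A)"
    and "\<And>(m::nat) A. (\<And>i. i < m \<Longrightarrow> A i \<in> sets lam) \<Longrightarrow> disjoint_family_on A {..<m} \<Longrightarrow>
      prob_space.indep_vars \<Omega> (\<lambda>_. borel) (\<lambda>i \<omega>. emeasure (\<xi> \<omega>) (A i)) {..<m}"
proof -
  note c = assms[unfolded poisson_random_measure_def]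
  show "prob_space \<Omega>" "point_process \<Omega> S \<xi>" "sets lam = sets (restrict_space borel S)"
    using c by (simp_all only: simp_thms)
  note c' = c[THEN conjunct2, THEN conjunct2, THEN conjunct2]
  show "measure \<Omega> {\<omega>\<in>space \<Omega>. emeasure (\<xi> \<omega>) A = of_nat k} = measure lam A ^ k / fact k * exp (- measure lam A)"
    if "A \<in> sets lam" "emeasure lam A < \<infinity>" for A k
    using that by (rule c'[THEN conjunct1, rule_format])
  show "prob_space.indep_vars \<Omega> (\<lambda>_. borel) (\<lambda>i \<omega>. emeasure (\<xi> \<omega>) (A i)) {..<m}"
    if "\<And>i. i < m \<Longrightarrow> A i \<in> sets lam" "disjoint_family_on A {..<m}" for m :: nat and A
    using that by (rule c'[THEN conjunct2, THEN conjunct2, rule_format])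
qed

text \<open>A Poisson random measure seen through its cumulative intensity \<open>L\<close>, which
  will be \<open>ln\<close> for the record times and \<open>- ln (H v)\<close> for the record
  values.\<close>

locale poisson_process =
  fixes \<Omega> :: "'v measure" and S :: "real set" and lam :: "real measure" and \<xi> :: "'v \<Rightarrow> real measure"
    and L :: "real \<Rightarrow> real"
  assumes prm: "poisson_random_measure \<Omega> S lam \<xi>" and S_open: "open S"
    and S_interval: "\<And>x y z. x \<in> S \<Longrightarrow> z \<in> S \<Longrightarrow> x \<le> y \<Longrightarrow> y \<le> z \<Longrightarrow> y \<in> S"
    and L_mono: "\<And>s t. s \<in> S \<Longrightarrow> t \<in> S \<Longrightarrow> s \<le> t \<Longrightarrow> L s \<le> L t" and L_cont: "continuous_on S L"
    and lam_cell: "\<And>s t. s \<in> S \<Longrightarrow> t \<in> S \<Longrightarrow> s \<le> t \<Longrightarrow> emeasure lam {s<..t} = ennreal (L t - L s)"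
begin

sublocale prob_space \<Omega>
  by (rule poisson_random_measureD(1)[OF prm])

lemmas pp = poisson_random_measureD(2)[OF prm] and sets_lam = poisson_random_measureD(3)[OF prm]
  and prob_count = poisson_random_measureD(4)[OF prm]

lemma counting_measurable [measurable]: "A \<in> sets lam \<Longrightarrow> (\<lambda>\<omega>. emeasure (\<xi> \<omega>) A) \<in> borel_measurable \<Omega>"
  using counting_processD(3)[OF point_process_counting[OF pp]] unfolding sets_lam .

lemma cell_sets: "s \<in> S \<Longrightarrow> t \<in> S \<Longrightarrow> {s<..t} \<in> sets lam"
  using S_interval[of s t] unfolding sets_lam by (auto simp: sets_restrict_open[OF S_open])

lemma measure_cell: "s \<in> S \<Longrightarrow> t \<in> S \<Longrightarrow> s \<le> t \<Longrightarrow> measure lam {s<..t} = L t - L s"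
  using lam_cell[of s t] L_mono[of s t] by (simp add: measure_def)

lemma prob_avoid:
  fixes A :: "nat \<Rightarrow> real set"
  assumes A: "\<And>i. i < N \<Longrightarrow> A i \<in> sets lam" "\<And>i. i < N \<Longrightarrow> emeasure lam (A i) < \<infinity>"
    and disj: "disjoint_family_on A {..<N}" and I: "I \<subseteq> {..<N}"
  shows "prob {\<omega>\<in>space \<Omega>. \<forall>i\<in>I. emeasure (\<xi> \<omega>) (A i) = 0} = (\<Prod>i\<in>I. exp (- measure lam (A i)))"
proof (cases "I = {}")
  case True
  then show ?thesis by (simp add: prob_space)
next
  case False
  have indep: "indep_vars (\<lambda>_. borel) (\<lambda>i \<omega>. emeasure (\<xi> \<omega>) (A i)) {..<N}"
    using A(1) disj by (rule poisson_random_measureD(5)[OF prm])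
  have fin: "finite I" by (rule finite_subset[OF I]) simp
  have "prob (\<Inter>i\<in>I. (\<lambda>\<omega>. emeasure (\<xi> \<omega>) (A i)) -` {0} \<inter> space \<Omega>)
      = (\<Prod>i\<in>I. prob ((\<lambda>\<omega>. emeasure (\<xi> \<omega>) (A i)) -` {0} \<inter> space \<Omega>))"
    by (rule indep_varsD[OF indep False fin I]) simp
  also have "\<dots> = (\<Prod>i\<in>I. exp (- measure lam (A i)))"
  proof (intro prod.cong refl)
    fix i assume "i \<in> I"
    then have i: "i < N" using I by auto
    have "(\<lambda>\<omega>. emeasure (\<xi> \<omega>) (A i)) -` {0} \<inter> space \<Omega> = {\<omega>\<in>space \<Omega>. emeasure (\<xi> \<omega>) (A i) = of_nat 0}" by auto
    then show "prob ((\<lambda>\<omega>. emeasure (\<xi> \<omega>) (A i)) -` {0} \<inter> space \<Omega>) = exp (- measure lam (A i))"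
      using prob_count[OF A[OF i], of 0] by simp
  qed
  also have "(\<Inter>i\<in>I. (\<lambda>\<omega>. emeasure (\<xi> \<omega>) (A i)) -` {0} \<inter> space \<Omega>) = {\<omega>\<in>space \<Omega>. \<forall>i\<in>I. emeasure (\<xi> \<omega>) (A i) = 0}"
    using False by auto
  finally show ?thesis .
qed

lemma prob_avoid_cells:
  assumes t: "\<And>i. i \<le> N \<Longrightarrow> t i \<in> S" "\<And>i. i < N \<Longrightarrow> t i < t (Suc i)" and I: "I \<subseteq> {..<N}"
  shows "prob {\<omega>\<in>space \<Omega>. \<forall>i\<in>I. emeasure (\<xi> \<omega>) {t i<..t (Suc i)} = 0} = (\<Prod>i\<in>I. exp (L (t i) - L (t (Suc i))))"
proof -
  have mono: "t i \<le> t j" if "i \<le> j" "j \<le> N" for i j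
    using that
  proof (induction j)
    case (Suc j)
    then show ?case using t(2)[of j] by (cases "i = Suc j") auto
  qed simp
  have "prob {\<omega>\<in>space \<Omega>. \<forall>i\<in>I. emeasure (\<xi> \<omega>) {t i<..t (Suc i)} = 0} = (\<Prod>i\<in>I. exp (- measure lam {t i<..t (Suc i)}))"
  proof (rule prob_avoid[OF _ _ _ I])
    fix i assume i: "i < N"
    show "{t i<..t (Suc i)} \<in> sets lam" using t(1)[of i] t(1)[of "Suc i"] i by (intro cell_sets) auto
    show "emeasure lam {t i<..t (Suc i)} < \<infinity>"
      using t(1)[of i] t(1)[of "Suc i"] t(2)[OF i] i by (subst lam_cell) auto
  next
    have "{t i<..t (Suc i)} \<inter> {t j<..t (Suc j)} = {}" if "i < j" "j < N" for i j
      using mono[of "Suc i" j] that by auto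
    then show "disjoint_family_on (\<lambda>i. {t i<..t (Suc i)}) {..<N}"
      unfolding disjoint_family_on_def by (metis Int_commute lessThan_iff linorder_neqE_nat)
  qed
  also have "\<dots> = (\<Prod>i\<in>I. exp (L (t i) - L (t (Suc i))))"
  proof (intro prod.cong refl)
    fix i assume "i \<in> I"
    then have i: "i < N" using I by auto
    show "exp (- measure lam {t i<..t (Suc i)}) = exp (L (t i) - L (t (Suc i)))"
      using t(1)[of i] t(1)[of "Suc i"] t(2)[OF i] i by (subst measure_cell) auto
  qed
  finally show ?thesis .
qed

text \<open>For mean \<open>x\<close> the probability is \<open>1 - (1 + x) * exp (- x)\<close>, and
  \<open>exp (- x) \<ge> 1 - x\<close> leaves \<open>x^2\<close>.\<close>

lemma prob_multiple_le:
  assumes A: "A \<in> sets lam" "emeasure lam A < \<infinity>"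
  shows "prob {\<omega>\<in>space \<Omega>. 2 \<le> emeasure (\<xi> \<omega>) A} \<le> (measure lam A)\<^sup>2"
proof -
  note [measurable] = counting_measurable[OF A(1)]
  define x where "x = measure lam A"
  let ?C = "\<lambda>k::nat. {\<omega>\<in>space \<Omega>. emeasure (\<xi> \<omega>) A = of_nat k}"
  have "{\<omega>\<in>space \<Omega>. 2 \<le> emeasure (\<xi> \<omega>) A} \<subseteq> space \<Omega> - (?C 0 \<union> ?C 1)" by auto
  then have "prob {\<omega>\<in>space \<Omega>. 2 \<le> emeasure (\<xi> \<omega>) A} \<le> prob (space \<Omega> - (?C 0 \<union> ?C 1))"
    by (intro finite_measure_mono) auto
  also have "\<dots> = 1 - (prob (?C 0) + prob (?C 1))"
  proof -
    have "prob (?C 0 \<union> ?C 1) = prob (?C 0) + prob (?C 1)" by (intro finite_measure_Union) auto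
    then show ?thesis by (subst prob_compl) auto
  qed
  also have "\<dots> = 1 - (1 + x) * exp (- x)"
    unfolding prob_count[OF A] by (simp add: x_def algebra_simps)
  also have "\<dots> \<le> 1 - (1 + x) * (1 - x)"
    using exp_ge_add_one_self[of "- x"] by (intro diff_left_mono mult_left_mono) (auto simp: x_def)
  also have "\<dots> = x\<^sup>2" by (simp add: algebra_simps power2_eq_square)
  finally show ?thesis by (simp add: x_def)
qed

lemma multiple_points_in_grid:
  assumes c: "c \<in> S" and d: "d \<in> S" and cd: "c < d" and e: "0 < e"
  shows "\<forall>\<^sub>F N in sequentially. prob {\<omega>\<in>space \<Omega>. \<exists>i<N. 2 \<le> emeasure (\<xi> \<omega>) (grid_cell c d N i)} \<le> e"
proof -
  \<comment> \<open>The bound for the increments of \<open>L\<close> over a cell: the squares add up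
    to at most \<open>\<eta> * (L d - L c)\<close>. The added 1 keeps the denominator
    positive.\<close>
  define \<eta> where "\<eta> = e / (L d - L c + 1)"
  have Lcd: "L c \<le> L d" using c d cd by (intro L_mono) auto
  have \<eta>: "0 < \<eta>" using e Lcd by (simp add: \<eta>_def)
  have cdS: "{c..d} \<subseteq> S" using S_interval[OF c d] by auto
  have "\<forall>\<^sub>F N in sequentially. 0 < N \<and> (\<forall>i<N. \<bar>L (grid_point c d N (Suc i)) - L (grid_point c d N i)\<bar> < \<eta>)"
    using continuous_on_subset[OF L_cont cdS] cd \<eta> by (rule grid_increments_small)
  then show ?thesis
  proof eventually_elim
    case (elim N)
    then have N: "0 < N" by simp
    let ?u = "\<lambda>i. L (grid_point c d N i)"
    have gS: "grid_point c d N i \<in> S" if "i \<le> N" for i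
      using grid_point_between[OF cd N that] cdS by auto
    have le: "grid_point c d N i \<le> grid_point c d N (Suc i)" for i using grid_point_le[OF cd N] by simp
    have cell: "grid_cell c d N i \<in> sets lam" "emeasure lam (grid_cell c d N i) < \<infinity>"
      "measure lam (grid_cell c d N i) = ?u (Suc i) - ?u i" if "i < N" for i
      using gS[of i] gS[of "Suc i"] le[of i] that unfolding grid_cell_def
      by (auto simp: cell_sets measure_cell lam_cell)
    have "{\<omega>\<in>space \<Omega>. \<exists>i<N. 2 \<le> emeasure (\<xi> \<omega>) (grid_cell c d N i)}
        = (\<Union>i<N. {\<omega>\<in>space \<Omega>. 2 \<le> emeasure (\<xi> \<omega>) (grid_cell c d N i)})" by auto
    also have "prob \<dots> \<le> (\<Sum>i<N. prob {\<omega>\<in>space \<Omega>. 2 \<le> emeasure (\<xi> \<omega>) (grid_cell c d N i)})"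
    proof (intro finite_measure_subadditive_finite finite_lessThan image_subsetI)
      fix i assume "i \<in> {..<N}"
      then have [measurable]: "(\<lambda>\<omega>. emeasure (\<xi> \<omega>) (grid_cell c d N i)) \<in> borel_measurable \<Omega>"
        using cell(1) by (intro counting_measurable) auto
      show "{\<omega>\<in>space \<Omega>. 2 \<le> emeasure (\<xi> \<omega>) (grid_cell c d N i)} \<in> events" by measurable
    qed
    also have "\<dots> \<le> (\<Sum>i<N. (?u (Suc i) - ?u i)\<^sup>2)"
    proof (rule sum_mono)
      fix i assume "i \<in> {..<N}"
      then have i: "i < N" by simp
      show "prob {\<omega>\<in>space \<Omega>. 2 \<le> emeasure (\<xi> \<omega>) (grid_cell c d N i)} \<le> (?u (Suc i) - ?u i)\<^sup>2"
        using prob_multiple_le[OF cell(1,2)[OF i]] unfolding cell(3)[OF i] .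
    qed
    also have "\<dots> \<le> \<eta> * (?u N - ?u 0)"
    proof (rule sum_squares_telescope_le)
      fix i assume i: "i < N"
      show "?u i \<le> ?u (Suc i)" using gS[of i] gS[of "Suc i"] i le[of i] by (intro L_mono) auto
      have "\<bar>?u (Suc i) - ?u i\<bar> < \<eta>" using elim i by blast
      then show "?u (Suc i) - ?u i \<le> \<eta>" by linarith
    qed
    also have "\<dots> = \<eta> * (L d - L c)" using N by simp
    also have "\<dots> \<le> e" using Lcd e by (simp add: \<eta>_def field_simps)
    finally show ?case .
  qed
qed

end

text \<open>The substitution \<open>x = exp u\<close> turns \<open>dx / x\<close> into
  \<open>du\<close>. It is carried out on the compact intervals \<open>K k\<close>, the images of
  \<open>{- k..k}\<close>, which exhaust the half-line.\<close>

lemma density_reciprocal_eq_distr_exp: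
  "density (restrict_space lborel {0<..}) (\<lambda>t. ennreal (1 / t)) = distr lborel (restrict_space borel {0<..}) (exp :: real \<Rightarrow> real)"
  (is "?D = ?E")
proof (rule measure_eqI)
  have sets: "sets ?D = sets (restrict_space borel {0<..})" by (simp cong: sets_restrict_space_cong)
  then show "sets ?D = sets ?E" by simp
  fix A assume "A \<in> sets ?D"
  then have A: "A \<in> sets (restrict_space borel {0<..})" using sets by simp
  then have Ab: "A \<in> sets borel" "A \<subseteq> {0<..}" by (auto simp: sets_restrict_open)
  have em: "exp \<in> measurable (borel :: real measure) (restrict_space borel {0<..})"
    by (intro measurable_restrict_space2) auto
  define K where "K k = {exp (- real k)..exp (real k)}" for k
  have K_sets: "K k \<in> sets borel" for k by (simp add: K_def)
  have K_pos: "K k \<subseteq> {0<..}" for k by (auto simp: K_def intro: less_le_trans[OF exp_gt_zero])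
  have AK: "A \<inter> K k \<in> sets (restrict_space borel {0<..})" for k
    using Ab K_sets by (auto simp: sets_restrict_open)
  have K_inc: "incseq K" unfolding K_def incseq_def by auto
  have K_UN: "(\<Union>k. A \<inter> K k) = A"
  proof
    show "A \<subseteq> (\<Union>k. A \<inter> K k)"
    proof
      fix x assume x: "x \<in> A"
      then have "0 < x" using Ab by auto
      obtain k where "\<bar>ln x\<bar> \<le> real k" using real_arch_simple by blast
      then have "exp (- real k) \<le> exp (ln x)" "exp (ln x) \<le> exp (real k)" by (auto simp: abs_le_iff)
      then show "x \<in> (\<Union>k. A \<inter> K k)" using x \<open>0 < x\<close> by (auto simp: K_def)
    qed
  qed auto
  have "emeasure ?D (A \<inter> K k) = emeasure ?E (A \<inter> K k)" for k
  proof -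
    have "emeasure ?D (A \<inter> K k) = (\<integral>\<^sup>+x. ennreal (1 / x) * indicator (A \<inter> K k) x \<partial>restrict_space lborel {0<..})"
      using AK by (intro emeasure_density) (auto cong: sets_restrict_space_cong measurable_cong_sets intro!: measurable_restrict_space1)
    also have "\<dots> = (\<integral>\<^sup>+x. ennreal (1 / x) * indicator (A \<inter> K k) x * indicator {0<..} x \<partial>lborel)"
      by (subst nn_integral_restrict_space) auto
    also have "\<dots> = (\<integral>\<^sup>+x. ennreal (indicator A x / x) * indicator {exp (- real k)..exp (real k)} x \<partial>lborel)"
    proof (intro nn_integral_cong)
      fix x :: real
      show "ennreal (1 / x) * indicator (A \<inter> K k) x * indicator {0<..} x = ennreal (indicator A x / x) * indicator {exp (- real k)..exp (real k)} x"
        using Ab(2) K_pos[of k] unfolding K_def by (auto simp: indicator_def)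
    qed
    also have "\<dots> = (\<integral>\<^sup>+x. ennreal (indicator A (exp x) / exp x * exp x) * indicator {- real k..real k} x \<partial>lborel)"
    proof -
      have m: "set_borel_measurable borel {exp (- real k)..exp (real k)} (\<lambda>x. indicator A x / x :: real)"
        unfolding set_borel_measurable_def using Ab by measurable
      have "(\<integral>\<^sup>+x. ennreal (indicator A x / x * indicator {exp (- real k)..exp (real k)} x) \<partial>lborel)
          = (\<integral>\<^sup>+x. ennreal (indicator A (exp x) / exp x * exp x * indicator {- real k..real k} x) \<partial>lborel)"
        by (rule nn_integral_substitution[where g = exp and g' = exp and a = "- real k" and b = "real k"
              and f = "\<lambda>x. indicator A x / x", OF m]) (auto intro!: continuous_intros derivative_eq_intros)
      then show ?thesis by (simp only: nn_integral_set_ennreal)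
    qed
    also have "\<dots> = (\<integral>\<^sup>+x. indicator (exp -` (A \<inter> K k)) x \<partial>lborel)"
      by (intro nn_integral_cong) (auto simp: indicator_def K_def)
    also have "\<dots> = emeasure lborel (exp -` (A \<inter> K k))"
      using measurable_sets[OF em AK] by (intro nn_integral_indicator) simp
    also have "\<dots> = emeasure ?E (A \<inter> K k)" using em AK by (subst emeasure_distr) (auto simp: measurable_def)
    finally show ?thesis .
  qed
  moreover have "(\<lambda>k. emeasure \<nu> (A \<inter> K k)) \<longlonglongrightarrow> emeasure \<nu> A" if "sets \<nu> = sets (restrict_space borel {0<..})" for \<nu>
  proof -
    have "incseq (\<lambda>k. A \<inter> K k)" using K_inc by (auto simp: incseq_def)
    then have "(\<lambda>k. emeasure \<nu> (A \<inter> K k)) \<longlonglongrightarrow> emeasure \<nu> (\<Union>k. A \<inter> K k)"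
      using AK that by (intro Lim_emeasure_incseq) auto
    then show ?thesis unfolding K_UN .
  qed
  from this[OF sets] this[of ?E] have "(\<lambda>k. emeasure ?D (A \<inter> K k)) \<longlonglongrightarrow> emeasure ?D A" "(\<lambda>k. emeasure ?E (A \<inter> K k)) \<longlonglongrightarrow> emeasure ?E A"
    by (simp_all only: sets_distr)
  ultimately show "emeasure ?D A = emeasure ?E A" by (intro LIMSEQ_unique) simp_all
qed

text \<open>The preimage of a cell under a monotone map is located up to its end-points; enclosing
  it between the open and the closed interval determines its Lebesgue measure.\<close>

lemma emeasure_distr_monotone_cell:
  fixes g \<Lambda> :: "real \<Rightarrow> real"
  assumes g: "g \<in> measurable borel (restrict_space borel S)" and A: "A \<in> sets (restrict_space borel S)"
    and sub: "{p<..<q} \<subseteq> g -` A" "g -` A \<subseteq> {p..q}" and pq: "p \<le> q"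
  shows "emeasure (distr lborel (restrict_space borel S) g) A = ennreal (q - p)"
proof -
  have gA: "g -` A \<in> sets borel" using measurable_sets[OF g A] by simp
  have "emeasure (distr lborel (restrict_space borel S) g) A = emeasure lborel (g -` A)"
    using g A by (subst emeasure_distr) (auto simp: measurable_def)
  moreover have "emeasure lborel {p<..<q} \<le> emeasure lborel (g -` A)" using sub(1) gA by (intro emeasure_mono) auto
  moreover have "emeasure lborel (g -` A) \<le> emeasure lborel {p..q}" using sub(2) by (intro emeasure_mono) auto
  ultimately show ?thesis using pq by simp
qed

section \<open>Convergence of the record processes\<close>

lemma time_in_cell_iff:
  assumes "0 < n" "0 \<le> s" "0 \<le> t"
  shows "real j / real n \<in> {s<..t} \<longleftrightarrow> j \<in> {time_index n s<..time_index n t}"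
proof -
  have "s < real j / real n \<longleftrightarrow> \<not> real j \<le> real n * s" "real j / real n \<le> t \<longleftrightarrow> real j \<le> real n * t"
    using assms(1) by (simp_all add: pos_less_divide_eq pos_divide_le_eq not_le mult.commute)
  then show ?thesis
    unfolding greaterThanAtMost_iff le_time_index_iff[OF assms(2), symmetric] le_time_index_iff[OF assms(3), symmetric]
    by (simp only: not_le)
qed

section \<open>Records do not cluster, and the criterion for weak convergence applies\<close>

context mixing_extremes
begin

lemma running_max_measurable [measurable]: "running_max X n \<in> borel_measurable M"
  unfolding running_max_def[abs_def] by (intro borel_measurable_SUP) auto

lemma is_record_measurable [measurable]: "Measurable.pred M (\<lambda>\<omega>. is_record X \<omega> j)"
  unfolding is_record_def by measurable

lemma record_times_counting:
  assumes "0 < n"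
  shows "counting_process M {0<..} (record_time_process X n)"
  unfolding counting_process_def
proof (intro conjI ballI)
  fix A assume A: "A \<in> sets (restrict_space borel {0<..} :: real measure)"
  show "emeasure (record_time_process X n \<omega>) A \<in> insert \<infinity> (range of_nat)" for \<omega>
    unfolding emeasure_record_time_process[OF assms A] by (rule emeasure_count_space_integer)
  show "(\<lambda>\<omega>. emeasure (record_time_process X n \<omega>) A) \<in> borel_measurable M"
    unfolding emeasure_record_time_process[OF assms A] by (intro emeasure_count_space_measurable) measurable
qed (simp add: record_time_process_def)

lemma record_values_counting:
  assumes "0 < n" and X1: "\<And>\<omega>. X 1 \<omega> \<noteq> -\<infinity>"
  shows "counting_process M E (record_value_process X a b E n)"
  unfolding counting_process_def
proof (intro conjI ballI)
  fix A assume A: "A \<in> sets (restrict_space borel E)"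
  show "emeasure (record_value_process X a b E n \<omega>) A \<in> insert \<infinity> (range of_nat)" for \<omega>
    unfolding emeasure_record_value_process[where X = X, OF X1 assms(1) A] by (rule emeasure_count_space_integer)
  have [measurable]: "ereal ` A \<in> sets borel"
  proof -
    have "ereal ` A = real_of_ereal -` A \<inter> - {\<infinity>, -\<infinity>}"
    proof (intro set_eqI iffI)
      fix x assume "x \<in> real_of_ereal -` A \<inter> - {\<infinity>, -\<infinity>}"
      then show "x \<in> ereal ` A" by (cases x) auto
    qed auto
    moreover have "real_of_ereal -` A \<in> sets borel"
      using measurable_sets[of real_of_ereal borel borel A] A by (simp add: sets_restrict_open E_open)
    ultimately show ?thesis by simp
  qed
  show "(\<lambda>\<omega>. emeasure (record_value_process X a b E n \<omega>) A) \<in> borel_measurable M"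
    unfolding emeasure_record_value_process[where X = X, OF X1 assms(1) A] by (intro emeasure_count_space_measurable) measurable
qed (simp add: record_value_process_def)

lemma time_cell_sets: "0 < s \<Longrightarrow> {s<..t} \<in> sets (restrict_space borel {0<..} :: real measure)"
  by (auto simp: sets_restrict_open)

lemma emeasure_record_time_cell:
  assumes "0 < n" "0 < s" "s \<le> t"
  shows "emeasure (record_time_process X n \<omega>) {s<..t} =
    emeasure (count_space UNIV) {j. is_record X \<omega> j \<and> j \<in> {time_index n s<..time_index n t}}"
  using assms time_in_cell_iff[of n s t] by (subst emeasure_record_time_process) (auto simp: time_cell_sets)

text \<open>A record after time \<open>c\<close> exceeds everything observed up to \<open>c\<close>.
  So once level \<open>v\<close> has been exceeded by then, two records in a cell are two
  exceedances of \<open>v\<close> in that cell.\<close>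

lemma two_record_times:
  assumes n: "0 < n" and N: "0 < N" and cd: "0 < c" "c < d"
    and two: "i < N" "2 \<le> emeasure (record_time_process X n \<omega>) (grid_cell c d N i)"
    and v: "\<not> (\<forall>j\<in>{0<..time_index n c}. X j \<omega> \<le> ereal (level n v))"
  defines "J \<equiv> {time_index n (grid_point c d N i)<..time_index n (grid_point c d N (Suc i))}"
  shows "\<exists>j\<in>J. \<exists>k\<in>J. j \<noteq> k \<and> ereal (level n v) < X j \<omega> \<and> ereal (level n v) < X k \<omega>"
proof -
  have g: "c \<le> grid_point c d N i" "grid_point c d N i \<le> grid_point c d N (Suc i)"
    using grid_point_le[OF cd(2) N, of 0 i] grid_point_le[OF cd(2) N, of i "Suc i"] by simp_all
  have "2 \<le> emeasure (count_space UNIV) {j. is_record X \<omega> j \<and> j \<in> J}"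
    using two(2) emeasure_record_time_cell[OF n, of "grid_point c d N i" "grid_point c d N (Suc i)" \<omega>] g cd(1)
    by (simp add: grid_cell_def J_def)
  then obtain j k where jk: "j \<in> {j. is_record X \<omega> j \<and> j \<in> J}" "k \<in> {j. is_record X \<omega> j \<and> j \<in> J}" "j \<noteq> k"
    by (rule emeasure_count_space_ge_2)
  obtain l where l: "1 \<le> l" "l \<le> time_index n c" "ereal (level n v) < X l \<omega>"
    using v by (auto simp: not_le Suc_le_eq)
  have "ereal (level n v) < X j \<omega>" if j: "is_record X \<omega> j" "j \<in> J" for j
  proof -
    have "time_index n c \<le> j - 1" using j(2) time_index_mono[OF g(1), of n] by (auto simp: J_def)
    then have "X l \<omega> \<le> running_max X (j - 1) \<omega>" using l by (intro running_max_upper) auto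
    also have "\<dots> < X j \<omega>" using j(1) by (simp add: is_record_def)
    finally show ?thesis using l(3) by (rule less_trans[rotated])
  qed
  then show ?thesis using jk by blast
qed

lemma record_times_simple:
  assumes cd: "0 < c" "c < d" and e: "0 < e"
  shows "\<forall>\<^sub>F N in sequentially. \<forall>\<^sub>F n in sequentially.
    prob {\<omega>\<in>space M. \<exists>i<N. 2 \<le> emeasure (record_time_process X n \<omega>) (grid_cell c d N i)} \<le> e"
proof -
  \<comment> \<open>The limiting mass of the level \<open>v\<close>, large enough that the
    probability \<open>exp (- (c * y))\<close> of not exceeding \<open>v\<close> up to time
    \<open>c\<close> is at most \<open>e / 4\<close>. With this level fixed, the grid is refined
    until the double exceedances, bounded in total by \<open>((d - c) * y)^2 / N\<close>, cost less
    than another \<open>e / 4\<close>.\<close>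
  define y where "y = max 1 (- ln (e / 4) / c)"
  have y: "0 < y" by (simp add: y_def)
  have "- ln (e / 4) / c \<le> y" by (simp add: y_def)
  then have "- (c * y) \<le> ln (e / 4)" using cd(1) by (simp add: field_simps)
  then have "exp (- (c * y)) \<le> exp (ln (e / 4))" by (simp only: exp_le_cancel_iff)
  then have y_small: "exp (- (c * y)) \<le> e / 4" using e by simp
  define v where "v = quantile y"
  have v: "v \<in> E" "H v = y" using quantile[OF y] by (simp_all add: v_def)
  have "(\<lambda>N. ((d - c) * y)\<^sup>2 / real N) \<longlonglongrightarrow> 0" by (rule lim_const_over_n)
  then have "\<forall>\<^sub>F N in sequentially. ((d - c) * y)\<^sup>2 / real N < e / 4" using e by (intro order_tendstoD) auto
  then show ?thesis using eventually_gt_at_top[of 0]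
  proof eventually_elim
    case (elim N)
    then have N: "0 < N" and N_large: "((d - c) * y)\<^sup>2 / real N < e / 4" by auto
    define w where "w = (d - c) / real N"
    define g where "g i = grid_point c d N i" for i
    have g: "0 \<le> g i" "g i \<le> g (Suc i)" for i
      using grid_point_le[OF cd(2) N, of 0 i] grid_point_le[OF cd(2) N, of i "Suc i"] cd(1) by (simp_all add: g_def)
    have gw: "g (Suc i) - g i = w" for i
      unfolding g_def w_def grid_point_def of_nat_Suc distrib_left add_divide_distrib by simp
    define A where "A n = {\<omega>\<in>space M. \<forall>i\<in>{()}. \<forall>j\<in>{time_index n 0<..time_index n c}. X j \<omega> \<le> ereal (level n v)}" for n
    define T where "T i n = {\<omega> \<in> space M. \<exists>j\<in>{time_index n (g i)<..time_index n (g (Suc i))}.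
        \<exists>k\<in>{time_index n (g i)<..time_index n (g (Suc i))}.
        j \<noteq> k \<and> ereal (level n v) < X j \<omega> \<and> ereal (level n v) < X k \<omega>}" for i n
    have [measurable]: "A n \<in> events" "T i n \<in> events" for i n unfolding A_def T_def by measurable
    have "\<exists>q. (\<forall>n. prob (T i n) \<le> q n) \<and> q \<longlonglongrightarrow> w * y - 1 + exp (- (w * y))" for i
    proof (rule two_exceedances_bound[OF g v(1)])
      fix q assume "\<And>n. prob {\<omega> \<in> space M. \<exists>i'\<in>{time_index n (g i)<..time_index n (g (Suc i))}. \<exists>j\<in>{time_index n (g i)<..time_index n (g (Suc i))}.
        i' \<noteq> j \<and> ereal (level n v) < X i' \<omega> \<and> ereal (level n v) < X j \<omega>} \<le> q n"
        "q \<longlonglongrightarrow> (g (Suc i) - g i) * H v - 1 + exp (- ((g (Suc i) - g i) * H v))"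
      then show ?thesis unfolding T_def gw v(2) by blast
    qed
    then obtain q where q: "\<And>i n. prob (T i n) \<le> q i n" "\<And>i. q i \<longlonglongrightarrow> w * y - 1 + exp (- (w * y))" by metis
    have A_lim: "(\<lambda>n. prob (A n)) \<longlonglongrightarrow> exp (- (c * y))"
      unfolding A_def using block_limit_time[of "{()}" "\<lambda>_. v" "\<lambda>_. 0" "\<lambda>_. c"] v cd(1) by simp
    have lim: "(\<lambda>n. prob (A n) + (\<Sum>i<N. q i n)) \<longlonglongrightarrow> exp (- (c * y)) + (\<Sum>i<N. w * y - 1 + exp (- (w * y)))"
      by (intro tendsto_intros A_lim q)
    have wy: "0 \<le> w * y" using cd y by (simp add: w_def)
    have "(\<Sum>i<N. w * y - 1 + exp (- (w * y))) \<le> real N * ((w * y)\<^sup>2)"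
    proof -
      have "w * y - 1 + exp (- (w * y)) \<le> (w * y)\<^sup>2"
        using exp_minus_bounds(2)[OF wy] zero_le_power2[of "w * y"] by linarith
      then show ?thesis by (simp add: mult_left_mono)
    qed
    also have "\<dots> = ((d - c) * y)\<^sup>2 / real N"
      unfolding w_def using N by (simp add: power2_eq_square field_simps)
    finally have small: "exp (- (c * y)) + (\<Sum>i<N. w * y - 1 + exp (- (w * y))) < e"
      using y_small N_large e by linarith
    have "\<forall>\<^sub>F n in sequentially. prob (A n) + (\<Sum>i<N. q i n) < e" using lim small by (rule order_tendstoD)
    then show ?case using eventually_gt_at_top[of 0]
    proof eventually_elim
      case (elim n)
      have "{\<omega>\<in>space M. \<exists>i<N. 2 \<le> emeasure (record_time_process X n \<omega>) (grid_cell c d N i)} \<subseteq> A n \<union> (\<Union>i<N. T i n)"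
      proof
        fix \<omega> assume "\<omega> \<in> {\<omega>\<in>space M. \<exists>i<N. 2 \<le> emeasure (record_time_process X n \<omega>) (grid_cell c d N i)}"
        then obtain i where i: "\<omega> \<in> space M" "i < N" "2 \<le> emeasure (record_time_process X n \<omega>) (grid_cell c d N i)" by auto
        show "\<omega> \<in> A n \<union> (\<Union>i<N. T i n)"
        proof (cases "\<omega> \<in> A n")
          case False
          then have "\<not> (\<forall>j\<in>{0<..time_index n c}. X j \<omega> \<le> ereal (level n v))" using i(1) by (simp add: A_def)
          from two_record_times[OF elim(2) N cd i(2,3) this] show ?thesis
            using i(1,2) by (auto simp: T_def g_def)
        qed simp
      qed
      then have "prob {\<omega>\<in>space M. \<exists>i<N. 2 \<le> emeasure (record_time_process X n \<omega>) (grid_cell c d N i)} \<le> prob (A n \<union> (\<Union>i<N. T i n))"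
        by (intro finite_measure_mono) auto
      also have "\<dots> \<le> prob (A n) + prob (\<Union>i<N. T i n)" by (intro measure_Un_le) auto
      also have "prob (\<Union>i<N. T i n) \<le> (\<Sum>i<N. prob (T i n))" by (intro finite_measure_subadditive_finite) auto
      also have "(\<Sum>i<N. prob (T i n)) \<le> (\<Sum>i<N. q i n)" by (intro sum_mono q)
      finally show ?case using elim(1) by simp
    qed
  qed
qed

lemma record_times_convergence:
  assumes "poisson_process \<Omega> {0<..} lam \<xi> ln"
  shows "avoidance_convergence M \<Omega> {0<..} (record_time_process X) \<xi>"
proof -
  interpret \<Omega>: poisson_process \<Omega> "{0<..}" lam \<xi> ln by fact
  show ?thesis
  proof (intro avoidance_convergence.intro avoidance_convergence_axioms.intro prob_space_axioms \<Omega>.prob_space_axioms)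
    fix t :: "nat \<Rightarrow> real" and N I
    assume t: "\<And>i. i \<le> N \<Longrightarrow> t i \<in> {0<..}" "\<And>i. i < N \<Longrightarrow> t i < t (Suc i)" and I: "I \<subseteq> {..<N}"
    \<comment> \<open>Cell \<open>i\<close> of the criterion is block \<open>i + 1\<close> of the
      race, since block 0 is the time up to \<open>t 0\<close>.\<close>
    have "(\<lambda>n. prob {\<omega> \<in> space M. \<forall>i\<in>Suc ` I. \<forall>j\<in>{time_index n (t (i - 1))<..time_index n (t i)}. \<not> is_record X \<omega> j})
       \<longlonglongrightarrow> (\<Prod>i\<in>Suc ` I. t (i - 1) / t i)"
      using t(1)[of 0] t(2) I by (intro record_time_avoidance[of t N]) auto
    moreover have "(\<Prod>i\<in>Suc ` I. t (i - 1) / t i) = \<Omega>.prob {\<omega>\<in>space \<Omega>. \<forall>i\<in>I. emeasure (\<xi> \<omega>) {t i<..t (Suc i)} = 0}"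
    proof -
      have "(\<Prod>i\<in>Suc ` I. t (i - 1) / t i) = (\<Prod>i\<in>I. t i / t (Suc i))"
        by (subst prod.reindex) auto
      also have "\<dots> = (\<Prod>i\<in>I. exp (ln (t i) - ln (t (Suc i))))"
      proof (intro prod.cong refl)
        fix i assume "i \<in> I"
        then have "0 < t i" "0 < t (Suc i)" using I t(1)[of i] t(1)[of "Suc i"] by auto
        then show "t i / t (Suc i) = exp (ln (t i) - ln (t (Suc i)))" by (simp add: exp_diff)
      qed
      also have "\<dots> = \<Omega>.prob {\<omega>\<in>space \<Omega>. \<forall>i\<in>I. emeasure (\<xi> \<omega>) {t i<..t (Suc i)} = 0}"
        using t I by (rule \<Omega>.prob_avoid_cells[symmetric])
      finally show ?thesis .
    qed
    moreover have "\<forall>\<^sub>F n in sequentially.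
        prob {\<omega> \<in> space M. \<forall>i\<in>Suc ` I. \<forall>j\<in>{time_index n (t (i - 1))<..time_index n (t i)}. \<not> is_record X \<omega> j}
        = prob {\<omega>\<in>space M. \<forall>i\<in>I. emeasure (record_time_process X n \<omega>) {t i<..t (Suc i)} = 0}"
      using eventually_gt_at_top[of 0]
    proof eventually_elim
      case (elim n)
      have "emeasure (record_time_process X n \<omega>) {t i<..t (Suc i)} = 0 \<longleftrightarrow>
          (\<forall>j\<in>{time_index n (t i)<..time_index n (t (Suc i))}. \<not> is_record X \<omega> j)" if i: "i \<in> I" for i \<omega>
      proof -
        have "i < N" using i I by auto
        then have ti: "0 < t i" "t i \<le> t (Suc i)" using t(1)[of i] t(2)[of i] by auto
        show ?thesis unfolding emeasure_record_time_cell[OF elim ti] emeasure_count_space_0_iff by auto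
      qed
      then show ?case by (simp cong: conj_cong)
    qed
    ultimately show "(\<lambda>n. prob {\<omega>\<in>space M. \<forall>i\<in>I. emeasure (record_time_process X n \<omega>) {t i<..t (Suc i)} = 0})
          \<longlonglongrightarrow> \<Omega>.prob {\<omega>\<in>space \<Omega>. \<forall>i\<in>I. emeasure (\<xi> \<omega>) {t i<..t (Suc i)} = 0}"
      by (simp only:) (rule Lim_transform_eventually)
  next
    fix c d e :: real assume cd: "c \<in> {0<..}" "d \<in> {0<..}" "c < d" "0 < e"
    then show "\<forall>\<^sub>F N in sequentially. \<forall>\<^sub>F n in sequentially.
        prob {\<omega>\<in>space M. \<exists>i<N. 2 \<le> emeasure (record_time_process X n \<omega>) (grid_cell c d N i)} \<le> e"
      by (intro record_times_simple) auto
    show "\<forall>\<^sub>F N in sequentially.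
        \<Omega>.prob {\<omega>\<in>space \<Omega>. \<exists>i<N. 2 \<le> emeasure (\<xi> \<omega>) (grid_cell c d N i)} \<le> e"
      using cd by (rule \<Omega>.multiple_points_in_grid)
  next
    show "point_process \<Omega> {0<..} \<xi>" by (rule \<Omega>.pp)
    show "counting_process M {0<..} (record_time_process X n)" if "0 < n" for n
      using that by (rule record_times_counting)
  qed auto
qed

lemma value_cell_sets: "s \<in> E \<Longrightarrow> t \<in> E \<Longrightarrow> {s<..t} \<in> sets (restrict_space borel E)"
  using E_interval[of s t] by (auto simp: sets_restrict_open E_open)

lemma emeasure_record_value_cell:
  assumes X1: "X 1 \<omega> \<noteq> -\<infinity>" and n: "0 < n" and st: "s \<in> E" "t \<in> E"
  shows "emeasure (record_value_process X a b E n \<omega>) {s<..t} =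
    emeasure (count_space UNIV) {j. is_record X \<omega> j \<and> ereal (level n s) < X j \<omega> \<and> X j \<omega> \<le> ereal (level n t)}"
  unfolding emeasure_record_value_process[where X = X and \<omega> = \<omega>, OF X1 n value_cell_sets[OF st]] level_def
  by (simp only: scaled_value_in_interval_iff[OF a_positive])

text \<open>Once \<open>d\<close> has been exceeded, no later record can have a value at most
  \<open>d\<close>. If this happens within the first \<open>m\<close> observations, both record
  values of the cell are found among these.\<close>

lemma two_record_values:
  assumes X1: "X 1 \<omega> \<noteq> -\<infinity>" and n: "0 < n" and N: "0 < N" and cd: "c \<in> E" "d \<in> E" "c < d"
    and two: "i < N" "2 \<le> emeasure (record_value_process X a b E n \<omega>) (grid_cell c d N i)"
    and d: "\<not> (\<forall>j\<in>{0<..m}. X j \<omega> \<le> ereal (level n d))"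
  defines "p \<equiv> level n (grid_point c d N i)" and "q \<equiv> level n (grid_point c d N (Suc i))"
  shows "\<exists>j\<in>{1..m}. \<exists>k\<in>{1..m}. j \<noteq> k \<and> ereal p < X j \<omega> \<and> X j \<omega> \<le> ereal q \<and> ereal p < X k \<omega> \<and> X k \<omega> \<le> ereal q"
proof -
  have gE: "grid_point c d N i \<in> E" "grid_point c d N (Suc i) \<in> E"
    using grid_point_between[OF cd(3) N, of i] grid_point_between[OF cd(3) N, of "Suc i"] two(1)
      E_interval[OF cd(1,2)] by auto
  have "2 \<le> emeasure (count_space UNIV) {j. is_record X \<omega> j \<and> ereal p < X j \<omega> \<and> X j \<omega> \<le> ereal q}"
    using two(2) unfolding grid_cell_def emeasure_record_value_cell[OF X1 n gE] p_def q_def .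
  then obtain j k where jk: "j \<in> {j. is_record X \<omega> j \<and> ereal p < X j \<omega> \<and> X j \<omega> \<le> ereal q}"
    "k \<in> {j. is_record X \<omega> j \<and> ereal p < X j \<omega> \<and> X j \<omega> \<le> ereal q}" "j \<noteq> k"
    by (rule emeasure_count_space_ge_2)
  obtain l where l: "1 \<le> l" "l \<le> m" "ereal (level n d) < X l \<omega>"
    using d by (auto simp: not_le Suc_le_eq)
  have "grid_point c d N (Suc i) \<le> d" using grid_point_between[OF cd(3) N, of "Suc i"] two(1) by auto
  then have qd: "ereal q \<le> ereal (level n d)" unfolding q_def by (simp add: level_mono)
  have "j \<in> {1..m}" if j: "is_record X \<omega> j" "X j \<omega> \<le> ereal q" for j
  proof (rule ccontr)
    assume "j \<notin> {1..m}"
    then have "l \<le> j - 1" using j(1) l by (auto simp: is_record_def)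
    then have "X l \<omega> \<le> running_max X (j - 1) \<omega>" using l by (intro running_max_upper) auto
    also have "\<dots> < X j \<omega>" using j(1) by (simp add: is_record_def)
    also have "\<dots> \<le> ereal (level n d)" using j(2) qd by (rule order_trans)
    finally show False using l(3) by simp
  qed
  then show ?thesis using jk by blast
qed

lemma record_values_simple:
  assumes X1: "\<And>\<omega>. X 1 \<omega> \<noteq> -\<infinity>" and cd: "c \<in> E" "d \<in> E" "c < d" and e: "0 < e"
  shows "\<forall>\<^sub>F N in sequentially. \<forall>\<^sub>F n in sequentially.
    prob {\<omega>\<in>space M. \<exists>i<N. 2 \<le> emeasure (record_value_process X a b E n \<omega>) (grid_cell c d N i)} \<le> e"
proof -
  have Hd: "0 < H d" using E_H_pos[OF cd(2)] .
  \<comment> \<open>Chooses a horizon \<open>T\<close> up to which \<open>d\<close> is exceeded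
    except with limiting probability at most \<open>e / 4\<close>. It is an integer because
    \<open>two_visits_bound\<close> works with rational times.\<close>
  obtain k :: nat where k: "- ln (e / 4) / H d \<le> real k" using real_arch_simple by blast
  define T where "T = real k"
  have T: "0 \<le> T" "T \<in> \<rat>" by (simp_all add: T_def)
  have "- (T * H d) \<le> ln (e / 4)" using k Hd by (simp add: field_simps T_def)
  then have "exp (- (T * H d)) \<le> exp (ln (e / 4))" by (simp only: exp_le_cancel_iff)
  then have T_small: "exp (- (T * H d)) \<le> e / 4" using e by simp
  have Hcd: "H d \<le> H c" using cd by (intro E_H_anti) auto
  \<comment> \<open>The bound for the increments of \<open>H\<close> over a cell. The squares of the
    \<open>x i\<close> then add up to at most \<open>\<eta> * T^2 * (H c - H d)\<close>, which is at
    most \<open>e / 4\<close>.\<close>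
  define \<eta> where "\<eta> = e / (4 * (T\<^sup>2 * (H c - H d) + 1))"
  have pos: "0 < T\<^sup>2 * (H c - H d) + 1" using Hcd by (intro add_nonneg_pos mult_nonneg_nonneg) auto
  then have \<eta>: "0 < \<eta>" using e by (simp add: \<eta>_def)
  have cdE: "{c..d} \<subseteq> E" using E_interval[OF cd(1,2)] by auto
  have "continuous_on {c..d} (\<lambda>v. - H v)"
    by (intro continuous_on_minus continuous_on_subset[OF H_continuous cdE])
  then have "\<forall>\<^sub>F N in sequentially. 0 < N \<and> (\<forall>i<N. \<bar>- H (grid_point c d N (Suc i)) - - H (grid_point c d N i)\<bar> < \<eta>)"
    using cd(3) \<eta> by (rule grid_increments_small)
  then show ?thesis
  proof eventually_elim
    case (elim N)
    then have N: "0 < N" by simp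
    define g where "g i = grid_point c d N i" for i
    have gE: "g i \<in> E" if "i \<le> N" for i
      using grid_point_between[OF cd(3) N that] cdE by (auto simp: g_def)
    have g_le: "g i \<le> g (Suc i)" for i using grid_point_le[OF cd(3) N, of i "Suc i"] by (simp add: g_def)
    define x where "x i = T * (H (g i) - H (g (Suc i)))" for i
    have x: "0 \<le> x i" if "i < N" for i
      using E_H_anti[OF gE g_le, of i] that T(1) by (simp add: x_def)
    define A where "A n = {\<omega>\<in>space M. \<forall>i\<in>{()}. \<forall>j\<in>{time_index n 0<..time_index n T}. X j \<omega> \<le> ereal (level n d)}" for n
    define V where "V i n = {\<omega> \<in> space M. \<exists>j\<in>{1..time_index n T}. \<exists>k\<in>{1..time_index n T}. j \<noteq> k \<and>
        ereal (level n (g i)) < X j \<omega> \<and> X j \<omega> \<le> ereal (level n (g (Suc i))) \<and>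
        ereal (level n (g i)) < X k \<omega> \<and> X k \<omega> \<le> ereal (level n (g (Suc i)))}" for i n
    have [measurable]: "A n \<in> events" "V i n \<in> events" for i n unfolding A_def V_def by measurable
    have "\<exists>q. (\<forall>n. prob (V i n) \<le> q n) \<and> q \<longlonglongrightarrow> x i - 1 + exp (- x i)" if "i < N" for i
    proof -
      have i: "g i \<in> E" "g (Suc i) \<in> E" using that by (auto intro: gE)
      show ?thesis
      proof (rule two_visits_bound[OF i g_le T])
        fix q assume "\<And>n. prob {\<omega> \<in> space M. \<exists>i'\<in>{1..time_index n T}. \<exists>j\<in>{1..time_index n T}. i' \<noteq> j \<and>
          ereal (level n (g i)) < X i' \<omega> \<and> X i' \<omega> \<le> ereal (level n (g (Suc i))) \<and>
          ereal (level n (g i)) < X j \<omega> \<and> X j \<omega> \<le> ereal (level n (g (Suc i)))} \<le> q n"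
          "q \<longlonglongrightarrow> T * (H (g i) - H (g (Suc i))) - 1 + exp (- (T * (H (g i) - H (g (Suc i)))))"
        then show ?thesis unfolding V_def x_def by blast
      qed
    qed
    then obtain q where q: "\<And>i n. i < N \<Longrightarrow> prob (V i n) \<le> q i n" "\<And>i. i < N \<Longrightarrow> q i \<longlonglongrightarrow> x i - 1 + exp (- x i)" by metis
    have A_lim: "(\<lambda>n. prob (A n)) \<longlonglongrightarrow> exp (- (T * H d))"
      unfolding A_def using block_limit_time[of "{()}" "\<lambda>_. d" "\<lambda>_. 0" "\<lambda>_. T"] cd(2) T(1) by simp
    have lim: "(\<lambda>n. prob (A n) + (\<Sum>i<N. q i n)) \<longlonglongrightarrow> exp (- (T * H d)) + (\<Sum>i<N. x i - 1 + exp (- x i))"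
      by (intro tendsto_add tendsto_sum A_lim q) simp
    have "(\<Sum>i<N. x i - 1 + exp (- x i)) \<le> (\<Sum>i<N. (x i)\<^sup>2)"
    proof (rule sum_mono)
      fix i assume "i \<in> {..<N}"
      then have "0 \<le> x i" using x by simp
      then show "x i - 1 + exp (- x i) \<le> (x i)\<^sup>2" using exp_minus_bounds(2)[of "x i"] zero_le_power2[of "x i"] by linarith
    qed
    also have "\<dots> = T\<^sup>2 * (\<Sum>i<N. (- H (g (Suc i)) - - H (g i))\<^sup>2)"
      by (simp add: x_def sum_distrib_left power_mult_distrib)
    also have "\<dots> \<le> T\<^sup>2 * (\<eta> * (- H (g N) - - H (g 0)))"
    proof (rule mult_left_mono[OF sum_squares_telescope_le])
      fix i assume i: "i < N"
      show "- H (g i) \<le> - H (g (Suc i))" using E_H_anti[OF gE g_le, of i] i by simp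
      have "\<bar>- H (g (Suc i)) - - H (g i)\<bar> < \<eta>" using elim i unfolding g_def by blast
      then show "- H (g (Suc i)) - - H (g i) \<le> \<eta>" by linarith
    qed simp
    also have "\<dots> = \<eta> * (T\<^sup>2 * (H c - H d))" using N by (simp add: g_def)
    also have "\<dots> \<le> \<eta> * (T\<^sup>2 * (H c - H d) + 1)" using \<eta> by (intro mult_left_mono) auto
    also have "\<dots> = e / 4"
    proof -
      have "e / (4 * K) * K = e / 4" if "0 < K" for K :: real using that by simp
      then show ?thesis unfolding \<eta>_def using pos by blast
    qed
    finally have small: "exp (- (T * H d)) + (\<Sum>i<N. x i - 1 + exp (- x i)) < e"
      using T_small e by linarith
    have "\<forall>\<^sub>F n in sequentially. prob (A n) + (\<Sum>i<N. q i n) < e" using lim small by (rule order_tendstoD)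
    then show ?case using eventually_gt_at_top[of 0]
    proof eventually_elim
      case (elim n)
      have "{\<omega>\<in>space M. \<exists>i<N. 2 \<le> emeasure (record_value_process X a b E n \<omega>) (grid_cell c d N i)} \<subseteq> A n \<union> (\<Union>i<N. V i n)"
      proof
        fix \<omega> assume "\<omega> \<in> {\<omega>\<in>space M. \<exists>i<N. 2 \<le> emeasure (record_value_process X a b E n \<omega>) (grid_cell c d N i)}"
        then obtain i where i: "\<omega> \<in> space M" "i < N" "2 \<le> emeasure (record_value_process X a b E n \<omega>) (grid_cell c d N i)" by auto
        show "\<omega> \<in> A n \<union> (\<Union>i<N. V i n)"
        proof (cases "\<omega> \<in> A n")
          case False
          then have "\<not> (\<forall>j\<in>{0<..time_index n T}. X j \<omega> \<le> ereal (level n d))" using i(1) by (simp add: A_def)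
          from two_record_values[OF X1 elim(2) N cd i(2,3) this] show ?thesis
            using i(1,2) unfolding V_def g_def by blast
        qed simp
      qed
      then have "prob {\<omega>\<in>space M. \<exists>i<N. 2 \<le> emeasure (record_value_process X a b E n \<omega>) (grid_cell c d N i)} \<le> prob (A n \<union> (\<Union>i<N. V i n))"
        by (intro finite_measure_mono) auto
      also have "\<dots> \<le> prob (A n) + prob (\<Union>i<N. V i n)" by (intro measure_Un_le) auto
      also have "prob (\<Union>i<N. V i n) \<le> (\<Sum>i<N. prob (V i n))" by (intro finite_measure_subadditive_finite) auto
      also have "(\<Sum>i<N. prob (V i n)) \<le> (\<Sum>i<N. q i n)" by (intro sum_mono q) simp
      finally show ?case using elim(1) by simp
    qed
  qed
qed

lemma record_values_convergence:
  assumes X1: "\<And>\<omega>. X 1 \<omega> \<noteq> -\<infinity>" and "poisson_process \<Omega> E lam \<xi> (\<lambda>v. - ln (H v))"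
  shows "avoidance_convergence M \<Omega> E (record_value_process X a b E) \<xi>"
proof -
  interpret \<Omega>: poisson_process \<Omega> E lam \<xi> "\<lambda>v. - ln (H v)" by fact
  show ?thesis
  proof (intro avoidance_convergence.intro avoidance_convergence_axioms.intro prob_space_axioms \<Omega>.prob_space_axioms)
    show "E \<noteq> {}" using quantile(1)[of 1] by auto
  next
    fix t :: "nat \<Rightarrow> real" and N I
    assume t: "\<And>i. i \<le> N \<Longrightarrow> t i \<in> E" "\<And>i. i < N \<Longrightarrow> t i < t (Suc i)" and I: "I \<subseteq> {..<N}"
    \<comment> \<open>Bins are numbered downwards and grid points upwards, so the order is reversed:
      cell \<open>i\<close> is bin \<open>N - i\<close>.\<close>
    define vs where "vs i = t (N - i)" for i
    define J where "J = (\<lambda>i. N - i) ` I"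
    have "(\<lambda>n. prob {\<omega> \<in> space M. \<forall>i\<in>J. \<forall>j. is_record X \<omega> j \<longrightarrow> \<not> in_bin vs n i (X j \<omega>)})
       \<longlonglongrightarrow> (\<Prod>i\<in>J. H (vs (i - 1)) / H (vs i))"
    proof (rule record_value_avoidance[of N])
      show "vs i \<in> E" if "i \<le> N" for i using t(1)[of "N - i"] by (simp add: vs_def)
      show "vs (Suc i) \<le> vs i" if "i < N" for i
        using t(2)[of "N - Suc i"] that by (simp add: vs_def Suc_diff_Suc)
      show "J \<subseteq> {1..N}" using I by (auto simp: J_def)
    qed
    moreover have ends: "vs (N - i) = t i" "vs (N - i - 1) = t (Suc i)" if "i \<in> I" for i
    proof -
      have "i < N" using that I by auto
      then have "N - (N - i) = i" "N - (N - i - 1) = Suc i" by auto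
      then show "vs (N - i) = t i" "vs (N - i - 1) = t (Suc i)" unfolding vs_def by (simp_all only:)
    qed
    have "(\<Prod>i\<in>J. H (vs (i - 1)) / H (vs i)) = \<Omega>.prob {\<omega>\<in>space \<Omega>. \<forall>i\<in>I. emeasure (\<xi> \<omega>) {t i<..t (Suc i)} = 0}"
    proof -
      have "inj_on (\<lambda>i. N - i) I" using I by (intro inj_onI) (auto simp: subset_eq)
      then have "(\<Prod>i\<in>J. H (vs (i - 1)) / H (vs i)) = (\<Prod>i\<in>I. H (vs (N - i - 1)) / H (vs (N - i)))"
        unfolding J_def by (simp add: prod.reindex)
      also have "\<dots> = (\<Prod>i\<in>I. exp (- ln (H (t i)) - - ln (H (t (Suc i)))))"
      proof (intro prod.cong refl)
        fix i assume i: "i \<in> I"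
        then have "0 < H (t i)" "0 < H (t (Suc i))" using I t(1)[of i] t(1)[of "Suc i"] by (auto intro!: E_H_pos)
        then show "H (vs (N - i - 1)) / H (vs (N - i)) = exp (- ln (H (t i)) - - ln (H (t (Suc i))))"
          unfolding ends[OF i] by (simp add: exp_diff exp_minus field_simps)
      qed
      also have "\<dots> = \<Omega>.prob {\<omega>\<in>space \<Omega>. \<forall>i\<in>I. emeasure (\<xi> \<omega>) {t i<..t (Suc i)} = 0}"
        using t I by (rule \<Omega>.prob_avoid_cells[symmetric])
      finally show ?thesis .
    qed
    moreover have "\<forall>\<^sub>F n in sequentially.
        prob {\<omega> \<in> space M. \<forall>i\<in>J. \<forall>j. is_record X \<omega> j \<longrightarrow> \<not> in_bin vs n i (X j \<omega>)}
        = prob {\<omega>\<in>space M. \<forall>i\<in>I. emeasure (record_value_process X a b E n \<omega>) {t i<..t (Suc i)} = 0}"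
      using eventually_gt_at_top[of 0]
    proof eventually_elim
      case (elim n)
      have "emeasure (record_value_process X a b E n \<omega>) {t i<..t (Suc i)} = 0 \<longleftrightarrow>
          (\<forall>j. is_record X \<omega> j \<longrightarrow> \<not> in_bin vs n (N - i) (X j \<omega>))" if i: "i \<in> I" for i \<omega>
      proof -
        have iN: "i < N" using i I by auto
        have bin: "in_bin vs n (N - i) x \<longleftrightarrow> ereal (level n (t i)) < x \<and> x \<le> ereal (level n (t (Suc i)))" for x
          using iN ends[OF i] by (simp add: in_bin_def)
        have tE: "t i \<in> E" "t (Suc i) \<in> E" using t(1)[of i] t(1)[of "Suc i"] iN by auto
        show ?thesis
          unfolding emeasure_record_value_cell[OF X1 elim tE] emeasure_count_space_0_iff bin by blast
      qed
      then show ?case by (simp add: J_def cong: conj_cong)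
    qed
    ultimately show "(\<lambda>n. prob {\<omega>\<in>space M. \<forall>i\<in>I. emeasure (record_value_process X a b E n \<omega>) {t i<..t (Suc i)} = 0})
          \<longlonglongrightarrow> \<Omega>.prob {\<omega>\<in>space \<Omega>. \<forall>i\<in>I. emeasure (\<xi> \<omega>) {t i<..t (Suc i)} = 0}"
      by (simp only:) (rule Lim_transform_eventually)
  next
    show "y \<in> E" if "x \<in> E" "z \<in> E" "x \<le> y" "y \<le> z" for x y z using E_interval[OF that] .
    show "point_process \<Omega> E \<xi>" by (rule \<Omega>.pp)
    show "counting_process M E (record_value_process X a b E n)" if "0 < n" for n
      using that X1 by (rule record_values_counting)
  next
    fix c d e :: real assume cd: "c \<in> E" "d \<in> E" "c < d" "0 < e"
    show "\<forall>\<^sub>F N in sequentially. \<forall>\<^sub>F n in sequentially.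
        prob {\<omega>\<in>space M. \<exists>i<N. 2 \<le> emeasure (record_value_process X a b E n \<omega>) (grid_cell c d N i)} \<le> e"
      using X1 cd by (rule record_values_simple)
    show "\<forall>\<^sub>F N in sequentially.
        \<Omega>.prob {\<omega>\<in>space \<Omega>. \<exists>i<N. 2 \<le> emeasure (\<xi> \<omega>) (grid_cell c d N i)} \<le> e"
      using cd by (rule \<Omega>.multiple_points_in_grid)
  qed (rule E_open)
qed

end

section \<open>The limiting Poisson processes\<close>

lemma bounded_vimage_compact:
  fixes g :: "real \<Rightarrow> real"
  assumes "\<And>p q. p \<in> S \<Longrightarrow> q \<in> S \<Longrightarrow> bounded (g -` {p..q})" and "compact K" "K \<subseteq> S"
  shows "bounded (g -` K)"
proof (cases "K = {}")
  case False
  obtain p where p: "p \<in> K" "\<And>x. x \<in> K \<Longrightarrow> p \<le> x" using compact_attains_inf[OF assms(2) False] by auto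
  obtain q where q: "q \<in> K" "\<And>x. x \<in> K \<Longrightarrow> x \<le> q" using compact_attains_sup[OF assms(2) False] by auto
  have "g -` K \<subseteq> g -` {p..q}" using p q by auto
  then show ?thesis using assms(1)[of p q] assms(3) p(1) q(1) bounded_subset by blast
qed simp

lemma exp_ln_iff:
  fixes x y :: real
  assumes "0 < y"
  shows "y \<le> exp x \<longleftrightarrow> ln y \<le> x" "exp x \<le> y \<longleftrightarrow> x \<le> ln y" "y < exp x \<longleftrightarrow> ln y < x" "exp x < y \<longleftrightarrow> x < ln y"
  using exp_le_cancel_iff[of "ln y" x] exp_le_cancel_iff[of x "ln y"] exp_less_cancel_iff[of "ln y" x]
    exp_less_cancel_iff[of x "ln y"] assms by simp_all

lemma log_poisson_process:
  "poisson_process sample_space {0<..} (density (restrict_space lborel {0<..}) (\<lambda>t. ennreal (1 / t)))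
     (\<lambda>\<omega>. distr (base_process \<omega>) (restrict_space borel {0<..}) exp) ln"
proof
  have g: "exp \<in> measurable (borel :: real measure) (restrict_space borel {0<..})"
    by (intro measurable_restrict_space2) auto
  show "poisson_random_measure sample_space {0<..} (density (restrict_space lborel {0<..}) (\<lambda>t. ennreal (1 / t)))
     (\<lambda>\<omega>. distr (base_process \<omega>) (restrict_space borel {0<..}) exp)"
    unfolding density_reciprocal_eq_distr_exp
  proof (rule poisson_random_measure_exists[OF g])
    fix K :: "real set" assume K: "compact K" "K \<subseteq> {0<..}"
    show "bounded (exp -` K)"
    proof (rule bounded_vimage_compact[OF _ K])
      fix p q :: real assume pq: "p \<in> {0<..}" "q \<in> {0<..}"
      then have "exp -` {p..q} \<subseteq> {ln p..ln q}" by (auto simp: exp_ln_iff)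
      then show "bounded (exp -` {p..q})" using bounded_closed_interval bounded_subset by blast
    qed
  qed
  show "emeasure (density (restrict_space lborel {0<..}) (\<lambda>t. ennreal (1 / t))) {s<..t} = ennreal (ln t - ln s)"
    if st: "s \<in> {0<..}" "t \<in> {0<..}" "s \<le> t" for s t :: real
    unfolding density_reciprocal_eq_distr_exp
  proof (rule emeasure_distr_monotone_cell[OF g])
    show "{s<..t} \<in> sets (restrict_space borel {0<..})" using st by (auto simp: sets_restrict_open)
    show "{ln s<..<ln t} \<subseteq> exp -` {s<..t}"
      using st by (auto simp flip: exp_ln_iff)
    show "exp -` {s<..t} \<subseteq> {ln s..ln t}" using st by (auto simp flip: exp_ln_iff)
    show "ln s \<le> ln t" using st by simp
  qed
qed (auto intro!: continuous_intros)

context mixing_extremes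
begin

definition record_value_map :: "real \<Rightarrow> real" where
  "record_value_map x = quantile (exp (- x))"

lemma record_value_map: "record_value_map x \<in> E" "H (record_value_map x) = exp (- x)"
  using quantile[of "exp (- x)"] by (simp_all add: record_value_map_def)

lemma record_value_map_measurable: "record_value_map \<in> measurable borel (restrict_space borel E)"
proof (intro measurable_restrict_space2)
  have "mono record_value_map" unfolding record_value_map_def by (intro monoI quantile_anti) auto
  then show "record_value_map \<in> borel_measurable borel" by (rule borel_measurable_mono)
qed (simp add: record_value_map)

text \<open>\<open>quantile\<close> picks one of possibly several points with the same value of
  \<open>H\<close>, so membership of the end-points in a preimage is undecided. Hence an inner bound
  by an open interval and an outer one by a closed interval.\<close>

lemma record_value_map_vimage:
  assumes st: "s \<in> E" "t \<in> E"
  shows "{- ln (H s)<..<- ln (H t)} \<subseteq> record_value_map -` {s<..t}"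
    and "record_value_map -` {s..t} \<subseteq> {- ln (H s)..- ln (H t)}"
proof -
  have pos: "0 < H s" "0 < H t" using st by (simp_all add: E_H_pos)
  show "{- ln (H s)<..<- ln (H t)} \<subseteq> record_value_map -` {s<..t}"
  proof
    fix x assume "x \<in> {- ln (H s)<..<- ln (H t)}"
    then have "exp (- x) < exp (ln (H s))" "exp (ln (H t)) < exp (- x)" by auto
    then have x: "H (record_value_map x) < H s" "H t < H (record_value_map x)" using pos by (simp_all add: record_value_map)
    then have "\<not> record_value_map x \<le> s" "\<not> t < record_value_map x"
      using E_H_anti[OF record_value_map(1), of x s] E_H_anti[OF st(2), of "record_value_map x"] by auto
    then show "x \<in> record_value_map -` {s<..t}" by auto
  qed
  show "record_value_map -` {s..t} \<subseteq> {- ln (H s)..- ln (H t)}"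
  proof
    fix x assume "x \<in> record_value_map -` {s..t}"
    then have "exp (- x) \<le> H s" "H t \<le> exp (- x)"
      using E_H_anti[OF st(1), of "record_value_map x"] E_H_anti[OF record_value_map(1), of x t]
      by (auto simp: record_value_map)
    then have "- x \<le> ln (H s)" "ln (H t) \<le> - x" using pos by (simp_all flip: exp_ln_iff)
    then show "x \<in> {- ln (H s)..- ln (H t)}" by auto
  qed
qed

definition record_value_intensity :: "real measure" where
  "record_value_intensity = distr lborel (restrict_space borel E) record_value_map"

text \<open>\<open>A\<close> ranges between the half-open and the closed interval because both are
  used: the former for the grid cells, the latter for the formula of the mean measure.\<close>

lemma emeasure_record_value_intensity:
  assumes st: "s \<in> E" "t \<in> E" "s \<le> t" and A: "{s<..t} \<subseteq> A" "A \<subseteq> {s..t}" "A \<in> sets borel"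
  shows "emeasure record_value_intensity A = ennreal (- ln (H t) - - ln (H s))"
  unfolding record_value_intensity_def
proof (rule emeasure_distr_monotone_cell[OF record_value_map_measurable])
  have "{s..t} \<subseteq> E" using E_interval[OF st(1,2)] by auto
  then show "A \<in> sets (restrict_space borel E)" using A by (auto simp: sets_restrict_open E_open)
  show "{- ln (H s)<..<- ln (H t)} \<subseteq> record_value_map -` A" using record_value_map_vimage(1)[OF st(1,2)] A(1) by auto
  show "record_value_map -` A \<subseteq> {- ln (H s)..- ln (H t)}" using record_value_map_vimage(2)[OF st(1,2)] A(2) by auto
  show "- ln (H s) \<le> - ln (H t)" using E_H_anti[OF st(1,3)] E_H_pos[OF st(2)] by simp
qed

lemma record_value_poisson_process:
  "poisson_process sample_space E record_value_intensity
     (\<lambda>\<omega>. distr (base_process \<omega>) (restrict_space borel E) record_value_map) (\<lambda>v. - ln (H v))"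
proof
  show "poisson_random_measure sample_space E record_value_intensity
     (\<lambda>\<omega>. distr (base_process \<omega>) (restrict_space borel E) record_value_map)"
    unfolding record_value_intensity_def
  proof (rule poisson_random_measure_exists[OF record_value_map_measurable])
    fix K assume K: "compact K" "K \<subseteq> E"
    show "bounded (record_value_map -` K)"
    proof (rule bounded_vimage_compact[OF _ K])
      fix p q assume "p \<in> E" "q \<in> E"
      from record_value_map_vimage(2)[OF this] show "bounded (record_value_map -` {p..q})"
        by (rule bounded_subset[OF bounded_closed_interval])
    qed
  qed
  show "- ln (H s) \<le> - ln (H t)" if "s \<in> E" "t \<in> E" "s \<le> t" for s t
    using E_H_anti[OF that(1,3)] E_H_pos[OF that(2)] by simp
  have "H v \<noteq> 0" if "v \<in> E" for v using E_H_pos[OF that] by simp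
  then show "continuous_on E (\<lambda>v. - ln (H v))"
    by (intro continuous_on_minus continuous_on_ln H_continuous) blast
  show "emeasure record_value_intensity {s<..t} = ennreal (- ln (H t) - - ln (H s))"
    if "s \<in> E" "t \<in> E" "s \<le> t" for s t
    using that by (rule emeasure_record_value_intensity) auto
  show "y \<in> E" if "x \<in> E" "z \<in> E" "x \<le> y" "y \<le> z" for x y z using E_interval[OF that] .
qed (rule E_open)

text \<open>The three claims for an abstract stationary sequence: the dynamical system has been
  reduced to the assumptions of the locale and to \<open>X 1\<close> never being
  -\<infinity>.\<close>

lemma record_processes_limits:
  assumes X1: "\<And>\<omega>. X 1 \<omega> \<noteq> -\<infinity>"
  shows "(\<exists>(\<Omega> :: (nat \<Rightarrow> real) measure) \<R>.
        poisson_random_measure \<Omega> {0<..}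
          (density (restrict_space lborel {0<..}) (\<lambda>t. ennreal (1 / t))) \<R> \<and>
        pp_weak_convergence {0<..} M (record_time_process X) \<Omega> \<R>)" (is ?times)
    and "\<And>s t (k::nat). 0 < s \<Longrightarrow> s < t \<Longrightarrow>
        (\<lambda>n. measure M {x\<in>space M. emeasure (record_time_process X n x) {s<..<t} = of_nat k})
          \<longlonglongrightarrow> ln (t / s) ^ k / fact k * (s / t)"
    and "\<exists>lamV. sets lamV = sets (restrict_space borel E) \<and>
        (\<forall>s t. s \<le> t \<longrightarrow> {s..t} \<subseteq> E \<longrightarrow>
           emeasure lamV {s..t} = ennreal (- ln (- ln (G t)) + ln (- ln (G s)))) \<and>
        (\<exists>(\<Omega> :: (nat \<Rightarrow> real) measure) \<V>.
           poisson_random_measure \<Omega> E lamV \<V> \<and>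
           pp_weak_convergence E M (record_value_process X a b E) \<Omega> \<V>)" (is ?values)
proof -
  let ?lam = "density (restrict_space lborel {0<..}) (\<lambda>t. ennreal (1 / t))"
  let ?\<R> = "\<lambda>\<omega>. distr (base_process \<omega>) (restrict_space borel {0<..}) exp"
  interpret R: poisson_process sample_space "{0<..}" ?lam ?\<R> ln by (rule log_poisson_process)
  interpret RC: avoidance_convergence M sample_space "{0<..}" "record_time_process X" ?\<R>
    by (rule record_times_convergence[OF log_poisson_process])
  show ?times using R.prm RC.weak_convergence by blast
  show "(\<lambda>n. measure M {x\<in>space M. emeasure (record_time_process X n x) {s<..<t} = of_nat k})
          \<longlonglongrightarrow> ln (t / s) ^ k / fact k * (s / t)" if st: "0 < s" "s < t" for s t k
  proof -
    \<comment> \<open>Single points carry no mass, which serves twice: the frontier of the open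
      interval almost surely contains no point, and the open interval has the mass of the half-open
      cell.\<close>
    have null: "emeasure ?lam {x} = 0" if "0 < x" for x
    proof -
      have x: "{x} \<in> sets (restrict_space borel {0<..})" using that by (simp add: sets_restrict_open)
      have g: "exp \<in> measurable (borel :: real measure) (restrict_space borel {0<..})"
        by (intro measurable_restrict_space2) auto
      have "exp -` {x} = {ln x}" using that by (auto dest: ln_unique)
      then show ?thesis unfolding density_reciprocal_eq_distr_exp
        using g x by (subst emeasure_distr) (auto simp: measurable_def)
    qed
    have sl: "A \<in> sets ?lam" if "A \<in> sets borel" "A \<subseteq> {0<..}" for A
      using that unfolding R.sets_lam by (simp add: sets_restrict_open)
    have fr: "frontier {s<..<t} = {s, t}" using st by (auto simp: frontier_def)
    have ends: "emeasure ?lam {s, t} = 0"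
    proof -
      have "emeasure ?lam {s, t} \<le> emeasure ?lam {s} + emeasure ?lam {t}"
        using emeasure_subadditive[of "{s}" ?lam "{t}"] st sl by (simp add: insert_commute)
      then show ?thesis using null st by simp
    qed
    have "measure sample_space {\<omega>\<in>space sample_space. emeasure (?\<R> \<omega>) {s, t} = of_nat 0} = 1"
      using R.prob_count[OF sl, of "{s, t}" 0] ends st by (simp add: measure_def)
    from sample.P.AE_prob_1[OF this]
    have AE: "AE \<omega> in sample_space. emeasure (?\<R> \<omega>) (frontier {s<..<t}) = 0"
      unfolding fr by eventually_elim simp
    have "emeasure ?lam {s<..t} = emeasure ?lam {s<..<t}"
    proof -
      have "{s<..t} = {s<..<t} \<union> {t}" using st by auto
      moreover have "{t} \<in> null_sets ?lam" using null[of t] sl[of "{t}"] st by (auto simp: null_sets_def)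
      moreover have "{s<..<t} \<in> sets ?lam" using st by (intro sl) auto
      ultimately show ?thesis by (simp only: emeasure_Un_null_set)
    qed
    then have mass: "emeasure ?lam {s<..<t} = ennreal (ln t - ln s)" using R.lam_cell[of s t] st by simp
    have "ln s \<le> ln t" using st by simp
    then have m: "measure ?lam {s<..<t} = ln (t / s)" using mass st by (simp add: measure_def ln_div)
    \<comment> \<open>The explicit formula is \<open>counts_limit\<close> for one set.\<close>
    have "(\<lambda>n. prob {\<omega>\<in>space M. \<forall>i<1::nat. emeasure (record_time_process X n \<omega>) {s<..<t} = of_nat k})
      \<longlonglongrightarrow> measure sample_space {\<omega>\<in>space sample_space. \<forall>i<1::nat. emeasure (?\<R> \<omega>) {s<..<t} = of_nat k}"
    proof (rule RC.counts_limit[where m = 1 and B = "\<lambda>_. {s<..<t}" and k = "\<lambda>_. k"])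
      show "closure {s<..<t} \<subseteq> {0<..}" using st by (auto simp: closure_greaterThanLessThan)
    qed (use AE st in \<open>auto simp: closure_greaterThanLessThan\<close>)
    also have "measure sample_space {\<omega>\<in>space sample_space. \<forall>i<1::nat. emeasure (?\<R> \<omega>) {s<..<t} = of_nat k}
        = ln (t / s) ^ k / fact k * exp (- ln (t / s))"
      using R.prob_count[OF sl, of "{s<..<t}" k] mass st unfolding m by (simp add: subset_eq)
    also have "exp (- ln (t / s)) = s / t" using st by (simp add: exp_minus)
    finally show ?thesis by simp
  qed
  let ?\<V> = "\<lambda>\<omega>. distr (base_process \<omega>) (restrict_space borel E) record_value_map"
  interpret V: poisson_process sample_space E record_value_intensity ?\<V> "\<lambda>v. - ln (H v)"
    by (rule record_value_poisson_process)
  interpret VC: avoidance_convergence M sample_space E "record_value_process X a b E" ?\<V>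
    by (rule record_values_convergence[OF X1 record_value_poisson_process])
  show ?values
  proof (intro exI conjI allI impI)
    show "emeasure record_value_intensity {s..t} = ennreal (- ln (- ln (G t)) + ln (- ln (G s)))"
      if st: "s \<le> t" "{s..t} \<subseteq> E" for s t
    proof -
      have "s \<in> E" "t \<in> E" "{s<..t} \<subseteq> {s..t}" using st by auto
      from emeasure_record_value_intensity[OF this(1,2) st(1) this(3) order_refl] show ?thesis by (simp add: H_def)
    qed
  qed (rule V.sets_lam V.prm VC.weak_convergence)+
qed

end

theorem theorem3p1:
  fixes \<X> :: "'a::euclidean_space set"
    and f :: "'a \<Rightarrow> 'a"
    and \<mu> :: "'a measure"
    and \<rho> :: "'a \<Rightarrow> ennreal"
    and \<psi> :: "real \<Rightarrow> ereal"
    and z :: 'a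
    and X :: "nat \<Rightarrow> 'a \<Rightarrow> ereal"
    and a b :: "nat \<Rightarrow> real"
    and G :: "real \<Rightarrow> real"
  assumes system: "acim_system \<X> f \<mu> \<rho>"
    and z: "z \<in> \<X>"
    and psi: "admissible_profile \<psi>"
    and X: "X = orbit_process (observable \<psi> z) f"
    and a_pos: "\<And>n. 0 < a n"
    and G: "nondegenerate_df G"
    and tails: "\<And>u. (\<lambda>n. ereal (real n * measure \<mu> {x\<in>space \<mu>. ereal (u / a n + b n) < X 1 x}))
                  \<longlonglongrightarrow> neg_log (G u)"
    and mixing: "\<And>(r::nat) (x :: nat \<Rightarrow> real) (u :: nat \<Rightarrow> nat \<Rightarrow> real).
        1 \<le> r \<Longrightarrow> 0 < x 1 \<Longrightarrow>
        (\<And>i j. 1 \<le> i \<Longrightarrow> i \<le> j \<Longrightarrow> j \<le> r \<Longrightarrow> x i \<le> x j) \<Longrightarrow>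
        (\<And>n i j. 1 \<le> i \<Longrightarrow> i \<le> j \<Longrightarrow> j \<le> r \<Longrightarrow> u j n \<le> u i n) \<Longrightarrow>
        (\<And>k. 1 \<le> k \<Longrightarrow> k \<le> r \<Longrightarrow>
           (\<lambda>n. real n * measure \<mu> {w\<in>space \<mu>. ereal (u k n) < X 1 w}) \<longlonglongrightarrow> x k) \<Longrightarrow>
        cond_D \<mu> X r u \<and> cond_D' \<mu> X r u"
  shows
    "(\<exists>(\<Omega> :: (nat \<Rightarrow> real) measure) \<R>.
        poisson_random_measure \<Omega> {0<..}
          (density (restrict_space lborel {0<..}) (\<lambda>t. ennreal (1 / t))) \<R> \<and>
        pp_weak_convergence {0<..} \<mu> (record_time_process X) \<Omega> \<R>)
     \<and> (\<forall>s t (k::nat). 0 < s \<longrightarrow> s < t \<longrightarrow>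
        (\<lambda>n. measure \<mu> {x\<in>space \<mu>. emeasure (record_time_process X n x) {s<..<t} = of_nat k})
          \<longlonglongrightarrow> ln (t / s) ^ k / fact k * (s / t))
     \<and> (\<exists>lamV. sets lamV = sets (restrict_space borel (df_domain G)) \<and>
        (\<forall>s t. s \<le> t \<longrightarrow> {s..t} \<subseteq> df_domain G \<longrightarrow>
           emeasure lamV {s..t} = ennreal (- ln (- ln (G t)) + ln (- ln (G s)))) \<and>
        (\<exists>(\<Omega> :: (nat \<Rightarrow> real) measure) \<V>.
           poisson_random_measure \<Omega> (df_domain G) lamV \<V> \<and>
           pp_weak_convergence (df_domain G) \<mu>
             (record_value_process X a b (df_domain G)) \<Omega> \<V>))"
proof -
  \<comment> \<open>A density leaves the sigma-algebra unchanged, so measurability for \<mu> is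
    measurability for the trace Borel sets.\<close>
  have sets_\<mu>: "sets \<mu> = sets (restrict_space borel \<X>)"
    using system unfolding acim_system_def by (auto cong: sets_restrict_space_cong)
  have f: "f \<in> measurable \<mu> \<mu>" "distr \<mu> \<mu> f = \<mu>" "prob_space \<mu>"
    using system unfolding acim_system_def by blast+
  have \<psi>: "\<psi> \<in> borel_measurable (restrict_space borel {0..})" "\<And>v. 0 \<le> v \<Longrightarrow> \<psi> v \<noteq> -\<infinity>"
    using psi unfolding admissible_profile_def by blast+
  have obs: "observable \<psi> z \<in> borel_measurable \<mu>"
  proof -
    have "(\<lambda>x. dist x z) \<in> measurable borel (restrict_space borel {0..})"
      by (intro measurable_restrict_space2) auto
    from measurable_compose[OF this \<psi>(1)] have "observable \<psi> z \<in> borel_measurable borel"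
      by (simp add: observable_def[abs_def])
    then have "observable \<psi> z \<in> borel_measurable (restrict_space borel \<X>)" by (rule measurable_restrict_space1)
    then show ?thesis by (simp only: measurable_cong_sets[OF sets_\<mu> refl])
  qed
  have fn: "f ^^ n \<in> measurable \<mu> \<mu>" for n
  proof (induction n)
    case (Suc n)
    show ?case using measurable_comp[OF Suc f(1)] by (simp only: funpow.simps)
  qed (simp add: id_def)
  interpret mixing_extremes \<mu> f X a b G
  proof (intro mixing_extremes.intro stationary_sequence.intro stationary_sequence_axioms.intro mixing_extremes_axioms.intro)
    show "X i \<in> borel_measurable \<mu>" for i
      unfolding X orbit_process_def using fn obs by (rule measurable_comp)
    show "X (Suc (Suc i)) \<omega> = X (Suc i) (f \<omega>)" for i \<omega>
      unfolding X orbit_process_def by (simp add: funpow_Suc_right del: funpow.simps)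
  qed (fact f G a_pos tails mixing)+
  \<comment> \<open>Distances are nonnegative, and there the profile avoids -\<infinity>; so the
    first observation is a record for every outcome.\<close>
  have "X 1 \<omega> \<noteq> -\<infinity>" for \<omega>
    unfolding X orbit_process_def observable_def using \<psi>(2) by simp
  from record_processes_limits[OF this] show ?thesis by blast
qed

end
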